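(* Let $N\ge 2$ and $m>0$, and let $f\in C^1(\mathbb{R})$ with $f(t)=0$ for $t<0$ and $F(t)=\int_0^t f(s)\,ds$. Suppose that $\lim_{t\to 0}\frac{f(t)}{t}=0$; that $\lim_{t\to\infty}\frac{f(t)}{t^{p}}=0$ for some $p\in\left(1,\frac{N+1}{N-1}\right)$; and that there exists $\theta>2$ such that $0<\theta F(t)<tf(t)$ for all $t>0$. Then the problem $$-\Delta u+m^2u=0\ \text{ in }\mathbb{R}^{N+1}_+,\qquad -\frac{\partial u}{\partial x}(0,y)=f(u(0,y)),\quad y\in\mathbb{R}^N,$$ has a non-negative ground state solution $w\in H^1(\mathbb{R}^{N+1}_+)$.
   Context: Points of $\mathbb{R}^{N+1}_+=(0,\infty)\times\mathbb{R}^N$ are written $(x,y)$ with $x>0$, $y\in\mathbb{R}^N$. $\gamma:H^1(\mathbb{R}^{N+1}_+)\to H^{1/2}(\mathbb{R}^N)$ denotes the trace operator on $\{x=0\}$ (also written $u(0,\cdot)$). The energy functional is $$J(u)=\frac12\iint_{\mathbb{R}^{N+1}_+}\left(|\nabla u|^2+m^2u^2\right)dx\,dy-\int_{\mathbb{R}^N}F(\gamma(u))\,dy .$$ A (weak) solution is a critical point of $J$, i.e. $u\in H^1(\mathbb{R}^{N+1}_+)$ with $\iint_{\mathbb{R}^{N+1}_+}[\nabla u\cdot\nabla\varphi+m^2u\varphi]\,dx\,dy=\int_{\mathbb{R}^N}f(\gamma(u))\gamma(\varphi)\,dy$ for all $\varphi\in H^1(\mathbb{R}^{N+1}_+)$.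 A ground state solution is a solution $w\neq 0$ such that $J(w)\le J(u)$ for every solution $u\ne 0$. *)

theory Defs
  imports "HOL-Analysis.Analysis"
begin

text \<open>
  Points of the half-space are pairs \<open>(x, y)\<close> with \<open>x > 0\<close> and \<open>y :: real ^ 'n\<close>, where
  \<open>N = CARD('n)\<close>. Elements of \<open>L\<^sup>2\<close> and \<open>H\<^sup>1\<close> are functions rather than classes of functions;
  equality and order between them are understood almost everywhere. Measurability is Borel
  measurability, which loses no class: every Lebesgue measurable function agrees a.e. with a
  Borel measurable one.
\<close>

definition half_space :: "(real \<times> (real ^ 'n)) set" where
  "half_space = {z. 0 < fst z}"

abbreviation half_measure :: "(real \<times> (real ^ 'n)) measure" where
  "half_measure \<equiv> restrict_space lborel half_space"

definition L2 :: "'a measure \<Rightarrow> ('a \<Rightarrow> 'b::euclidean_space) set" where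
  "L2 M = {u \<in> borel_measurable M. integrable M (\<lambda>z. (norm (u z))\<^sup>2)}"

primrec Ck :: "nat \<Rightarrow> ('a::euclidean_space \<Rightarrow> real) \<Rightarrow> bool" where
  "Ck 0 \<phi> \<longleftrightarrow> continuous_on UNIV \<phi>"
| "Ck (Suc k) \<phi> \<longleftrightarrow> (\<forall>z. \<phi> differentiable (at z)) \<and>
     (\<forall>b\<in>Basis. Ck k (\<lambda>z. frechet_derivative \<phi> (at z) b))"

definition test_functions :: "'a::euclidean_space set \<Rightarrow> ('a \<Rightarrow> real) set" where
  "test_functions \<Omega> = {\<phi>. (\<forall>k. Ck k \<phi>) \<and> (\<exists>K. compact K \<and> K \<subseteq> \<Omega> \<and> (\<forall>z. z \<notin> K \<longrightarrow> \<phi> z = 0))}"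

definition has_weak_gradient ::
  "(real \<times> (real ^ 'n) \<Rightarrow> real) \<Rightarrow> (real \<times> (real ^ 'n) \<Rightarrow> real \<times> (real ^ 'n)) \<Rightarrow> bool" where
  "has_weak_gradient u g \<longleftrightarrow> g \<in> L2 half_measure \<and>
     (\<forall>\<phi>\<in>test_functions half_space. \<forall>b\<in>Basis.
        (\<integral>z. u z * frechet_derivative \<phi> (at z) b \<partial>half_measure)
          = - (\<integral>z. (g z \<bullet> b) * \<phi> z \<partial>half_measure))"

definition H1 :: "(real \<times> (real ^ 'n) \<Rightarrow> real) set" where
  "H1 = {u \<in> L2 half_measure. \<exists>g. has_weak_gradient u g}"

text \<open>The weak gradient is determined only up to a null set, hence the choice of a representative.\<close>

definition weak_gradient ::
  "(real \<times> (real ^ 'n) \<Rightarrow> real) \<Rightarrow> (real \<times> (real ^ 'n) \<Rightarrow> real \<times> (real ^ 'n))" where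
  "weak_gradient u = (SOME g. has_weak_gradient u g)"

definition H1_norm :: "(real \<times> (real ^ 'n) \<Rightarrow> real) \<Rightarrow> real" where
  "H1_norm u = sqrt (\<integral>z. (norm (weak_gradient u z))\<^sup>2 + (u z)\<^sup>2 \<partial>half_measure)"

text \<open>
  The trace operator is the continuous extension to \<open>H\<^sup>1\<close> of the restriction
  \<open>\<phi> \<mapsto> \<phi>(0, \<cdot>)\<close>, defined on the (dense) functions that are smooth with compact support up to the
  boundary. The limit of the boundary values is taken in \<open>L\<^sup>2(\<real>\<^sup>N)\<close>; it then automatically
  belongs to \<open>H\<^bsup>1/2\<^esup>(\<real>\<^sup>N)\<close>.
\<close>

definition is_trace :: "(real \<times> (real ^ 'n) \<Rightarrow> real) \<Rightarrow> (real ^ 'n \<Rightarrow> real) \<Rightarrow> bool" where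
  "is_trace u v \<longleftrightarrow> u \<in> H1 \<and> v \<in> L2 lborel \<and>
     (\<exists>\<phi>. (\<forall>k::nat. \<phi> k \<in> test_functions UNIV) \<and>
          (\<lambda>k. H1_norm (\<lambda>z. \<phi> k z - u z)) \<longlonglongrightarrow> 0 \<and>
          (\<lambda>k. \<integral>y. (\<phi> k (0, y) - v y)\<^sup>2 \<partial>lborel) \<longlonglongrightarrow> 0)"

definition trace_op :: "(real \<times> (real ^ 'n) \<Rightarrow> real) \<Rightarrow> (real ^ 'n \<Rightarrow> real)" where
  "trace_op u = (SOME v. is_trace u v)"

definition primitive :: "(real \<Rightarrow> real) \<Rightarrow> real \<Rightarrow> real" where
  "primitive f t = (LBINT s=ereal 0..ereal t. f s)"

definition energy :: "real \<Rightarrow> (real \<Rightarrow> real) \<Rightarrow> (real \<times> (real ^ 'n) \<Rightarrow> real) \<Rightarrow> real" where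
  "energy m f u =
     1 / 2 * (\<integral>z. (norm (weak_gradient u z))\<^sup>2 + m\<^sup>2 * (u z)\<^sup>2 \<partial>half_measure)
       - (\<integral>y. primitive f (trace_op u y) \<partial>lborel)"

definition weak_solution :: "real \<Rightarrow> (real \<Rightarrow> real) \<Rightarrow> (real \<times> (real ^ 'n) \<Rightarrow> real) \<Rightarrow> bool" where
  "weak_solution m f u \<longleftrightarrow> u \<in> H1 \<and>
     (\<forall>\<phi>\<in>H1. (\<integral>z. weak_gradient u z \<bullet> weak_gradient \<phi> z + m\<^sup>2 * u z * \<phi> z \<partial>half_measure)
               = (\<integral>y. f (trace_op u y) * trace_op \<phi> y \<partial>lborel))"

definition nonzero_solution :: "real \<Rightarrow> (real \<Rightarrow> real) \<Rightarrow> (real \<times> (real ^ 'n) \<Rightarrow> real) \<Rightarrow> bool" where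
  "nonzero_solution m f u \<longleftrightarrow> weak_solution m f u \<and> \<not> (AE z in half_measure. u z = 0)"

definition ground_state :: "real \<Rightarrow> (real \<Rightarrow> real) \<Rightarrow> (real \<times> (real ^ 'n) \<Rightarrow> real) \<Rightarrow> bool" where
  "ground_state m f w \<longleftrightarrow> nonzero_solution m f w \<and>
     (\<forall>u :: real \<times> (real ^ 'n) \<Rightarrow> real. nonzero_solution m f u \<longrightarrow> energy m f w \<le> energy m f u)"

end

theory Submission
  imports Defs "HOL-Library.Diagonal_Subsequence"
begin

text \<open>
  The Sobolev space of the half-space, modulo equality almost everywhere, is a Hilbert space. On it
  the weak solutions are the critical points of the energy \<open>J x = 1 / 2 * form (m\<^sup>2) x x - \<integral> F (tr x)\<close>, whose
  derivative is \<open>form (m\<^sup>2) x - K x\<close> with \<open>K x h = \<integral> f (tr x) * tr h\<close>. A nonzero solution is found at a mountain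
  pass, and the least energy is attained because sequences of almost critical points do not lose
  all of their mass.

  What the theory of fractional Sobolev spaces would give for the trace is obtained from a
  single estimate: a translation by \<open>h\<close> along the boundary changes the trace, in the mean square, by
  at most \<open>4 * sqrt (norm h)\<close> times the norm (\<open>norm2_tr_increment_le\<close>). Comparing a function
  that satisfies such an estimate with its averages over cubes of side \<open>\<epsilon>\<close> gives three facts. Optimizing \<open>\<epsilon>\<close>
  on each level set bounds the \<open>q\<close>-norms for \<open>2 \<le> q < 2 N / (N - 1)\<close>, after finitely many rounds
  (\<open>half_smooth_uniform_Lq\<close>); this makes \<open>J\<close> differentiable, with a gradient \<open>G\<close> that is uniformly
  continuous on bounded sets. For fixed \<open>\<epsilon>\<close>, if no unit cube carries much mass, then the level sets
  have small measure (\<open>vanishing_level_sets\<close>). And weak convergence implies strong convergence on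
  balls (\<open>local_convergence_from_averages\<close>), as averages over cubes are continuous functionals.

  Let \<open>x\<^sub>n\<close> be bounded with \<open>G x\<^sub>n\<close> tending to \<open>0\<close>, \<open>J x\<^sub>n\<close> tending to \<open>c\<close>, and \<open>K x\<^sub>n x\<^sub>n\<close>
  bounded away from \<open>0\<close>. By the second fact some unit cube carries a fixed amount of the mass of
  each trace; translate it to the origin. By the third fact the weak limit \<open>w\<close> of a subsequence
  is not \<open>0\<close>, and it is a critical point. On critical points \<open>J\<close> is the integral of the
  nonnegative function \<open>1 / 2 * f t * t - F t\<close> of the trace, so \<open>J w \<le> c\<close> by Fatou's lemma. This statement,
  \<open>almost_critical_concentration\<close>, is used twice: for the almost critical points supplied by
  \<open>mountain_pass_almost_critical_points\<close>, which yields a nonzero solution, and for a sequence of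
  nonzero solutions that minimizes the energy, which yields a ground state. The superquadraticity
  condition bounds both sequences (\<open>almost_critical_bound\<close>), and the growth conditions
  keep nonzero solutions away from \<open>0\<close> (\<open>K_small\<close>).

  A solution \<open>w\<close> minimizes the convex functional \<open>1 / 2 * form (m\<^sup>2) x x - K w x\<close>, which does not increase
  when \<open>x\<close> is replaced by \<open>\<bar>x\<bar>\<close> since \<open>f\<close> is nonnegative. So every solution is nonnegative
  (\<open>critical_point_nonneg\<close>).
\<close>


section \<open>Hilbert spaces\<close>

text \<open>A minimizing sequence is a Cauchy sequence by the parallelogram law, since the midpoints stay in
  the convex set.\<close>

lemma min_norm_point_exists:
  fixes S :: "'a::{real_inner,complete_space} set"
  assumes S: "closed S" "convex S" "S \<noteq> {}"
  shows "\<exists>x\<in>S. \<forall>y\<in>S. norm x \<le> norm y"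
proof -
  define d where "d = Inf (norm ` S)"
  have bdd: "bdd_below (norm ` S)" by (rule bdd_belowI[of _ 0]) auto
  have dle: "d \<le> norm y" if "y \<in> S" for y
    unfolding d_def using that bdd by (simp add: cInf_lower)
  have "\<exists>x\<in>S. norm x < d + 1 / real (Suc n)" for n
  proof -
    have "Inf (norm ` S) < d + 1 / real (Suc n)" unfolding d_def by simp
    then show ?thesis using bdd S(3) by (subst (asm) cInf_less_iff) auto
  qed
  then obtain x where xS: "\<And>n. x n \<in> S" and xn: "\<And>n. norm (x n) < d + 1 / real (Suc n)"
    by metis
  have d0: "d \<ge> 0" unfolding d_def using S(3) by (intro cInf_greatest) auto
  have lim: "(\<lambda>n. norm (x n)) \<longlonglongrightarrow> d"
  proof (rule real_tendsto_sandwich[where f="\<lambda>_. d" and h="\<lambda>n. d + 1 / real (Suc n)"])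
    show "(\<lambda>n. d + 1 / real (Suc n)) \<longlonglongrightarrow> d"
      using tendsto_add[OF tendsto_const LIMSEQ_inverse_real_of_nat, of d] by (simp add: inverse_eq_divide)
  qed (use dle xS xn in \<open>auto intro!: always_eventually less_imp_le simp del: of_nat_Suc\<close>)
  have par: "(norm (x n - x k))\<^sup>2 \<le> 2 * (norm (x n))\<^sup>2 + 2 * (norm (x k))\<^sup>2 - 4 * d\<^sup>2" for n k
  proof -
    have "(1/2) *\<^sub>R x n + (1/2) *\<^sub>R x k \<in> S"
      using S(2) xS[of n] xS[of k] unfolding convex_def by force
    then have "d \<le> norm ((1/2) *\<^sub>R (x n + x k))" using dle by (simp add: scaleR_add_right)
    then have "2 * d \<le> norm (x n + x k)" by simp
    then have "(2 * d)\<^sup>2 \<le> (norm (x n + x k))\<^sup>2" using d0 by (intro power_mono) auto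
    moreover have "(norm (x n - x k))\<^sup>2 + (norm (x n + x k))\<^sup>2
        = 2 * (norm (x n))\<^sup>2 + 2 * (norm (x k))\<^sup>2"
      by (simp add: power2_norm_eq_inner inner_simps inner_commute)
    ultimately show ?thesis by (simp add: power_mult_distrib)
  qed
  have "Cauchy x"
  proof (rule metric_CauchyI)
    fix e :: real assume e: "e > 0"
    have "(\<lambda>n. (norm (x n))\<^sup>2) \<longlonglongrightarrow> d\<^sup>2" by (intro tendsto_intros lim)
    moreover have "d\<^sup>2 < d\<^sup>2 + e\<^sup>2 / 4" using e by simp
    ultimately have "eventually (\<lambda>n. (norm (x n))\<^sup>2 < d\<^sup>2 + e\<^sup>2 / 4) sequentially"
      by (rule order_tendstoD)
    then obtain M where M: "\<And>n. n \<ge> M \<Longrightarrow> (norm (x n))\<^sup>2 < d\<^sup>2 + e\<^sup>2 / 4"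
      by (auto simp: eventually_sequentially)
    have "dist (x n) (x k) < e" if "n \<ge> M" "k \<ge> M" for n k
    proof -
      have "(norm (x n - x k))\<^sup>2 < e\<^sup>2" using par[of n k] M[OF that(1)] M[OF that(2)] by linarith
      then show ?thesis using e by (simp add: dist_norm power2_less_imp_less)
    qed
    then show "\<exists>M. \<forall>m\<ge>M. \<forall>n\<ge>M. dist (x m) (x n) < e" by blast
  qed
  then obtain l where l: "x \<longlonglongrightarrow> l" using Cauchy_convergent convergent_def by blast
  have "l \<in> S" using S(1) xS l closed_sequentially by blast
  moreover have "norm l = d" using lim tendsto_norm[OF l] LIMSEQ_unique by blast
  ultimately show ?thesis using dle by auto
qed

lemma min_norm_imp_orthogonal:
  fixes z y :: "'a::real_inner"
  assumes min: "\<And>t. norm z \<le> norm (z + t *\<^sub>R y)"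
  shows "z \<bullet> y = 0"
proof (cases "y = 0")
  case False
  then have yy: "y \<bullet> y > 0" by simp
  define t where "t = - (z \<bullet> y) / (y \<bullet> y)"
  have "(norm z)\<^sup>2 \<le> (norm (z + t *\<^sub>R y))\<^sup>2" using min by (intro power_mono) auto
  also have "\<dots> = (norm z)\<^sup>2 + 2 * t * (z \<bullet> y) + t * t * (y \<bullet> y)"
    by (simp add: power2_norm_eq_inner inner_simps inner_commute algebra_simps)
  also have "\<dots> = (norm z)\<^sup>2 - (z \<bullet> y) * (z \<bullet> y) / (y \<bullet> y)"
    using yy by (simp add: t_def field_simps)
  finally have "(z \<bullet> y) * (z \<bullet> y) / (y \<bullet> y) \<le> 0" by simp
  then have "(z \<bullet> y) * (z \<bullet> y) \<le> 0" using yy by (simp add: divide_le_0_iff)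
  then show ?thesis by (auto simp: mult_le_0_iff)
qed auto

lemma orthogonal_projection_exists:
  fixes S :: "'a::{real_inner,complete_space} set"
  assumes S: "closed S" "subspace S"
  shows "\<exists>p\<in>S. \<forall>s\<in>S. (x - p) \<bullet> s = 0"
proof -
  have eq: "(\<lambda>s. x - s) ` S = (+) x ` S"
  proof safe
    fix s assume "s \<in> S"
    then have "- s \<in> S" by (simp add: S(2) subspace_neg)
    then show "x - s \<in> (+) x ` S" "x + s \<in> (\<lambda>s. x - s) ` S"
      by (metis add_uminus_conv_diff image_eqI, metis diff_minus_eq_add image_eqI)
  qed
  have "closed ((\<lambda>s. x - s) ` S)" "convex ((\<lambda>s. x - s) ` S)" "(\<lambda>s. x - s) ` S \<noteq> {}"
    unfolding eq using S subspace_imp_convex[OF S(2)] subspace_0[OF S(2)]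
    by (auto simp: closed_translation convex_translation)
  from min_norm_point_exists[OF this] obtain p where p: "p \<in> S" and
    min: "\<And>s. s \<in> S \<Longrightarrow> norm (x - p) \<le> norm (x - s)" by auto
  have "(x - p) \<bullet> s = 0" if "s \<in> S" for s
  proof (rule min_norm_imp_orthogonal)
    fix t :: real
    have "p - t *\<^sub>R s \<in> S" using p that S(2) by (simp add: subspace_diff subspace_scale)
    from min[OF this] show "norm (x - p) \<le> norm (x - p + t *\<^sub>R s)" by (simp add: algebra_simps)
  qed
  then show ?thesis using p by blast
qed

lemma riesz_representation:
  fixes f :: "'a::{real_inner,complete_space} \<Rightarrow> real"
  assumes f: "bounded_linear f"
  shows "\<exists>g. \<forall>x. f x = g \<bullet> x"
proof (cases "\<forall>x. f x = 0")
  case True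
  then show ?thesis by (intro exI[of _ 0]) simp
next
  case False
  interpret bounded_linear f by fact
  obtain x1 where "f x1 \<noteq> 0" using False by blast
  then have "f ((1 / f x1) *\<^sub>R x1) = 1" by (simp add: scaleR)
  then have ne: "{x. f x = 1} \<noteq> {}" by blast
  have cl: "closed {x. f x = 1}"
    by (intro closed_Collect_eq continuous_intros continuous_on)
  have "convex {x. f x = 1}"
    unfolding convex_def by (auto simp: add scaleR)
  from min_norm_point_exists[OF cl this ne] obtain z where z: "f z = 1" and
    min: "\<And>y. f y = 1 \<Longrightarrow> norm z \<le> norm y" by auto
  have orth: "z \<bullet> y = 0" if "f y = 0" for y
    by (rule min_norm_imp_orthogonal, rule min) (simp add: add scaleR z that)
  have z0: "z \<bullet> z \<noteq> 0" using z zero by auto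
  have "f x = ((1 / (z \<bullet> z)) *\<^sub>R z) \<bullet> x" for x
  proof -
    have "z \<bullet> (x - f x *\<^sub>R z) = 0" by (rule orth) (simp add: diff scaleR z)
    then have "z \<bullet> x = f x * (z \<bullet> z)" by (simp add: inner_simps)
    then show ?thesis using z0 by (simp add: field_simps)
  qed
  then show ?thesis by blast
qed

text \<open>The points \<open>x\<close> against which the inner products converge form a closed subspace. A diagonal
  argument puts all members of the sequence into it, so its orthogonal complement only produces
  constant zero sequences, and it is the whole space.\<close>

lemma bounded_imp_weakly_convergent_subseq:
  fixes u :: "nat \<Rightarrow> 'a::{real_inner,complete_space}"
  assumes R: "\<And>n. norm (u n) \<le> R"
  shows "\<exists>r w. strict_mono r \<and> (\<forall>x. (\<lambda>n. u (r n) \<bullet> x) \<longlonglongrightarrow> w \<bullet> x)"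
proof -
  have R0: "R \<ge> 0" using R[of 0] norm_ge_zero order_trans by blast
  interpret subseqs "\<lambda>n s. convergent (\<lambda>i. u (s i) \<bullet> u n)"
  proof
    fix n and s :: "nat \<Rightarrow> nat" assume "strict_mono s"
    have "\<bar>u (s i) \<bullet> u n\<bar> \<le> R * R" for i
      using Cauchy_Schwarz_ineq2[of "u (s i)" "u n"] R[of "s i"] R[of n]
      by (smt (verit) mult_mono norm_ge_zero)
    then have "bounded (range (\<lambda>i. u (s i) \<bullet> u n))" by (intro boundedI[of _ "R*R"]) auto
    from bounded_imp_convergent_subsequence[OF this] obtain l r'
      where "strict_mono r'" "((\<lambda>i. u (s i) \<bullet> u n) \<circ> r') \<longlonglongrightarrow> l" by blast
    then show "\<exists>r'. strict_mono r' \<and> convergent (\<lambda>i. u ((s \<circ> r') i) \<bullet> u n)"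
      by (auto simp: convergent_def o_def)
  qed
  define r where "r = diagseq"
  have sm: "strict_mono r" unfolding r_def by (rule subseq_diagseq)
  have conv_u: "convergent (\<lambda>i. u (r i) \<bullet> u k)" for k
  proof -
    have "convergent (\<lambda>i. u ((diagseq \<circ> (+) (Suc k)) i) \<bullet> u k)"
      by (rule diagseq_holds) (auto dest: convergent_subseq_convergent simp: o_def)
    then show ?thesis unfolding r_def o_def using convergent_ignore_initial_segment[of "\<lambda>i. u (diagseq i) \<bullet> u k" "Suc k"]
      by (simp add: add.commute)
  qed
  define A where "A = {x. convergent (\<lambda>i. u (r i) \<bullet> x)}"
  have subA: "subspace A"
    unfolding subspace_def A_def by (auto simp: inner_add_right intro: convergent_add convergent_mult convergent_const)
  have clA: "closed A"
  proof (rule closed_sequential_limits[THEN iffD2], safe)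
    fix x l assume x: "\<forall>n. x n \<in> A" and l: "x \<longlonglongrightarrow> l"
    have "Cauchy (\<lambda>i. u (r i) \<bullet> l)"
    proof (rule metric_CauchyI)
      fix e :: real assume e: "e > 0"
      then have "e / (3 * (R + 1)) > 0" using R0 by simp
      then obtain n where n: "norm (x n - l) < e / (3 * (R + 1))"
        using LIMSEQ_D[OF l] by blast
      have "Cauchy (\<lambda>i. u (r i) \<bullet> x n)"
        using x by (auto simp: A_def intro: convergent_Cauchy)
      then obtain M where M: "\<And>i j. i \<ge> M \<Longrightarrow> j \<ge> M \<Longrightarrow> \<bar>u (r i) \<bullet> x n - u (r j) \<bullet> x n\<bar> < e/3"
        using metric_CauchyD[of "\<lambda>i. u (r i) \<bullet> x n" "e/3"] e unfolding dist_real_def by auto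
      have small: "\<bar>u i \<bullet> (x n - l)\<bar> < e/3" for i
      proof -
        have "\<bar>u i \<bullet> (x n - l)\<bar> \<le> (R + 1) * norm (x n - l)"
          using Cauchy_Schwarz_ineq2[of "u i" "x n - l"] R[of i]
          by (smt (verit) mult_right_mono norm_ge_zero)
        also have "\<dots> < (R + 1) * (e / (3 * (R + 1)))" using n R0 by (intro mult_strict_left_mono) auto
        also have "\<dots> = e/3" using R0 by (simp add: field_simps)
        finally show ?thesis .
      qed
      have "dist (u (r i) \<bullet> l) (u (r j) \<bullet> l) < e" if "i \<ge> M" "j \<ge> M" for i j
        using M[OF that] small[of "r i"] small[of "r j"] unfolding dist_real_def inner_diff_right by linarith
      then show "\<exists>M. \<forall>m\<ge>M. \<forall>n\<ge>M. dist (u (r m) \<bullet> l) (u (r n) \<bullet> l) < e" by blast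
    qed
    then show "l \<in> A" by (simp add: A_def Cauchy_convergent)
  qed
  have uA: "u k \<in> A" for k using conv_u by (simp add: A_def)
  have conv: "convergent (\<lambda>i. u (r i) \<bullet> x)" for x
  proof -
    obtain p where p: "p \<in> A" "\<And>s. s \<in> A \<Longrightarrow> (x - p) \<bullet> s = 0"
      using orthogonal_projection_exists[OF clA subA] by blast
    have "u i \<bullet> x = u i \<bullet> p" for i using p(2)[OF uA, of i] by (simp add: inner_diff_right inner_commute[of _ "u i"])
    then show ?thesis using p(1) by (simp add: A_def)
  qed
  define L where "L x = lim (\<lambda>i. u (r i) \<bullet> x)" for x
  have L: "(\<lambda>i. u (r i) \<bullet> x) \<longlonglongrightarrow> L x" for x
    using conv unfolding L_def by (simp add: convergent_LIMSEQ_iff)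
  have "bounded_linear L"
  proof (rule bounded_linear_intro)
    show "L (x + y) = L x + L y" for x y
      using LIMSEQ_unique[OF L[of "x + y"]] tendsto_add[OF L[of x] L[of y]] by (simp add: inner_add_right)
    show "L (c *\<^sub>R x) = c *\<^sub>R L x" for c x
      using LIMSEQ_unique[OF L[of "c *\<^sub>R x"]] tendsto_mult[OF tendsto_const L[of x], of c] by simp
    show "norm (L x) \<le> norm x * R" for x
    proof (rule tendsto_upperbound[OF tendsto_norm[OF L[of x]]])
      show "\<forall>\<^sub>F i in sequentially. norm (u (r i) \<bullet> x) \<le> norm x * R"
      proof (intro always_eventually allI)
        fix i
        have "\<bar>u (r i) \<bullet> x\<bar> \<le> norm (u (r i)) * norm x" by (rule Cauchy_Schwarz_ineq2)
        also have "\<dots> \<le> R * norm x" using R by (intro mult_right_mono) auto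
        finally show "norm (u (r i) \<bullet> x) \<le> norm x * R" by (simp add: mult.commute)
      qed
    qed simp
  qed
  from riesz_representation[OF this] obtain w where "\<And>x. L x = w \<bullet> x" by blast
  then show ?thesis using sm L by metis
qed

text \<open>The minimax principle in the form that yields almost critical points. If the gradient were
  bounded below on the slab between the ridge and the top of the segment, then finitely many short
  steps of steepest descent, cut off below the ridge so that both end points stay fixed, would
  deform the segment continuously into a path that never reaches the height of the ridge; but
  every such path has to cross the sphere. Uniform continuity of the gradient on bounded
  sets gives one step length for all points, so that discrete steps replace the gradient flow.\<close>

lemma mountain_pass_almost_critical_points:
  fixes J :: "'a::real_inner \<Rightarrow> real" and G :: "'a \<Rightarrow> 'a"
  assumes deriv: "\<And>x. (J has_derivative (\<lambda>h. G x \<bullet> h)) (at x)"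
    and uc: "\<And>R \<epsilon>. \<epsilon> > 0 \<Longrightarrow>
       \<exists>\<delta>>0. \<forall>x y. norm x \<le> R \<longrightarrow> norm y \<le> R \<longrightarrow> norm (x - y) \<le> \<delta> \<longrightarrow> norm (G x - G y) \<le> \<epsilon>"
    and J0: "J 0 \<le> 0" and Je: "J e \<le> 0" and r: "r > 0" "norm e > r"
    and a: "a > 0" and ridge: "\<And>x. norm x = r \<Longrightarrow> a \<le> J x"
  shows "\<exists>b. \<forall>\<delta>>0. \<exists>x. a / 2 \<le> J x \<and> J x \<le> b \<and> norm (G x) \<le> \<delta>"
proof -
  have contJ: "continuous_on UNIV J"
    by (intro continuous_at_imp_continuous_on ballI) (rule has_derivative_continuous[OF deriv])
  have contG: "continuous_on UNIV G"
  proof (rule continuous_at_imp_continuous_on, rule ballI)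
    fix x
    show "isCont G x"
      unfolding continuous_at_eps_delta
    proof (intro allI impI)
      fix \<epsilon> :: real assume "\<epsilon> > 0"
      from uc[of "\<epsilon>/2" "norm x + 1"] this obtain \<delta> where \<delta>: "\<delta> > 0"
        "\<And>x' y. norm x' \<le> norm x + 1 \<Longrightarrow> norm y \<le> norm x + 1 \<Longrightarrow> norm (x' - y) \<le> \<delta> \<Longrightarrow> norm (G x' - G y) \<le> \<epsilon>/2"
        by fastforce
      have "dist (G y) (G x) < \<epsilon>" if "dist y x < min 1 \<delta>" for y
      proof -
        have "norm y \<le> norm x + 1" using that norm_triangle_sub[of y x] by (simp add: dist_norm)
        then have "norm (G y - G x) \<le> \<epsilon>/2" using \<delta>(2)[of y x] that by (simp add: dist_norm)
        then show ?thesis using \<open>\<epsilon> > 0\<close> by (simp add: dist_norm)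
      qed
      then show "\<exists>d>0. \<forall>x'. dist x' x < d \<longrightarrow> dist (G x') (G x) < \<epsilon>"
        using \<delta>(1) by (intro exI[of _ "min 1 \<delta>"]) auto
    qed
  qed
  have "compact ((\<lambda>t. J (t *\<^sub>R e)) ` {0..1})"
    by (intro compact_continuous_image continuous_on_compose2[OF contJ] continuous_intros) auto
  then have "bounded ((\<lambda>t. J (t *\<^sub>R e)) ` {0..1})" by (rule compact_imp_bounded)
  then obtain b where "\<forall>z\<in>(\<lambda>t. J (t *\<^sub>R e)) ` {0..1}. norm z \<le> b" unfolding bounded_iff by blast
  then have bseg: "\<And>t. 0 \<le> t \<Longrightarrow> t \<le> 1 \<Longrightarrow> J (t *\<^sub>R e) \<le> b" by force
  have "\<exists>x. a / 2 \<le> J x \<and> J x \<le> b \<and> norm (G x) \<le> d" if d: "d > 0" for d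
  proof (rule ccontr)
    assume "\<not> ?thesis"
    then have big: "\<And>x. a / 2 \<le> J x \<Longrightarrow> J x \<le> b \<Longrightarrow> norm (G x) > d" by force
    have b0: "b > 0"
    proof -
      have "norm ((r / norm e) *\<^sub>R e) = r" using r by auto
      from ridge[OF this] have "a \<le> J ((r / norm e) *\<^sub>R e)" .
      moreover have "r / norm e \<le> 1" "0 \<le> r / norm e" using r by (auto simp add: divide_le_eq_1)
      ultimately show ?thesis
        using bseg[of "r / norm e"] a by linarith
    qed
    define R where "R = norm e + 2 * b / d + 2"
    obtain s0 where s0: "s0 > 0"
      "\<And>x y. norm x \<le> R \<Longrightarrow> norm y \<le> R \<Longrightarrow> norm (x - y) \<le> s0 \<Longrightarrow> norm (G x - G y) \<le> d/2"
      using uc[of "d/2" R] d by auto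
    define s where "s = min 1 s0"
    have s: "s > 0" "s \<le> 1" "s \<le> s0" using s0 by (auto simp: s_def)
    \<comment> \<open>The cutoff vanishes at levels up to \<open>a / 2\<close>, where both end points lie, and equals \<open>1\<close> from \<open>a\<close> on.\<close>
    define \<eta> where "\<eta> t = min 1 (max 0 ((t - a/2) / (a/2)))" for t :: real
    have \<eta>: "0 \<le> \<eta> t" "\<eta> t \<le> 1" for t by (auto simp: \<eta>_def)
    have \<eta>0: "\<eta> t = 0" if "t \<le> a/2" for t using that a by (simp add: \<eta>_def min_def max_def field_simps)
    have \<eta>1: "\<eta> t = 1" if "a \<le> t" for t using that a by (simp add: \<eta>_def min_def max_def field_simps)
    define V where "V x = (1 / max d (norm (G x))) *\<^sub>R G x" for x
    have V1: "norm (V x) \<le> 1" for x using d by (simp add: V_def field_simps)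
    define T where "T x = x - (s * \<eta> (J x)) *\<^sub>R V x" for x
    have contT: "continuous_on UNIV T"
      unfolding T_def V_def \<eta>_def using d a
      by (intro continuous_intros contJ contG) (auto simp: max_def)
    have Tn: "norm (T x) \<le> norm x + s" for x
    proof -
      have "norm (T x) \<le> norm x + norm ((s * \<eta> (J x)) *\<^sub>R V x)" unfolding T_def by (rule norm_triangle_ineq4)
      also have "norm ((s * \<eta> (J x)) *\<^sub>R V x) \<le> (s * 1) * 1"
        using s \<eta>[of "J x"] V1[of x] unfolding norm_scaleR by (intro mult_mono) (auto simp: abs_mult)
      finally show ?thesis by simp
    qed
    have descent: "J (T x) \<le> J x - s * \<eta> (J x) * (d/2)" if x: "norm x \<le> R - 1" "J x \<le> b" for x
    proof (cases "J x \<le> a/2")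
      case True
      then show ?thesis by (simp add: T_def \<eta>0)
    next
      case False
      define \<sigma> where "\<sigma> = s * \<eta> (J x)"
      have \<sigma>: "0 \<le> \<sigma>" "\<sigma> \<le> s"
        using s \<eta>[of "J x"] by (auto simp: \<sigma>_def intro: mult_left_le)
      have Gd: "norm (G x) > d" using False x(2) by (intro big) auto
      then have GV: "G x \<bullet> V x = norm (G x)"
        by (simp add: V_def max_def dot_square_norm power2_eq_square)
      define g where "g t = J (x - (t * \<sigma>) *\<^sub>R V x)" for t
      have gd: "(g has_real_derivative - \<sigma> * (G (x - (t * \<sigma>) *\<^sub>R V x) \<bullet> V x)) (at t)" for t
      proof -
        have "((\<lambda>t. x - (t * \<sigma>) *\<^sub>R V x) has_derivative (\<lambda>h. - ((h * \<sigma>) *\<^sub>R V x))) (at t)"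
          by (auto intro!: derivative_eq_intros)
        from has_derivative_compose[OF this deriv]
        have "(g has_derivative (\<lambda>h. G (x - (t * \<sigma>) *\<^sub>R V x) \<bullet> (- ((h * \<sigma>) *\<^sub>R V x)))) (at t)"
          unfolding g_def .
        then show ?thesis unfolding has_field_derivative_def
          by (rule has_derivative_eq_rhs) (auto simp: algebra_simps)
      qed
      obtain \<xi> where \<xi>: "0 < \<xi>" "\<xi> < 1"
        "g 1 - g 0 = (1 - 0) * (- \<sigma> * (G (x - (\<xi> * \<sigma>) *\<^sub>R V x) \<bullet> V x))"
        using MVT2[of 0 1 g "\<lambda>t. - \<sigma> * (G (x - (t * \<sigma>) *\<^sub>R V x) \<bullet> V x)"] gd by auto
      define y where "y = x - (\<xi> * \<sigma>) *\<^sub>R V x"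
      have nxy: "norm (x - y) \<le> s"
      proof -
        have "norm (x - y) = \<xi> * \<sigma> * norm (V x)" using \<xi> \<sigma> by (simp add: y_def)
        also have "\<dots> \<le> (1 * s) * 1" using \<xi> \<sigma> V1[of x] s by (intro mult_mono) auto
        finally show ?thesis by simp
      qed
      have "norm y \<le> R" using nxy x(1) s norm_triangle_sub[of y x] by (simp add: norm_minus_commute)
      then have Gxy: "norm (G x - G y) \<le> d/2" using s0(2)[of x y] nxy s x(1) by simp
      have "(G x - G y) \<bullet> V x \<le> d/2"
      proof -
        have "(G x - G y) \<bullet> V x \<le> norm (G x - G y) * norm (V x)" by (rule norm_cauchy_schwarz)
        also have "\<dots> \<le> (d/2) * 1" using Gxy V1[of x] d by (intro mult_mono) auto
        finally show ?thesis by simp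
      qed
      then have "G y \<bullet> V x \<ge> d/2" using GV Gd by (simp add: inner_diff_left)
      then have "\<sigma> * (G y \<bullet> V x) \<ge> \<sigma> * (d/2)" using \<sigma> by (intro mult_left_mono) auto
      then show ?thesis using \<xi>(3) by (simp add: g_def T_def y_def \<sigma>_def)
    qed
    define \<gamma> where "\<gamma> k t = (T ^^ k) (t *\<^sub>R e)" for k t
    have \<gamma>Suc: "\<gamma> (Suc k) t = T (\<gamma> k t)" for k t by (simp add: \<gamma>_def)
    have \<gamma>n: "norm (\<gamma> k t) \<le> norm e + real k * s" if "0 \<le> t" "t \<le> 1" for k t
    proof (induction k)
      case 0
      then show ?case using that by (simp add: \<gamma>_def mult_left_le_one_le)
    next
      case (Suc k)
      then show ?case using Tn[of "\<gamma> k t"] by (simp add: \<gamma>Suc algebra_simps)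
    qed
    \<comment> \<open>Each step lowers a level above \<open>a\<close> by \<open>s d / 2\<close>, and levels start below \<open>b\<close>.\<close>
    define K where "K = nat \<lceil>2 * b / (s * d)\<rceil>"
    have "2 * b / (s * d) \<ge> 0" using b0 s d by simp
    then have K: "real K \<ge> 2 * b / (s * d)" "real K \<le> 2 * b / (s * d) + 1"
      unfolding K_def by linarith+
    have Ks: "real K * s \<le> 2 * b / d + 1"
    proof -
      have "real K * s \<le> (2 * b / (s * d) + 1) * s" using K s by (intro mult_right_mono) auto
      also have "\<dots> = 2 * b / d + s" using s d by (simp add: field_simps)
      finally show ?thesis using s by linarith
    qed
    have Kb: "real K * s * (d/2) \<ge> b"
    proof -
      have "real K * (s * (d/2)) \<ge> 2 * b / (s * d) * (s * (d/2))" using K(1) s d by (intro mult_right_mono) auto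
      then show ?thesis using s d by simp
    qed
    have desc: "J (\<gamma> k t) \<le> b \<and> (J (\<gamma> k t) < a \<or> J (\<gamma> k t) \<le> b - real k * s * (d/2))"
      if t: "0 \<le> t" "t \<le> 1" and "k \<le> K" for k t
      using \<open>k \<le> K\<close>
    proof (induction k)
      case 0
      then show ?case using bseg t by (simp add: \<gamma>_def)
    next
      case (Suc k)
      have "real k * s \<le> real K * s" using Suc.prems s by (intro mult_right_mono) auto
      then have "norm (\<gamma> k t) \<le> R - 1" using \<gamma>n[OF t, of k] Ks by (simp add: R_def)
      from descent[OF this] Suc have D: "J (\<gamma> (Suc k) t) \<le> J (\<gamma> k t) - s * \<eta> (J (\<gamma> k t)) * (d/2)"
        by (simp add: \<gamma>Suc)
      have nn: "s * \<eta> (J (\<gamma> k t)) * (d/2) \<ge> 0" using s d \<eta> by simp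
      show ?case
      proof (cases "J (\<gamma> k t) < a")
        case True
        then show ?thesis using D nn Suc by linarith
      next
        case False
        then have "\<eta> (J (\<gamma> k t)) = 1" by (intro \<eta>1) auto
        moreover have "J (\<gamma> k t) \<le> b - real k * s * (d/2)" using False Suc by simp
        ultimately show ?thesis using D nn Suc by (simp add: algebra_simps add_divide_distrib)
      qed
    qed
    have below: "J (\<gamma> K t) < a" if "0 \<le> t" "t \<le> 1" for t
      using desc[OF that, of K] Kb a by auto
    have "T 0 = 0" "T e = e" using J0 Je a by (auto simp: T_def \<eta>0)
    then have ends: "\<gamma> K 0 = 0" "\<gamma> K 1 = e"
      unfolding \<gamma>_def by (induction K) auto
    have "continuous_on UNIV (T ^^ k)" for k
    proof (induction k)
      case (Suc k)
      then show ?case using continuous_on_compose[OF Suc continuous_on_subset[OF contT]] by (simp add: comp_def)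
    qed (simp add: id_def)
    then have "continuous_on {0..1} (\<lambda>t. norm (\<gamma> K t))"
      unfolding \<gamma>_def
      by (intro continuous_on_norm continuous_on_compose2[of UNIV "T ^^ K" "{0..1}" "\<lambda>t. t *\<^sub>R e"]
          continuous_intros) auto
    then obtain t where "0 \<le> t" "t \<le> 1" "norm (\<gamma> K t) = r"
      using IVT'[of "\<lambda>t. norm (\<gamma> K t)" 0 r 1] ends r by auto
    then show False using ridge[of "\<gamma> K t"] below[of t] by linarith
  qed
  then show ?thesis by blast
qed

section \<open>The space of square integrable functions\<close>

definition norm2 :: "'a measure \<Rightarrow> ('a \<Rightarrow> 'b::euclidean_space) \<Rightarrow> real" where
  "norm2 M f = sqrt (\<integral>z. (norm (f z))\<^sup>2 \<partial>M)"

lemma L2_measurable [measurable_dest]: "f \<in> L2 M \<Longrightarrow> f \<in> borel_measurable M"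
  and L2_integrable_square: "f \<in> L2 M \<Longrightarrow> integrable M (\<lambda>z. (norm (f z))\<^sup>2)"
  by (auto simp: L2_def)

lemma norm2_nonneg [simp]: "0 \<le> norm2 M f"
  by (simp add: norm2_def)

lemma norm2_square: "(norm2 M f)\<^sup>2 = (\<integral>z. (norm (f z))\<^sup>2 \<partial>M)"
  by (simp add: norm2_def)

lemma norm2_square_real: "(norm2 M f)\<^sup>2 = (\<integral>z. (f z)\<^sup>2 \<partial>M)" for f :: "'a \<Rightarrow> real"
  by (simp add: norm2_def)

lemma norm2_le_iff: "0 \<le> c \<Longrightarrow> norm2 M f \<le> c \<longleftrightarrow> (\<integral>z. (norm (f z))\<^sup>2 \<partial>M) \<le> c\<^sup>2"
  unfolding norm2_square[symmetric] by (simp add: power_mono_iff)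

lemma L2_dominated:
  assumes g: "g \<in> L2 M" and f: "f \<in> borel_measurable M" and le: "AE z in M. norm (f z) \<le> norm (g z)"
  shows "f \<in> L2 M"
  unfolding L2_def
proof (safe intro!: f Bochner_Integration.integrable_bound[OF L2_integrable_square[OF g]])
  show "AE z in M. norm ((norm (f z))\<^sup>2) \<le> norm ((norm (g z))\<^sup>2)"
    using le by eventually_elim (simp add: power_mono)
qed (use f in measurable)

lemma norm2_cong_AE:
  assumes "f \<in> borel_measurable M" "g \<in> borel_measurable M" "AE z in M. f z = g z"
  shows "norm2 M f = norm2 M g"
  unfolding norm2_def using assms by (intro arg_cong[where f=sqrt] integral_cong_AE) auto

lemma norm2_mono:
  assumes g: "g \<in> L2 M" and f: "f \<in> borel_measurable M" and le: "AE z in M. norm (f z) \<le> norm (g z)"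
  shows "norm2 M f \<le> norm2 M g"
  unfolding norm2_def
proof (intro real_sqrt_le_mono integral_mono_AE)
  show "AE z in M. (norm (f z))\<^sup>2 \<le> (norm (g z))\<^sup>2"
    using le by eventually_elim (simp add: power_mono)
qed (use g L2_dominated[OF assms] in \<open>auto intro: L2_integrable_square\<close>)

lemma norm_add_square_le: "(norm (x + y))\<^sup>2 \<le> 2 * (norm x)\<^sup>2 + 2 * (norm y)\<^sup>2" for x y :: "'a::real_inner"
proof -
  have "(norm (x + y))\<^sup>2 + (norm (x - y))\<^sup>2 = 2 * (norm x)\<^sup>2 + 2 * (norm y)\<^sup>2"
    by (simp add: power2_norm_eq_inner inner_simps inner_commute)
  then show ?thesis by (smt (verit) zero_le_power2)
qed

lemma L2_add:
  assumes f: "f \<in> L2 M" and g: "g \<in> L2 M" shows "(\<lambda>z. f z + g z) \<in> L2 M"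
  unfolding L2_def
proof safe
  show m: "(\<lambda>z. f z + g z) \<in> borel_measurable M" using f g by measurable
  show "integrable M (\<lambda>z. (norm (f z + g z))\<^sup>2)"
  proof (rule Bochner_Integration.integrable_bound)
    show "integrable M (\<lambda>z. 2 * (norm (f z))\<^sup>2 + 2 * (norm (g z))\<^sup>2)"
      using L2_integrable_square[OF f] L2_integrable_square[OF g] by auto
    show "AE z in M. norm ((norm (f z + g z))\<^sup>2) \<le> norm (2 * (norm (f z))\<^sup>2 + 2 * (norm (g z))\<^sup>2)"
      using norm_add_square_le by (auto simp: abs_of_nonneg)
  qed (use m in measurable)
qed

lemma L2_scaleR: "f \<in> L2 M \<Longrightarrow> (\<lambda>z. c *\<^sub>R f z) \<in> L2 M"
  by (auto simp: L2_def power_mult_distrib)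

lemma L2_cmult: "f \<in> L2 M \<Longrightarrow> (\<lambda>z. c * f z) \<in> L2 M" for f :: "'a \<Rightarrow> real"
  using L2_scaleR[of f M c] by simp

lemma L2_uminus: "f \<in> L2 M \<Longrightarrow> (\<lambda>z. - f z) \<in> L2 M"
  using L2_scaleR[of f M "-1"] by simp

lemma L2_diff: "f \<in> L2 M \<Longrightarrow> g \<in> L2 M \<Longrightarrow> (\<lambda>z. f z - g z) \<in> L2 M"
  using L2_add[OF _ L2_uminus, of f M g] by simp

lemma L2_zero: "(\<lambda>z. 0) \<in> L2 M"
  by (simp add: L2_def)

lemma L2_norm: "f \<in> L2 M \<Longrightarrow> (\<lambda>z. norm (f z)) \<in> L2 M"
  by (auto simp: L2_def)

lemma L2_inner_const: "f \<in> L2 M \<Longrightarrow> (\<lambda>z. f z \<bullet> b) \<in> L2 M"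
proof -
  assume f: "f \<in> L2 M"
  have "AE z in M. norm (f z \<bullet> b) \<le> norm (norm b *\<^sub>R f z)"
    using Cauchy_Schwarz_ineq2[of "f _" b] by (intro AE_I2) (simp add: mult.commute)
  then show ?thesis by (rule L2_dominated[OF L2_scaleR[OF f, of "norm b"] borel_measurable_inner[OF L2_measurable[OF f] borel_measurable_const]])
qed

lemma L2_of_components:
  assumes "\<And>b. b \<in> Basis \<Longrightarrow> (\<lambda>z. f z \<bullet> b) \<in> L2 M" shows "f \<in> L2 M"
proof -
  have "(\<lambda>z. \<Sum>b\<in>B. (f z \<bullet> b) *\<^sub>R b) \<in> L2 M" if "finite B" "B \<subseteq> Basis" for B
    using that
  proof induction
    case (insert b B)
    have "(\<lambda>z. (f z \<bullet> b) *\<^sub>R b) \<in> L2 M"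
    proof (rule L2_dominated)
      show "(\<lambda>z. norm b *\<^sub>R (f z \<bullet> b)) \<in> L2 M" using insert assms by (intro L2_scaleR) auto
      show "(\<lambda>z. (f z \<bullet> b) *\<^sub>R b) \<in> borel_measurable M"
        using assms[of b] insert by (intro borel_measurable_scaleR[OF L2_measurable borel_measurable_const]) auto
    qed (auto simp: abs_mult)
    with insert show ?case by (auto intro: L2_add)
  qed (auto intro: L2_zero)
  from this[of Basis] show ?thesis by (simp add: euclidean_representation)
qed

lemma integrable_norm_mult_norm:
  assumes f: "f \<in> L2 M" and g: "g \<in> L2 M"
  shows "integrable M (\<lambda>z. norm (f z) * norm (g z))"
proof (rule Bochner_Integration.integrable_bound)
  show "integrable M (\<lambda>z. (norm (f z))\<^sup>2 + (norm (g z))\<^sup>2)" using L2_integrable_square[OF f] L2_integrable_square[OF g] by auto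
  show "AE z in M. norm (norm (f z) * norm (g z)) \<le> norm ((norm (f z))\<^sup>2 + (norm (g z))\<^sup>2)"
  proof (rule AE_I2)
    fix z
    have "norm (f z) * norm (g z) \<le> (norm (f z))\<^sup>2 + (norm (g z))\<^sup>2"
      using sum_squares_bound[of "norm (f z)" "norm (g z)"]
        mult_nonneg_nonneg[OF norm_ge_zero[of "f z"] norm_ge_zero[of "g z"]]
      unfolding mult.assoc by linarith
    then show "norm (norm (f z) * norm (g z)) \<le> norm ((norm (f z))\<^sup>2 + (norm (g z))\<^sup>2)" by simp
  qed
  show "(\<lambda>z. norm (f z) * norm (g z)) \<in> borel_measurable M" using f g by measurable
qed

lemma integrable_inner:
  assumes f: "f \<in> L2 M" and g: "g \<in> L2 M" shows "integrable M (\<lambda>z. f z \<bullet> g z)"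
proof (rule Bochner_Integration.integrable_bound[OF integrable_norm_mult_norm[OF f g]])
  show "(\<lambda>z. f z \<bullet> g z) \<in> borel_measurable M"
    by (intro borel_measurable_inner L2_measurable f g)
  show "AE z in M. norm (f z \<bullet> g z) \<le> norm (norm (f z) * norm (g z))"
    using Cauchy_Schwarz_ineq2[of "f _" "g _"] by (intro AE_I2) (simp add: abs_mult)
qed

lemma integrable_mult_L2:
  fixes f g :: "'a \<Rightarrow> real"
  assumes f: "f \<in> L2 M" and g: "g \<in> L2 M" shows "integrable M (\<lambda>z. f z * g z)"
  using integrable_inner[OF f g] by simp

lemma Cauchy_Schwarz_norms:
  assumes f: "f \<in> L2 M" and g: "g \<in> L2 M"
  shows "(\<integral>z. norm (f z) * norm (g z) \<partial>M) \<le> norm2 M f * norm2 M g"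
proof -
  note int = L2_integrable_square[OF f] L2_integrable_square[OF g] integrable_norm_mult_norm[OF f g]
  define a b c where "a = (\<integral>z. (norm (f z))\<^sup>2 \<partial>M)" and "b = (\<integral>z. (norm (g z))\<^sup>2 \<partial>M)"
    and "c = (\<integral>z. norm (f z) * norm (g z) \<partial>M)"
  have a0: "a \<ge> 0" and b0: "b \<ge> 0" by (simp_all add: a_def b_def)
  have key: "t\<^sup>2 * a - 2 * t * c + b \<ge> 0" for t
  proof -
    have "0 \<le> (\<integral>z. (t * norm (f z) - norm (g z))\<^sup>2 \<partial>M)" by simp
    also have "(\<integral>z. (t * norm (f z) - norm (g z))\<^sup>2 \<partial>M)
      = (\<integral>z. t\<^sup>2 * (norm (f z))\<^sup>2 - 2 * t * (norm (f z) * norm (g z)) + (norm (g z))\<^sup>2 \<partial>M)"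
      by (intro Bochner_Integration.integral_cong) (auto simp: power2_eq_square algebra_simps)
    also have "\<dots> = t\<^sup>2 * a - 2 * t * c + b" using int by (simp add: a_def b_def c_def)
    finally show ?thesis .
  qed
  have "c\<^sup>2 \<le> a * b"
  proof (cases "a = 0")
    case True
    have "c = 0"
    proof (rule ccontr)
      assume "c \<noteq> 0"
      then have "2 * ((b + 1) / (2 * c)) * c = b + 1" by (simp add: field_simps)
      with key[of "(b + 1) / (2 * c)"] True show False by simp
    qed
    then show ?thesis using True by simp
  next
    case False
    then show ?thesis using key[of "c / a"] a0 by (simp add: power2_eq_square field_simps)
  qed
  then have "c \<le> sqrt (a * b)" by (rule real_le_rsqrt)
  then show ?thesis by (simp add: norm2_def a_def b_def c_def real_sqrt_mult)
qed

lemma Cauchy_Schwarz_L2: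
  assumes f: "f \<in> L2 M" and g: "g \<in> L2 M"
  shows "\<bar>\<integral>z. f z \<bullet> g z \<partial>M\<bar> \<le> norm2 M f * norm2 M g"
proof -
  have "\<bar>\<integral>z. f z \<bullet> g z \<partial>M\<bar> \<le> (\<integral>z. norm (f z) * norm (g z) \<partial>M)"
    using Cauchy_Schwarz_ineq2
    by (intro order_trans[OF integral_abs_bound] integral_mono integrable_abs
        integrable_inner integrable_norm_mult_norm f g) auto
  also note Cauchy_Schwarz_norms[OF f g]
  finally show ?thesis .
qed

lemma Cauchy_Schwarz_L2_real:
  fixes f g :: "'a \<Rightarrow> real"
  assumes f: "f \<in> L2 M" and g: "g \<in> L2 M"
  shows "\<bar>\<integral>z. f z * g z \<partial>M\<bar> \<le> norm2 M f * norm2 M g"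
  using Cauchy_Schwarz_L2[OF f g] by simp

lemma norm2_add_square:
  assumes f: "f \<in> L2 M" and g: "g \<in> L2 M"
  shows "(norm2 M (\<lambda>z. f z + g z))\<^sup>2 = (norm2 M f)\<^sup>2 + 2 * (\<integral>z. f z \<bullet> g z \<partial>M) + (norm2 M g)\<^sup>2"
proof -
  note int = L2_integrable_square[OF f] L2_integrable_square[OF g] integrable_inner[OF f g]
  have "(\<integral>z. (norm (f z + g z))\<^sup>2 \<partial>M) = (\<integral>z. (norm (f z))\<^sup>2 + 2 * (f z \<bullet> g z) + (norm (g z))\<^sup>2 \<partial>M)"
    by (intro Bochner_Integration.integral_cong) (auto simp: power2_norm_eq_inner inner_simps inner_commute)
  then show ?thesis using int by (simp add: norm2_square)
qed

lemma norm2_triangle: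
  assumes f: "f \<in> L2 M" and g: "g \<in> L2 M"
  shows "norm2 M (\<lambda>z. f z + g z) \<le> norm2 M f + norm2 M g"
proof (rule power2_le_imp_le)
  show "(norm2 M (\<lambda>z. f z + g z))\<^sup>2 \<le> (norm2 M f + norm2 M g)\<^sup>2"
    using norm2_add_square[OF f g] Cauchy_Schwarz_L2[OF f g] by (simp add: power2_sum)
qed simp

lemma norm2_scaleR: "norm2 M (\<lambda>z. c *\<^sub>R f z) = \<bar>c\<bar> * norm2 M f"
  by (simp add: norm2_def power_mult_distrib real_sqrt_mult)

lemma norm2_cmult: "norm2 M (\<lambda>z. c * f z) = \<bar>c\<bar> * norm2 M f" for f :: "'a \<Rightarrow> real"
  using norm2_scaleR[of M c f] by simp

lemma norm2_uminus: "norm2 M (\<lambda>z. - f z) = norm2 M f"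
  by (simp add: norm2_def)

lemma norm2_diff_commute: "norm2 M (\<lambda>z. f z - g z) = norm2 M (\<lambda>z. g z - f z)"
  by (simp add: norm2_def norm_minus_commute)

lemma norm2_triangle_diff:
  assumes "f \<in> L2 M" "g \<in> L2 M" "h \<in> L2 M"
  shows "norm2 M (\<lambda>z. f z - h z) \<le> norm2 M (\<lambda>z. f z - g z) + norm2 M (\<lambda>z. g z - h z)"
  using norm2_triangle[OF L2_diff[OF assms(1,2)] L2_diff[OF assms(2,3)]] by simp

lemma norm2_eq_0_imp_AE:
  assumes f: "f \<in> L2 M" and "norm2 M f = 0" shows "AE z in M. f z = 0"
proof -
  have "(\<integral>z. (norm (f z))\<^sup>2 \<partial>M) = 0" using assms by (simp add: norm2_def)
  then have "AE z in M. (norm (f z))\<^sup>2 = 0"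
    using integral_nonneg_eq_0_iff_AE[OF L2_integrable_square[OF f]] by simp
  then show ?thesis by simp
qed

lemma norm2_le_sum_components:
  fixes f :: "'a \<Rightarrow> 'b::euclidean_space"
  assumes "f \<in> L2 M" shows "norm2 M f \<le> (\<Sum>b\<in>Basis. norm2 M (\<lambda>z. f z \<bullet> b))"
proof -
  have "(norm2 M f)\<^sup>2 = (\<integral>z. (\<Sum>b\<in>Basis. (f z \<bullet> b)\<^sup>2) \<partial>M)"
    unfolding norm2_square power2_norm_eq_inner by (subst euclidean_inner) (simp add: power2_eq_square)
  also have "\<dots> = (\<Sum>b\<in>Basis. (norm2 M (\<lambda>z. f z \<bullet> b))\<^sup>2)"
    using L2_integrable_square[OF L2_inner_const[OF assms]]
    by (subst Bochner_Integration.integral_sum) (simp_all add: norm2_square)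
  finally have "norm2 M f = L2_set (\<lambda>b. norm2 M (\<lambda>z. f z \<bullet> b)) Basis"
    unfolding L2_set_def by (metis norm2_nonneg real_sqrt_unique)
  then show ?thesis by (simp add: L2_set_le_sum)
qed

text \<open>Fatou's lemma for real integrals, with integrability of the limit as part of the conclusion.\<close>

lemma fatou_bounded:
  fixes f :: "nat \<Rightarrow> 'a \<Rightarrow> real"
  assumes f: "\<And>k. integrable M (f k)" and nn: "\<And>k. AE z in M. 0 \<le> f k z"
    and g: "g \<in> borel_measurable M" and lim: "AE z in M. (\<lambda>k. f k z) \<longlonglongrightarrow> g z"
    and c: "eventually (\<lambda>k. (\<integral>z. f k z \<partial>M) \<le> c) sequentially"
  shows "integrable M g" "(\<integral>z. g z \<partial>M) \<le> c"
proof -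
  have nnall: "AE z in M. \<forall>k. 0 \<le> f k z" using nn by (simp add: AE_all_countable)
  have g0: "AE z in M. 0 \<le> g z"
    using nnall lim by eventually_elim (auto intro: LIMSEQ_le_const)
  obtain k where "(\<integral>z. f k z \<partial>M) \<le> c" using c by (auto simp: eventually_sequentially)
  then have c0: "c \<ge> 0" using integral_nonneg_AE[OF nn[of k]] by simp
  have [measurable]: "f k \<in> borel_measurable M" for k using f by auto
  have "(\<integral>\<^sup>+ z. ennreal (g z) \<partial>M) = (\<integral>\<^sup>+ z. liminf (\<lambda>k. ennreal (f k z)) \<partial>M)"
  proof (rule nn_integral_cong_AE)
    show "AE z in M. ennreal (g z) = liminf (\<lambda>k. ennreal (f k z))"
      using lim by eventually_elim (auto intro!: lim_imp_Liminf[symmetric] tendsto_ennrealI)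
  qed
  also have "\<dots> \<le> liminf (\<lambda>k. \<integral>\<^sup>+ z. ennreal (f k z) \<partial>M)"
    by (rule nn_integral_liminf) auto
  also have "\<dots> \<le> liminf (\<lambda>k. ennreal c)"
  proof (rule Liminf_mono)
    show "\<forall>\<^sub>F k in sequentially. (\<integral>\<^sup>+ z. ennreal (f k z) \<partial>M) \<le> ennreal c"
      using c by eventually_elim (simp add: nn_integral_eq_integral f nn ennreal_leI)
  qed
  also have "\<dots> = ennreal c" by (simp add: Liminf_const)
  finally have le: "(\<integral>\<^sup>+ z. ennreal (g z) \<partial>M) \<le> ennreal c" .
  show int: "integrable M g"
    using le g0 g by (intro integrableI_nonneg) (auto simp: order_le_less_trans[OF _ ennreal_less_top])
  have "ennreal (\<integral>z. g z \<partial>M) \<le> ennreal c" using le nn_integral_eq_integral[OF int g0] by simp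
  then show "(\<integral>z. g z \<partial>M) \<le> c" using c0 by simp
qed

text \<open>Along a subsequence with \<open>\<parallel>f\<^sub>k\<^sub>+\<^sub>1 - f\<^sub>k\<parallel> \<le> 2\<^sup>-\<^sup>k\<close> the function
  \<open>\<Sum>k. 2\<^sup>k \<bar>f\<^sub>k\<^sub>+\<^sub>1 - f\<^sub>k\<bar>\<^sup>2\<close> is integrable, so that almost everywhere the increments decay geometrically.\<close>

lemma L2_complete:
  fixes f :: "nat \<Rightarrow> 'a \<Rightarrow> 'b::euclidean_space"
  assumes fL: "\<And>n. f n \<in> L2 M"
    and cauchy: "\<And>e. e > 0 \<Longrightarrow> \<exists>K. \<forall>m\<ge>K. \<forall>n\<ge>K. norm2 M (\<lambda>z. f m z - f n z) < e"
  shows "\<exists>g\<in>L2 M. (\<lambda>n. norm2 M (\<lambda>z. f n z - g z)) \<longlonglongrightarrow> 0"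
proof -
  have [measurable]: "f n \<in> borel_measurable M" for n using fL by (rule L2_measurable)
  have "\<exists>r. \<forall>k. (\<forall>m\<ge>r k. \<forall>n\<ge>r k. norm2 M (\<lambda>z. f m z - f n z) < (1/2)^k) \<and> r k < (r (Suc k) :: nat)"
  proof (rule dependent_nat_choice)
    show "\<exists>x. \<forall>m\<ge>x. \<forall>n\<ge>x. norm2 M (\<lambda>z. f m z - f n z) < (1/2)^0" using cauchy[of 1] by simp
  next
    fix x :: nat and k :: nat
    obtain K where K: "\<forall>m\<ge>K. \<forall>n\<ge>K. norm2 M (\<lambda>z. f m z - f n z) < (1/2)^Suc k"
      using cauchy[of "(1/2)^Suc k"] by auto
    then show "\<exists>y. (\<forall>m\<ge>y. \<forall>n\<ge>y. norm2 M (\<lambda>z. f m z - f n z) < (1/2)^Suc k) \<and> x < y"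
      by (intro exI[of _ "max K (Suc x)"]) auto
  qed
  then obtain r where r: "\<And>k m n. m \<ge> r k \<Longrightarrow> n \<ge> r k \<Longrightarrow> norm2 M (\<lambda>z. f m z - f n z) < (1/2)^k"
    and rinc: "\<And>k. r k < r (Suc k)" by blast
  have sm: "strict_mono r" using rinc by (simp add: strict_mono_Suc_iff)
  define h where "h k z = 2^k * (norm (f (r (Suc k)) z - f (r k) z))\<^sup>2" for k z
  have h0: "0 \<le> h k z" for k z by (simp add: h_def)
  have [measurable]: "h k \<in> borel_measurable M" for k unfolding h_def by measurable
  have hint: "(\<integral>\<^sup>+z. ennreal (h k z) \<partial>M) \<le> ennreal ((1/2)^k)" for k
  proof -
    have d: "(\<lambda>z. f (r (Suc k)) z - f (r k) z) \<in> L2 M" by (intro L2_diff fL)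
    then have int: "integrable M (h k)" unfolding h_def using L2_integrable_square by auto
    have "(\<integral>z. h k z \<partial>M) = 2^k * (norm2 M (\<lambda>z. f (r (Suc k)) z - f (r k) z))\<^sup>2"
      by (simp add: h_def norm2_square)
    also have "\<dots> \<le> 2^k * ((1/2)^k)\<^sup>2"
      using r[of k "r (Suc k)" "r k"] rinc[of k] by (intro mult_left_mono power_mono) auto
    also have "\<dots> = (1/2)^k" by (simp add: power_divide power2_eq_square)
    finally show ?thesis using nn_integral_eq_integral[OF int] h0 by (simp add: ennreal_leI)
  qed
  have "(\<integral>\<^sup>+z. (\<Sum>k. ennreal (h k z)) \<partial>M) = (\<Sum>k. \<integral>\<^sup>+z. ennreal (h k z) \<partial>M)"
    by (rule nn_integral_suminf) auto
  also have "\<dots> \<le> (\<Sum>k. ennreal ((1/2)^k))" using hint by (intro suminf_le) auto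
  also have "\<dots> = ennreal (\<Sum>k. (1/2)^k)" by (rule suminf_ennreal2) auto
  finally have "(\<integral>\<^sup>+z. (\<Sum>k. ennreal (h k z)) \<partial>M) \<noteq> \<infinity>"
    using ennreal_less_top[of "\<Sum>k. (1/2)^k"] by (auto simp: top_unique)
  then have "AE z in M. (\<Sum>k. ennreal (h k z)) \<noteq> \<infinity>" by (intro nn_integral_PInf_AE) auto
  then have conv: "AE z in M. convergent (\<lambda>k. f (r k) z)"
  proof eventually_elim
    case (elim z)
    then have "summable (\<lambda>k. h k z)" using h0 by (intro summable_suminf_not_top) auto
    then have "Bseq (\<lambda>k. h k z)"
      by (intro convergent_imp_Bseq) (auto simp: convergent_def dest: summable_LIMSEQ_zero)
    then obtain B where B: "B > 0" "\<And>k. norm (h k z) \<le> B" by (auto simp: Bseq_def)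
    have bd: "norm (f (r (Suc k)) z - f (r k) z) \<le> sqrt B * (sqrt (1/2))^k" for k
    proof -
      have "2^k * (norm (f (r (Suc k)) z - f (r k) z))\<^sup>2 \<le> B" using B(2)[of k] by (simp add: h_def)
      then have "(norm (f (r (Suc k)) z - f (r k) z))\<^sup>2 \<le> B * (1/2)^k" by (simp add: power_divide field_simps)
      then have "norm (f (r (Suc k)) z - f (r k) z) \<le> sqrt (B * (1/2)^k)" by (rule real_le_rsqrt)
      then show ?thesis by (simp only: real_sqrt_mult real_sqrt_power)
    qed
    have "sqrt (1/2) < (1::real)" by (simp add: real_sqrt_divide)
    then have "summable (\<lambda>k. sqrt B * (sqrt (1/2))^k)" by (intro summable_mult summable_geometric) simp
    then have "summable (\<lambda>k. f (r (Suc k)) z - f (r k) z)"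
      by (rule summable_comparison_test'[where N=0]) (use bd in auto)
    then have "convergent (\<lambda>n. \<Sum>k<n. f (r (Suc k)) z - f (r k) z)" by (simp add: summable_iff_convergent)
    then have "convergent (\<lambda>n. (f (r n) z - f (r 0) z) + f (r 0) z)"
      by (intro convergent_add convergent_const) (simp add: sum_lessThan_telescope[of "\<lambda>k. f (r k) z"])
    then show ?case by simp
  qed
  define g where "g z = lim (\<lambda>k. f (r k) z)" for z
  have [measurable]: "g \<in> borel_measurable M" unfolding g_def by measurable
  have lim: "AE z in M. (\<lambda>k. f (r k) z) \<longlonglongrightarrow> g z"
    using conv by eventually_elim (simp add: g_def convergent_LIMSEQ_iff)
  have bound: "integrable M (\<lambda>z. (norm (f n z - g z))\<^sup>2) \<and> (\<integral>z. (norm (f n z - g z))\<^sup>2 \<partial>M) \<le> e\<^sup>2"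
    if "\<forall>m\<ge>K. \<forall>n\<ge>K. norm2 M (\<lambda>z. f m z - f n z) < e" "n \<ge> K" "e > 0" for n K e
  proof -
    have 1: "integrable M (\<lambda>z. (norm (f n z - f (r k) z))\<^sup>2)" for k
      by (intro L2_integrable_square L2_diff fL)
    have 2: "AE z in M. 0 \<le> (norm (f n z - f (r k) z))\<^sup>2" for k by simp
    have 3: "(\<lambda>z. (norm (f n z - g z))\<^sup>2) \<in> borel_measurable M" by measurable
    have 4: "AE z in M. (\<lambda>k. (norm (f n z - f (r k) z))\<^sup>2) \<longlonglongrightarrow> (norm (f n z - g z))\<^sup>2"
      using lim by eventually_elim (intro tendsto_intros)
    have "\<forall>\<^sub>F k in sequentially. K \<le> r k"
      unfolding eventually_sequentially using seq_suble[OF sm] order_trans by (intro exI[of _ K]) blast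
    then have 5: "\<forall>\<^sub>F k in sequentially. (\<integral>z. (norm (f n z - f (r k) z))\<^sup>2 \<partial>M) \<le> e\<^sup>2"
      using that by (auto simp flip: norm2_le_iff elim!: eventually_mono intro: less_imp_le)
    show ?thesis using fatou_bounded[OF 1 2 3 4 5] by blast
  qed
  have gL: "g \<in> L2 M"
  proof -
    obtain K where K: "\<forall>m\<ge>K. \<forall>n\<ge>K. norm2 M (\<lambda>z. f m z - f n z) < 1" using cauchy[of 1] by auto
    from bound[OF this, of K] have "(\<lambda>z. f K z - g z) \<in> L2 M" by (simp add: L2_def)
    from L2_diff[OF fL[of K] this] show ?thesis by simp
  qed
  have "(\<lambda>n. norm2 M (\<lambda>z. f n z - g z)) \<longlonglongrightarrow> 0"
  proof (rule LIMSEQ_I)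
    fix e :: real assume e: "e > 0"
    obtain K where K: "\<forall>m\<ge>K. \<forall>n\<ge>K. norm2 M (\<lambda>z. f m z - f n z) < e/2" using cauchy[of "e/2"] e by auto
    have "norm2 M (\<lambda>z. f n z - g z) \<le> e/2" if "n \<ge> K" for n
      using bound[OF K that] e by (intro norm2_le_iff[THEN iffD2]) auto
    then show "\<exists>K. \<forall>n\<ge>K. norm (norm2 M (\<lambda>z. f n z - g z) - 0) < e"
      using e by (intro exI[of _ K]) force
  qed
  then show ?thesis using gL by blast
qed

lemma integral_inner_tendsto:
  assumes f: "\<And>n. f n \<in> L2 M" "g \<in> L2 M" and F: "\<And>n. F n \<in> L2 M" "G \<in> L2 M"
    and lim: "(\<lambda>n. norm2 M (\<lambda>z. f n z - g z)) \<longlonglongrightarrow> 0" "(\<lambda>n. norm2 M (\<lambda>z. F n z - G z)) \<longlonglongrightarrow> 0"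
  shows "(\<lambda>n. \<integral>z. f n z \<bullet> F n z \<partial>M) \<longlonglongrightarrow> (\<integral>z. g z \<bullet> G z \<partial>M)"
proof -
  have "(\<lambda>n. norm2 M (\<lambda>z. f n z - g z) * norm2 M (\<lambda>z. F n z - G z) + norm2 M (\<lambda>z. f n z - g z) * norm2 M G
      + norm2 M g * norm2 M (\<lambda>z. F n z - G z)) \<longlonglongrightarrow> 0 * 0 + 0 * norm2 M G + norm2 M g * 0"
    by (intro tendsto_intros lim)
  then have "(\<lambda>n. norm2 M (\<lambda>z. f n z - g z) * norm2 M (\<lambda>z. F n z - G z) + norm2 M (\<lambda>z. f n z - g z) * norm2 M G
      + norm2 M g * norm2 M (\<lambda>z. F n z - G z)) \<longlonglongrightarrow> 0" by simp
  then have "(\<lambda>n. (\<integral>z. f n z \<bullet> F n z \<partial>M) - (\<integral>z. g z \<bullet> G z \<partial>M)) \<longlonglongrightarrow> 0"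
  proof (rule Lim_null_comparison[rotated], intro always_eventually allI)
    fix n
    let ?d = "\<lambda>z. f n z - g z" and ?D = "\<lambda>z. F n z - G z"
    have L: "?d \<in> L2 M" "?D \<in> L2 M" using f F by (auto intro: L2_diff)
    have "(\<integral>z. f n z \<bullet> F n z \<partial>M) - (\<integral>z. g z \<bullet> G z \<partial>M) = (\<integral>z. f n z \<bullet> F n z - g z \<bullet> G z \<partial>M)"
      using f F by (simp add: integrable_inner)
    also have "\<dots> = (\<integral>z. ?d z \<bullet> ?D z + ?d z \<bullet> G z + g z \<bullet> ?D z \<partial>M)"
      by (intro Bochner_Integration.integral_cong) (auto simp: inner_simps)
    also have "\<dots> = (\<integral>z. ?d z \<bullet> ?D z \<partial>M) + (\<integral>z. ?d z \<bullet> G z \<partial>M) + (\<integral>z. g z \<bullet> ?D z \<partial>M)"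
    proof -
      have I: "integrable M (\<lambda>z. ?d z \<bullet> ?D z)" "integrable M (\<lambda>z. ?d z \<bullet> G z)" "integrable M (\<lambda>z. g z \<bullet> ?D z)"
        using L f F by (auto intro: integrable_inner)
      show ?thesis
        by (simp only: Bochner_Integration.integral_add[OF Bochner_Integration.integrable_add[OF I(1,2)] I(3)]
            Bochner_Integration.integral_add[OF I(1,2)])
    qed
    finally show "norm ((\<integral>z. f n z \<bullet> F n z \<partial>M) - (\<integral>z. g z \<bullet> G z \<partial>M)) \<le>
       norm2 M ?d * norm2 M ?D + norm2 M ?d * norm2 M G + norm2 M g * norm2 M ?D"
      using Cauchy_Schwarz_L2[OF L] Cauchy_Schwarz_L2[OF L(1) F(2)] Cauchy_Schwarz_L2[OF f(2) L(2)]
      unfolding real_norm_def by linarith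
  qed
  then show ?thesis by (simp add: LIM_zero_iff)
qed

lemma norm2_tendsto:
  assumes f: "\<And>n. f n \<in> L2 M" "g \<in> L2 M" and lim: "(\<lambda>n. norm2 M (\<lambda>z. f n z - g z)) \<longlonglongrightarrow> 0"
  shows "(\<lambda>n. norm2 M (f n)) \<longlonglongrightarrow> norm2 M g"
  unfolding norm2_def power2_norm_eq_inner
  by (intro tendsto_real_sqrt integral_inner_tendsto f lim)

section \<open>Translations\<close>

lemma nn_integral_translate:
  fixes f :: "'a::euclidean_space \<Rightarrow> ennreal"
  assumes "f \<in> borel_measurable borel"
  shows "(\<integral>\<^sup>+z. f (z + a) \<partial>lborel) = (\<integral>\<^sup>+z. f z \<partial>lborel)"
proof -
  have "(\<integral>\<^sup>+z. f z \<partial>lborel) = (\<integral>\<^sup>+z. f z \<partial>distr lborel borel ((+) a))" by (simp only: lborel_distr_plus)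
  also have "\<dots> = (\<integral>\<^sup>+z. f (a + z) \<partial>lborel)" using assms by (subst nn_integral_distr) auto
  finally show ?thesis by (simp add: add.commute)
qed

lemma integrable_translate:
  fixes f :: "'a::euclidean_space \<Rightarrow> 'b::{banach,second_countable_topology}"
  assumes "integrable lborel f"
  shows "integrable lborel (\<lambda>z. f (z + a))"
proof -
  have "f \<in> borel_measurable borel" using borel_measurable_integrable[OF assms] by simp
  then have "integrable (distr lborel borel ((+) a)) f \<longleftrightarrow> integrable lborel (\<lambda>z. f (a + z))"
    by (intro integrable_distr_eq) auto
  then show ?thesis using assms by (simp add: lborel_distr_plus add.commute)
qed

lemma integral_translate:
  fixes f :: "'a::euclidean_space \<Rightarrow> 'b::{banach,second_countable_topology}"
  assumes "f \<in> borel_measurable borel"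
  shows "(\<integral>z. f (z + a) \<partial>lborel) = (\<integral>z. f z \<partial>lborel)"
proof -
  have "(\<integral>z. f z \<partial>lborel) = (\<integral>z. f z \<partial>distr lborel borel ((+) a))" by (simp only: lborel_distr_plus)
  also have "\<dots> = (\<integral>z. f (a + z) \<partial>lborel)" using assms by (subst integral_distr) auto
  finally show ?thesis by (simp add: add.commute)
qed

lemma AE_translate:
  fixes P :: "'a::euclidean_space \<Rightarrow> bool"
  assumes P: "AE z in lborel. P z"
  shows "AE z in lborel. P (z + a)"
proof -
  obtain N where N: "N \<in> sets lborel" "emeasure lborel N = 0" "{z. \<not> P z} \<subseteq> N"
    using P by (auto elim: AE_E)
  have Nb [measurable]: "N \<in> sets borel" using N by simp
  have "(\<integral>\<^sup>+z. indicator N (z + a) \<partial>lborel) = emeasure lborel N"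
    using Nb by (subst nn_integral_translate) auto
  then have "(\<integral>\<^sup>+z. indicator N (z + a) \<partial>lborel) = 0" using N by simp
  then have "AE z in lborel. indicator N (z + a) = (0::ennreal)"
    by (subst (asm) nn_integral_0_iff_AE) auto
  then show ?thesis by eventually_elim (use N(3) in \<open>auto simp: indicator_def split: if_splits\<close>)
qed

lemma L2_translate: "f \<in> L2 lborel \<Longrightarrow> (\<lambda>z. f (z + a)) \<in> L2 lborel"
  for f :: "'a::euclidean_space \<Rightarrow> 'b::euclidean_space"
  unfolding L2_def
  by (auto intro: integrable_translate[of "\<lambda>z. (norm (f z))\<^sup>2"] measurable_compose[of "\<lambda>z. z + a" borel borel f borel])

lemma norm2_translate:
  fixes f :: "'a::euclidean_space \<Rightarrow> 'b::euclidean_space"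
  assumes "f \<in> borel_measurable borel"
  shows "norm2 lborel (\<lambda>z. f (z + a)) = norm2 lborel f"
  unfolding norm2_def using assms by (subst integral_translate[of "\<lambda>z. (norm (f z))\<^sup>2"]) auto

text \<open>For an open set \<open>U\<close> the functions \<open>indicator U (z + a\<^sub>n)\<close> converge to \<open>1\<close> at every point of
  \<open>U\<close>; as \<open>U\<close> and its translates have equal measure, this controls the whole symmetric difference.\<close>

lemma translation_continuous_open:
  fixes U :: "'a::euclidean_space set"
  assumes U: "open U" "emeasure lborel U < \<infinity>" and a: "a \<longlonglongrightarrow> 0"
  shows "(\<lambda>n. \<integral>z. \<bar>indicator U (z + a n) - indicator U z :: real\<bar> \<partial>lborel) \<longlonglongrightarrow> 0"
proof -
  have Ub [measurable]: "U \<in> sets borel" using U by simp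
  have int: "integrable lborel (indicator U :: 'a \<Rightarrow> real)" using U by simp
  note intt = integrable_translate[OF int]
  have intp: "integrable lborel (\<lambda>z. indicator U z * indicator U (z + b) :: real)" for b
    by (rule Bochner_Integration.integrable_bound[OF int]) (auto simp: indicator_def)
  have eq: "(\<integral>z. \<bar>indicator U (z + a n) - indicator U z :: real\<bar> \<partial>lborel)
     = 2 * (\<integral>z. indicator U z \<partial>lborel) - 2 * (\<integral>z. indicator U z * indicator U (z + a n) \<partial>lborel)" for n
  proof -
    have "(\<integral>z. \<bar>indicator U (z + a n) - indicator U z :: real\<bar> \<partial>lborel) =
      (\<integral>z. indicator U (z + a n) + indicator U z - 2 * (indicator U z * indicator U (z + a n)) \<partial>lborel)"
      by (intro Bochner_Integration.integral_cong) (auto simp: indicator_def)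
    also have "\<dots> = (\<integral>z. indicator U (z + a n) \<partial>lborel) + (\<integral>z. indicator U z \<partial>lborel)
        - 2 * (\<integral>z. indicator U z * indicator U (z + a n) \<partial>lborel)"
      using int intt[of "a n"] intp[of "a n"] by simp
    also have "(\<integral>z. indicator U (z + a n) \<partial>lborel) = (\<integral>z. indicator U z \<partial>lborel :: real)"
      by (rule integral_translate) simp
    finally show ?thesis by simp
  qed
  have "(\<lambda>n. \<integral>z. indicator U z * indicator U (z + a n) \<partial>lborel) \<longlonglongrightarrow> (\<integral>z. (indicator U z :: real) \<partial>lborel)"
  proof (rule integral_dominated_convergence[where w="indicator U"])
    show "AE z in lborel. (\<lambda>n. indicator U z * indicator U (z + a n)) \<longlonglongrightarrow> (indicator U z :: real)"
    proof (rule AE_I2)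
      fix z
      show "(\<lambda>n. indicator U z * indicator U (z + a n)) \<longlonglongrightarrow> (indicator U z :: real)"
      proof (cases "z \<in> U")
        case True
        have "(\<lambda>n. z + a n) \<longlonglongrightarrow> z" using tendsto_add[OF tendsto_const a, of z] by simp
        then have "eventually (\<lambda>n. z + a n \<in> U) sequentially" using U(1) True by (rule topological_tendstoD)
        then show ?thesis using True by (intro tendsto_eventually) (auto elim: eventually_mono)
      qed auto
    qed
  qed (use int in \<open>auto simp: indicator_def\<close>)
  from tendsto_diff[OF tendsto_const[of "2 * (\<integral>z. indicator U z \<partial>lborel)"] tendsto_mult[OF tendsto_const[of 2] this]]
  show ?thesis unfolding eq by simp
qed

lemma translation_continuous_L1:
  fixes f :: "'a::euclidean_space \<Rightarrow> real"
  assumes f: "integrable lborel f" and a: "a \<longlonglongrightarrow> 0"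
  shows "(\<lambda>n. \<integral>z. \<bar>f (z + a n) - f z\<bar> \<partial>lborel) \<longlonglongrightarrow> 0"
proof -
  let ?d = "\<lambda>f n. \<integral>z. \<bar>f (z + a n) - f z\<bar> \<partial>lborel"
  \<comment> \<open>The property passes to \<open>f\<close> from functions that approximate \<open>f\<close> in the mean.\<close>
  have approx: "?d f \<longlonglongrightarrow> 0"
    if f: "integrable lborel f" and
      ap: "\<And>e. e > 0 \<Longrightarrow> \<exists>g. integrable lborel g \<and> (\<integral>z. \<bar>f z - g z\<bar> \<partial>lborel) < e \<and>
        ?d g \<longlonglongrightarrow> 0" for f :: "'a \<Rightarrow> real"
  proof (rule LIMSEQ_I)
    fix e :: real assume e: "e > 0"
    then obtain g where g: "integrable lborel g" and fg: "(\<integral>z. \<bar>f z - g z\<bar> \<partial>lborel) < e/3"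
      and lim: "?d g \<longlonglongrightarrow> 0" using ap[of "e/3"] by auto
    have [measurable]: "f \<in> borel_measurable borel" "g \<in> borel_measurable borel"
      using borel_measurable_integrable[OF f] borel_measurable_integrable[OF g] by simp_all
    obtain K where K: "\<And>n. n \<ge> K \<Longrightarrow> norm (?d g n - 0) < e/3"
      using LIMSEQ_D[OF lim, of "e/3"] e by auto
    have "norm (?d f n - 0) < e" if "n \<ge> K" for n
    proof -
      note it = integrable_translate[OF f, of "a n"] integrable_translate[OF g, of "a n"]
      have tr: "(\<integral>z. \<bar>f (z + a n) - g (z + a n)\<bar> \<partial>lborel) = (\<integral>z. \<bar>f z - g z\<bar> \<partial>lborel)"
        by (rule integral_translate[of "\<lambda>z. \<bar>f z - g z\<bar>"]) simp
      have "?d f n \<le>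
        (\<integral>z. \<bar>f (z + a n) - g (z + a n)\<bar> + \<bar>g (z + a n) - g z\<bar> + \<bar>f z - g z\<bar> \<partial>lborel)"
        using f g it by (intro integral_mono Bochner_Integration.integrable_add integrable_abs
            Bochner_Integration.integrable_diff) auto
      also have "\<dots> = (\<integral>z. \<bar>f z - g z\<bar> \<partial>lborel) + ?d g n + (\<integral>z. \<bar>f z - g z\<bar> \<partial>lborel)"
        using f g it tr by simp
      finally have "?d f n < e" using fg K[OF that] by simp
      then show ?thesis by simp
    qed
    then show "\<exists>K. \<forall>n\<ge>K. norm (?d f n - 0) < e" by blast
  qed
  show ?thesis using f
  proof (induction rule: integrable_induct)
    case (base A c)
    have Ab [measurable]: "A \<in> sets borel" and Afin: "emeasure lborel A < \<infinity>" using base by auto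
    have "(\<lambda>n. \<integral>z. \<bar>indicator A (z + a n) - indicator A z :: real\<bar> \<partial>lborel) \<longlonglongrightarrow> 0"
    proof (rule approx)
      show "integrable lborel (indicator A :: 'a \<Rightarrow> real)" using Afin by simp
      fix e :: real assume e: "e > 0"
      obtain U where U: "open U" "A \<subseteq> U" "emeasure lborel (U - A) < e"
        using outer_regular_lborel[OF Ab e] by blast
      have Ub [measurable]: "U \<in> sets borel" using U by simp
      have "emeasure lborel U \<le> emeasure lborel A + emeasure lborel (U - A)"
        using emeasure_subadditive[of A lborel "U - A"] Diff_partition[OF U(2)] by simp
      also have "\<dots> < \<infinity>" using Afin order.strict_trans[OF U(3) ennreal_less_top] by auto
      finally have Ufin: "emeasure lborel U < \<infinity>" .
      have "(\<integral>z. \<bar>indicator A z - indicator U z :: real\<bar> \<partial>lborel) = (\<integral>z. indicator (U - A) z \<partial>lborel)"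
        using U(2) by (intro Bochner_Integration.integral_cong) (auto simp: indicator_def)
      also have "\<dots> = measure lborel (U - A)" by simp
      also have "\<dots> < e"
      proof -
        have "emeasure lborel (U - A) \<noteq> \<infinity>" using U(3) by auto
        then have "ennreal (measure lborel (U - A)) < ennreal e"
          using U(3) by (simp add: emeasure_eq_ennreal_measure)
        then show ?thesis using e by (simp add: ennreal_less_iff)
      qed
      finally have "(\<integral>z. \<bar>indicator A z - indicator U z :: real\<bar> \<partial>lborel) < e" .
      then show "\<exists>g. integrable lborel g \<and> (\<integral>z. \<bar>indicator A z - g z\<bar> \<partial>lborel) < e \<and>
          ?d g \<longlonglongrightarrow> 0"
        using translation_continuous_open[OF U(1) Ufin a] Ufin
        by (intro exI[of _ "indicator U"]) auto
    qed
    from tendsto_mult[OF tendsto_const[of "\<bar>c\<bar>"] this]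
    have "(\<lambda>n. \<bar>c\<bar> * (\<integral>z. \<bar>indicator A (z + a n) - indicator A z :: real\<bar> \<partial>lborel)) \<longlonglongrightarrow> 0" by simp
    moreover have "\<bar>indicator A (z + a n) *\<^sub>R c - indicator A z *\<^sub>R c\<bar>
       = \<bar>c\<bar> * \<bar>indicator A (z + a n) - indicator A z\<bar>" for z n
      by (auto simp: indicator_def)
    ultimately show ?case by simp
  next
    case (add f g)
    have [measurable]: "f \<in> borel_measurable borel" "g \<in> borel_measurable borel"
      using borel_measurable_integrable[OF add(1)] borel_measurable_integrable[OF add(2)] by simp_all
    have "(\<lambda>n. ?d f n + ?d g n) \<longlonglongrightarrow> 0"
      using tendsto_add[OF add(3,4)] by simp
    then show ?case
    proof (rule Lim_null_comparison[rotated], intro always_eventually allI)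
      fix n
      note it = integrable_translate[OF add(1), of "a n"] integrable_translate[OF add(2), of "a n"]
      have "(\<integral>z. \<bar>(f (z + a n) + g (z + a n)) - (f z + g z)\<bar> \<partial>lborel) \<le>
        (\<integral>z. \<bar>f (z + a n) - f z\<bar> + \<bar>g (z + a n) - g z\<bar> \<partial>lborel)"
        using add(1,2) it by (intro integral_mono Bochner_Integration.integrable_add integrable_abs
            Bochner_Integration.integrable_diff) auto
      also have "\<dots> = ?d f n + ?d g n"
        using add(1,2) it by simp
      finally show "norm (\<integral>z. \<bar>(f (z + a n) + g (z + a n)) - (f z + g z)\<bar> \<partial>lborel) \<le>
        ?d f n + ?d g n" by simp
    qed
  next
    case (lim f s)
    show ?case
    proof (rule approx[OF lim(4)])
      fix e :: real assume e: "e > 0"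
      have "(\<lambda>i. \<integral>z. \<bar>f z - s i z\<bar> \<partial>lborel) \<longlonglongrightarrow> (\<integral>z. 0 \<partial>(lborel :: 'a measure))"
      proof (rule integral_dominated_convergence[where w="\<lambda>z. 3 * \<bar>f z\<bar>"])
        show "AE z in lborel. (\<lambda>i. \<bar>f z - s i z\<bar>) \<longlonglongrightarrow> 0"
        proof (rule AE_I2)
          fix z :: 'a
          have "(\<lambda>i. \<bar>f z - s i z\<bar>) \<longlonglongrightarrow> \<bar>f z - f z\<bar>" using lim(2)[of z] by (intro tendsto_intros) auto
          then show "(\<lambda>i. \<bar>f z - s i z\<bar>) \<longlonglongrightarrow> 0" by simp
        qed
        fix i
        show "AE z in lborel. norm \<bar>f z - s i z\<bar> \<le> 3 * \<bar>f z\<bar>"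
        proof (rule AE_I2)
          fix z :: 'a
          have "\<bar>s i z\<bar> \<le> 2 * \<bar>f z\<bar>" using lim(3)[of z i] by simp
          then show "norm \<bar>f z - s i z\<bar> \<le> 3 * \<bar>f z\<bar>" by simp
        qed
      qed (use lim(1,4) borel_measurable_integrable in auto)
      then have "(\<lambda>i. \<integral>z. \<bar>f z - s i z\<bar> \<partial>lborel) \<longlonglongrightarrow> 0" by simp
      from LIMSEQ_D[OF this e] obtain i where "(\<integral>z. \<bar>f z - s i z\<bar> \<partial>lborel) < e" by force
      then show "\<exists>g. integrable lborel g \<and> (\<integral>z. \<bar>f z - g z\<bar> \<partial>lborel) < e \<and>
          ?d g \<longlonglongrightarrow> 0"
        using lim(1,5) by blast
    qed
  qed
qed

text \<open>For nonnegative numbers \<open>\<bar>s - t\<bar>\<^sup>2 \<le> \<bar>s\<^sup>2 - t\<^sup>2\<bar>\<close>, which reduces the claim to the positive and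
  negative parts and there to the squares, that is, to integrable functions.\<close>

lemma translation_continuous_L2:
  fixes f :: "'a::euclidean_space \<Rightarrow> real"
  assumes f: "f \<in> L2 lborel" and a: "a \<longlonglongrightarrow> 0"
  shows "(\<lambda>n. norm2 lborel (\<lambda>z. f (z + a n) - f z)) \<longlonglongrightarrow> 0"
proof -
  have pos: "(\<lambda>n. norm2 lborel (\<lambda>z. g (z + a n) - g z)) \<longlonglongrightarrow> 0"
    if g: "g \<in> L2 lborel" and g0: "\<And>z. g z \<ge> 0" for g :: "'a \<Rightarrow> real"
  proof -
    have sq: "integrable lborel (\<lambda>z. (g z)\<^sup>2)" using L2_integrable_square[OF g] by simp
    have le: "norm2 lborel (\<lambda>z. g (z + a n) - g z) \<le> sqrt (\<integral>z. \<bar>(g (z + a n))\<^sup>2 - (g z)\<^sup>2\<bar> \<partial>lborel)" for n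
      unfolding norm2_def
    proof (intro real_sqrt_le_mono integral_mono L2_integrable_square L2_diff L2_translate g
        integrable_abs Bochner_Integration.integrable_diff sq integrable_translate[OF sq])
      fix z
      have "\<bar>g (z + a n) - g z\<bar> * \<bar>g (z + a n) - g z\<bar> \<le> \<bar>g (z + a n) - g z\<bar> * \<bar>g (z + a n) + g z\<bar>"
        using g0[of z] g0[of "z + a n"] by (intro mult_left_mono) auto
      then show "(norm (g (z + a n) - g z))\<^sup>2 \<le> \<bar>(g (z + a n))\<^sup>2 - (g z)\<^sup>2\<bar>"
        by (simp add: power2_eq_square abs_mult[symmetric] algebra_simps)
    qed
    have "(\<lambda>n. sqrt (\<integral>z. \<bar>(g (z + a n))\<^sup>2 - (g z)\<^sup>2\<bar> \<partial>lborel)) \<longlonglongrightarrow> 0"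
      using tendsto_real_sqrt[OF translation_continuous_L1[OF sq a]] by simp
    then show ?thesis by (rule Lim_null_comparison[rotated]) (use le in auto)
  qed
  define p q where "p z = max (f z) 0" and "q z = max (- f z) 0" for z
  have [measurable]: "f \<in> borel_measurable lborel" using f by (rule L2_measurable)
  have pL: "p \<in> L2 lborel" and qL: "q \<in> L2 lborel"
    unfolding p_def q_def by (auto intro!: L2_dominated[OF f])
  have "(\<lambda>n. norm2 lborel (\<lambda>z. p (z + a n) - p z) + norm2 lborel (\<lambda>z. q (z + a n) - q z)) \<longlonglongrightarrow> 0"
    using tendsto_add[OF pos[OF pL] pos[OF qL]] by (simp add: p_def q_def)
  then show ?thesis
  proof (rule Lim_null_comparison[rotated], intro always_eventually allI)
    fix n
    have "norm2 lborel (\<lambda>z. (p (z + a n) - p z) + - (q (z + a n) - q z))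
      \<le> norm2 lborel (\<lambda>z. p (z + a n) - p z) + norm2 lborel (\<lambda>z. - (q (z + a n) - q z))"
      by (intro norm2_triangle L2_uminus L2_diff L2_translate pL qL)
    moreover have "(p (z + a n) - p z) + - (q (z + a n) - q z) = f (z + a n) - f z" for z
      by (auto simp: p_def q_def max_def)
    ultimately have "norm2 lborel (\<lambda>z. f (z + a n) - f z) \<le>
       norm2 lborel (\<lambda>z. p (z + a n) - p z) + norm2 lborel (\<lambda>z. - (q (z + a n) - q z))"
      by (simp only:)
    then show "norm (norm2 lborel (\<lambda>z. f (z + a n) - f z)) \<le>
       norm2 lborel (\<lambda>z. p (z + a n) - p z) + norm2 lborel (\<lambda>z. q (z + a n) - q z)"
      by (simp only: norm2_uminus real_norm_def abs_of_nonneg norm2_nonneg)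
  qed
qed

section \<open>Smooth functions\<close>

abbreviation partial :: "'a::euclidean_space \<Rightarrow> ('a \<Rightarrow> real) \<Rightarrow> 'a \<Rightarrow> real" where
  "partial b \<phi> z \<equiv> frechet_derivative \<phi> (at z) b"

lemma frechet_derivative_eqI: "(\<phi> has_derivative D) (at z) \<Longrightarrow> frechet_derivative \<phi> (at z) = D"
  using frechet_derivative_at by metis

lemma Ck_differentiable: "Ck (Suc k) \<phi> \<Longrightarrow> \<phi> differentiable (at z)"
  by simp

lemma Ck_has_derivative: "Ck (Suc k) \<phi> \<Longrightarrow> (\<phi> has_derivative frechet_derivative \<phi> (at z)) (at z)"
  using frechet_derivative_works[of \<phi> "at z"] by simp

lemma Ck_partial: "Ck (Suc k) \<phi> \<Longrightarrow> b \<in> Basis \<Longrightarrow> Ck k (partial b \<phi>)"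
  by simp

lemma Ck_SucI:
  assumes "\<And>z. (\<phi> has_derivative D z) (at z)" "\<And>b. b \<in> Basis \<Longrightarrow> Ck k (\<lambda>z. D z b)"
  shows "Ck (Suc k) \<phi>"
  using assms(2) by (auto simp: frechet_derivative_eqI[OF assms(1)] intro: differentiableI[OF assms(1)])

lemma Ck_Suc_imp_Ck: "Ck (Suc k) \<phi> \<Longrightarrow> Ck k \<phi>"
proof (induction k arbitrary: \<phi>)
  case 0
  then show ?case by (auto intro!: continuous_at_imp_continuous_on differentiable_imp_continuous_within)
next
  case (Suc k)
  have "Ck (Suc k) (partial b \<phi>)" if "b \<in> Basis" for b using Suc.prems that by (rule Ck_partial)
  from Suc.IH[OF this] show ?case using Ck_differentiable[OF Suc.prems] by simp
qed

lemma Ck_continuous: "Ck k \<phi> \<Longrightarrow> continuous_on UNIV \<phi>"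
proof (induction k)
  case (Suc k)
  show ?case by (rule Suc.IH[OF Ck_Suc_imp_Ck[OF Suc.prems]])
qed simp

lemma Ck_const: "Ck k (\<lambda>z::'a::euclidean_space. c)"
  by (induction k arbitrary: c) auto

lemma Ck_add: "Ck k \<phi> \<Longrightarrow> Ck k \<psi> \<Longrightarrow> Ck k (\<lambda>z. \<phi> z + \<psi> z)"
proof (induction k arbitrary: \<phi> \<psi>)
  case 0
  then show ?case by (auto intro: continuous_on_add)
next
  case (Suc k)
  show ?case
  proof (rule Ck_SucI)
    show "((\<lambda>z. \<phi> z + \<psi> z) has_derivative (\<lambda>h. partial h \<phi> z + partial h \<psi> z)) (at z)" for z
      by (intro has_derivative_add Ck_has_derivative[OF Suc.prems(1)] Ck_has_derivative[OF Suc.prems(2)])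
  qed (use Suc Ck_partial in blast)
qed

lemma Ck_mult: "Ck k \<phi> \<Longrightarrow> Ck k \<psi> \<Longrightarrow> Ck k (\<lambda>z. \<phi> z * \<psi> z)"
proof (induction k arbitrary: \<phi> \<psi>)
  case 0
  then show ?case by (auto intro: continuous_on_mult)
next
  case (Suc k)
  show ?case
  proof (rule Ck_SucI)
    show "((\<lambda>z. \<phi> z * \<psi> z) has_derivative (\<lambda>h. \<phi> z * partial h \<psi> z + partial h \<phi> z * \<psi> z)) (at z)" for z
      by (intro has_derivative_mult Ck_has_derivative[OF Suc.prems(1)] Ck_has_derivative[OF Suc.prems(2)])
    fix b :: 'a assume b: "b \<in> Basis"
    show "Ck k (\<lambda>z. \<phi> z * partial b \<psi> z + partial b \<phi> z * \<psi> z)"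
      using b by (intro Ck_add Suc.IH Ck_partial Suc.prems Suc.prems[THEN Ck_Suc_imp_Ck])
  qed
qed

lemma Ck_prod: "finite B \<Longrightarrow> (\<And>b. b \<in> B \<Longrightarrow> Ck k (\<phi> b)) \<Longrightarrow> Ck k (\<lambda>z. \<Prod>b\<in>B. \<phi> b z)"
  by (induction rule: finite_induct) (auto intro: Ck_const Ck_mult)

lemma Ck_inner: "Ck k (\<lambda>z. z \<bullet> a)"
proof (cases k)
  case 0
  then show ?thesis by (auto intro: continuous_intros)
next
  case (Suc j)
  have "((\<lambda>z. z \<bullet> a) has_derivative (\<lambda>h. h \<bullet> a)) (at z)" for z :: 'a
    by (auto intro!: derivative_eq_intros)
  then have "Ck (Suc j) (\<lambda>z. z \<bullet> a)" by (rule Ck_SucI) (rule Ck_const)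
  then show ?thesis by (simp only: Suc)
qed

lemma has_derivative_compose_affine:
  fixes \<phi> :: "'a::euclidean_space \<Rightarrow> real"
  assumes "\<phi> differentiable (at (a + c *\<^sub>R z))"
  shows "((\<lambda>z. \<phi> (a + c *\<^sub>R z)) has_derivative (\<lambda>h. c * frechet_derivative \<phi> (at (a + c *\<^sub>R z)) h)) (at z)"
proof -
  have D: "(\<phi> has_derivative frechet_derivative \<phi> (at (a + c *\<^sub>R z))) (at (a + c *\<^sub>R z))"
    using assms frechet_derivative_works by blast
  have "((\<lambda>z. a + c *\<^sub>R z) has_derivative (\<lambda>h. c *\<^sub>R h)) (at z)"
    by (auto intro!: derivative_eq_intros)
  from has_derivative_compose[OF this D]
  show ?thesis
    using linear_cmul[OF has_derivative_linear[OF D]] by (simp add: o_def)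
qed

lemma Ck_compose_affine: "Ck k \<phi> \<Longrightarrow> Ck k (\<lambda>z. \<phi> (a + c *\<^sub>R z))"
proof (induction k arbitrary: \<phi>)
  case 0
  then show ?case by (auto intro!: continuous_on_compose2[of UNIV \<phi>] continuous_intros)
next
  case (Suc k)
  show ?case
  proof (rule Ck_SucI)
    show "((\<lambda>z. \<phi> (a + c *\<^sub>R z)) has_derivative (\<lambda>h. c * partial h \<phi> (a + c *\<^sub>R z))) (at z)" for z
      by (rule has_derivative_compose_affine[OF Ck_differentiable[OF Suc.prems]])
    fix b :: 'a assume b: "b \<in> Basis"
    show "Ck k (\<lambda>z. c * partial b \<phi> (a + c *\<^sub>R z))"
      using Suc.prems b by (intro Ck_mult Ck_const Suc.IH Ck_partial)
  qed
qed

lemma has_derivative_compose_real: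
  fixes \<phi> :: "'a::euclidean_space \<Rightarrow> real"
  assumes "(g has_real_derivative g') (at (\<phi> z))" "(\<phi> has_derivative D) (at z)"
  shows "((\<lambda>z. g (\<phi> z)) has_derivative (\<lambda>h. g' * D h)) (at z)"
  using has_derivative_compose[OF assms(2) assms(1)[unfolded has_field_derivative_def]] .

text \<open>A smooth function of one real variable enters through the whole sequence of its derivatives,
  which makes the induction over the order of differentiability a single application of the chain
  rule.\<close>

lemma Ck_compose_real:
  assumes G: "\<And>i t. (G i has_real_derivative G (Suc i) t) (at t)"
  shows "Ck k \<phi> \<Longrightarrow> Ck k (\<lambda>z. G i (\<phi> z))"
proof (induction k arbitrary: i \<phi>)
  case 0
  have "continuous_on UNIV (G i)"
    by (intro continuous_at_imp_continuous_on ballI DERIV_isCont[OF G])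
  then show ?case using 0 by (auto intro: continuous_on_compose2)
next
  case (Suc k)
  show ?case
  proof (rule Ck_SucI)
    show "((\<lambda>z. G i (\<phi> z)) has_derivative (\<lambda>h. G (Suc i) (\<phi> z) * partial h \<phi> z)) (at z)" for z
      by (rule has_derivative_compose_real[OF G Ck_has_derivative[OF Suc.prems]])
    fix b :: 'a assume b: "b \<in> Basis"
    show "Ck k (\<lambda>z. G (Suc i) (\<phi> z) * partial b \<phi> z)"
      using b by (intro Ck_mult Suc.IH Ck_partial Suc.prems Suc.prems[THEN Ck_Suc_imp_Ck])
  qed
qed

subsection \<open>Bump functions\<close>

text \<open>The derivatives of \<open>exp (-1/t)\<close> have the form \<open>p (1/t) exp (-1/t)\<close> with polynomials \<open>p\<close>.\<close>

primrec flat_poly :: "nat \<Rightarrow> real poly" where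
  "flat_poly 0 = 1"
| "flat_poly (Suc k) = [:0, 0, 1:] * (flat_poly k - pderiv (flat_poly k))"

definition flat_deriv :: "nat \<Rightarrow> real \<Rightarrow> real" where
  "flat_deriv k t = (if t > 0 then poly (flat_poly k) (1 / t) * exp (- (1 / t)) else 0)"

lemma tendsto_poly_times_exp_minus: "((\<lambda>x. poly p x * exp (- x)) \<longlongrightarrow> (0::real)) at_top"
proof -
  have "((\<lambda>x. \<Sum>i\<le>degree p. coeff p i * (x ^ i / exp x)) \<longlongrightarrow> (\<Sum>i\<le>degree p. coeff p i * 0)) at_top"
    by (intro tendsto_intros tendsto_power_div_exp_0)
  moreover have "(\<Sum>i\<le>degree p. coeff p i * (x ^ i / exp x)) = poly p x * exp (- x)" for x
    by (simp add: poly_altdef sum_distrib_right exp_minus divide_inverse mult.assoc)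
  ultimately show ?thesis by simp
qed

lemma flat_deriv_has_derivative: "(flat_deriv k has_real_derivative flat_deriv (Suc k) t) (at t)"
proof -
  consider "t > 0" | "t < 0" | "t = 0" by linarith
  then show ?thesis
  proof cases
    case 1
    have "((\<lambda>t. poly (flat_poly k) (1 / t) * exp (- (1 / t))) has_real_derivative
        poly (flat_poly (Suc k)) (1 / t) * exp (- (1 / t))) (at t)"
    proof -
      have 2: "((\<lambda>t. 1 / t) has_real_derivative - (1 / (t * t))) (at t)"
        using 1 by (auto intro!: derivative_eq_intros simp: field_simps)
      have 3: "((\<lambda>t. poly (flat_poly k) (1 / t)) has_real_derivative
          poly (pderiv (flat_poly k)) (1 / t) * (- (1 / (t * t)))) (at t)"
        by (rule DERIV_chain2[OF poly_DERIV 2])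
      have 4: "((\<lambda>t. exp (- (1 / t))) has_real_derivative exp (- (1 / t)) * (1 / (t * t))) (at t)"
        using DERIV_chain2[OF DERIV_exp DERIV_minus[OF 2]] by simp
      show ?thesis
        by (rule DERIV_cong[OF DERIV_mult[OF 3 4]]) (simp add: algebra_simps)
    qed
    moreover have "eventually (\<lambda>s. s > 0) (nhds t)" using 1 by (rule eventually_nhds_in_open[OF open_greaterThan, simplified])
    ultimately show ?thesis using 1
      by (subst DERIV_cong_ev[OF refl _ refl]) (auto simp: flat_deriv_def elim: eventually_mono)
  next
    case 2
    have "eventually (\<lambda>s. s < 0) (nhds t)" using 2 by (rule eventually_nhds_in_open[OF open_lessThan, simplified])
    then have "(flat_deriv k has_real_derivative 0) (at t)"
      by (subst DERIV_cong_ev[OF refl _ refl, where g="\<lambda>_. 0"]) (auto simp: flat_deriv_def elim: eventually_mono)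
    then show ?thesis using 2 by (simp add: flat_deriv_def)
  next
    case 3
    have "((\<lambda>h. (flat_deriv k h - flat_deriv k 0) / (h - 0)) \<longlongrightarrow> 0) (at 0)"
    proof (rule filterlim_split_at)
      show "((\<lambda>h. (flat_deriv k h - flat_deriv k 0) / (h - 0)) \<longlongrightarrow> 0) (at_left 0)"
        by (rule tendsto_eventually) (auto simp: eventually_at_filter flat_deriv_def)
      have "((\<lambda>h. poly ([:0, 1:] * flat_poly k) (inverse h) * exp (- inverse h)) \<longlongrightarrow> 0) (at_right (0::real))"
        by (rule filterlim_compose[OF tendsto_poly_times_exp_minus filterlim_inverse_at_top_right])
      then show "((\<lambda>h. (flat_deriv k h - flat_deriv k 0) / (h - 0)) \<longlongrightarrow> 0) (at_right 0)"
      proof (rule Lim_transform_eventually)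
        show "\<forall>\<^sub>F h in at_right (0::real). poly ([:0, 1:] * flat_poly k) (inverse h) * exp (- inverse h)
            = (flat_deriv k h - flat_deriv k 0) / (h - 0)"
          by (auto simp: eventually_at_filter flat_deriv_def field_simps)
      qed
    qed
    then show ?thesis using 3 by (simp add: has_field_derivative_iff flat_deriv_def)
  qed
qed

definition bump :: "'a::euclidean_space \<Rightarrow> real" where
  "bump z = (\<Prod>b\<in>Basis. flat_deriv 0 (z \<bullet> b) * flat_deriv 0 (1 - z \<bullet> b))"

lemma Ck_bump: "Ck k bump"
proof -
  have 1: "Ck k (\<lambda>z. 1 - z \<bullet> b)" for b :: 'a
    using Ck_add[OF Ck_const[of k 1] Ck_mult[OF Ck_const[of k "-1"] Ck_inner[of k b]]] by simp
  show ?thesis unfolding bump_def[abs_def]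
    by (intro Ck_prod Ck_mult Ck_compose_real[where G=flat_deriv, OF flat_deriv_has_derivative] Ck_inner 1) auto
qed

lemma bump_nonneg: "0 \<le> bump z"
  unfolding bump_def by (intro prod_nonneg) (auto simp: flat_deriv_def)

lemma bump_nonzero_iff: "bump z \<noteq> 0 \<longleftrightarrow> z \<in> box 0 One"
  by (auto simp: bump_def box_def flat_deriv_def)

subsection \<open>Test functions\<close>

lemma test_functionsI:
  "(\<And>k. Ck k \<phi>) \<Longrightarrow> compact K \<Longrightarrow> K \<subseteq> \<Omega> \<Longrightarrow> (\<And>z. z \<notin> K \<Longrightarrow> \<phi> z = 0) \<Longrightarrow> \<phi> \<in> test_functions \<Omega>"
  unfolding test_functions_def by blast

lemma test_functionsE:
  assumes "\<phi> \<in> test_functions \<Omega>"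
  obtains K where "compact K" "K \<subseteq> \<Omega>" "\<And>z. z \<notin> K \<Longrightarrow> \<phi> z = 0"
  using assms unfolding test_functions_def by blast

lemma test_function_Ck: "\<phi> \<in> test_functions \<Omega> \<Longrightarrow> Ck k \<phi>"
  unfolding test_functions_def by blast

lemma test_function_has_derivative:
  "\<phi> \<in> test_functions \<Omega> \<Longrightarrow> (\<phi> has_derivative frechet_derivative \<phi> (at z)) (at z)"
  by (rule Ck_has_derivative[OF test_function_Ck[of _ _ "Suc 0"]])

lemma test_function_continuous: "\<phi> \<in> test_functions \<Omega> \<Longrightarrow> continuous_on UNIV \<phi>"
  by (rule Ck_continuous[OF test_function_Ck[of _ _ 0]])

lemma partial_zero_outside:
  assumes "closed K" "\<And>z. z \<notin> K \<Longrightarrow> \<phi> z = (0::real)" "z \<notin> K"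
  shows "partial b \<phi> z = 0"
proof -
  have "((\<lambda>_. 0) has_derivative (\<lambda>_. 0)) (at z)" by simp
  then have "(\<phi> has_derivative (\<lambda>_. 0)) (at z)"
    by (rule has_derivative_transform_within_open[OF _ open_Compl[OF assms(1)]]) (use assms in auto)
  then show ?thesis by (simp add: frechet_derivative_eqI)
qed

lemma test_function_partial:
  assumes "\<phi> \<in> test_functions \<Omega>" "b \<in> Basis"
  shows "partial b \<phi> \<in> test_functions \<Omega>"
proof -
  obtain K where K: "compact K" "K \<subseteq> \<Omega>" "\<And>z. z \<notin> K \<Longrightarrow> \<phi> z = 0" using assms(1) by (rule test_functionsE) blast
  show ?thesis
  proof (rule test_functionsI[OF _ K(1,2)])
    show "Ck k (partial b \<phi>)" for k using test_function_Ck[OF assms(1)] assms(2) by (rule Ck_partial)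
  qed (use K in \<open>auto intro: partial_zero_outside compact_imp_closed\<close>)
qed

lemma test_function_mult:
  assumes "\<phi> \<in> test_functions \<Omega>" "\<And>k. Ck k \<psi>"
  shows "(\<lambda>z. \<psi> z * \<phi> z) \<in> test_functions \<Omega>"
proof -
  obtain K where K: "compact K" "K \<subseteq> \<Omega>" "\<And>z. z \<notin> K \<Longrightarrow> \<phi> z = 0" using assms(1) by (rule test_functionsE) blast
  show ?thesis
    by (rule test_functionsI[OF Ck_mult[OF assms(2) test_function_Ck[OF assms(1)]] K(1,2)]) (simp add: K(3))
qed

lemma test_function_cmult: "\<phi> \<in> test_functions \<Omega> \<Longrightarrow> (\<lambda>z. c * \<phi> z) \<in> test_functions \<Omega>"
  by (rule test_function_mult[OF _ Ck_const])

lemma test_function_uminus: "\<phi> \<in> test_functions \<Omega> \<Longrightarrow> (\<lambda>z. - \<phi> z) \<in> test_functions \<Omega>"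
  using test_function_cmult[of \<phi> \<Omega> "-1"] by simp

lemma test_function_add:
  assumes "\<phi> \<in> test_functions \<Omega>" "\<psi> \<in> test_functions \<Omega>"
  shows "(\<lambda>z. \<phi> z + \<psi> z) \<in> test_functions \<Omega>"
proof -
  obtain K where K: "compact K" "K \<subseteq> \<Omega>" "\<And>z. z \<notin> K \<Longrightarrow> \<phi> z = 0" using assms(1) by (rule test_functionsE) blast
  obtain L where L: "compact L" "L \<subseteq> \<Omega>" "\<And>z. z \<notin> L \<Longrightarrow> \<psi> z = 0" using assms(2) by (rule test_functionsE) blast
  show ?thesis
    by (rule test_functionsI[of _ "K \<union> L"]) (use K L assms in \<open>auto intro: Ck_add test_function_Ck\<close>)
qed

lemma test_function_affine:
  assumes "\<phi> \<in> test_functions UNIV" "c \<noteq> 0"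
  shows "(\<lambda>z. \<phi> (a + c *\<^sub>R z)) \<in> test_functions UNIV"
proof -
  obtain K where K: "compact K" "\<And>z. z \<notin> K \<Longrightarrow> \<phi> z = 0" using assms(1) by (rule test_functionsE) blast
  have "compact ((\<lambda>z. (1 / c) *\<^sub>R (z - a)) ` K)" by (intro compact_continuous_image continuous_intros K)
  then show ?thesis
  proof (rule test_functionsI[rotated])
    fix z assume z: "z \<notin> (\<lambda>z. (1 / c) *\<^sub>R (z - a)) ` K"
    have "z = (1 / c) *\<^sub>R ((a + c *\<^sub>R z) - a)" using assms(2) by simp
    then show "\<phi> (a + c *\<^sub>R z) = 0" using z K(2) by blast
  qed (auto intro: Ck_compose_affine test_function_Ck[OF assms(1)])
qed

lemma test_function_bounded_support:
  assumes "\<phi> \<in> test_functions \<Omega>"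
  obtains R where "R > 0" "\<And>z. norm z > R \<Longrightarrow> \<phi> z = 0"
proof -
  obtain K where K: "compact K" "\<And>z. z \<notin> K \<Longrightarrow> \<phi> z = 0" using assms by (rule test_functionsE) blast
  obtain R where R: "R > 0" "\<And>z. z \<in> K \<Longrightarrow> norm z \<le> R" using compact_imp_bounded[OF K(1)] by (auto simp: bounded_pos)
  show ?thesis by (rule that[OF R(1)]) (use R(2) K(2) in force)
qed

lemma test_function_bounded:
  assumes "\<phi> \<in> test_functions \<Omega>"
  obtains B where "B > 0" "\<And>z. \<bar>\<phi> z\<bar> \<le> B"
proof -
  obtain R where R: "R > 0" "\<And>z. norm z > R \<Longrightarrow> \<phi> z = 0" using assms by (rule test_function_bounded_support) blast
  have "compact (\<phi> ` cball 0 R)"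
    by (intro compact_continuous_image continuous_on_subset[OF test_function_continuous[OF assms]]) auto
  then obtain B where B: "B > 0" "\<And>z. z \<in> cball 0 R \<Longrightarrow> \<bar>\<phi> z\<bar> \<le> B"
    using compact_imp_bounded by (force simp: bounded_pos)
  have "\<bar>\<phi> z\<bar> \<le> B" for z using B R(2)[of z] by (cases "norm z \<le> R") auto
  with B(1) show ?thesis by (rule that)
qed

lemma test_function_measurable: "\<phi> \<in> test_functions \<Omega> \<Longrightarrow> \<phi> \<in> borel_measurable borel"
  by (rule borel_measurable_continuous_onI[OF test_function_continuous])

lemma bounded_support_L2:
  fixes \<phi> :: "'a::euclidean_space \<Rightarrow> real"
  assumes "\<phi> \<in> borel_measurable borel" "\<And>z. \<bar>\<phi> z\<bar> \<le> B" "\<And>z. norm z > R \<Longrightarrow> \<phi> z = 0"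
  shows "\<phi> \<in> L2 lborel" "integrable lborel \<phi>"
proof -
  have fin: "emeasure lborel (cball (0::'a) R) < \<infinity>" by (intro emeasure_bounded_finite) auto
  have B0: "B \<ge> 0" using assms(2)[of 0] by linarith
  have ind: "integrable lborel (\<lambda>z. indicator (cball (0::'a) R) z * c)" for c :: real using fin by simp
  have "(\<lambda>z. indicator (cball (0::'a) R) z * B) \<in> L2 lborel"
  proof -
    have "(norm (indicator (cball 0 R) z * B))\<^sup>2 = indicator (cball 0 R) z * B\<^sup>2" for z :: 'a
      by (simp add: indicator_def)
    moreover have "(\<lambda>z. indicator (cball (0::'a) R) z * B) \<in> borel_measurable lborel"
      by (intro borel_measurable_times borel_measurable_indicator) auto
    ultimately show ?thesis using ind[of "B\<^sup>2"] by (simp only: L2_def mem_Collect_eq simp_thms)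
  qed
  then show "\<phi> \<in> L2 lborel"
    by (rule L2_dominated) (use assms B0 in \<open>auto simp: indicator_def not_le\<close>)
  show "integrable lborel \<phi>"
    by (rule Bochner_Integration.integrable_bound[OF ind[of B]]) (use assms B0 in \<open>auto simp: indicator_def not_le\<close>)
qed

lemma test_function_L2: "\<phi> \<in> test_functions \<Omega> \<Longrightarrow> \<phi> \<in> L2 lborel"
  and test_function_integrable: "\<phi> \<in> test_functions \<Omega> \<Longrightarrow> integrable lborel \<phi>"
proof -
  assume t: "\<phi> \<in> test_functions \<Omega>"
  obtain R where R: "R > 0" "\<And>z. norm z > R \<Longrightarrow> \<phi> z = 0" using t by (rule test_function_bounded_support) blast
  obtain B where B: "B > 0" "\<And>z. \<bar>\<phi> z\<bar> \<le> B" using t by (rule test_function_bounded) blast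
  show "\<phi> \<in> L2 lborel" "integrable lborel \<phi>"
    by (rule bounded_support_L2[OF test_function_measurable[OF t] B(2) R(2)]; assumption)+
qed

lemma test_function_uniformly_continuous:
  assumes t: "\<phi> \<in> test_functions \<Omega>" and e: "e > 0"
  shows "\<exists>d>0. \<forall>x y. norm (x - y) < d \<longrightarrow> \<bar>\<phi> x - \<phi> y\<bar> < e"
proof -
  obtain R where R: "R > 0" "\<And>z. norm z > R \<Longrightarrow> \<phi> z = 0" using t by (rule test_function_bounded_support) blast
  have "uniformly_continuous_on (cball 0 (R + 1)) \<phi>"
    by (intro compact_uniformly_continuous continuous_on_subset[OF test_function_continuous[OF t]]) auto
  then obtain d where d: "d > 0" "\<And>x y. x \<in> cball 0 (R + 1) \<Longrightarrow> y \<in> cball 0 (R + 1) \<Longrightarrow> dist y x < d \<Longrightarrow> dist (\<phi> y) (\<phi> x) < e"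
    using e unfolding uniformly_continuous_on_def by meson
  have "\<bar>\<phi> x - \<phi> y\<bar> < e" if "norm (x - y) < min d 1" for x y
  proof (cases "norm x \<le> R + 1 \<and> norm y \<le> R + 1")
    case True
    then show ?thesis using d(2)[of y x] that by (simp add: dist_norm dist_real_def)
  next
    case False
    then have "norm x > R" "norm y > R"
      using that norm_triangle_ineq2[of x y] norm_triangle_ineq2[of y x] by (auto simp: norm_minus_commute)
    then show ?thesis using R(2) e by simp
  qed
  then show ?thesis using d(1) by (intro exI[of _ "min d 1"]) auto
qed

lemma frechet_derivative_sum_partial:
  fixes \<phi> :: "'a::euclidean_space \<Rightarrow> real"
  assumes "\<phi> differentiable (at z)"
  shows "frechet_derivative \<phi> (at z) h = (\<Sum>b\<in>Basis. (h \<bullet> b) * partial b \<phi> z)"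
proof -
  interpret linear "frechet_derivative \<phi> (at z)"
    using assms frechet_derivative_works has_derivative_linear by blast
  have "frechet_derivative \<phi> (at z) (\<Sum>b\<in>Basis. (h \<bullet> b) *\<^sub>R b) = (\<Sum>b\<in>Basis. (h \<bullet> b) * partial b \<phi> z)"
    by (simp add: sum scale)
  then show ?thesis by (simp add: euclidean_representation)
qed

lemma test_function_mean_value:
  assumes t: "\<phi> \<in> test_functions \<Omega>"
  shows "\<exists>s. 0 < s \<and> s < 1 \<and> \<phi> (p + h) - \<phi> p = (\<Sum>b\<in>Basis. (h \<bullet> b) * partial b \<phi> (p + s *\<^sub>R h))"
proof -
  have "((\<lambda>s. \<phi> (p + s *\<^sub>R h)) has_real_derivative frechet_derivative \<phi> (at (p + s *\<^sub>R h)) h) (at s)" for s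
  proof -
    have 1: "((\<lambda>s. p + s *\<^sub>R h) has_derivative (\<lambda>r. r *\<^sub>R h)) (at s)" by (auto intro!: derivative_eq_intros)
    note D = test_function_has_derivative[OF t, of "p + s *\<^sub>R h"]
    show ?thesis unfolding has_field_derivative_def
      by (rule has_derivative_eq_rhs[OF has_derivative_compose[OF 1 D]])
        (simp add: linear_cmul[OF has_derivative_linear[OF D]] fun_eq_iff mult.commute)
  qed
  from MVT2[of 0 1, OF _ this] obtain s where "0 < s" "s < 1"
    "\<phi> (p + h) - \<phi> p = frechet_derivative \<phi> (at (p + s *\<^sub>R h)) h" by auto
  then show ?thesis using frechet_derivative_sum_partial Ck_differentiable test_function_Ck[OF t] by metis
qed

text \<open>The integral of a derivative of a compactly supported function vanishes, as the integral of
  each of its difference quotients does.\<close>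

lemma integral_partial_eq_0:
  assumes t: "\<phi> \<in> test_functions \<Omega>" and b: "b \<in> Basis"
  shows "(\<integral>z. partial b \<phi> z \<partial>lborel) = 0"
proof -
  note tp = test_function_partial[OF t b]
  obtain R where R: "R > 0" "\<And>z. norm z > R \<Longrightarrow> \<phi> z = 0" using t by (rule test_function_bounded_support) blast
  obtain B where B: "B > 0" "\<And>z. \<bar>partial b \<phi> z\<bar> \<le> B" using tp by (rule test_function_bounded) blast
  define a where "a n = inverse (real (Suc n))" for n
  have a: "0 < a n" "a n \<le> 1" for n by (auto simp: a_def field_simps)
  have bb: "(\<Sum>b'\<in>Basis. (c *\<^sub>R b \<bullet> b') * f b') = c * f b" for c and f :: "'a \<Rightarrow> real"
    using b by (simp add: inner_Basis if_distrib if_distribR sum.delta cong: if_cong)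
  define q where "q n z = (\<phi> (z + a n *\<^sub>R b) - \<phi> z) / a n" for n z
  have mv: "\<exists>s. 0 < s \<and> s < 1 \<and> q n z = partial b \<phi> (z + s *\<^sub>R (a n *\<^sub>R b))" for n z
    using test_function_mean_value[OF t, of z "a n *\<^sub>R b"] a(1)[of n] unfolding bb q_def
    by (metis nonzero_mult_div_cancel_left less_irrefl)
  have "(\<lambda>n. \<integral>z. q n z \<partial>lborel) \<longlonglongrightarrow> (\<integral>z. partial b \<phi> z \<partial>lborel)"
  proof (rule integral_dominated_convergence[where w="\<lambda>z. indicator (cball 0 (R + 1)) z * B"])
    show "integrable lborel (\<lambda>z. indicator (cball (0::'a) (R + 1)) z * B)"
      by (intro integrable_mult_left integrable_real_indicator emeasure_bounded_finite) auto
    show "AE z in lborel. (\<lambda>n. q n z) \<longlonglongrightarrow> partial b \<phi> z"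
    proof (rule AE_I2, rule LIMSEQ_I)
      fix z :: 'a and e :: real assume "e > 0"
      from test_function_uniformly_continuous[OF tp this] obtain d where
        d: "d > 0" "\<And>x y. norm (x - y) < d \<Longrightarrow> \<bar>partial b \<phi> x - partial b \<phi> y\<bar> < e" by blast
      have "a \<longlonglongrightarrow> 0" unfolding a_def by (rule LIMSEQ_inverse_real_of_nat)
      from LIMSEQ_D[OF this d(1)] obtain K where K: "\<And>n. n \<ge> K \<Longrightarrow> a n < d" using a by force
      have "norm (q n z - partial b \<phi> z) < e" if n: "n \<ge> K" for n
      proof -
        obtain s where s: "0 < s" "s < 1" "q n z = partial b \<phi> (z + s *\<^sub>R (a n *\<^sub>R b))" using mv by blast
        have "norm ((z + s *\<^sub>R (a n *\<^sub>R b)) - z) = s * a n" using s a[of n] b by simp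
        also have "\<dots> \<le> 1 * a n" using s a[of n] by (intro mult_right_mono) auto
        finally have "norm ((z + s *\<^sub>R (a n *\<^sub>R b)) - z) < d" using K[OF n] by linarith
        from d(2)[OF this] show ?thesis using s by simp
      qed
      then show "\<exists>K. \<forall>n\<ge>K. norm (q n z - partial b \<phi> z) < e" by blast
    qed
    show "AE z in lborel. norm (q n z) \<le> indicator (cball 0 (R + 1)) z * B" for n
    proof (rule AE_I2)
      fix z :: 'a
      show "norm (q n z) \<le> indicator (cball 0 (R + 1)) z * B"
      proof (cases "norm z \<le> R + 1")
        case True
        then show ?thesis using mv[of n z] B(2) by auto
      next
        case False
        have "norm (z + a n *\<^sub>R b) > R"
          using norm_triangle_ineq4[of "z + a n *\<^sub>R b" "a n *\<^sub>R b"] False a[of n] b by simp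
        then show ?thesis using False R(2) by (simp add: q_def)
      qed
    qed
  qed (use test_function_measurable[OF t] test_function_measurable[OF tp] in \<open>simp_all add: q_def\<close>)
  moreover have "(\<integral>z. q n z \<partial>lborel) = 0" for n
    unfolding q_def using test_function_integrable[OF t] integrable_translate[OF test_function_integrable[OF t]]
    by (simp add: integral_translate[OF test_function_measurable[OF t]])
  ultimately show ?thesis using LIMSEQ_unique[OF _ tendsto_const] by fastforce
qed

subsection \<open>Averages of translates\<close>

definition average :: "('a::euclidean_space \<Rightarrow> real) \<Rightarrow> ('a \<Rightarrow> real) \<Rightarrow> 'a \<Rightarrow> real" where
  "average \<kappa> u z = (\<integral>w. \<kappa> w * u (z + w) \<partial>lborel)"

text \<open>Two kinds of kernels occur: smooth ones, which produce test functions, and normalized indicators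
  of small cubes, which measure the oscillation of functions with half a derivative.\<close>

locale averaging_kernel =
  fixes \<kappa> :: "'a::euclidean_space \<Rightarrow> real" and B :: real
  assumes measurable [measurable]: "\<kappa> \<in> borel_measurable borel" and nonneg: "0 \<le> \<kappa> w"
    and bounded: "\<kappa> w \<le> B" and integrable: "integrable lborel \<kappa>" and integral: "(\<integral>w. \<kappa> w \<partial>lborel) = 1"
begin

lemma L2: "\<kappa> \<in> L2 lborel"
proof -
  have "integrable lborel (\<lambda>z. (norm (\<kappa> z))\<^sup>2)"
  proof (rule Bochner_Integration.integrable_bound)
    show "integrable lborel (\<lambda>w. B * \<kappa> w)" using integrable by simp
    have "norm ((norm (\<kappa> w))\<^sup>2) \<le> norm (B * \<kappa> w)" for w
    proof -
      have "\<kappa> w * \<kappa> w \<le> B * \<kappa> w" using nonneg bounded by (intro mult_right_mono)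
      also have "\<dots> \<le> norm (B * \<kappa> w)" by simp
      finally show ?thesis by (simp add: power2_eq_square)
    qed
    then show "AE w in lborel. norm ((norm (\<kappa> w))\<^sup>2) \<le> norm (B * \<kappa> w)" by (rule AE_I2)
  qed measurable
  then show ?thesis by (simp add: L2_def)
qed

lemma integrable_mult:
  assumes "f \<in> L2 lborel"
  shows "integrable lborel (\<lambda>w. \<kappa> w * f w)" "integrable lborel (\<lambda>w. \<kappa> w * (f w)\<^sup>2)"
proof -
  show "integrable lborel (\<lambda>w. \<kappa> w * f w)" by (rule integrable_mult_L2[OF L2 assms])
  have [measurable]: "f \<in> borel_measurable borel" using L2_measurable[OF assms] by simp
  show "integrable lborel (\<lambda>w. \<kappa> w * (f w)\<^sup>2)"
  proof (rule Bochner_Integration.integrable_bound)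
    show "integrable lborel (\<lambda>w. B * (f w)\<^sup>2)" using L2_integrable_square[OF assms] by simp
    have "\<kappa> w * (f w)\<^sup>2 \<le> B * (f w)\<^sup>2" for w using bounded by (intro mult_right_mono) auto
    then show "AE w in lborel. norm (\<kappa> w * (f w)\<^sup>2) \<le> norm (B * (f w)\<^sup>2)"
      using nonneg order_trans[OF nonneg bounded] by (intro AE_I2) (simp add: abs_mult)
  qed measurable
qed

lemma jensen_square:
  assumes f: "f \<in> L2 lborel"
  shows "(\<integral>w. \<kappa> w * f w \<partial>lborel)\<^sup>2 \<le> (\<integral>w. \<kappa> w * (f w)\<^sup>2 \<partial>lborel)"
proof -
  note int = integrable_mult[OF f]
  define m where "m = (\<integral>w. \<kappa> w * f w \<partial>lborel)"
  have "0 \<le> (\<integral>w. \<kappa> w * (f w - m)\<^sup>2 \<partial>lborel)" using nonneg by (intro integral_nonneg_AE) auto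
  also have "(\<integral>w. \<kappa> w * (f w - m)\<^sup>2 \<partial>lborel)
     = (\<integral>w. \<kappa> w * (f w)\<^sup>2 - 2 * m * (\<kappa> w * f w) + m\<^sup>2 * \<kappa> w \<partial>lborel)"
    by (intro Bochner_Integration.integral_cong) (auto simp: power2_eq_square algebra_simps)
  also have "\<dots> = (\<integral>w. \<kappa> w * (f w)\<^sup>2 \<partial>lborel) - 2 * m * m + m\<^sup>2"
    using int integrable integral by (simp add: m_def)
  finally show ?thesis by (simp add: m_def power2_eq_square)
qed

lemma average_measurable [measurable]:
  assumes [measurable]: "u \<in> borel_measurable borel" shows "average \<kappa> u \<in> borel_measurable borel"
proof -
  have "(\<lambda>z. \<integral>w. \<kappa> w * u (z + w) \<partial>lborel) \<in> borel_measurable lborel"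
    by (rule lborel.borel_measurable_lebesgue_integral) measurable
  then show ?thesis by (simp add: average_def[abs_def])
qed

lemma square_diff_average_le:
  assumes u: "u \<in> L2 lborel"
  shows "(average \<kappa> u z - u z)\<^sup>2 \<le> (\<integral>w. \<kappa> w * (u (z + w) - u z)\<^sup>2 \<partial>lborel)"
    "integrable lborel (\<lambda>w. \<kappa> w * (u (z + w) - u z)\<^sup>2)"
proof -
  have uz: "(\<lambda>w. u (z + w)) \<in> L2 lborel" using L2_translate[OF u, of z] by (simp add: add.commute)
  note int = integrable_mult[OF uz]
  define c where "c = u z"
  show 1: "integrable lborel (\<lambda>w. \<kappa> w * (u (z + w) - u z)\<^sup>2)"
  proof -
    have "integrable lborel (\<lambda>w. \<kappa> w * (u (z + w))\<^sup>2 - 2 * c * (\<kappa> w * u (z + w)) + c\<^sup>2 * \<kappa> w)"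
      using int integrable by auto
    then show ?thesis
      by (rule Bochner_Integration.integrable_cong[THEN iffD1, rotated -1])
        (auto simp: c_def power2_eq_square algebra_simps)
  qed
  define m where "m = average \<kappa> u z"
  have "(\<integral>w. \<kappa> w * (u (z + w) - c)\<^sup>2 \<partial>lborel)
     = (\<integral>w. \<kappa> w * (u (z + w))\<^sup>2 - 2 * c * (\<kappa> w * u (z + w)) + c\<^sup>2 * \<kappa> w \<partial>lborel)"
    by (intro Bochner_Integration.integral_cong) (auto simp: power2_eq_square algebra_simps)
  also have "\<dots> = (\<integral>w. \<kappa> w * (u (z + w))\<^sup>2 \<partial>lborel) - 2 * c * m + c\<^sup>2"
    using int integrable integral by (simp add: m_def average_def)
  also have "\<dots> \<ge> m\<^sup>2 - 2 * c * m + c\<^sup>2" using jensen_square[OF uz] by (simp add: m_def average_def)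
  finally show "(average \<kappa> u z - u z)\<^sup>2 \<le> (\<integral>w. \<kappa> w * (u (z + w) - u z)\<^sup>2 \<partial>lborel)"
    by (simp add: c_def m_def power2_diff algebra_simps)
qed

lemma norm2_average_diff:
  assumes u: "u \<in> L2 lborel" and e: "e \<ge> 0"
    and le: "\<And>w. \<kappa> w \<noteq> 0 \<Longrightarrow> norm2 lborel (\<lambda>z. u (z + w) - u z) \<le> e"
  shows "(\<lambda>z. average \<kappa> u z - u z) \<in> L2 lborel" "norm2 lborel (\<lambda>z. average \<kappa> u z - u z) \<le> e"
proof -
  have [measurable]: "u \<in> borel_measurable borel" using L2_measurable[OF u] by simp
  have "(\<integral>\<^sup>+z. ennreal ((average \<kappa> u z - u z)\<^sup>2) \<partial>lborel)
     \<le> (\<integral>\<^sup>+z. (\<integral>\<^sup>+w. ennreal (\<kappa> w * (u (z + w) - u z)\<^sup>2) \<partial>lborel) \<partial>lborel)"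
    using square_diff_average_le[OF u] nonneg
    by (intro nn_integral_mono) (simp add: nn_integral_eq_integral ennreal_leI)
  also have "\<dots> = (\<integral>\<^sup>+w. (\<integral>\<^sup>+z. ennreal (\<kappa> w * (u (z + w) - u z)\<^sup>2) \<partial>lborel) \<partial>lborel)"
    by (rule lborel_pair.Fubini') measurable
  also have "\<dots> \<le> (\<integral>\<^sup>+w. ennreal (e\<^sup>2 * \<kappa> w) \<partial>lborel)"
  proof (rule nn_integral_mono)
    fix w :: 'a
    have d: "(\<lambda>z. u (z + w) - u z) \<in> L2 lborel" by (intro L2_diff L2_translate u)
    have "(\<integral>\<^sup>+z. ennreal (\<kappa> w * (u (z + w) - u z)\<^sup>2) \<partial>lborel) = ennreal (\<integral>z. \<kappa> w * (u (z + w) - u z)\<^sup>2 \<partial>lborel)"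
      using L2_integrable_square[OF d] nonneg by (intro nn_integral_eq_integral) auto
    also have "(\<integral>z. \<kappa> w * (u (z + w) - u z)\<^sup>2 \<partial>lborel) = \<kappa> w * (norm2 lborel (\<lambda>z. u (z + w) - u z))\<^sup>2"
      by (simp add: norm2_square_real)
    also have "\<dots> \<le> e\<^sup>2 * \<kappa> w"
    proof (cases "\<kappa> w = 0")
      case False
      then show ?thesis using le[OF False] nonneg[of w] by (subst mult.commute) (intro mult_right_mono power_mono, auto)
    qed simp
    finally show "(\<integral>\<^sup>+z. ennreal (\<kappa> w * (u (z + w) - u z)\<^sup>2) \<partial>lborel) \<le> ennreal (e\<^sup>2 * \<kappa> w)"
      by (simp add: ennreal_leI)
  qed
  also have "\<dots> = ennreal (e\<^sup>2)"
    using integrable integral nonneg by (subst nn_integral_eq_integral) auto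
  finally have le2: "(\<integral>\<^sup>+z. ennreal ((average \<kappa> u z - u z)\<^sup>2) \<partial>lborel) \<le> ennreal (e\<^sup>2)" .
  have int: "integrable lborel (\<lambda>z. (average \<kappa> u z - u z)\<^sup>2)"
    using le2 by (intro integrableI_nonneg) (auto simp: order_le_less_trans[OF _ ennreal_less_top])
  then show "(\<lambda>z. average \<kappa> u z - u z) \<in> L2 lborel" by (simp add: L2_def)
  have "ennreal (\<integral>z. (average \<kappa> u z - u z)\<^sup>2 \<partial>lborel) \<le> ennreal (e\<^sup>2)"
    using le2 int by (subst (asm) nn_integral_eq_integral) auto
  then have "(norm2 lborel (\<lambda>z. average \<kappa> u z - u z))\<^sup>2 \<le> e\<^sup>2" by (simp add: norm2_square_real)
  then show "norm2 lborel (\<lambda>z. average \<kappa> u z - u z) \<le> e" using e power2_le_imp_le by blast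
qed

end

text \<open>Averages against a test function are smooth since all derivatives can be moved to the
  kernel.\<close>

lemma average_eq_convolution:
  assumes "\<kappa> \<in> borel_measurable borel" "u \<in> borel_measurable borel"
  shows "average \<kappa> u z = (\<integral>w. \<kappa> (w - z) * u w \<partial>lborel)"
  using integral_translate[of "\<lambda>w. \<kappa> (w - z) * u w" z] assms
  by (simp add: average_def add.commute)

lemma average_has_derivative:
  fixes \<kappa> u :: "'a::euclidean_space \<Rightarrow> real"
  assumes k: "\<kappa> \<in> test_functions UNIV" and u: "u \<in> L2 lborel"
  shows "(average \<kappa> u has_derivative (\<lambda>h. \<Sum>b\<in>Basis. (h \<bullet> b) * average (\<lambda>w. - partial b \<kappa> w) u z)) (at z)"
    (is "(_ has_derivative ?D) _")
proof -
  have um [measurable]: "u \<in> borel_measurable borel" using L2_measurable[OF u] by simp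
  have uz: "(\<lambda>w. u (z + w)) \<in> L2 lborel" for z using L2_translate[OF u, of z] by (simp add: add.commute)
  obtain R where R: "R > 0" "\<And>z. norm z > R \<Longrightarrow> \<kappa> z = 0" using k by (rule test_function_bounded_support) blast
  have pk: "partial b \<kappa> \<in> test_functions UNIV" if "b \<in> Basis" for b using test_function_partial[OF k that] .
  have km [measurable]: "\<kappa> \<in> borel_measurable borel" by (rule test_function_measurable[OF k])
  have pz: "partial b \<kappa> w = 0" if "norm w > R" for b w
    by (rule partial_zero_outside[of "cball 0 R"]) (use R that in auto)
  let ?B = "\<lambda>w. indicator (cball (0::'a) (R + 1)) w :: real"
  have BL: "?B \<in> L2 lborel" by (rule bounded_support_L2[where B=1 and R="R+1"]) (auto simp: indicator_def)
  have iB: "integrable lborel (\<lambda>w. ?B w * \<bar>u (z + w)\<bar>)"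
    using integrable_mult_L2[OF BL L2_norm[OF uz]] by simp
  define M where "M = (\<integral>w. ?B w * \<bar>u (z + w)\<bar> \<partial>lborel)"
  have M: "M \<ge> 0" by (simp add: M_def)
  show ?thesis
    unfolding has_derivative_at
  proof (intro conjI)
    show "bounded_linear ?D" by (intro bounded_linear_sum bounded_linear_mult_left[THEN bounded_linear_compose] bounded_linear_inner_left)
    show "(\<lambda>h. norm (average \<kappa> u (z + h) - average \<kappa> u z - ?D h) / norm h) \<midarrow>0\<rightarrow> 0"
    proof (rule LIM_I)
      fix e :: real assume e: "e > 0"
      define e' where "e' = e / (real DIM('a) * (M + 1))"
      have e': "e' > 0" using e M unfolding e'_def by (intro divide_pos_pos mult_pos_pos) auto
      have "\<exists>d. \<forall>b\<in>Basis. d b > 0 \<and> (\<forall>x y. norm (x - y) < d b \<longrightarrow> \<bar>partial b \<kappa> x - partial b \<kappa> y\<bar> < e')"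
        by (rule bchoice) (use test_function_uniformly_continuous[OF pk e'] in blast)
      then obtain d where d: "\<And>b. b \<in> Basis \<Longrightarrow> d b > 0"
        "\<And>b x y. b \<in> Basis \<Longrightarrow> norm (x - y) < d b \<Longrightarrow> \<bar>partial b \<kappa> x - partial b \<kappa> y\<bar> < e'" by blast
      define \<delta> where "\<delta> = min 1 (Min (d ` Basis))"
      have \<delta>: "\<delta> > 0" "\<delta> \<le> 1" "\<And>b. b \<in> Basis \<Longrightarrow> \<delta> \<le> d b" using d(1) by (auto simp: \<delta>_def min_le_iff_disj)
      have "norm (average \<kappa> u (z + h) - average \<kappa> u z - ?D h) / norm h < e" if h: "h \<noteq> 0" "norm h < \<delta>" for h
      proof -
        define r where "r w = \<kappa> (w - h) - \<kappa> w + (\<Sum>b\<in>Basis. (h \<bullet> b) * partial b \<kappa> w)" for w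
        have kh: "(\<lambda>w. \<kappa> (w - h)) \<in> L2 lborel" using L2_translate[OF test_function_L2[OF k], of "- h"] by simp
        have sumL: "(\<lambda>w. \<Sum>b\<in>S. (h \<bullet> b) * partial b \<kappa> w) \<in> L2 lborel" if "finite S" "S \<subseteq> Basis" for S
          using that
        proof (induction rule: finite_induct)
          case (insert b F)
          then show ?case using L2_add[OF L2_cmult[OF test_function_L2[OF pk]]] by simp
        qed (simp add: L2_zero)
        have rL: "r \<in> L2 lborel" unfolding r_def
          by (intro L2_add L2_diff kh test_function_L2[OF k] sumL) auto
        have rb: "\<bar>r w\<bar> \<le> (real DIM('a) * e' * norm h) * ?B w" for w
        proof (cases "norm w \<le> R + 1")
          case True
          obtain s where s: "0 < s" "s < 1" "\<kappa> (w + (- h)) - \<kappa> w = (\<Sum>b\<in>Basis. ((- h) \<bullet> b) * partial b \<kappa> (w + s *\<^sub>R (- h)))"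
            using test_function_mean_value[OF k, of w "- h"] by blast
          have "r w = (\<Sum>b\<in>Basis. (h \<bullet> b) * (partial b \<kappa> w - partial b \<kappa> (w - s *\<^sub>R h)))"
            using s(3) by (simp add: r_def algebra_simps sum.distrib sum_negf sum_subtractf)
          also have "\<bar>\<dots>\<bar> \<le> (\<Sum>b\<in>(Basis::'a set). norm h * e')"
          proof (rule order_trans[OF sum_abs sum_mono])
            fix b :: 'a assume b: "b \<in> Basis"
            have "norm (w - (w - s *\<^sub>R h)) = s * norm h" using s by simp
            also have "\<dots> \<le> 1 * norm h" using s by (intro mult_right_mono) auto
            finally have "norm (w - (w - s *\<^sub>R h)) < d b" using h(2) \<delta>(3)[OF b] by linarith
            from d(2)[OF b this] Basis_le_norm[OF b, of h]
            show "\<bar>(h \<bullet> b) * (partial b \<kappa> w - partial b \<kappa> (w - s *\<^sub>R h))\<bar> \<le> norm h * e'"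
              unfolding abs_mult by (intro mult_mono) auto
          qed
          finally show ?thesis using True by (simp add: mult_ac)
        next
          case False
          then have "norm w > R" "norm (w - h) > R"
            using norm_triangle_ineq2[of w h] h(2) \<delta>(2) by auto
          then show ?thesis using False R(2) pz by (simp add: r_def)
        qed
        have "average \<kappa> u (z + h) - average \<kappa> u z - ?D h = (\<integral>w. r w * u (z + w) \<partial>lborel)"
        proof -
          have i1: "integrable lborel (\<lambda>w. \<kappa> (w - h) * u (z + w))" by (rule integrable_mult_L2[OF kh uz])
          have i2: "integrable lborel (\<lambda>w. \<kappa> w * u (z + w))" by (rule integrable_mult_L2[OF test_function_L2[OF k] uz])
          have i3: "integrable lborel (\<lambda>w. partial b \<kappa> w * u (z + w))" if "b \<in> Basis" for b
            by (rule integrable_mult_L2[OF test_function_L2[OF pk[OF that]] uz])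
          have "(\<integral>w. r w * u (z + w) \<partial>lborel) = (\<integral>w. \<kappa> (w - h) * u (z + w) - \<kappa> w * u (z + w)
             + (\<Sum>b\<in>Basis. (h \<bullet> b) * (partial b \<kappa> w * u (z + w))) \<partial>lborel)"
            by (intro Bochner_Integration.integral_cong) (auto simp: r_def algebra_simps sum_distrib_left)
          also have "\<dots> = (\<integral>w. \<kappa> (w - h) * u (z + w) \<partial>lborel) - (\<integral>w. \<kappa> w * u (z + w) \<partial>lborel)
             + (\<Sum>b\<in>Basis. (h \<bullet> b) * (\<integral>w. partial b \<kappa> w * u (z + w) \<partial>lborel))"
            using i1 i2 i3 by (simp add: Bochner_Integration.integral_sum)
          also have "(\<integral>w. \<kappa> (w - h) * u (z + w) \<partial>lborel) = average \<kappa> u (z + h)"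
            using integral_translate[of "\<lambda>w. \<kappa> (w - h) * u (z + w)" h] by (simp add: average_def add_ac)
          finally show ?thesis by (simp add: average_def sum_negf)
        qed
        also have "\<bar>\<dots>\<bar> \<le> (\<integral>w. \<bar>r w * u (z + w)\<bar> \<partial>lborel)" by (rule integral_abs_bound)
        also have "\<dots> \<le> (\<integral>w. (real DIM('a) * e' * norm h) * (?B w * \<bar>u (z + w)\<bar>) \<partial>lborel)"
        proof (rule integral_mono[OF integrable_abs[OF integrable_mult_L2[OF rL uz]] integrable_mult_right[OF iB]])
          show "\<bar>r w * u (z + w)\<bar> \<le> (real DIM('a) * e' * norm h) * (?B w * \<bar>u (z + w)\<bar>)" for w
            using mult_right_mono[OF rb[of w], of "\<bar>u (z + w)\<bar>"] by (simp only: abs_mult mult.assoc abs_ge_zero)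
        qed
        also have "\<dots> = real DIM('a) * e' * norm h * M" by (simp add: M_def)
        also have "\<dots> = norm h * (e * (M / (M + 1)))" by (simp add: e'_def)
        also have "\<dots> < norm h * e"
          using h(1) e M by (intro mult_strict_left_mono) (auto simp: field_simps)
        finally show ?thesis using h by (simp add: divide_simps mult.commute)
      qed
      then show "\<exists>s>0. \<forall>x. x \<noteq> 0 \<and> norm (x - 0) < s \<longrightarrow>
          norm (norm (average \<kappa> u (z + x) - average \<kappa> u z - ?D x) / norm x - 0) < e"
        using \<delta>(1) by (intro exI[of _ \<delta>]) auto
    qed
  qed
qed

lemma average_partial:
  fixes \<kappa> u :: "'a::euclidean_space \<Rightarrow> real"
  assumes k: "\<kappa> \<in> test_functions UNIV" and u: "u \<in> L2 lborel" and b: "b \<in> Basis"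
  shows "partial b (average \<kappa> u) = average (\<lambda>w. - partial b \<kappa> w) u"
  unfolding frechet_derivative_eqI[OF average_has_derivative[OF k u]]
  using b by (auto simp: inner_Basis if_distrib if_distribR sum.delta cong: if_cong)

lemma average_Ck:
  fixes \<kappa> u :: "'a::euclidean_space \<Rightarrow> real"
  assumes "\<kappa> \<in> test_functions UNIV" and u: "u \<in> L2 lborel"
  shows "Ck k (average \<kappa> u)"
  using assms(1)
proof (induction k arbitrary: \<kappa>)
  case 0
  show ?case using average_has_derivative[OF 0 u]
    by (auto intro!: continuous_at_imp_continuous_on has_derivative_continuous)
next
  case (Suc k)
  have "average \<kappa> u differentiable (at z)" for z
    using average_has_derivative[OF Suc.prems u] differentiableI by blast
  moreover have "Ck k (partial b (average \<kappa> u))" if "b \<in> Basis" for b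
    unfolding average_partial[OF Suc.prems u that]
    by (intro Suc.IH test_function_uminus test_function_partial Suc.prems that)
  ultimately show ?case by simp
qed

text \<open>The kernels are supported on one side of all coordinate hyperplanes, so that the average of
  a function at a point of the half-space, or even of its boundary, only involves values
  inside the half-space.\<close>

lemma one_sided_mollifier_exists:
  assumes e: "\<epsilon> > 0"
  shows "\<exists>\<kappa>\<in>test_functions UNIV. (\<exists>B. averaging_kernel \<kappa> B) \<and>
     (\<forall>w::'a::euclidean_space. \<kappa> w \<noteq> 0 \<longrightarrow> w \<in> cbox (\<epsilon> *\<^sub>R One) ((2 * \<epsilon>) *\<^sub>R One))"
proof -
  define \<phi> :: "'a \<Rightarrow> real" where "\<phi> w = bump ((- One) + (1 / \<epsilon>) *\<^sub>R w)" for w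
  have "(bump :: 'a \<Rightarrow> real) \<in> test_functions UNIV"
  proof (rule test_functionsI[where K="cbox 0 One"])
    show "bump z = 0" if "z \<notin> cbox 0 One" for z :: 'a
      using that bump_nonzero_iff[of z] box_subset_cbox[of "0::'a" One] by blast
  qed (auto intro: Ck_bump)
  then have t: "\<phi> \<in> test_functions UNIV" unfolding \<phi>_def using e by (intro test_function_affine) auto
  have supp: "w \<in> box (\<epsilon> *\<^sub>R One) ((2 * \<epsilon>) *\<^sub>R One) \<longleftrightarrow> \<phi> w \<noteq> 0" for w
    using e by (auto simp: \<phi>_def bump_nonzero_iff box_def inner_simps inner_sum_left_Basis field_simps)
  have nn: "0 \<le> \<phi> w" for w by (simp add: \<phi>_def bump_nonneg)
  define I where "I = (\<integral>w. \<phi> w \<partial>lborel)"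
  have "I \<noteq> 0"
  proof
    assume "I = 0"
    then have "AE w in lborel. \<phi> w = 0"
      using integral_nonneg_eq_0_iff_AE[OF test_function_integrable[OF t]] nn by (simp add: I_def)
    then have "AE w in lborel. w \<notin> box (\<epsilon> *\<^sub>R (One::'a)) ((2 * \<epsilon>) *\<^sub>R One)" by eventually_elim (use supp in blast)
    then have "emeasure lborel (box (\<epsilon> *\<^sub>R (One::'a)) ((2 * \<epsilon>) *\<^sub>R One)) = 0"
      by (subst (asm) AE_iff_measurable[where N="box (\<epsilon> *\<^sub>R One) ((2 * \<epsilon>) *\<^sub>R One)"]) auto
    then show False using e by (simp add: emeasure_lborel_box_eq inner_simps inner_sum_left_Basis)
  qed
  moreover have "I \<ge> 0" unfolding I_def using nn by simp
  ultimately have I: "I > 0" by simp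
  define \<kappa> where "\<kappa> w = (1 / I) * \<phi> w" for w
  have k: "\<kappa> \<in> test_functions UNIV" unfolding \<kappa>_def by (rule test_function_cmult[OF t])
  obtain B where B: "B > 0" "\<And>z. \<bar>\<kappa> z\<bar> \<le> B" using k by (rule test_function_bounded) blast
  have "averaging_kernel \<kappa> B"
  proof
    show "\<kappa> w \<le> B" for w using B(2)[of w] by simp
    show "(\<integral>w. \<kappa> w \<partial>lborel) = 1" using I by (simp add: \<kappa>_def I_def)
  qed (use test_function_measurable[OF k] test_function_integrable[OF k] nn I in \<open>auto simp: \<kappa>_def\<close>)
  moreover have "w \<in> cbox (\<epsilon> *\<^sub>R One) ((2 * \<epsilon>) *\<^sub>R One)" if "\<kappa> w \<noteq> 0" for w
    using that supp[of w] box_subset_cbox by (auto simp: \<kappa>_def)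
  ultimately show ?thesis using k by blast
qed

lemma translation_continuous_L2_eps:
  fixes u :: "'a::euclidean_space \<Rightarrow> real"
  assumes u: "u \<in> L2 lborel" and e: "e > 0"
  shows "\<exists>\<delta>>0. \<forall>a. norm a < \<delta> \<longrightarrow> norm2 lborel (\<lambda>z. u (z + a) - u z) < e"
proof (rule ccontr)
  assume "\<not> ?thesis"
  then have "\<exists>a. norm a < inverse (real (Suc n)) \<and> \<not> norm2 lborel (\<lambda>z. u (z + a) - u z) < e" for n
    by (meson inverse_positive_iff_positive of_nat_0_less_iff zero_less_Suc)
  then obtain a where a: "\<And>n. norm (a n) < inverse (real (Suc n))"
    "\<And>n. \<not> norm2 lborel (\<lambda>z. u (z + a n) - u z) < e" by metis
  have "a \<longlonglongrightarrow> 0"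
    by (rule Lim_null_comparison[OF _ LIMSEQ_inverse_real_of_nat]) (use a(1) less_imp_le in \<open>auto intro!: always_eventually\<close>)
  from LIMSEQ_D[OF translation_continuous_L2[OF u this] e] show False using a(2) by force
qed

lemma mollification_exists:
  fixes u :: "'a::euclidean_space \<Rightarrow> real"
  assumes F: "finite F" "F \<subseteq> L2 lborel" and e: "e > 0"
  shows "\<exists>\<epsilon>>0. \<exists>\<kappa>\<in>test_functions UNIV.
     (\<forall>w::'a. \<kappa> w \<noteq> 0 \<longrightarrow> w \<in> cbox (\<epsilon> *\<^sub>R One) ((2 * \<epsilon>) *\<^sub>R One)) \<and>
     (\<forall>u\<in>F. average \<kappa> u \<in> L2 lborel \<and> norm2 lborel (\<lambda>z. average \<kappa> u z - u z) \<le> e)"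
proof -
  have "\<exists>\<delta>. \<forall>u\<in>F. \<delta> u > 0 \<and> (\<forall>a. norm a < \<delta> u \<longrightarrow> norm2 lborel (\<lambda>z. u (z + a) - u z) < e)"
    by (rule bchoice) (use translation_continuous_L2_eps[OF _ e] F(2) in blast)
  then obtain \<delta> where \<delta>: "\<And>u. u \<in> F \<Longrightarrow> \<delta> u > 0"
    "\<And>u a. u \<in> F \<Longrightarrow> norm a < \<delta> u \<Longrightarrow> norm2 lborel (\<lambda>z. u (z + a) - u z) < e" by blast
  define d where "d = Min (insert 1 (\<delta> ` F))"
  have d: "d > 0" "\<And>u. u \<in> F \<Longrightarrow> d \<le> \<delta> u" using F(1) \<delta>(1) by (auto simp: d_def)
  define \<epsilon> where "\<epsilon> = d / (3 * real DIM('a))"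
  have \<epsilon>: "\<epsilon> > 0" using d by (simp add: \<epsilon>_def)
  obtain \<kappa> B where k: "\<kappa> \<in> test_functions UNIV" "averaging_kernel \<kappa> B"
    "\<And>w::'a. \<kappa> w \<noteq> 0 \<Longrightarrow> w \<in> cbox (\<epsilon> *\<^sub>R One) ((2 * \<epsilon>) *\<^sub>R One)"
    using one_sided_mollifier_exists[OF \<epsilon>] by blast
  have small: "norm w < d" if "\<kappa> w \<noteq> 0" for w
  proof -
    have "norm w \<le> (\<Sum>b\<in>Basis. \<bar>w \<bullet> b\<bar>)" by (rule norm_le_l1)
    also have "\<dots> \<le> (\<Sum>b\<in>(Basis::'a set). 2 * \<epsilon>)"
      using k(3)[OF that] \<epsilon> by (intro sum_mono) (fastforce simp: mem_box inner_simps inner_sum_left_Basis)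
    also have "\<dots> = 2 * d / 3" by (simp add: \<epsilon>_def)
    finally show ?thesis using d by linarith
  qed
  have "average \<kappa> u \<in> L2 lborel \<and> norm2 lborel (\<lambda>z. average \<kappa> u z - u z) \<le> e" if "u \<in> F" for u
  proof -
    have u: "u \<in> L2 lborel" using F that by blast
    have le: "norm2 lborel (\<lambda>z. u (z + w) - u z) \<le> e" if "\<kappa> w \<noteq> 0" for w
      using \<delta>(2)[OF \<open>u \<in> F\<close>, of w] small[OF that] d(2)[OF \<open>u \<in> F\<close>] by simp
    note A = averaging_kernel.norm2_average_diff[OF k(2) u less_imp_le[OF e] le]
    show ?thesis using A L2_add[OF A(1) u] by simp
  qed
  then show ?thesis using k \<epsilon> by blast
qed

section \<open>Density of test functions in the Sobolev space of the half-space\<close>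

abbreviation zero_ext :: "(real \<times> (real ^ 'n) \<Rightarrow> 'b::real_vector) \<Rightarrow> real \<times> (real ^ 'n) \<Rightarrow> 'b" where
  "zero_ext u z \<equiv> indicator half_space z *\<^sub>R u z"

lemma open_half_space: "open half_space"
  unfolding half_space_def by (intro open_Collect_less continuous_intros)

lemma half_space_borel [measurable]: "half_space \<in> sets borel"
  by (rule borel_open[OF open_half_space])

lemma space_half_measure [simp]: "space half_measure = half_space"
  by (simp add: space_restrict_space)

lemma measurable_half: "f \<in> borel_measurable borel \<Longrightarrow> f \<in> borel_measurable half_measure"
  by (intro measurable_restrict_space1) simp

lemma L2_half_iff: "u \<in> L2 half_measure \<longleftrightarrow> zero_ext u \<in> L2 lborel"
  for u :: "real \<times> (real ^ 'n) \<Rightarrow> 'b::euclidean_space"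
proof -
  have "(norm (zero_ext u z))\<^sup>2 = zero_ext (\<lambda>z. (norm (u z))\<^sup>2) z" for z by (simp add: indicator_def)
  then show ?thesis
    by (simp add: L2_def borel_measurable_restrict_space_iff integrable_restrict_space)
qed

lemma norm2_half: "norm2 half_measure u = norm2 lborel (zero_ext u)"
  for u :: "real \<times> (real ^ 'n) \<Rightarrow> 'b::euclidean_space"
proof -
  have "(norm (zero_ext u z))\<^sup>2 = zero_ext (\<lambda>z. (norm (u z))\<^sup>2) z" for z by (simp add: indicator_def)
  then show ?thesis by (simp add: norm2_def integral_restrict_space)
qed

lemma L2_lborel_imp_half:
  assumes f: "f \<in> L2 lborel"
  shows "f \<in> L2 half_measure" "norm2 half_measure f \<le> norm2 lborel f"
proof -
  have "f \<in> borel_measurable borel" using L2_measurable[OF f] by simp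
  then have m: "zero_ext f \<in> borel_measurable lborel" by measurable
  have le: "AE z in lborel. norm (zero_ext f z) \<le> norm (f z)" by (auto simp: indicator_def)
  show "f \<in> L2 half_measure" unfolding L2_half_iff by (rule L2_dominated[OF f m le])
  show "norm2 half_measure f \<le> norm2 lborel f" unfolding norm2_half by (rule norm2_mono[OF f m le])
qed

lemma norm2_half_diff_le:
  assumes f: "f \<in> L2 lborel" and g: "g \<in> L2 half_measure"
  shows "norm2 half_measure (\<lambda>z. f z - g z) \<le> norm2 lborel (\<lambda>z. f z - zero_ext g z)"
proof -
  have d: "(\<lambda>z. f z - zero_ext g z) \<in> L2 lborel" using g by (intro L2_diff f) (simp only: L2_half_iff)
  have "norm2 half_measure (\<lambda>z. f z - g z) = norm2 half_measure (\<lambda>z. f z - zero_ext g z)"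
    unfolding norm2_half by (rule arg_cong[where f="norm2 lborel"]) (auto simp: indicator_def)
  also have "\<dots> \<le> norm2 lborel (\<lambda>z. f z - zero_ext g z)" by (rule L2_lborel_imp_half[OF d])
  finally show ?thesis .
qed

lemma integral_half_eq:
  fixes f :: "real \<times> (real ^ 'n) \<Rightarrow> real"
  assumes "\<And>z. z \<notin> half_space \<Longrightarrow> f z = 0"
  shows "(\<integral>z. f z \<partial>half_measure) = (\<integral>z. f z \<partial>lborel)"
proof -
  have "zero_ext f z = f z" for z using assms[of z] by (cases "z \<in> half_space") auto
  then have "(\<integral>z. zero_ext f z \<partial>lborel) = (\<integral>z. f z \<partial>lborel)" by (simp only:)
  moreover have "(\<integral>z. f z \<partial>half_measure) = (\<integral>z. zero_ext f z \<partial>lborel)" by (simp add: integral_restrict_space)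
  ultimately show ?thesis by simp
qed

lemma half_space_iff: "z \<in> half_space \<longleftrightarrow> 0 < z \<bullet> (1, 0)"
  by (simp add: half_space_def inner_prod_def)

lemma has_weak_gradientD:
  assumes "has_weak_gradient u g"
  shows "g \<in> L2 half_measure"
    "\<phi> \<in> test_functions half_space \<Longrightarrow> b \<in> Basis \<Longrightarrow>
      (\<integral>z. u z * partial b \<phi> z \<partial>half_measure) = - (\<integral>z. (g z \<bullet> b) * \<phi> z \<partial>half_measure)"
  using assms unfolding has_weak_gradient_def by blast+

lemma one_sided_shift_in_half_space:
  fixes z :: "real \<times> (real ^ 'n)"
  assumes "\<epsilon> > 0" "z \<in> half_space" "w \<in> cbox (\<epsilon> *\<^sub>R One) ((2 * \<epsilon>) *\<^sub>R One)"
  shows "w + z \<in> half_space"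
proof -
  have b: "(1, 0) \<in> (Basis :: (real \<times> (real ^ 'n)) set)" by (simp add: Basis_prod_def)
  have "\<epsilon> \<le> w \<bullet> (1, 0)" using assms(3) b by (force simp: mem_box inner_simps inner_sum_left_Basis)
  then show ?thesis using assms(1,2) unfolding half_space_iff inner_add_left by linarith
qed

lemma test_function_kernel_shift:
  assumes k: "\<kappa> \<in> test_functions UNIV" and e: "\<epsilon> > 0" and z: "z \<in> half_space"
    and supp: "\<And>w. \<kappa> w \<noteq> 0 \<Longrightarrow> w \<in> cbox (\<epsilon> *\<^sub>R One) ((2 * \<epsilon>) *\<^sub>R One)"
  shows "(\<lambda>w. \<kappa> (w - z)) \<in> test_functions half_space"
proof (rule test_functionsI)
  show "Ck k (\<lambda>w. \<kappa> (w - z))" for k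
    using Ck_compose_affine[OF test_function_Ck[OF k], of k "- z" 1] by simp
  show "compact ((\<lambda>w. w + z) ` cbox (\<epsilon> *\<^sub>R One) ((2 * \<epsilon>) *\<^sub>R One))"
    by (intro compact_continuous_image continuous_intros) auto
  show "(\<lambda>w. w + z) ` cbox (\<epsilon> *\<^sub>R One) ((2 * \<epsilon>) *\<^sub>R One) \<subseteq> half_space"
    using one_sided_shift_in_half_space[OF e z] by blast
  fix w assume w: "w \<notin> (\<lambda>w. w + z) ` cbox (\<epsilon> *\<^sub>R One) ((2 * \<epsilon>) *\<^sub>R One)"
  have "w = (w - z) + z" by simp
  then show "\<kappa> (w - z) = 0" using w supp[of "w - z"] by blast
qed

lemma average_zero_ext:
  assumes "\<kappa> \<in> test_functions UNIV" and u: "u \<in> L2 half_measure"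
  shows "average \<kappa> (zero_ext u) z = (\<integral>w. \<kappa> (w - z) * u w \<partial>half_measure)"
proof -
  have "zero_ext u \<in> borel_measurable borel" using L2_measurable[of "zero_ext u" lborel] u by (simp add: L2_half_iff)
  then have "average \<kappa> (zero_ext u) z = (\<integral>w. \<kappa> (w - z) * zero_ext u w \<partial>lborel)"
    by (intro average_eq_convolution test_function_measurable[OF assms(1)])
  also have "\<dots> = (\<integral>w. \<kappa> (w - z) * u w \<partial>half_measure)"
    by (simp add: integral_restrict_space mult.left_commute)
  finally show ?thesis .
qed

lemma partial_average_zero_ext:
  assumes k: "\<kappa> \<in> test_functions UNIV" and e: "\<epsilon> > 0" and z: "z \<in> half_space" and b: "b \<in> Basis"
    and supp: "\<And>w. \<kappa> w \<noteq> 0 \<Longrightarrow> w \<in> cbox (\<epsilon> *\<^sub>R One) ((2 * \<epsilon>) *\<^sub>R One)"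
    and u: "u \<in> L2 half_measure" and g: "has_weak_gradient u g"
  shows "partial b (average \<kappa> (zero_ext u)) z = average \<kappa> (zero_ext (\<lambda>z. g z \<bullet> b)) z"
proof -
  have uL: "zero_ext u \<in> L2 lborel" using u by (simp only: L2_half_iff)
  have gL: "(\<lambda>z. g z \<bullet> b) \<in> L2 half_measure" using has_weak_gradientD(1)[OF g] by (rule L2_inner_const)
  have shift: "partial b (\<lambda>w. \<kappa> (w - z)) w = partial b \<kappa> (w - z)" for w
    using frechet_derivative_eqI[OF has_derivative_compose_affine[of \<kappa> "- z" 1 w]]
      Ck_differentiable[OF test_function_Ck[OF k]] by simp
  have "partial b (average \<kappa> (zero_ext u)) z = average (\<lambda>w. - partial b \<kappa> w) (zero_ext u) z"
    by (rule fun_cong[OF average_partial[OF k uL b]])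
  also have "\<dots> = (\<integral>w. - partial b \<kappa> (w - z) * u w \<partial>half_measure)"
    by (rule average_zero_ext[OF test_function_uminus[OF test_function_partial[OF k b]] u])
  also have "\<dots> = - (\<integral>w. u w * partial b (\<lambda>w. \<kappa> (w - z)) w \<partial>half_measure)"
    by (simp add: shift mult.commute)
  also have "\<dots> = (\<integral>w. (g w \<bullet> b) * \<kappa> (w - z) \<partial>half_measure)"
    using has_weak_gradientD(2)[OF g test_function_kernel_shift[OF k e z supp] b] by simp
  also have "\<dots> = average \<kappa> (zero_ext (\<lambda>z. g z \<bullet> b)) z"
    unfolding average_zero_ext[OF k gL] by (simp add: mult.commute)
  finally show ?thesis .
qed

lemma cutoff_exists:
  "\<exists>\<eta>\<in>test_functions UNIV. (\<forall>z::'a::euclidean_space. 0 \<le> \<eta> z) \<and> \<eta> 0 = 1"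
proof -
  have t: "(bump :: 'a \<Rightarrow> real) \<in> test_functions UNIV"
  proof (rule test_functionsI[where K="cbox 0 One"])
    show "bump z = 0" if "z \<notin> cbox 0 One" for z :: 'a
      using that bump_nonzero_iff[of z] box_subset_cbox[of "0::'a" One] by blast
  qed (auto intro: Ck_bump)
  define c :: 'a where "c = (1/2) *\<^sub>R One"
  have "c \<in> box 0 One" by (auto simp: c_def box_def inner_simps inner_sum_left_Basis)
  then have "bump c > 0" using bump_nonneg[of c] bump_nonzero_iff[of c] by simp
  then show ?thesis
    using test_function_cmult[OF test_function_affine[OF t, of 1 c], of "1 / bump c"] bump_nonneg
    by (intro bexI[of _ "\<lambda>z. (1 / bump c) * bump (c + 1 *\<^sub>R z)"]) (auto intro!: divide_nonneg_pos)
qed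

lemma cutoff_tendsto:
  fixes f :: "'a::euclidean_space \<Rightarrow> real"
  assumes \<eta>: "\<eta> \<in> test_functions UNIV" "\<eta> 0 = 1" and f: "f \<in> L2 lborel"
  shows "(\<lambda>z. \<eta> (inverse (real (Suc n)) *\<^sub>R z) * f z) \<in> L2 lborel"
    "(\<lambda>n. norm2 lborel (\<lambda>z. \<eta> (inverse (real (Suc n)) *\<^sub>R z) * f z - f z)) \<longlonglongrightarrow> 0"
proof -
  let ?s = "\<lambda>n z. inverse (real (Suc n)) *\<^sub>R (z :: 'a)"
  have [measurable]: "f \<in> borel_measurable borel" "\<eta> \<in> borel_measurable borel"
    using L2_measurable[OF f] test_function_measurable[OF \<eta>(1)] by simp_all
  obtain B where B: "B > 0" "\<And>z. \<bar>\<eta> z\<bar> \<le> B" using \<eta>(1) by (rule test_function_bounded) blast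
  show "(\<lambda>z. \<eta> (?s n z) * f z) \<in> L2 lborel" for n
  proof (rule L2_dominated[OF L2_cmult[OF f, of B]])
    have "norm (\<eta> (?s n z) * f z) \<le> norm (B * f z)" for z
      unfolding norm_mult using B order_trans[OF B(2) abs_ge_self] by (intro mult_right_mono) auto
    then show "AE z in lborel. norm (\<eta> (?s n z) * f z) \<le> norm (B * f z)" by (rule AE_I2)
  qed measurable
  have "(\<lambda>n. \<integral>z. (\<eta> (?s n z) * f z - f z)\<^sup>2 \<partial>lborel) \<longlonglongrightarrow> (\<integral>z. 0 \<partial>(lborel :: 'a measure))"
  proof (rule integral_dominated_convergence[where w="\<lambda>z. (B + 1)\<^sup>2 * (f z)\<^sup>2"])
    show "integrable lborel (\<lambda>z. (B + 1)\<^sup>2 * (f z)\<^sup>2)" using L2_integrable_square[OF f] by simp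
    show "AE z in lborel. (\<lambda>n. (\<eta> (?s n z) * f z - f z)\<^sup>2) \<longlonglongrightarrow> 0"
    proof (rule AE_I2)
      fix z :: 'a
      have "isCont \<eta> 0" using test_function_continuous[OF \<eta>(1)] by (simp add: continuous_on_eq_continuous_at)
      moreover have "(\<lambda>n. ?s n z) \<longlonglongrightarrow> 0"
        using tendsto_scaleR[OF LIMSEQ_inverse_real_of_nat tendsto_const, of z] by simp
      ultimately have "(\<lambda>n. \<eta> (?s n z)) \<longlonglongrightarrow> \<eta> 0" by (rule isCont_tendsto_compose)
      then have "(\<lambda>n. (\<eta> (?s n z) * f z - f z)\<^sup>2) \<longlonglongrightarrow> (\<eta> 0 * f z - f z)\<^sup>2"
        by (intro tendsto_intros)
      then show "(\<lambda>n. (\<eta> (?s n z) * f z - f z)\<^sup>2) \<longlonglongrightarrow> 0" using \<eta>(2) by simp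
    qed
    show "AE z in lborel. norm ((\<eta> (?s n z) * f z - f z)\<^sup>2) \<le> (B + 1)\<^sup>2 * (f z)\<^sup>2" for n
    proof (rule AE_I2)
      fix z :: 'a
      have "\<bar>\<eta> (?s n z) - 1\<bar> \<le> B + 1" using B(2)[of "?s n z"] by linarith
      then have "\<bar>\<eta> (?s n z) - 1\<bar>\<^sup>2 * (f z)\<^sup>2 \<le> (B + 1)\<^sup>2 * (f z)\<^sup>2"
        by (intro mult_right_mono power_mono) auto
      moreover have "(\<eta> (?s n z) * f z - f z)\<^sup>2
          = \<bar>\<eta> (?s n z) - 1\<bar>\<^sup>2 * (f z)\<^sup>2"
        unfolding power2_abs power_mult_distrib[symmetric] by (simp add: algebra_simps)
      ultimately show "norm ((\<eta> (?s n z) * f z - f z)\<^sup>2) \<le> (B + 1)\<^sup>2 * (f z)\<^sup>2"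
        by simp
    qed
  qed measurable
  from tendsto_real_sqrt[OF this]
  show "(\<lambda>n. norm2 lborel (\<lambda>z. \<eta> (?s n z) * f z - f z)) \<longlonglongrightarrow> 0"
    by (simp add: norm2_def)
qed

text \<open>Averages over points further inside the half-space are smooth up to the boundary, and inside the
  half-space their gradients are the averages of the weak gradient. A cutoff makes the support compact.\<close>

lemma test_functions_dense:
  fixes u :: "real \<times> (real ^ 'n) \<Rightarrow> real"
  assumes u: "u \<in> L2 half_measure" and g: "has_weak_gradient u g" and e: "e > 0"
  shows "\<exists>\<phi>\<in>test_functions UNIV. norm2 half_measure (\<lambda>z. \<phi> z - u z) < e \<and>
     (\<forall>b\<in>Basis. norm2 half_measure (\<lambda>z. partial b \<phi> z - g z \<bullet> b) < e)"
proof -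
  have gL: "(\<lambda>z. g z \<bullet> b) \<in> L2 half_measure" for b using has_weak_gradientD(1)[OF g] by (rule L2_inner_const)
  have uL: "zero_ext u \<in> L2 lborel" using u by (simp only: L2_half_iff)
  define F where "F = insert (zero_ext u) ((\<lambda>b. zero_ext (\<lambda>z. g z \<bullet> b)) ` Basis)"
  have F: "finite F" "F \<subseteq> L2 lborel" using uL gL unfolding F_def L2_half_iff by auto
  obtain \<epsilon> \<kappa> where \<epsilon>: "\<epsilon> > 0" and k: "\<kappa> \<in> test_functions UNIV"
    and supp: "\<And>w. \<kappa> w \<noteq> 0 \<Longrightarrow> w \<in> cbox (\<epsilon> *\<^sub>R One) ((2 * \<epsilon>) *\<^sub>R One)"
    and app: "\<And>u. u \<in> F \<Longrightarrow> average \<kappa> u \<in> L2 lborel \<and> norm2 lborel (\<lambda>z. average \<kappa> u z - u z) \<le> e/2"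
    using mollification_exists[OF F, of "e/2"] e by auto
  define v where "v = average \<kappa> (zero_ext u)"
  define vb where "vb b = average \<kappa> (zero_ext (\<lambda>z. g z \<bullet> b))" for b
  have v: "v \<in> L2 lborel" "norm2 half_measure (\<lambda>z. v z - u z) \<le> e/2"
    using app[of "zero_ext u"] norm2_half_diff_le[of v u] u by (auto simp: F_def v_def)
  have vb: "vb b \<in> L2 lborel" "norm2 half_measure (\<lambda>z. vb b z - g z \<bullet> b) \<le> e/2" if "b \<in> Basis" for b
    using app[of "zero_ext (\<lambda>z. g z \<bullet> b)"] norm2_half_diff_le[of "vb b" "\<lambda>z. g z \<bullet> b"] gL[of b] that
    by (auto simp: F_def vb_def)
  have Ckv: "Ck k v" for k unfolding v_def by (rule average_Ck[OF k uL])
  have pv: "partial b v z = vb b z" if "b \<in> Basis" "z \<in> half_space" for b z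
    unfolding v_def vb_def by (rule partial_average_zero_ext[OF k \<epsilon> that(2,1) supp u g])
  obtain \<eta> :: "real \<times> (real ^ 'n) \<Rightarrow> real" where \<eta>: "\<eta> \<in> test_functions UNIV" "\<eta> 0 = 1" using cutoff_exists by blast
  define c where "c n = inverse (real (Suc n))" for n
  define \<phi> where "\<phi> n z = \<eta> (c n *\<^sub>R z) * v z" for n z
  have ct: "(\<lambda>z. \<eta> (c n *\<^sub>R z)) \<in> test_functions UNIV" for n
    using test_function_affine[OF \<eta>(1), of "c n" 0] by (simp add: c_def)
  have t: "\<phi> n \<in> test_functions UNIV" for n
    using test_function_mult[OF ct Ckv] by (simp add: \<phi>_def[abs_def] mult.commute)
  have 1: "(\<lambda>n. norm2 lborel (\<lambda>z. \<phi> n z - v z)) \<longlonglongrightarrow> 0"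
    using cutoff_tendsto(2)[OF \<eta> v(1)] by (simp add: \<phi>_def c_def)
  have ev1: "\<forall>\<^sub>F n in sequentially. norm2 half_measure (\<lambda>z. \<phi> n z - u z) < e"
  proof -
    have "\<forall>\<^sub>F n in sequentially. norm2 lborel (\<lambda>z. \<phi> n z - v z) < e/2"
      using order_tendstoD(2)[OF 1, of "e/2"] e by simp
    then show ?thesis
    proof eventually_elim
      case (elim n)
      have "norm2 half_measure (\<lambda>z. \<phi> n z - u z)
        \<le> norm2 half_measure (\<lambda>z. \<phi> n z - v z) + norm2 half_measure (\<lambda>z. v z - u z)"
        by (intro norm2_triangle_diff L2_lborel_imp_half test_function_L2[OF t] v(1) u)
      also have "norm2 half_measure (\<lambda>z. \<phi> n z - v z) \<le> norm2 lborel (\<lambda>z. \<phi> n z - v z)"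
        by (intro L2_lborel_imp_half L2_diff test_function_L2[OF t] v(1))
      finally show ?case using v(2) elim by linarith
    qed
  qed
  have ev2: "\<forall>\<^sub>F n in sequentially. norm2 half_measure (\<lambda>z. partial b (\<phi> n) z - g z \<bullet> b) < e" if b: "b \<in> Basis" for b
  proof -
    have tb: "partial b \<eta> \<in> test_functions UNIV" by (rule test_function_partial[OF \<eta>(1) b])
    obtain B where B: "B > 0" "\<And>z. \<bar>partial b \<eta> z\<bar> \<le> B" using tb by (rule test_function_bounded) blast
    have p\<phi>: "partial b (\<phi> n) z = \<eta> (c n *\<^sub>R z) * vb b z + (c n * partial b \<eta> (c n *\<^sub>R z)) * v z"
      if "z \<in> half_space" for n z
    proof -
      have D1: "((\<lambda>z. \<eta> (c n *\<^sub>R z)) has_derivative (\<lambda>h. c n * partial h \<eta> (c n *\<^sub>R z))) (at z)"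
        using has_derivative_compose_affine[of \<eta> 0 "c n" z] Ck_differentiable[OF test_function_Ck[OF \<eta>(1)]] by simp
      have "(\<phi> n has_derivative (\<lambda>h. \<eta> (c n *\<^sub>R z) * partial h v z + (c n * partial h \<eta> (c n *\<^sub>R z)) * v z)) (at z)"
        unfolding \<phi>_def[abs_def] by (rule has_derivative_mult[OF D1 Ck_has_derivative[OF Ckv]])
      then show ?thesis using pv[OF b that] by (simp add: frechet_derivative_eqI)
    qed
    have L: "(\<lambda>z. \<eta> (c n *\<^sub>R z) * vb b z) \<in> L2 lborel" for n
      using cutoff_tendsto(1)[OF \<eta> vb(1)[OF b]] by (simp add: c_def)
    have pm: "(\<lambda>z. (c n * partial b \<eta> (c n *\<^sub>R z)) * v z) \<in> borel_measurable lborel" for n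
    proof -
      have [measurable]: "partial b \<eta> \<in> borel_measurable borel" "v \<in> borel_measurable borel"
        using test_function_measurable[OF tb] L2_measurable[OF v(1)] by simp_all
      show ?thesis by measurable
    qed
    have ple: "AE z in lborel. norm ((c n * partial b \<eta> (c n *\<^sub>R z)) * v z) \<le> norm ((c n * B) * v z)" for n
    proof (rule AE_I2)
      fix z :: "real \<times> (real ^ 'n)"
      have "\<bar>c n\<bar> * \<bar>partial b \<eta> (c n *\<^sub>R z)\<bar> * \<bar>v z\<bar> \<le> \<bar>c n\<bar> * \<bar>B\<bar> * \<bar>v z\<bar>"
        using B(1) B(2)[of "c n *\<^sub>R z"] by (intro mult_right_mono mult_left_mono) auto
      then show "norm ((c n * partial b \<eta> (c n *\<^sub>R z)) * v z) \<le> norm ((c n * B) * v z)" by (simp add: abs_mult)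
    qed
    note pL = L2_dominated[OF L2_cmult[OF v(1)] pm ple] and pn = norm2_mono[OF L2_cmult[OF v(1)] pm ple]
    have "(\<lambda>n. norm2 lborel (\<lambda>z. \<eta> (c n *\<^sub>R z) * vb b z - vb b z) + c n * B * norm2 lborel v) \<longlonglongrightarrow> 0 + 0 * B * norm2 lborel v"
      unfolding c_def by (intro tendsto_intros cutoff_tendsto(2)[OF \<eta> vb(1)[OF b]] LIMSEQ_inverse_real_of_nat)
    then have "\<forall>\<^sub>F n in sequentially. norm2 lborel (\<lambda>z. \<eta> (c n *\<^sub>R z) * vb b z - vb b z) + c n * B * norm2 lborel v < e/2"
      using e by (intro order_tendstoD) auto
    then show ?thesis
    proof eventually_elim
      case (elim n)
      let ?p = "\<lambda>z. (c n * partial b \<eta> (c n *\<^sub>R z)) * v z"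
      have "norm2 half_measure (\<lambda>z. partial b (\<phi> n) z - g z \<bullet> b)
        = norm2 half_measure (\<lambda>z. ((\<eta> (c n *\<^sub>R z) * vb b z - vb b z) + ?p z) + (vb b z - g z \<bullet> b))"
        unfolding norm2_half by (rule arg_cong[where f="norm2 lborel"]) (auto simp: indicator_def p\<phi>)
      also have "\<dots> \<le> norm2 half_measure (\<lambda>z. (\<eta> (c n *\<^sub>R z) * vb b z - vb b z) + ?p z)
          + norm2 half_measure (\<lambda>z. vb b z - g z \<bullet> b)"
        by (intro norm2_triangle L2_diff gL L2_lborel_imp_half L2_add L pL vb(1)[OF b])
      also have "norm2 half_measure (\<lambda>z. (\<eta> (c n *\<^sub>R z) * vb b z - vb b z) + ?p z)
          \<le> norm2 half_measure (\<lambda>z. \<eta> (c n *\<^sub>R z) * vb b z - vb b z) + norm2 half_measure ?p"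
        by (intro norm2_triangle L2_lborel_imp_half L2_diff L pL vb(1)[OF b])
      also have "norm2 half_measure (\<lambda>z. \<eta> (c n *\<^sub>R z) * vb b z - vb b z)
          \<le> norm2 lborel (\<lambda>z. \<eta> (c n *\<^sub>R z) * vb b z - vb b z)"
        by (intro L2_lborel_imp_half L2_diff L vb(1)[OF b])
      also have "norm2 half_measure ?p \<le> norm2 lborel ?p" by (intro L2_lborel_imp_half pL)
      also have "norm2 lborel ?p \<le> c n * B * norm2 lborel v"
        using pn[of n] B(1) by (simp add: norm2_cmult c_def abs_mult)
      finally show ?case using elim vb(2)[OF b] by linarith
    qed
  qed
  have "\<forall>\<^sub>F n in sequentially. norm2 half_measure (\<lambda>z. \<phi> n z - u z) < e \<and>
     (\<forall>b\<in>Basis. norm2 half_measure (\<lambda>z. partial b (\<phi> n) z - g z \<bullet> b) < e)"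
    by (intro eventually_conj ev1 eventually_ball_finite ballI ev2) auto
  then obtain n where "norm2 half_measure (\<lambda>z. \<phi> n z - u z) < e \<and>
     (\<forall>b\<in>Basis. norm2 half_measure (\<lambda>z. partial b (\<phi> n) z - g z \<bullet> b) < e)"
    by (auto simp: eventually_sequentially)
  then show ?thesis using t by blast
qed

section \<open>Weak gradients\<close>

definition gradient :: "('a::euclidean_space \<Rightarrow> real) \<Rightarrow> 'a \<Rightarrow> 'a" where
  "gradient \<phi> z = (\<Sum>b\<in>Basis. partial b \<phi> z *\<^sub>R b)"

lemma gradient_inner: "b \<in> Basis \<Longrightarrow> gradient \<phi> z \<bullet> b = partial b \<phi> z"
  by (simp add: gradient_def)

lemma gradient_L2: "\<phi> \<in> test_functions \<Omega> \<Longrightarrow> gradient \<phi> \<in> L2 lborel"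
  by (rule L2_of_components) (simp add: gradient_inner test_function_L2[OF test_function_partial])

lemma test_function_vanishes: "\<phi> \<in> test_functions \<Omega> \<Longrightarrow> z \<notin> \<Omega> \<Longrightarrow> \<phi> z = 0"
  unfolding test_functions_def by blast

lemma has_weak_gradient_test_function:
  fixes \<phi> :: "real \<times> (real ^ 'n) \<Rightarrow> real"
  assumes t: "\<phi> \<in> test_functions UNIV"
  shows "has_weak_gradient \<phi> (gradient \<phi>)"
  unfolding has_weak_gradient_def
proof (intro conjI ballI)
  show "gradient \<phi> \<in> L2 half_measure" by (rule L2_lborel_imp_half[OF gradient_L2[OF t]])
  fix \<psi> :: "real \<times> (real ^ 'n) \<Rightarrow> real" and b :: "real \<times> (real ^ 'n)"
  assume \<psi>: "\<psi> \<in> test_functions half_space" and b: "b \<in> Basis"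
  note pt = test_function_partial[OF t b] and p\<psi> = test_function_partial[OF \<psi> b]
  have "partial b (\<lambda>z. \<phi> z * \<psi> z) z = \<phi> z * partial b \<psi> z + partial b \<phi> z * \<psi> z" for z
    by (simp add: frechet_derivative_eqI[OF has_derivative_mult[OF test_function_has_derivative[OF t]
          test_function_has_derivative[OF \<psi>]]])
  then have "0 = (\<integral>z. \<phi> z * partial b \<psi> z + partial b \<phi> z * \<psi> z \<partial>lborel)"
    using integral_partial_eq_0[OF test_function_mult[OF \<psi> test_function_Ck[OF t]] b] by simp
  also have "\<dots> = (\<integral>z. \<phi> z * partial b \<psi> z \<partial>lborel) + (\<integral>z. partial b \<phi> z * \<psi> z \<partial>lborel)"
    by (intro Bochner_Integration.integral_add integrable_mult_L2 test_function_L2[OF t] test_function_L2[OF \<psi>]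
        test_function_L2[OF pt] test_function_L2[OF p\<psi>])
  finally show "(\<integral>z. \<phi> z * partial b \<psi> z \<partial>half_measure) = - (\<integral>z. (gradient \<phi> z \<bullet> b) * \<psi> z \<partial>half_measure)"
    by (subst (1 2) integral_half_eq) (use b test_function_vanishes[OF \<psi>] test_function_vanishes[OF p\<psi>] in
        \<open>auto simp: gradient_inner\<close>)
qed

lemma test_function_H1: "\<phi> \<in> test_functions UNIV \<Longrightarrow> \<phi> \<in> H1"
  unfolding H1_def using has_weak_gradient_test_function L2_lborel_imp_half(1)[OF test_function_L2] by blast

text \<open>The averages of \<open>d\<close> against one-sided kernels are integrals of \<open>d\<close> against test functions of the
  half-space, so they vanish, and they approximate \<open>d\<close>.\<close>

lemma orthogonal_test_functions_imp_AE_0: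
  assumes d: "d \<in> L2 half_measure" and orth: "\<And>\<phi>. \<phi> \<in> test_functions half_space \<Longrightarrow> (\<integral>z. d z * \<phi> z \<partial>half_measure) = 0"
  shows "AE z in half_measure. d z = 0"
proof (rule norm2_eq_0_imp_AE[OF d])
  have dL: "zero_ext d \<in> L2 lborel" using d by (simp only: L2_half_iff)
  have "norm2 half_measure d \<le> e" if e: "e > 0" for e
  proof -
    obtain \<epsilon> \<kappa> where \<epsilon>: "\<epsilon> > 0" and k: "\<kappa> \<in> test_functions UNIV"
      and supp: "\<And>w. \<kappa> w \<noteq> 0 \<Longrightarrow> w \<in> cbox (\<epsilon> *\<^sub>R One) ((2 * \<epsilon>) *\<^sub>R One)"
      and app: "average \<kappa> (zero_ext d) \<in> L2 lborel" "norm2 lborel (\<lambda>z. average \<kappa> (zero_ext d) z - zero_ext d z) \<le> e"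
      using mollification_exists[of "{zero_ext d}" e] e dL by auto
    have z: "average \<kappa> (zero_ext d) z = 0" if "z \<in> half_space" for z
      using orth[OF test_function_kernel_shift[OF k \<epsilon> that supp]] unfolding average_zero_ext[OF k d]
      by (simp add: mult.commute)
    have "norm2 half_measure d = norm2 half_measure (\<lambda>z. average \<kappa> (zero_ext d) z - d z)"
      unfolding norm2_half norm2_def by (rule arg_cong[where f=sqrt], rule Bochner_Integration.integral_cong)
        (auto simp: z[simplified])
    also have "\<dots> \<le> e" using norm2_half_diff_le[OF app(1) d] app(2) by linarith
    finally show ?thesis .
  qed
  then have "norm2 half_measure d \<le> 0" by (rule field_le_epsilon) simp
  then show "norm2 half_measure d = 0" by (simp add: order_antisym)
qed

lemma weak_gradient_AE_cong:
  fixes u v :: "real \<times> (real ^ 'n) \<Rightarrow> real"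
  assumes u: "u \<in> L2 half_measure" and v: "v \<in> L2 half_measure" and uv: "AE z in half_measure. u z = v z"
    and g: "has_weak_gradient u g" and h: "has_weak_gradient v h"
  shows "AE z in half_measure. g z = h z"
proof -
  note gL = has_weak_gradientD(1)[OF g] and hL = has_weak_gradientD(1)[OF h]
  have "AE z in half_measure. (g z - h z) \<bullet> b = 0" if b: "b \<in> Basis" for b
  proof (rule orthogonal_test_functions_imp_AE_0)
    show "(\<lambda>z. (g z - h z) \<bullet> b) \<in> L2 half_measure" by (intro L2_inner_const L2_diff gL hL)
    fix \<phi> :: "real \<times> (real ^ 'n) \<Rightarrow> real" assume t: "\<phi> \<in> test_functions half_space"
    note L = L2_lborel_imp_half(1)[OF test_function_L2]
    have "(\<integral>z. (g z - h z) \<bullet> b * \<phi> z \<partial>half_measure)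
      = (\<integral>z. (g z \<bullet> b) * \<phi> z - (h z \<bullet> b) * \<phi> z \<partial>half_measure)"
      by (simp add: inner_diff_left left_diff_distrib)
    also have "\<dots> = (\<integral>z. (g z \<bullet> b) * \<phi> z \<partial>half_measure) - (\<integral>z. (h z \<bullet> b) * \<phi> z \<partial>half_measure)"
      by (intro Bochner_Integration.integral_diff integrable_mult_L2 L2_inner_const gL hL L[OF t])
    also have "\<dots> = (\<integral>z. v z * partial b \<phi> z \<partial>half_measure) - (\<integral>z. u z * partial b \<phi> z \<partial>half_measure)"
      using has_weak_gradientD(2)[OF g t b] has_weak_gradientD(2)[OF h t b] by simp
    also have "(\<integral>z. v z * partial b \<phi> z \<partial>half_measure) = (\<integral>z. u z * partial b \<phi> z \<partial>half_measure)"
      using uv L[OF test_function_partial[OF t b]] u v by (intro integral_cong_AE) (auto dest!: L2_measurable)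
    finally show "(\<integral>z. (g z - h z) \<bullet> b * \<phi> z \<partial>half_measure) = 0" by simp
  qed
  then have "AE z in half_measure. \<forall>b\<in>Basis. (g z - h z) \<bullet> b = 0" by (intro AE_finite_allI) auto
  then show ?thesis
    by eventually_elim (simp add: euclidean_eq_iff[of "g _" "h _"] inner_diff_left)
qed

lemma has_weak_gradient_lincomb:
  fixes u v :: "real \<times> (real ^ 'n) \<Rightarrow> real"
  assumes u: "u \<in> L2 half_measure" and v: "v \<in> L2 half_measure"
    and g: "has_weak_gradient u g" and h: "has_weak_gradient v h"
  shows "has_weak_gradient (\<lambda>z. u z + c * v z) (\<lambda>z. g z + c *\<^sub>R h z)"
  unfolding has_weak_gradient_def
proof (intro conjI ballI)
  note gL = has_weak_gradientD(1)[OF g] and hL = has_weak_gradientD(1)[OF h]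
  show "(\<lambda>z. g z + c *\<^sub>R h z) \<in> L2 half_measure" by (intro L2_add L2_scaleR gL hL)
  fix \<phi> :: "real \<times> (real ^ 'n) \<Rightarrow> real" and b :: "real \<times> (real ^ 'n)"
  assume t: "\<phi> \<in> test_functions half_space" and b: "b \<in> Basis"
  note L = L2_lborel_imp_half(1)[OF test_function_L2]
  have I: "integrable half_measure (\<lambda>z. u z * partial b \<phi> z)" "integrable half_measure (\<lambda>z. v z * partial b \<phi> z)"
    "integrable half_measure (\<lambda>z. (g z \<bullet> b) * \<phi> z)" "integrable half_measure (\<lambda>z. (h z \<bullet> b) * \<phi> z)"
    by (intro integrable_mult_L2 u v L[OF t] L[OF test_function_partial[OF t b]] L2_inner_const gL hL)+
  have "(\<integral>z. (u z + c * v z) * partial b \<phi> z \<partial>half_measure)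
     = (\<integral>z. u z * partial b \<phi> z + c * (v z * partial b \<phi> z) \<partial>half_measure)"
    by (simp add: algebra_simps)
  also have "\<dots> = (\<integral>z. u z * partial b \<phi> z \<partial>half_measure) + c * (\<integral>z. v z * partial b \<phi> z \<partial>half_measure)"
    using I by simp
  also have "\<dots> = - ((\<integral>z. (g z \<bullet> b) * \<phi> z \<partial>half_measure) + c * (\<integral>z. (h z \<bullet> b) * \<phi> z \<partial>half_measure))"
    using has_weak_gradientD(2)[OF g t b] has_weak_gradientD(2)[OF h t b] by simp
  also have "\<dots> = - (\<integral>z. (g z \<bullet> b) * \<phi> z + c * ((h z \<bullet> b) * \<phi> z) \<partial>half_measure)"
    using I by simp
  finally show "(\<integral>z. (u z + c * v z) * partial b \<phi> z \<partial>half_measure)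
     = - (\<integral>z. ((g z + c *\<^sub>R h z) \<bullet> b) * \<phi> z \<partial>half_measure)"
    by (simp add: algebra_simps inner_add_left)
qed

lemma has_weak_gradient_limit:
  fixes u :: "nat \<Rightarrow> real \<times> (real ^ 'n) \<Rightarrow> real"
  assumes u: "\<And>n. u n \<in> L2 half_measure" "v \<in> L2 half_measure"
    and g: "\<And>n. has_weak_gradient (u n) (g n)" and h: "h \<in> L2 half_measure"
    and lim: "(\<lambda>n. norm2 half_measure (\<lambda>z. u n z - v z)) \<longlonglongrightarrow> 0" "(\<lambda>n. norm2 half_measure (\<lambda>z. g n z - h z)) \<longlonglongrightarrow> 0"
  shows "has_weak_gradient v h"
  unfolding has_weak_gradient_def
proof (intro conjI ballI h)
  fix \<phi> :: "real \<times> (real ^ 'n) \<Rightarrow> real" and b :: "real \<times> (real ^ 'n)"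
  assume t: "\<phi> \<in> test_functions half_space" and b: "b \<in> Basis"
  note L = L2_lborel_imp_half(1)[OF test_function_L2]
  note gL = has_weak_gradientD(1)[OF g]
  have "(\<lambda>n. \<integral>z. u n z \<bullet> partial b \<phi> z \<partial>half_measure) \<longlonglongrightarrow> (\<integral>z. v z \<bullet> partial b \<phi> z \<partial>half_measure)"
    by (rule integral_inner_tendsto[OF u L[OF test_function_partial[OF t b]] L[OF test_function_partial[OF t b]] lim(1)])
      (simp add: norm2_def)
  moreover have "(\<lambda>n. \<integral>z. g n z \<bullet> (\<phi> z *\<^sub>R b) \<partial>half_measure) \<longlonglongrightarrow> (\<integral>z. h z \<bullet> (\<phi> z *\<^sub>R b) \<partial>half_measure)"
  proof (rule integral_inner_tendsto[OF gL h _ _ lim(2)])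
    show "(\<lambda>z. \<phi> z *\<^sub>R b) \<in> L2 half_measure" "(\<lambda>z. \<phi> z *\<^sub>R b) \<in> L2 half_measure"
      using L[OF t] b by (auto simp: L2_def intro!: borel_measurable_scaleR)
  qed (simp add: norm2_def)
  moreover have "(\<integral>z. u n z \<bullet> partial b \<phi> z \<partial>half_measure) = - (\<integral>z. g n z \<bullet> (\<phi> z *\<^sub>R b) \<partial>half_measure)" for n
    using has_weak_gradientD(2)[OF g t b, of n] by (simp add: mult.commute)
  ultimately have "(\<integral>z. v z \<bullet> partial b \<phi> z \<partial>half_measure) = - (\<integral>z. h z \<bullet> (\<phi> z *\<^sub>R b) \<partial>half_measure)"
    using LIMSEQ_unique[OF _ tendsto_minus] by fastforce
  then show "(\<integral>z. v z * partial b \<phi> z \<partial>half_measure) = - (\<integral>z. (h z \<bullet> b) * \<phi> z \<partial>half_measure)"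
    by (simp add: mult.commute)
qed

section \<open>The Sobolev space as a Hilbert space\<close>

lemma H1_L2: "u \<in> H1 \<Longrightarrow> u \<in> L2 half_measure"
  by (simp add: H1_def)

lemma H1I: "u \<in> L2 half_measure \<Longrightarrow> has_weak_gradient u g \<Longrightarrow> u \<in> H1"
  unfolding H1_def by blast

lemma has_weak_gradient_weak_gradient: "u \<in> H1 \<Longrightarrow> has_weak_gradient u (weak_gradient u)"
  unfolding weak_gradient_def H1_def by (auto intro: someI[of "has_weak_gradient u"])

lemma weak_gradient_L2: "u \<in> H1 \<Longrightarrow> weak_gradient u \<in> L2 half_measure"
  by (rule has_weak_gradientD(1)[OF has_weak_gradient_weak_gradient])

lemma weak_gradient_eq_AE:
  assumes "u \<in> L2 half_measure" "has_weak_gradient u g"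
  shows "AE z in half_measure. weak_gradient u z = g z"
  using assms by (intro weak_gradient_AE_cong[of u u] has_weak_gradient_weak_gradient H1I) auto

lemma weak_gradient_cong_AE:
  assumes "u \<in> H1" "v \<in> H1" "AE z in half_measure. u z = v z"
  shows "AE z in half_measure. weak_gradient u z = weak_gradient v z"
  using assms by (intro weak_gradient_AE_cong[of u v] has_weak_gradient_weak_gradient H1_L2)

lemma H1_lincomb:
  assumes u: "u \<in> H1" and v: "v \<in> H1"
  shows "(\<lambda>z. u z + c * v z) \<in> H1"
    "AE z in half_measure. weak_gradient (\<lambda>z. u z + c * v z) z = weak_gradient u z + c *\<^sub>R weak_gradient v z"
proof -
  have L: "(\<lambda>z. u z + c * v z) \<in> L2 half_measure" using u v by (intro L2_add L2_cmult H1_L2)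
  have g: "has_weak_gradient (\<lambda>z. u z + c * v z) (\<lambda>z. weak_gradient u z + c *\<^sub>R weak_gradient v z)"
    using u v by (intro has_weak_gradient_lincomb H1_L2 has_weak_gradient_weak_gradient)
  show "(\<lambda>z. u z + c * v z) \<in> H1" by (rule H1I[OF L g])
  show "AE z in half_measure. weak_gradient (\<lambda>z. u z + c * v z) z = weak_gradient u z + c *\<^sub>R weak_gradient v z"
    by (rule weak_gradient_eq_AE[OF L g])
qed

lemma H1_zero: "(\<lambda>z. 0) \<in> H1"
proof -
  have "has_weak_gradient (\<lambda>z. 0) (\<lambda>z. 0)" by (simp add: has_weak_gradient_def L2_zero)
  then show ?thesis by (intro H1I L2_zero)
qed

text \<open>Functions that agree almost everywhere are identified, so that the general results on Hilbert
  spaces apply; \<open>fn\<close> picks a representative.\<close>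

definition H1_class :: "(real \<times> (real ^ 'n) \<Rightarrow> real) \<Rightarrow> (real \<times> (real ^ 'n) \<Rightarrow> real) set" where
  "H1_class u = {v \<in> H1. AE z in half_measure. v z = u z}"

typedef (overloaded) ('n::finite) sobolev = "H1_class ` (H1 :: (real \<times> (real ^ 'n) \<Rightarrow> real) set)"
  using H1_zero by blast

definition cls :: "(real \<times> (real ^ 'n) \<Rightarrow> real) \<Rightarrow> 'n sobolev" where
  "cls u = Abs_sobolev (H1_class u)"

definition fn :: "'n::finite sobolev \<Rightarrow> real \<times> (real ^ 'n) \<Rightarrow> real" where
  "fn x = (SOME u. u \<in> Rep_sobolev x)"

abbreviation grad :: "'n::finite sobolev \<Rightarrow> real \<times> (real ^ 'n) \<Rightarrow> real \<times> (real ^ 'n)" where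
  "grad x \<equiv> weak_gradient (fn x)"

lemma fn_in_Rep: "fn x \<in> Rep_sobolev x"
proof -
  obtain u where "u \<in> H1" "Rep_sobolev x = H1_class u" using Rep_sobolev[of x] by blast
  then have "u \<in> Rep_sobolev x" by (simp add: H1_class_def)
  then show ?thesis unfolding fn_def using someI[of "\<lambda>u. u \<in> Rep_sobolev x" u] by simp
qed

lemma fn_H1 [simp]: "fn x \<in> H1"
  using fn_in_Rep[of x] Rep_sobolev[of x] by (auto simp: H1_class_def)

lemma fn_L2 [simp]: "fn x \<in> L2 half_measure"
  by (rule H1_L2[OF fn_H1])

lemma grad_L2 [simp]: "grad x \<in> L2 half_measure"
  by (rule weak_gradient_L2[OF fn_H1])

lemma fn_cls: "u \<in> H1 \<Longrightarrow> AE z in half_measure. fn (cls u) z = u z"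
  using fn_in_Rep[of "cls u"] by (simp add: cls_def Abs_sobolev_inverse H1_class_def)

lemma grad_cls: "u \<in> H1 \<Longrightarrow> AE z in half_measure. grad (cls u) z = weak_gradient u z"
  by (rule weak_gradient_cong_AE[OF fn_H1 _ fn_cls])

lemma H1_class_eqI:
  assumes "AE z in half_measure. u z = v z" shows "H1_class u = H1_class v"
proof -
  have "(AE z in half_measure. w z = u z) \<longleftrightarrow> (AE z in half_measure. w z = v z)" for w :: "real \<times> (real ^ 'a) \<Rightarrow> real"
  proof
    assume "AE z in half_measure. w z = u z"
    with assms show "AE z in half_measure. w z = v z" by eventually_elim simp
  next
    assume "AE z in half_measure. w z = v z"
    with assms show "AE z in half_measure. w z = u z" by eventually_elim simp
  qed
  then show ?thesis by (auto simp: H1_class_def)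
qed

lemma sobolev_eqI:
  assumes "AE z in half_measure. fn x z = fn y z" shows "x = y"
proof -
  have rep: "Rep_sobolev x = H1_class (fn x)" for x :: "'a sobolev"
  proof -
    obtain u where u: "u \<in> H1" "Rep_sobolev x = H1_class u" using Rep_sobolev[of x] by blast
    have "AE z in half_measure. fn x z = u z" using fn_in_Rep[of x] u by (simp add: H1_class_def)
    then show ?thesis using H1_class_eqI u(2) by metis
  qed
  have "Rep_sobolev x = Rep_sobolev y" unfolding rep[of x] rep[of y] by (rule H1_class_eqI[OF assms])
  then show ?thesis by (simp add: Rep_sobolev_inject)
qed

lemma cls_fn: "cls (fn x) = x"
  by (rule sobolev_eqI, rule fn_cls, rule fn_H1)

lemma cls_eqI: "u \<in> H1 \<Longrightarrow> v \<in> H1 \<Longrightarrow> AE z in half_measure. u z = v z \<Longrightarrow> cls u = cls v"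
  by (simp add: cls_def H1_class_eqI)

instantiation sobolev :: (finite) real_vector
begin

definition "0 = cls (\<lambda>z. 0)"
definition "x + y = cls (\<lambda>z. fn x z + 1 * fn y z)"
definition "x - y = cls (\<lambda>z. fn x z + (-1) * fn y z)"
definition "- x = cls (\<lambda>z. 0 + (-1) * fn x z)"
definition "c *\<^sub>R x = cls (\<lambda>z. 0 + c * fn x z)"

lemma fn_lincomb:
  "AE z in half_measure. fn (0::'a sobolev) z = 0"
  "AE z in half_measure. fn (x + y) z = fn x z + fn y z"
  "AE z in half_measure. fn (x - y) z = fn x z - fn y z"
  "AE z in half_measure. fn (- x) z = - fn x z"
  "AE z in half_measure. fn (c *\<^sub>R x) z = c * fn x z"
  for x y :: "'a sobolev"
proof -
  show "AE z in half_measure. fn (0::'a sobolev) z = 0" unfolding zero_sobolev_def by (rule fn_cls[OF H1_zero])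
  show "AE z in half_measure. fn (x + y) z = fn x z + fn y z"
    using fn_cls[OF H1_lincomb(1)[OF fn_H1[of x] fn_H1[of y], of 1]] unfolding plus_sobolev_def by simp
  show "AE z in half_measure. fn (x - y) z = fn x z - fn y z"
    using fn_cls[OF H1_lincomb(1)[OF fn_H1[of x] fn_H1[of y], of "-1"]] unfolding minus_sobolev_def by simp
  show "AE z in half_measure. fn (- x) z = - fn x z"
    using fn_cls[OF H1_lincomb(1)[OF H1_zero fn_H1[of x], of "-1"]] unfolding uminus_sobolev_def by simp
  show "AE z in half_measure. fn (c *\<^sub>R x) z = c * fn x z"
    using fn_cls[OF H1_lincomb(1)[OF H1_zero fn_H1[of x], of c]] unfolding scaleR_sobolev_def by simp
qed

instance
proof
  fix x y w :: "'a sobolev" and c d :: real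
  note L = fn_lincomb
  show "x + y + w = x + (y + w)"
    by (rule sobolev_eqI) (use L(2)[of "x + y" w] L(2)[of x y] L(2)[of x "y + w"] L(2)[of y w] in eventually_elim, simp)
  show "x + y = y + x"
    by (rule sobolev_eqI) (use L(2)[of x y] L(2)[of y x] in eventually_elim, simp)
  show "0 + x = x"
    by (rule sobolev_eqI) (use L(2)[of 0 x] L(1) in eventually_elim, simp)
  show "- x + x = 0"
    by (rule sobolev_eqI) (use L(2)[of "- x" x] L(4)[of x] L(1) in eventually_elim, simp)
  show "x - y = x + - y"
    by (rule sobolev_eqI) (use L(2)[of x "- y"] L(4)[of y] L(3)[of x y] in eventually_elim, simp)
  show "c *\<^sub>R (x + y) = c *\<^sub>R x + c *\<^sub>R y"
    by (rule sobolev_eqI) (use L(2)[of x y] L(5)[of c "x + y"] L(5)[of c x] L(5)[of c y] L(2)[of "c *\<^sub>R x" "c *\<^sub>R y"]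
        in eventually_elim, simp add: algebra_simps)
  show "(c + d) *\<^sub>R x = c *\<^sub>R x + d *\<^sub>R x"
    by (rule sobolev_eqI) (use L(5)[of "c + d" x] L(5)[of c x] L(5)[of d x] L(2)[of "c *\<^sub>R x" "d *\<^sub>R x"]
        in eventually_elim, simp add: algebra_simps)
  show "c *\<^sub>R d *\<^sub>R x = (c * d) *\<^sub>R x"
    by (rule sobolev_eqI) (use L(5)[of c "d *\<^sub>R x"] L(5)[of d x] L(5)[of "c * d" x] in eventually_elim, simp)
  show "1 *\<^sub>R x = x"
    by (rule sobolev_eqI) (use L(5)[of 1 x] in eventually_elim, simp)
qed

end

lemma grad_lincomb:
  fixes x y :: "'n::finite sobolev"
  shows "AE z in half_measure. grad (x + y) z = grad x z + grad y z"
    "AE z in half_measure. grad (x - y) z = grad x z - grad y z"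
    "AE z in half_measure. grad (c *\<^sub>R x) z = c *\<^sub>R grad x z"
    "AE z in half_measure. grad (0 :: 'n sobolev) z = 0"
proof -
  have *: "AE z in half_measure. grad w z = grad x z + c *\<^sub>R grad y z"
    if "AE z in half_measure. fn w z = fn x z + c * fn y z" for w x y :: "'n sobolev" and c
  proof -
    have "AE z in half_measure. grad w z = weak_gradient (\<lambda>z. fn x z + c * fn y z) z"
      by (rule weak_gradient_cong_AE[OF fn_H1 H1_lincomb(1)[OF fn_H1 fn_H1] that])
    with H1_lincomb(2)[OF fn_H1[of x] fn_H1[of y], of c] show ?thesis by eventually_elim simp
  qed
  show "AE z in half_measure. grad (x + y) z = grad x z + grad y z"
    using *[of "x + y" x 1 y] fn_lincomb(2)[of x y] by simp
  show "AE z in half_measure. grad (x - y) z = grad x z - grad y z"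
    using *[of "x - y" x "-1" y] fn_lincomb(3)[of x y] by simp
  have "AE z in half_measure. fn (0::'n sobolev) z = fn (0::'n sobolev) z + (-1) * fn (0::'n sobolev) z"
    using fn_lincomb(1) by eventually_elim simp
  from *[OF this] show 0: "AE z in half_measure. grad (0 :: 'n sobolev) z = 0" by simp
  have "AE z in half_measure. fn (c *\<^sub>R x) z = fn (0::'n sobolev) z + c * fn x z"
    using fn_lincomb(5)[of c x] fn_lincomb(1) by eventually_elim simp
  from *[OF this] 0 show "AE z in half_measure. grad (c *\<^sub>R x) z = c *\<^sub>R grad x z" by eventually_elim simp
qed

text \<open>The form with coefficient \<open>c = 1\<close> is the inner product, with \<open>c = m\<^sup>2\<close> it is the quadratic part of
  the energy.\<close>

definition form :: "real \<Rightarrow> 'n::finite sobolev \<Rightarrow> 'n sobolev \<Rightarrow> real" where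
  "form c x y = (\<integral>z. grad x z \<bullet> grad y z + c * fn x z * fn y z \<partial>half_measure)"

lemma form_eq:
  "form c x y = (\<integral>z. grad x z \<bullet> grad y z \<partial>half_measure) + c * (\<integral>z. fn x z * fn y z \<partial>half_measure)"
  using integrable_inner[OF grad_L2[of x] grad_L2[of y]] integrable_mult_L2[OF fn_L2[of x] fn_L2[of y]]
  by (simp add: form_def mult.assoc)

lemma form_self: "form c x x = (norm2 half_measure (grad x))\<^sup>2 + c * (norm2 half_measure (fn x))\<^sup>2"
  by (simp add: form_eq norm2_square power2_norm_eq_inner) (simp add: power2_eq_square)

lemma form_commute: "form c x y = form c y x"
  by (simp add: form_def inner_commute mult_ac)

lemma form_add_left: "form c (x + y) w = form c x w + form c y w"
proof -
  note I = integrable_inner[OF grad_L2[of x] grad_L2[of w]] integrable_inner[OF grad_L2[of y] grad_L2[of w]]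
    integrable_mult_L2[OF fn_L2[of x] fn_L2[of w]] integrable_mult_L2[OF fn_L2[of y] fn_L2[of w]]
  have "form c (x + y) w = (\<integral>z. (grad x z \<bullet> grad w z + c * (fn x z * fn w z))
      + (grad y z \<bullet> grad w z + c * (fn y z * fn w z)) \<partial>half_measure)"
    unfolding form_def
  proof (rule integral_cong_AE)
    show "AE z in half_measure. grad (x + y) z \<bullet> grad w z + c * fn (x + y) z * fn w z
      = (grad x z \<bullet> grad w z + c * (fn x z * fn w z)) + (grad y z \<bullet> grad w z + c * (fn y z * fn w z))"
      using grad_lincomb(1)[of x y] fn_lincomb(2)[of x y] by eventually_elim (simp add: inner_simps algebra_simps)
  qed (intro borel_measurable_add borel_measurable_inner borel_measurable_times borel_measurable_const
      L2_measurable[OF fn_L2] L2_measurable[OF grad_L2])+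
  then show ?thesis using I by (simp add: form_eq)
qed

lemma form_scaleR_left: "form c (a *\<^sub>R x) y = a * form c x y"
proof -
  have "form c (a *\<^sub>R x) y = (\<integral>z. a * (grad x z \<bullet> grad y z + c * fn x z * fn y z) \<partial>half_measure)"
    unfolding form_def
  proof (rule integral_cong_AE)
    show "AE z in half_measure. grad (a *\<^sub>R x) z \<bullet> grad y z + c * fn (a *\<^sub>R x) z * fn y z
      = a * (grad x z \<bullet> grad y z + c * fn x z * fn y z)"
      using grad_lincomb(3)[of a x] fn_lincomb(5)[of a x] by eventually_elim (simp add: algebra_simps)
  qed (intro borel_measurable_add borel_measurable_inner borel_measurable_times borel_measurable_const
      L2_measurable[OF fn_L2] L2_measurable[OF grad_L2])+
  then show ?thesis by (simp add: form_def)
qed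

instantiation sobolev :: (finite) real_inner
begin

definition "inner x y = form 1 x (y :: 'a sobolev)"
definition "norm x = sqrt (inner x (x :: 'a sobolev))"
definition "dist x y = norm (x - y :: 'a sobolev)"
definition "sgn x = (inverse (norm x)) *\<^sub>R (x :: 'a sobolev)"
definition "uniformity = (INF e\<in>{0<..}. principal {(x, y :: 'a sobolev). dist x y < e})"
definition "open (U :: 'a sobolev set) = (\<forall>x\<in>U. eventually (\<lambda>(x', y). x' = x \<longrightarrow> y \<in> U) uniformity)"

instance
proof
  fix x y w :: "'a sobolev" and c :: real
  show "dist x y = norm (x - y)" by (simp add: dist_sobolev_def)
  show "sgn x = x /\<^sub>R norm x" by (simp add: sgn_sobolev_def)
  show "uniformity = (INF e\<in>{0<..}. principal {(x, y :: 'a sobolev). dist x y < e})"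
    by (simp add: uniformity_sobolev_def)
  show "open U = (\<forall>x\<in>U. eventually (\<lambda>(x', y). x' = x \<longrightarrow> y \<in> U) uniformity)" for U :: "'a sobolev set"
    by (simp add: open_sobolev_def)
  show "inner x y = inner y x" by (simp add: inner_sobolev_def form_commute)
  show "inner (x + y) w = inner x w + inner y w" by (simp add: inner_sobolev_def form_add_left)
  show "inner (c *\<^sub>R x) y = c * inner x y" by (simp add: inner_sobolev_def form_scaleR_left)
  show "0 \<le> inner x x" by (simp add: inner_sobolev_def form_self)
  show "norm x = sqrt (inner x x)" by (simp add: norm_sobolev_def)
  show "inner x x = 0 \<longleftrightarrow> x = 0"
  proof
    assume "inner x x = 0"
    then have "norm2 half_measure (fn x) = 0" by (simp add: inner_sobolev_def form_self add_nonneg_eq_0_iff)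
    then have "AE z in half_measure. fn x z = 0" by (intro norm2_eq_0_imp_AE) simp_all
    with fn_lincomb(1) have "AE z in half_measure. fn x z = fn (0::'a sobolev) z" by eventually_elim simp
    then show "x = 0" by (rule sobolev_eqI)
  next
    assume "x = 0"
    then show "inner x x = 0" using form_scaleR_left[of 1 0 x x] by (simp add: inner_sobolev_def)
  qed
qed

end

lemma norm_sobolev_square: "(norm x)\<^sup>2 = (norm2 half_measure (grad x))\<^sup>2 + (norm2 half_measure (fn x))\<^sup>2"
  for x :: "'n::finite sobolev"
  by (simp add: power2_norm_eq_inner inner_sobolev_def form_self)

lemma norm2_fn_le: "norm2 half_measure (fn x) \<le> norm x"
  and norm2_grad_le: "norm2 half_measure (grad x) \<le> norm x"
  for x :: "'n::finite sobolev"
  by (rule power2_le_imp_le; simp add: norm_sobolev_square)+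

lemma norm_sobolev_le: "norm x \<le> norm2 half_measure (grad x) + norm2 half_measure (fn x)"
  for x :: "'n::finite sobolev"
  by (rule power2_le_imp_le) (simp_all add: norm_sobolev_square power2_sum)

lemma norm2_fn_diff: "norm2 half_measure (fn (x - y)) = norm2 half_measure (\<lambda>z. fn x z - fn y z)"
  and norm2_grad_diff: "norm2 half_measure (grad (x - y)) = norm2 half_measure (\<lambda>z. grad x z - grad y z)"
  by (intro norm2_cong_AE fn_lincomb(3) grad_lincomb(2) L2_measurable L2_diff fn_L2 grad_L2)+

instance sobolev :: (finite) complete_space
proof
  fix X :: "nat \<Rightarrow> 'a sobolev" assume X: "Cauchy X"
  have *: "\<exists>K. \<forall>m\<ge>K. \<forall>n\<ge>K. norm (X m - X n) < e" if "e > 0" for e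
    using metric_CauchyD[OF X that] by (simp add: dist_norm)
  have "\<exists>u\<in>L2 half_measure. (\<lambda>n. norm2 half_measure (\<lambda>z. fn (X n) z - u z)) \<longlonglongrightarrow> 0"
  proof (rule L2_complete[OF fn_L2])
    fix e :: real assume "e > 0"
    from *[OF this] obtain K where K: "\<And>m n. m \<ge> K \<Longrightarrow> n \<ge> K \<Longrightarrow> norm (X m - X n) < e" by blast
    have "norm2 half_measure (\<lambda>z. fn (X m) z - fn (X n) z) < e" if "m \<ge> K" "n \<ge> K" for m n
      using K[OF that] norm2_fn_le[of "X m - X n"] by (simp add: norm2_fn_diff)
    then show "\<exists>K. \<forall>m\<ge>K. \<forall>n\<ge>K. norm2 half_measure (\<lambda>z. fn (X m) z - fn (X n) z) < e" by blast
  qed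
  then obtain u where u: "u \<in> L2 half_measure" "(\<lambda>n. norm2 half_measure (\<lambda>z. fn (X n) z - u z)) \<longlonglongrightarrow> 0" by blast
  have "\<exists>g\<in>L2 half_measure. (\<lambda>n. norm2 half_measure (\<lambda>z. grad (X n) z - g z)) \<longlonglongrightarrow> 0"
  proof (rule L2_complete[OF grad_L2])
    fix e :: real assume "e > 0"
    from *[OF this] obtain K where K: "\<And>m n. m \<ge> K \<Longrightarrow> n \<ge> K \<Longrightarrow> norm (X m - X n) < e" by blast
    have "norm2 half_measure (\<lambda>z. grad (X m) z - grad (X n) z) < e" if "m \<ge> K" "n \<ge> K" for m n
      using K[OF that] norm2_grad_le[of "X m - X n"] by (simp add: norm2_grad_diff)
    then show "\<exists>K. \<forall>m\<ge>K. \<forall>n\<ge>K. norm2 half_measure (\<lambda>z. grad (X m) z - grad (X n) z) < e" by blast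
  qed
  then obtain g where g: "g \<in> L2 half_measure" "(\<lambda>n. norm2 half_measure (\<lambda>z. grad (X n) z - g z)) \<longlonglongrightarrow> 0" by blast
  have ug: "has_weak_gradient u g"
    by (rule has_weak_gradient_limit[OF fn_L2 u(1) has_weak_gradient_weak_gradient[OF fn_H1] g(1) u(2) g(2)])
  have uH: "u \<in> H1" by (rule H1I[OF u(1) ug])
  have "(\<lambda>n. norm (X n - cls u)) \<longlonglongrightarrow> 0"
  proof (rule Lim_null_comparison[OF always_eventually[OF allI]])
    show "(\<lambda>n. norm2 half_measure (\<lambda>z. grad (X n) z - g z) + norm2 half_measure (\<lambda>z. fn (X n) z - u z)) \<longlonglongrightarrow> 0"
      using tendsto_add[OF g(2) u(2)] by simp
    fix n
    have "norm2 half_measure (grad (X n - cls u)) = norm2 half_measure (\<lambda>z. grad (X n) z - g z)"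
      unfolding norm2_grad_diff
    proof (rule norm2_cong_AE)
      show "AE z in half_measure. grad (X n) z - grad (cls u) z = grad (X n) z - g z"
        using grad_cls[OF uH] weak_gradient_eq_AE[OF u(1) ug] by eventually_elim simp
    qed (intro L2_measurable L2_diff grad_L2 g(1))+
    moreover have "norm2 half_measure (fn (X n - cls u)) = norm2 half_measure (\<lambda>z. fn (X n) z - u z)"
      unfolding norm2_fn_diff
    proof (rule norm2_cong_AE)
      show "AE z in half_measure. fn (X n) z - fn (cls u) z = fn (X n) z - u z"
        using fn_cls[OF uH] by eventually_elim simp
    qed (intro L2_measurable L2_diff fn_L2 u(1))+
    ultimately show "norm (norm (X n - cls u)) \<le>
       norm2 half_measure (\<lambda>z. grad (X n) z - g z) + norm2 half_measure (\<lambda>z. fn (X n) z - u z)"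
      using norm_sobolev_le[of "X n - cls u"] by simp
  qed
  then show "convergent X" unfolding convergent_def by (intro exI[of _ "cls u"]) (simp add: tendsto_norm_zero_iff LIM_zero_iff)
qed

lemma H1_norm_eq: "u \<in> H1 \<Longrightarrow> H1_norm u = norm (cls u)"
  for u :: "real \<times> (real ^ 'n) \<Rightarrow> real"
proof -
  assume u: "u \<in> H1"
  have "(\<integral>z. (norm (weak_gradient u z))\<^sup>2 + (u z)\<^sup>2 \<partial>half_measure) = form 1 (cls u) (cls u)"
    unfolding form_def
  proof (rule integral_cong_AE)
    show "AE z in half_measure. (norm (weak_gradient u z))\<^sup>2 + (u z)\<^sup>2
       = grad (cls u) z \<bullet> grad (cls u) z + 1 * fn (cls u) z * fn (cls u) z"
      using fn_cls[OF u] grad_cls[OF u] by eventually_elim (simp add: power2_norm_eq_inner, simp add: power2_eq_square)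
  next
    show "(\<lambda>z. (norm (weak_gradient u z))\<^sup>2 + (u z)\<^sup>2) \<in> borel_measurable half_measure"
      using L2_measurable[OF weak_gradient_L2[OF u]] L2_measurable[OF H1_L2[OF u]] by measurable
  qed (intro borel_measurable_add borel_measurable_inner borel_measurable_times borel_measurable_const
      L2_measurable[OF fn_L2] L2_measurable[OF grad_L2])
  then show ?thesis by (simp add: H1_norm_def norm_eq_sqrt_inner inner_sobolev_def)
qed

lemma cls_diff: "u \<in> H1 \<Longrightarrow> v \<in> H1 \<Longrightarrow> cls (\<lambda>z. u z - v z) = cls u - cls v"
  and H1_diff: "u \<in> H1 \<Longrightarrow> v \<in> H1 \<Longrightarrow> (\<lambda>z. u z - v z) \<in> H1"
  for u v :: "real \<times> (real ^ 'n) \<Rightarrow> real"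
proof -
  assume u: "u \<in> H1" and v: "v \<in> H1"
  show d: "(\<lambda>z. u z - v z) \<in> H1" using H1_lincomb(1)[OF u v, of "-1"] by simp
  show "cls (\<lambda>z. u z - v z) = cls u - cls v"
    by (rule sobolev_eqI) (use fn_cls[OF d] fn_lincomb(3)[of "cls u" "cls v"] fn_cls[OF u] fn_cls[OF v]
        in eventually_elim, simp)
qed

subsection \<open>Smooth elements\<close>

lemma norm_cls_test_function_diff:
  assumes t: "\<phi> \<in> test_functions UNIV"
  shows "norm (cls \<phi> - x) \<le> norm2 half_measure (\<lambda>z. \<phi> z - fn x z)
    + (\<Sum>b\<in>Basis. norm2 half_measure (\<lambda>z. partial b \<phi> z - grad x z \<bullet> b))"
proof -
  note tH = test_function_H1[OF t]
  have gL: "gradient \<phi> \<in> L2 half_measure" by (rule L2_lborel_imp_half[OF gradient_L2[OF t]])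
  have AEg: "AE z in half_measure. grad (cls \<phi>) z = gradient \<phi> z"
    using grad_cls[OF tH] weak_gradient_eq_AE[OF H1_L2[OF tH] has_weak_gradient_test_function[OF t]]
    by eventually_elim simp
  have "norm2 half_measure (grad (cls \<phi> - x)) = norm2 half_measure (\<lambda>z. gradient \<phi> z - grad x z)"
    unfolding norm2_grad_diff
  proof (rule norm2_cong_AE)
    show "AE z in half_measure. grad (cls \<phi>) z - grad x z = gradient \<phi> z - grad x z"
      using AEg by eventually_elim simp
  qed (intro L2_measurable L2_diff grad_L2 gL)+
  also have "\<dots> \<le> (\<Sum>b\<in>Basis. norm2 half_measure (\<lambda>z. (gradient \<phi> z - grad x z) \<bullet> b))"
    by (intro norm2_le_sum_components L2_diff grad_L2 gL)
  also have "\<dots> = (\<Sum>b\<in>Basis. norm2 half_measure (\<lambda>z. partial b \<phi> z - grad x z \<bullet> b))"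
    by (intro sum.cong refl) (simp add: inner_diff_left gradient_inner)
  finally have 1: "norm2 half_measure (grad (cls \<phi> - x)) \<le> (\<Sum>b\<in>Basis. norm2 half_measure (\<lambda>z. partial b \<phi> z - grad x z \<bullet> b))" .
  have "norm2 half_measure (fn (cls \<phi> - x)) = norm2 half_measure (\<lambda>z. \<phi> z - fn x z)"
    unfolding norm2_fn_diff
  proof (rule norm2_cong_AE)
    show "AE z in half_measure. fn (cls \<phi>) z - fn x z = \<phi> z - fn x z"
      using fn_cls[OF tH] by eventually_elim simp
  qed (intro L2_measurable L2_diff fn_L2 H1_L2[OF tH])+
  then show ?thesis using 1 norm_sobolev_le[of "cls \<phi> - x"] by linarith
qed

lemma test_functions_dense_sobolev:
  fixes x :: "'n::finite sobolev"
  assumes e: "e > 0"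
  shows "\<exists>\<phi>\<in>test_functions UNIV. norm (cls \<phi> - x) < e"
proof -
  define N where "N = real (DIM(real \<times> (real ^ 'n))) + 1"
  have N: "N > 0" by (simp add: N_def)
  then have "e / (2 * N) > 0" using e by simp
  from test_functions_dense[OF fn_L2 has_weak_gradient_weak_gradient[OF fn_H1] this, of x]
  obtain \<phi> where \<phi>: "\<phi> \<in> test_functions UNIV" "norm2 half_measure (\<lambda>z. \<phi> z - fn x z) < e / (2 * N)"
    "\<And>b. b \<in> Basis \<Longrightarrow> norm2 half_measure (\<lambda>z. partial b \<phi> z - grad x z \<bullet> b) < e / (2 * N)" by blast
  have "norm (cls \<phi> - x) \<le> e / (2 * N) + (\<Sum>b\<in>(Basis :: (real \<times> (real ^ 'n)) set). e / (2 * N))"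
    using \<phi>(2,3) by (intro order_trans[OF norm_cls_test_function_diff[OF \<phi>(1)]] add_mono sum_mono) (auto intro: less_imp_le)
  also have "\<dots> = e / (2 * N) + (N - 1) * (e / (2 * N))" by (simp add: N_def)
  also have "\<dots> = e / 2" using N by (simp add: field_simps)
  finally show ?thesis using \<phi>(1) e by (intro bexI[of _ \<phi>]) auto
qed

lemma test_functions_dense_seq:
  fixes x :: "'n::finite sobolev"
  shows "\<exists>\<phi>. (\<forall>k. \<phi> k \<in> test_functions UNIV) \<and> (\<lambda>k. cls (\<phi> k)) \<longlonglongrightarrow> x"
proof -
  have "\<exists>\<phi>\<in>test_functions UNIV. norm (cls \<phi> - x) < inverse (real (Suc k))" for k
    by (rule test_functions_dense_sobolev) simp
  then obtain \<phi> where \<phi>: "\<And>k. \<phi> k \<in> test_functions UNIV" "\<And>k. norm (cls (\<phi> k) - x) < inverse (real (Suc k))"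
    by metis
  have "(\<lambda>k. cls (\<phi> k) - x) \<longlonglongrightarrow> 0"
    by (rule Lim_null_comparison[OF always_eventually[OF allI] LIMSEQ_inverse_real_of_nat]) (use \<phi>(2) less_imp_le in blast)
  then show ?thesis using \<phi>(1) by (intro exI[of _ \<phi>]) (simp add: LIM_zero_iff)
qed

section \<open>The trace on the boundary\<close>

lemma nn_integral_half_eq_iterated:
  assumes [measurable]: "F \<in> borel_measurable borel"
  shows "(\<integral>\<^sup>+z. F z \<partial>half_measure) = (\<integral>\<^sup>+y. (\<integral>\<^sup>+t. indicator {0<..} t * F (t, y) \<partial>lborel) \<partial>lborel)"
proof -
  have m: "(\<lambda>z. indicator half_space z * F z) \<in> borel_measurable (lborel \<Otimes>\<^sub>M lborel)"
    unfolding lborel_prod by measurable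
  have "(\<integral>\<^sup>+z. F z \<partial>half_measure) = (\<integral>\<^sup>+z. indicator half_space z * F z \<partial>(lborel \<Otimes>\<^sub>M lborel))"
    unfolding lborel_prod by (subst nn_integral_restrict_space) (auto simp: mult.commute)
  also have "\<dots> = (\<integral>\<^sup>+y. (\<integral>\<^sup>+t. indicator half_space (t, y) * F (t, y) \<partial>lborel) \<partial>lborel)"
    by (rule lborel_pair.nn_integral_snd[OF m, symmetric])
  also have "\<dots> = (\<integral>\<^sup>+y. (\<integral>\<^sup>+t. indicator {0<..} t * F (t, y) \<partial>lborel) \<partial>lborel)"
    by (intro nn_integral_cong) (auto simp: half_space_def indicator_def)
  finally show ?thesis .
qed

lemma ennreal_norm2_square:
  assumes "f \<in> L2 M"
  shows "ennreal ((norm2 M f)\<^sup>2) = (\<integral>\<^sup>+z. ennreal ((norm (f z))\<^sup>2) \<partial>M)"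
  unfolding norm2_square by (rule nn_integral_eq_integral[symmetric, OF L2_integrable_square[OF assms]]) simp

lemma square_increment_le:
  fixes g :: "real \<Rightarrow> real"
  assumes ab: "a \<le> b" and d: "\<And>t. (g has_real_derivative g' t) (at t)" and c: "continuous_on UNIV g'"
  shows "ennreal ((g b - g a)\<^sup>2) \<le> ennreal (b - a) * (\<integral>\<^sup>+t. indicator {a..b} t * ennreal ((g' t)\<^sup>2) \<partial>lborel)"
proof -
  have [measurable]: "g' \<in> borel_measurable borel" using c by (rule borel_measurable_continuous_onI)
  have "compact (g' ` {a..b})" by (intro compact_continuous_image continuous_on_subset[OF c]) auto
  then obtain B where B: "B > 0" "\<And>t. t \<in> {a..b} \<Longrightarrow> \<bar>g' t\<bar> \<le> B"
    using compact_imp_bounded by (force simp: bounded_pos)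
  have L1: "(\<lambda>t. indicator {a..b} t :: real) \<in> L2 lborel"
    by (rule bounded_support_L2[where B=1 and R="max \<bar>a\<bar> \<bar>b\<bar>"]) (auto simp: indicator_def)
  have L2: "(\<lambda>t. indicator {a..b} t * g' t) \<in> L2 lborel"
    by (rule bounded_support_L2[where B=B and R="max \<bar>a\<bar> \<bar>b\<bar>"]) (use B in \<open>auto simp: indicator_def\<close>)
  have "(LBINT t. indicator {a..b} t *\<^sub>R g' t) = g b - g a"
  proof (rule integral_FTC_Icc[OF ab])
    show "(g has_vector_derivative g' x) (at x within {a..b})" for x
      using d[of x] by (simp add: has_real_derivative_iff_has_vector_derivative has_vector_derivative_at_within)
  qed (rule continuous_on_subset[OF c], simp)
  then have eq: "(\<integral>t. indicator {a..b} t * (indicator {a..b} t * g' t) \<partial>lborel) = g b - g a"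
    by (simp add: mult.assoc[symmetric] indicator_inter_arith[symmetric])
  have n1: "(norm2 lborel (\<lambda>t. indicator {a..b} t :: real))\<^sup>2 = b - a"
  proof -
    have "(norm (indicator {a..b} t :: real))\<^sup>2 = indicator {a..b} t" for t by (simp add: indicator_def)
    then show ?thesis using ab by (simp add: norm2_square)
  qed
  have "(g b - g a)\<^sup>2 \<le> (norm2 lborel (\<lambda>t. indicator {a..b} t :: real) * norm2 lborel (\<lambda>t. indicator {a..b} t * g' t))\<^sup>2"
    using Cauchy_Schwarz_L2_real[OF L1 L2] unfolding eq by (metis abs_ge_zero power2_abs power_mono)
  also have "\<dots> = (b - a) * (norm2 lborel (\<lambda>t. indicator {a..b} t * g' t))\<^sup>2"
    by (simp add: power_mult_distrib n1)
  finally have "ennreal ((g b - g a)\<^sup>2) \<le> ennreal (b - a) * ennreal ((norm2 lborel (\<lambda>t. indicator {a..b} t * g' t))\<^sup>2)"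
    using ab by (simp add: ennreal_mult[symmetric] ennreal_leI)
  also have "ennreal ((norm2 lborel (\<lambda>t. indicator {a..b} t * g' t))\<^sup>2)
      = (\<integral>\<^sup>+t. indicator {a..b} t * ennreal ((g' t)\<^sup>2) \<partial>lborel)"
    unfolding ennreal_norm2_square[OF L2] by (intro nn_integral_cong) (auto simp: indicator_def)
  finally show ?thesis .
qed

lemma test_function_line_derivative:
  fixes \<phi> :: "'a::euclidean_space \<Rightarrow> real"
  assumes t: "\<phi> \<in> test_functions \<Omega>"
  shows "((\<lambda>t. \<phi> (p + t *\<^sub>R h)) has_real_derivative gradient \<phi> (p + t *\<^sub>R h) \<bullet> h) (at t)"
proof -
  have 1: "((\<lambda>s. p + s *\<^sub>R h) has_derivative (\<lambda>r. r *\<^sub>R h)) (at t)" by (auto intro!: derivative_eq_intros)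
  note D = test_function_has_derivative[OF t, of "p + t *\<^sub>R h"]
  have "gradient \<phi> q \<bullet> h = frechet_derivative \<phi> (at q) h" for q
    by (subst frechet_derivative_sum_partial[OF Ck_differentiable[OF test_function_Ck[OF t]]])
      (simp add: gradient_def inner_sum_left, simp add: inner_commute mult.commute)
  then show ?thesis unfolding has_field_derivative_def
    by (intro has_derivative_eq_rhs[OF has_derivative_compose[OF 1 D]])
      (simp add: linear_cmul[OF has_derivative_linear[OF D]] fun_eq_iff mult.commute)
qed

lemma gradient_continuous: "\<phi> \<in> test_functions \<Omega> \<Longrightarrow> continuous_on UNIV (gradient \<phi>)"
  unfolding gradient_def[abs_def]
  by (intro continuous_on_sum continuous_on_scaleR continuous_on_const test_function_continuous[OF test_function_partial])

lemma gradient_measurable: "\<phi> \<in> test_functions \<Omega> \<Longrightarrow> gradient \<phi> \<in> borel_measurable borel"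
  by (rule borel_measurable_continuous_onI[OF gradient_continuous])

lemma boundary_restriction_L2:
  fixes \<phi> :: "real \<times> (real ^ 'n) \<Rightarrow> real"
  assumes t: "\<phi> \<in> test_functions UNIV"
  shows "(\<lambda>y. \<phi> (0, y)) \<in> L2 lborel"
proof -
  obtain R where R: "R > 0" "\<And>z. norm z > R \<Longrightarrow> \<phi> z = 0" using t by (rule test_function_bounded_support) blast
  obtain B where B: "B > 0" "\<And>z. \<bar>\<phi> z\<bar> \<le> B" using t by (rule test_function_bounded) blast
  show ?thesis
  proof (rule bounded_support_L2(1)[where B=B and R=R])
    have "continuous_on UNIV (\<lambda>y. \<phi> (0, y))"
      by (intro continuous_on_compose2[OF test_function_continuous[OF t]] continuous_intros) auto
    then show "(\<lambda>y. \<phi> (0, y)) \<in> borel_measurable borel" by (rule borel_measurable_continuous_onI)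
  qed (use B R in auto)
qed

text \<open>The energy along the normal line above \<open>y\<close> bounds the change between the boundary and height
  \<open>s\<close>: its square is at most \<open>s\<close> times this energy.\<close>

definition normal_energy :: "(real \<times> (real ^ 'n) \<Rightarrow> real) \<Rightarrow> real ^ 'n \<Rightarrow> ennreal" where
  "normal_energy \<phi> y = (\<integral>\<^sup>+t. indicator {0<..} t * ennreal ((norm (gradient \<phi> (t, y)))\<^sup>2) \<partial>lborel)"

lemma normal_energy_measurable:
  fixes \<phi> :: "real \<times> (real ^ 'n) \<Rightarrow> real"
  assumes t: "\<phi> \<in> test_functions UNIV"
  shows "normal_energy \<phi> \<in> borel_measurable borel"
proof -
  have [measurable]: "gradient \<phi> \<in> borel_measurable (borel \<Otimes>\<^sub>M borel)"
    using gradient_measurable[OF t] by (simp add: borel_prod)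
  have "(\<lambda>y. \<integral>\<^sup>+t. indicator {0<..} t * ennreal ((norm (gradient \<phi> (t, y)))\<^sup>2) \<partial>lborel) \<in> borel_measurable lborel"
    by (rule lborel.borel_measurable_nn_integral) measurable
  then show ?thesis by (simp add: normal_energy_def[abs_def])
qed

lemma integral_normal_energy:
  assumes t: "\<phi> \<in> test_functions UNIV"
  shows "(\<integral>\<^sup>+y. normal_energy \<phi> y \<partial>lborel) = ennreal ((norm2 half_measure (gradient \<phi>))\<^sup>2)"
proof -
  have [measurable]: "gradient \<phi> \<in> borel_measurable borel" by (rule gradient_measurable[OF t])
  show ?thesis
    unfolding normal_energy_def ennreal_norm2_square[OF L2_lborel_imp_half(1)[OF gradient_L2[OF t]]]
    by (rule nn_integral_half_eq_iterated[symmetric]) measurable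
qed

lemma square_boundary_increment_le:
  fixes \<phi> :: "real \<times> (real ^ 'n) \<Rightarrow> real"
  assumes t: "\<phi> \<in> test_functions UNIV" and s: "0 < s"
  shows "ennreal ((\<phi> (s, y) - \<phi> (0, y))\<^sup>2) \<le> ennreal s * normal_energy \<phi> y"
proof -
  define g' where "g' t = gradient \<phi> ((0, y) + t *\<^sub>R (1, 0)) \<bullet> (1, 0)" for t
  have "continuous_on UNIV g'"
    unfolding g'_def[abs_def]
    by (intro continuous_on_inner continuous_on_const continuous_on_compose2[OF gradient_continuous[OF t]] continuous_intros) auto
  from square_increment_le[OF less_imp_le[OF s] test_function_line_derivative[OF t, of "(0, y)" "(1, 0)"] this[unfolded g'_def[abs_def]]]
  have "ennreal ((\<phi> (s, y) - \<phi> (0, y))\<^sup>2) \<le> ennreal s * (\<integral>\<^sup>+t. indicator {0..s} t * ennreal ((g' t)\<^sup>2) \<partial>lborel)"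
    by (simp add: g'_def)
  also have "(\<integral>\<^sup>+t. indicator {0..s} t * ennreal ((g' t)\<^sup>2) \<partial>lborel) \<le> normal_energy \<phi> y"
    unfolding normal_energy_def
  proof (rule nn_integral_mono_AE)
    have "\<bar>g' t\<bar> \<le> norm (gradient \<phi> (t, y)) * norm ((1, 0) :: real \<times> (real ^ 'n))" for t
      unfolding g'_def using Cauchy_Schwarz_ineq2[of "gradient \<phi> (t, y)" "(1, 0)"] by simp
    then have "\<bar>g' t\<bar> \<le> norm (gradient \<phi> (t, y))" for t by (simp add: norm_Pair)
    then have g: "(g' t)\<^sup>2 \<le> (norm (gradient \<phi> (t, y)))\<^sup>2" for t by (metis abs_ge_zero power2_abs power_mono)
    show "AE t in lborel. indicator {0..s} t * ennreal ((g' t)\<^sup>2)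
       \<le> indicator {0<..} t * ennreal ((norm (gradient \<phi> (t, y)))\<^sup>2)"
      using AE_lborel_singleton[of "0::real"] by eventually_elim (use g in \<open>auto simp: indicator_def intro: ennreal_leI\<close>)
  qed
  finally show ?thesis by (simp add: mult_left_mono)
qed

lemma ennreal_square_add_le:
  "ennreal ((a + b)\<^sup>2) \<le> 2 * ennreal (a\<^sup>2) + 2 * ennreal (b\<^sup>2)" for a b :: real
proof -
  have "(a + b)\<^sup>2 \<le> 2 * a\<^sup>2 + 2 * b\<^sup>2" using norm_add_square_le[of a b] by simp
  then have "ennreal ((a + b)\<^sup>2) \<le> ennreal (2 * a\<^sup>2 + 2 * b\<^sup>2)" by (rule ennreal_leI)
  also have "\<dots> = 2 * ennreal (a\<^sup>2) + 2 * ennreal (b\<^sup>2)" by (simp add: ennreal_mult)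
  finally show ?thesis .
qed

lemma boundary_values_bound:
  assumes t: "\<phi> \<in> test_functions UNIV"
  shows "(norm2 lborel (\<lambda>y. \<phi> (0, y)))\<^sup>2 \<le> 2 * (norm2 half_measure \<phi>)\<^sup>2 + 2 * (norm2 half_measure (gradient \<phi>))\<^sup>2"
proof -
  let ?I = "\<lambda>y. \<integral>\<^sup>+s. indicator {0<..} s * ennreal ((\<phi> (s, y))\<^sup>2) \<partial>lborel"
  have [measurable]: "\<phi> \<in> borel_measurable borel" by (rule test_function_measurable[OF t])
  then have mP [measurable]: "\<phi> \<in> borel_measurable (borel \<Otimes>\<^sub>M borel)" by (simp add: borel_prod)
  have pL: "\<phi> \<in> L2 half_measure" by (rule L2_lborel_imp_half(1)[OF test_function_L2[OF t]])
  have nm [measurable]: "normal_energy \<phi> \<in> borel_measurable borel" by (rule normal_energy_measurable[OF t])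
  have pt: "ennreal ((\<phi> (0, y))\<^sup>2)
      \<le> 2 * ?I y + 2 * normal_energy \<phi> y" for y
  proof -
    have "ennreal ((\<phi> (0, y))\<^sup>2) = (\<integral>\<^sup>+s. ennreal ((\<phi> (0, y))\<^sup>2) * indicator {0<..<1::real} s \<partial>lborel)"
      by (subst nn_integral_cmult_indicator) auto
    also have "\<dots> \<le> (\<integral>\<^sup>+s. 2 * (indicator {0<..} s * ennreal ((\<phi> (s, y))\<^sup>2))
        + 2 * (normal_energy \<phi> y * indicator {0<..<1} s) \<partial>lborel)"
    proof (rule nn_integral_mono)
      fix s :: real
      show "ennreal ((\<phi> (0, y))\<^sup>2) * indicator {0<..<1} s \<le> 2 * (indicator {0<..} s * ennreal ((\<phi> (s, y))\<^sup>2))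
        + 2 * (normal_energy \<phi> y * indicator {0<..<1} s)"
      proof (cases "0 < s \<and> s < 1")
        case True
        have "ennreal ((\<phi> (0, y))\<^sup>2) \<le> 2 * ennreal ((\<phi> (s, y))\<^sup>2) + 2 * ennreal ((\<phi> (0, y) - \<phi> (s, y))\<^sup>2)"
          using ennreal_square_add_le[of "\<phi> (s, y)" "\<phi> (0, y) - \<phi> (s, y)"] by simp
        also have "ennreal ((\<phi> (0, y) - \<phi> (s, y))\<^sup>2) \<le> ennreal s * normal_energy \<phi> y"
          using square_boundary_increment_le[OF t, of s y] True by (simp add: power2_commute)
        also have "\<dots> \<le> 1 * normal_energy \<phi> y" using True by (intro mult_right_mono) auto
        finally show ?thesis using True by (simp add: add_left_mono mult_left_mono)
      qed (auto simp: indicator_def)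
    qed
    also have "\<dots> = 2 * ?I y + 2 * normal_energy \<phi> y"
      by (subst nn_integral_add) (auto simp: nn_integral_cmult)
    finally show ?thesis .
  qed
  have "ennreal ((norm2 lborel (\<lambda>y. \<phi> (0, y)))\<^sup>2) = (\<integral>\<^sup>+y. ennreal ((\<phi> (0, y))\<^sup>2) \<partial>lborel)"
    using ennreal_norm2_square[OF boundary_restriction_L2[OF t]] by simp
  also have "\<dots> \<le> (\<integral>\<^sup>+y. 2 * ?I y + 2 * normal_energy \<phi> y \<partial>lborel)"
    by (intro nn_integral_mono pt)
  also have "\<dots> = 2 * (\<integral>\<^sup>+y. ?I y \<partial>lborel)
      + 2 * (\<integral>\<^sup>+y. normal_energy \<phi> y \<partial>lborel)"
    by (subst nn_integral_add) (auto simp: nn_integral_cmult)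
  also have "(\<integral>\<^sup>+y. ?I y \<partial>lborel) = ennreal ((norm2 half_measure \<phi>)\<^sup>2)"
    unfolding ennreal_norm2_square[OF pL]
    by (subst nn_integral_half_eq_iterated) auto
  also have "2 * ennreal ((norm2 half_measure \<phi>)\<^sup>2) + 2 * (\<integral>\<^sup>+y. normal_energy \<phi> y \<partial>lborel)
     = ennreal (2 * (norm2 half_measure \<phi>)\<^sup>2 + 2 * (norm2 half_measure (gradient \<phi>))\<^sup>2)"
    by (simp add: integral_normal_energy[OF t] ennreal_mult)
  finally have "ennreal ((norm2 lborel (\<lambda>y. \<phi> (0, y)))\<^sup>2)
     \<le> ennreal (2 * (norm2 half_measure \<phi>)\<^sup>2 + 2 * (norm2 half_measure (gradient \<phi>))\<^sup>2)" .
  then show ?thesis by (subst (asm) ennreal_le_iff) auto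
qed

subsection \<open>Translations along the boundary\<close>

lemma half_space_shift: "z + (0, a) \<in> half_space \<longleftrightarrow> z \<in> half_space"
  by (simp add: half_space_def)

lemma nn_integral_half_shift:
  assumes [measurable]: "F \<in> borel_measurable borel"
  shows "(\<integral>\<^sup>+z. F (z + (0, a)) \<partial>half_measure) = (\<integral>\<^sup>+z. F z \<partial>half_measure)"
proof -
  have "(\<integral>\<^sup>+z. F (z + (0, a)) \<partial>half_measure) = (\<integral>\<^sup>+z. F (z + (0, a)) * indicator half_space (z + (0, a)) \<partial>lborel)"
    by (subst nn_integral_restrict_space) (auto simp: indicator_def half_space_shift)
  also have "\<dots> = (\<integral>\<^sup>+z. F z * indicator half_space z \<partial>lborel)"
    by (rule nn_integral_translate[of "\<lambda>z. F z * indicator half_space z"]) measurable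
  finally show ?thesis by (simp add: nn_integral_restrict_space)
qed

lemma norm2_tangential_increment_le:
  fixes \<phi> :: "real \<times> (real ^ 'n) \<Rightarrow> real"
  assumes t: "\<phi> \<in> test_functions UNIV"
  shows "(\<integral>\<^sup>+z. ennreal ((\<phi> (z + (0, h)) - \<phi> z)\<^sup>2) \<partial>half_measure)
    \<le> ennreal ((norm h)\<^sup>2 * (norm2 half_measure (gradient \<phi>))\<^sup>2)"
proof -
  let ?e = "\<lambda>z s. indicator {0..1} s * ennreal ((norm (gradient \<phi> (z + s *\<^sub>R (0, h))))\<^sup>2)"
  have gm: "gradient \<phi> \<in> borel_measurable borel" by (rule gradient_measurable[OF t])
  have gm2: "(\<lambda>p. gradient \<phi> (fst p + snd p *\<^sub>R (0, h))) \<in> borel_measurable (half_measure \<Otimes>\<^sub>M lborel)"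
  proof -
    have "fst \<in> measurable (half_measure \<Otimes>\<^sub>M lborel) (borel :: (real \<times> (real ^ 'n)) measure)"
      using measurable_compose[OF measurable_fst measurable_half[of "\<lambda>z. z"]] by simp
    then have "(\<lambda>p. fst p + snd p *\<^sub>R (0, h)) \<in> borel_measurable (half_measure \<Otimes>\<^sub>M lborel)"
      by measurable
    from measurable_compose[OF this gm] show ?thesis .
  qed
  interpret half: sigma_finite_measure "half_measure :: (real \<times> (real ^ 'n)) measure"
    by (rule sigma_finite_measure_restrict_space) (simp_all add: sigma_finite_lborel)
  interpret pair_sigma_finite "half_measure :: (real \<times> (real ^ 'n)) measure" "lborel :: real measure" ..
  have pt: "ennreal ((\<phi> (z + (0, h)) - \<phi> z)\<^sup>2) \<le>
      (\<integral>\<^sup>+s. ennreal ((norm h)\<^sup>2) * ?e z s \<partial>lborel)" for z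
  proof -
    have "continuous_on UNIV (\<lambda>s. gradient \<phi> (z + s *\<^sub>R (0, h)) \<bullet> (0, h))"
      by (intro continuous_on_inner continuous_on_const continuous_on_compose2[OF gradient_continuous[OF t]] continuous_intros) auto
    from square_increment_le[of 0 1, OF _ test_function_line_derivative[OF t, of z "(0, h)"] this]
    have "ennreal ((\<phi> (z + (0, h)) - \<phi> z)\<^sup>2)
      \<le> (\<integral>\<^sup>+s. indicator {0..1} s * ennreal ((gradient \<phi> (z + s *\<^sub>R (0, h)) \<bullet> (0, h))\<^sup>2) \<partial>lborel)"
      by (simp add: zero_prod_def[symmetric])
    also have "\<dots> \<le> (\<integral>\<^sup>+s. ennreal ((norm h)\<^sup>2) * ?e z s \<partial>lborel)"
    proof (rule nn_integral_mono)
      fix s :: real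
      let ?g = "gradient \<phi> (z + s *\<^sub>R (0, h))"
      have "\<bar>?g \<bullet> (0, h)\<bar> \<le> norm h * norm ?g"
        using Cauchy_Schwarz_ineq2[of ?g "(0, h)"] by (simp add: norm_Pair mult.commute)
      then have "(?g \<bullet> (0, h))\<^sup>2 \<le> (norm h * norm ?g)\<^sup>2" by (metis abs_ge_zero power2_abs power_mono)
      then have "ennreal ((?g \<bullet> (0, h))\<^sup>2) \<le> ennreal ((norm h)\<^sup>2) * ennreal ((norm ?g)\<^sup>2)"
        by (simp add: ennreal_mult[symmetric] power_mult_distrib ennreal_leI)
      then show "indicator {0..1} s * ennreal ((?g \<bullet> (0, h))\<^sup>2)
        \<le> ennreal ((norm h)\<^sup>2) * (indicator {0..1} s * ennreal ((norm ?g)\<^sup>2))"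
        by (auto simp: indicator_def)
    qed
    finally show ?thesis .
  qed
  have "(\<integral>\<^sup>+z. ennreal ((\<phi> (z + (0, h)) - \<phi> z)\<^sup>2) \<partial>half_measure)
    \<le> (\<integral>\<^sup>+z. (\<integral>\<^sup>+s. ennreal ((norm h)\<^sup>2) * ?e z s \<partial>lborel) \<partial>half_measure)"
    by (intro nn_integral_mono pt)
  also have "\<dots> = (\<integral>\<^sup>+s. (\<integral>\<^sup>+z. ennreal ((norm h)\<^sup>2) * ?e z s \<partial>half_measure) \<partial>lborel)"
    by (rule Fubini'[symmetric]) (use gm2 in \<open>simp add: split_beta\<close>)
  also have "\<dots> = (\<integral>\<^sup>+s. ennreal ((norm h)\<^sup>2 * (norm2 half_measure (gradient \<phi>))\<^sup>2) * indicator {0..1::real} s \<partial>lborel)"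
  proof (rule nn_integral_cong)
    fix s :: real
    have gm': "(\<lambda>z. ennreal ((norm (gradient \<phi> z))\<^sup>2)) \<in> borel_measurable borel" using gm by measurable
    have m: "(\<lambda>z. ennreal ((norm (gradient \<phi> (z + (0, s *\<^sub>R h))))\<^sup>2)) \<in> borel_measurable half_measure"
      by (rule measurable_half, rule measurable_compose[OF _ gm']) measurable
    have "(\<integral>\<^sup>+z. ennreal ((norm (gradient \<phi> (z + (0, s *\<^sub>R h))))\<^sup>2) \<partial>half_measure) = ennreal ((norm2 half_measure (gradient \<phi>))\<^sup>2)"
      unfolding nn_integral_half_shift[OF gm'] by (rule ennreal_norm2_square[symmetric, OF L2_lborel_imp_half(1)[OF gradient_L2[OF t]]])
    then show "(\<integral>\<^sup>+z. ennreal ((norm h)\<^sup>2) * ?e z s \<partial>half_measure)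
      = ennreal ((norm h)\<^sup>2 * (norm2 half_measure (gradient \<phi>))\<^sup>2) * indicator {0..1} s"
      using m by (simp add: nn_integral_cmult ennreal_mult mult_ac)
  qed
  also have "\<dots> = ennreal ((norm h)\<^sup>2 * (norm2 half_measure (gradient \<phi>))\<^sup>2)"
    by (subst nn_integral_cmult_indicator) auto
  finally show ?thesis .
qed

text \<open>To compare the boundary values at \<open>y\<close> and \<open>y + h\<close> go up to height \<open>s\<close>, move by \<open>h\<close> and come
  back, and average over \<open>0 < s < norm h\<close>: every leg costs \<open>norm h\<close> times the Dirichlet integral.
  This half derivative of the trace is the source of all compactness.\<close>

lemma boundary_increment_bound:
  assumes t: "\<phi> \<in> test_functions UNIV"
  shows "(norm2 lborel (\<lambda>y. \<phi> (0, y + h) - \<phi> (0, y)))\<^sup>2 \<le> 12 * norm h * (norm2 half_measure (gradient \<phi>))\<^sup>2"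
proof (cases "h = 0")
  case True
  then show ?thesis by (simp add: norm2_def)
next
  case False
  let ?S = "\<lambda>y. \<integral>\<^sup>+s. indicator {0<..} s * ennreal ((\<phi> (s, y + h) - \<phi> (s, y))\<^sup>2) \<partial>lborel"
  define r where "r = norm h"
  have r: "r > 0" using False by (simp add: r_def)
  define G where "G = (norm2 half_measure (gradient \<phi>))\<^sup>2"
  have G: "G \<ge> 0" by (simp add: G_def)
  have pm [measurable]: "\<phi> \<in> borel_measurable borel" by (rule test_function_measurable[OF t])
  then have mP [measurable]: "\<phi> \<in> borel_measurable (borel \<Otimes>\<^sub>M borel)" by (simp add: borel_prod)
  have nm [measurable]: "normal_energy \<phi> \<in> borel_measurable borel" by (rule normal_energy_measurable[OF t])
  have dL: "(\<lambda>y. \<phi> (0, y + h) - \<phi> (0, y)) \<in> L2 lborel"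
    by (rule L2_diff[OF L2_translate[OF boundary_restriction_L2[OF t]] boundary_restriction_L2[OF t]])
  have pt: "ennreal r * ennreal ((\<phi> (0, y + h) - \<phi> (0, y))\<^sup>2)
      \<le> 2 * ?S y
        + ennreal (4 * r\<^sup>2) * (normal_energy \<phi> (y + h) + normal_energy \<phi> y)" for y
  proof -
    let ?E = "normal_energy \<phi> (y + h) + normal_energy \<phi> y"
    have "ennreal r * ennreal ((\<phi> (0, y + h) - \<phi> (0, y))\<^sup>2)
      = (\<integral>\<^sup>+s. ennreal ((\<phi> (0, y + h) - \<phi> (0, y))\<^sup>2) * indicator {0<..<r} s \<partial>lborel)"
      using r by (subst nn_integral_cmult) (auto simp: mult.commute)
    also have "\<dots> \<le> (\<integral>\<^sup>+s. 2 * (indicator {0<..} s * ennreal ((\<phi> (s, y + h) - \<phi> (s, y))\<^sup>2))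
        + (ennreal (4 * r) * ?E) * indicator {0<..<r} s \<partial>lborel)"
    proof (rule nn_integral_mono)
      fix s :: real
      show "ennreal ((\<phi> (0, y + h) - \<phi> (0, y))\<^sup>2) * indicator {0<..<r} s
        \<le> 2 * (indicator {0<..} s * ennreal ((\<phi> (s, y + h) - \<phi> (s, y))\<^sup>2)) + (ennreal (4 * r) * ?E) * indicator {0<..<r} s"
      proof (cases "0 < s \<and> s < r")
        case True
        let ?a = "\<phi> (s, y + h) - \<phi> (s, y)" and ?b = "\<phi> (s, y) - \<phi> (0, y)" and ?c = "- (\<phi> (s, y + h) - \<phi> (0, y + h))"
        have inc: "ennreal ((\<phi> (s, q) - \<phi> (0, q))\<^sup>2) \<le> ennreal r * normal_energy \<phi> q" for q
          using square_boundary_increment_le[OF t, of s q] True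
          by (auto intro!: order_trans[OF _ mult_right_mono[of "ennreal s" "ennreal r"]] ennreal_leI)
        have "ennreal ((\<phi> (0, y + h) - \<phi> (0, y))\<^sup>2) = ennreal ((?a + (?b + ?c))\<^sup>2)" by simp
        also have "\<dots> \<le> 2 * ennreal (?a\<^sup>2) + 2 * ennreal ((?b + ?c)\<^sup>2)" by (rule ennreal_square_add_le)
        also have "ennreal ((?b + ?c)\<^sup>2) \<le> 2 * ennreal (?b\<^sup>2) + 2 * ennreal (?c\<^sup>2)" by (rule ennreal_square_add_le)
        also have "2 * ennreal (?b\<^sup>2) + 2 * ennreal (?c\<^sup>2) \<le> 2 * (ennreal r * normal_energy \<phi> y) + 2 * (ennreal r * normal_energy \<phi> (y + h))"
          using inc[of y] inc[of "y + h"] by (intro add_mono mult_left_mono) (simp_all only: power2_minus zero_le_numeral)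
        also have "2 * ennreal (?a\<^sup>2) + 2 * (2 * (ennreal r * normal_energy \<phi> y) + 2 * (ennreal r * normal_energy \<phi> (y + h)))
          = 2 * ennreal (?a\<^sup>2) + ennreal (4 * r) * ?E"
        proof -
          have "ennreal (4 * r) = 4 * ennreal r" using r by (simp add: ennreal_mult)
          then show ?thesis by (simp add: algebra_simps)
        qed
        finally show ?thesis using True by (simp add: add_left_mono mult_left_mono)
      qed (auto simp: indicator_def)
    qed
    also have "\<dots> = 2 * ?S y
        + (ennreal (4 * r) * ?E) * ennreal r"
      using r by (subst nn_integral_add) (auto simp: nn_integral_cmult)
    also have "(ennreal (4 * r) * ?E) * ennreal r = ennreal (4 * r\<^sup>2) * ?E"
      using r by (simp add: ennreal_mult power2_eq_square mult_ac)
    finally show ?thesis .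
  qed
  have "ennreal r * ennreal ((norm2 lborel (\<lambda>y. \<phi> (0, y + h) - \<phi> (0, y)))\<^sup>2)
     = (\<integral>\<^sup>+y. ennreal r * ennreal ((\<phi> (0, y + h) - \<phi> (0, y))\<^sup>2) \<partial>lborel)"
    unfolding ennreal_norm2_square[OF dL] by (subst nn_integral_cmult) auto
  also have "\<dots> \<le> (\<integral>\<^sup>+y. 2 * ?S y
        + ennreal (4 * r\<^sup>2) * (normal_energy \<phi> (y + h) + normal_energy \<phi> y) \<partial>lborel)"
    by (intro nn_integral_mono pt)
  also have "\<dots> = 2 * (\<integral>\<^sup>+y. ?S y \<partial>lborel)
        + ennreal (4 * r\<^sup>2) * ((\<integral>\<^sup>+y. normal_energy \<phi> (y + h) \<partial>lborel) + (\<integral>\<^sup>+y. normal_energy \<phi> y \<partial>lborel))"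
    by (subst nn_integral_add) (auto simp: nn_integral_cmult nn_integral_add)
  also have "(\<integral>\<^sup>+y. normal_energy \<phi> (y + h) \<partial>lborel) = (\<integral>\<^sup>+y. normal_energy \<phi> y \<partial>lborel)" by (rule nn_integral_translate[OF nm])
  also have "(\<integral>\<^sup>+y. ?S y \<partial>lborel)
      = (\<integral>\<^sup>+z. ennreal ((\<phi> (z + (0, h)) - \<phi> z)\<^sup>2) \<partial>half_measure)"
    by (subst nn_integral_half_eq_iterated) auto
  also have "2 * (\<integral>\<^sup>+z. ennreal ((\<phi> (z + (0, h)) - \<phi> z)\<^sup>2) \<partial>half_measure)
      + ennreal (4 * r\<^sup>2) * ((\<integral>\<^sup>+y. normal_energy \<phi> y \<partial>lborel) + (\<integral>\<^sup>+y. normal_energy \<phi> y \<partial>lborel))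
     \<le> 2 * ennreal (r\<^sup>2 * G) + ennreal (4 * r\<^sup>2) * (ennreal G + ennreal G)"
    using norm2_tangential_increment_le[OF t, of h] unfolding integral_normal_energy[OF t] r_def G_def
    by (intro add_right_mono mult_left_mono) auto
  also have "\<dots> = ennreal (2 * (r\<^sup>2 * G) + 4 * r\<^sup>2 * (G + G))"
  proof -
    have e1: "ennreal G + ennreal G = ennreal (G + G)" by (rule ennreal_plus[OF G G, symmetric])
    have e2: "ennreal (4 * r\<^sup>2) * ennreal (G + G) = ennreal (4 * r\<^sup>2 * (G + G))"
      by (rule ennreal_mult[symmetric]) (use G in auto)
    have e3: "2 * ennreal (r\<^sup>2 * G) = ennreal (2 * (r\<^sup>2 * G))" using G by (subst ennreal_mult) auto
    show ?thesis unfolding e1 e2 e3 by (rule ennreal_plus[symmetric]) (use G in auto)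
  qed
  finally have "r * (norm2 lborel (\<lambda>y. \<phi> (0, y + h) - \<phi> (0, y)))\<^sup>2 \<le> 2 * (r\<^sup>2 * G) + 4 * r\<^sup>2 * (G + G)"
    using r G by (simp add: ennreal_mult[symmetric] ennreal_le_iff)
  also have "\<dots> \<le> r * (12 * r * G)" using G r by (simp add: power2_eq_square)
  finally show ?thesis using r by (simp add: r_def G_def)
qed

subsection \<open>Existence and uniqueness of the trace\<close>

lemma norm2_grad_cls_test:
  assumes t: "\<phi> \<in> test_functions UNIV"
  shows "norm2 half_measure (gradient \<phi>) = norm2 half_measure (grad (cls \<phi>))"
    "norm2 half_measure \<phi> = norm2 half_measure (fn (cls \<phi>))"
proof -
  note tH = test_function_H1[OF t]
  have "AE z in half_measure. gradient \<phi> z = grad (cls \<phi>) z"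
    using grad_cls[OF tH] weak_gradient_eq_AE[OF H1_L2[OF tH] has_weak_gradient_test_function[OF t]] by eventually_elim simp
  then show "norm2 half_measure (gradient \<phi>) = norm2 half_measure (grad (cls \<phi>))"
    by (intro norm2_cong_AE L2_measurable L2_lborel_imp_half(1)[OF gradient_L2[OF t]] grad_L2)
  have "AE z in half_measure. \<phi> z = fn (cls \<phi>) z" using fn_cls[OF tH] by eventually_elim simp
  then show "norm2 half_measure \<phi> = norm2 half_measure (fn (cls \<phi>))"
    by (intro norm2_cong_AE L2_measurable H1_L2[OF tH] fn_L2)
qed

lemma boundary_norm_le:
  assumes t: "\<phi> \<in> test_functions UNIV"
  shows "norm2 lborel (\<lambda>y. \<phi> (0, y)) \<le> 2 * norm (cls \<phi>)"
    "norm2 lborel (\<lambda>y. \<phi> (0, y + h) - \<phi> (0, y)) \<le> 4 * sqrt (norm h) * norm (cls \<phi>)"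
proof -
  show "norm2 lborel (\<lambda>y. \<phi> (0, y)) \<le> 2 * norm (cls \<phi>)"
  proof (rule power2_le_imp_le)
    have "(norm2 lborel (\<lambda>y. \<phi> (0, y)))\<^sup>2 \<le> 2 * (norm (cls \<phi>))\<^sup>2"
      using boundary_values_bound[OF t] by (simp add: norm_sobolev_square norm2_grad_cls_test[OF t])
    also have "\<dots> \<le> (2 * norm (cls \<phi>))\<^sup>2" by (simp add: power_mult_distrib)
    finally show "(norm2 lborel (\<lambda>y. \<phi> (0, y)))\<^sup>2 \<le> (2 * norm (cls \<phi>))\<^sup>2" .
  qed simp
  have "(norm2 lborel (\<lambda>y. \<phi> (0, y + h) - \<phi> (0, y)))\<^sup>2 \<le> 12 * norm h * (norm2 half_measure (grad (cls \<phi>)))\<^sup>2"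
    using boundary_increment_bound[OF t, of h] by (simp add: norm2_grad_cls_test[OF t])
  also have "\<dots> \<le> 16 * norm h * (norm (cls \<phi>))\<^sup>2"
    by (intro mult_mono power_mono norm2_grad_le) auto
  also have "\<dots> = (4 * sqrt (norm h) * norm (cls \<phi>))\<^sup>2" by (simp add: power_mult_distrib)
  finally show "norm2 lborel (\<lambda>y. \<phi> (0, y + h) - \<phi> (0, y)) \<le> 4 * sqrt (norm h) * norm (cls \<phi>)"
    by (rule power2_le_imp_le) simp
qed

lemma test_function_diff: "\<phi> \<in> test_functions \<Omega> \<Longrightarrow> \<psi> \<in> test_functions \<Omega> \<Longrightarrow> (\<lambda>z. \<phi> z - \<psi> z) \<in> test_functions \<Omega>"
  using test_function_add[OF _ test_function_uminus, of \<phi> \<Omega> \<psi>] by simp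

lemma boundary_norm_diff_le:
  assumes "\<phi> \<in> test_functions UNIV" "\<psi> \<in> test_functions UNIV"
  shows "norm2 lborel (\<lambda>y. \<phi> (0, y) - \<psi> (0, y)) \<le> 2 * norm (cls \<phi> - cls \<psi>)"
  using boundary_norm_le(1)[OF test_function_diff[OF assms]] by (simp add: cls_diff test_function_H1 assms)

lemma is_trace_iff:
  fixes u :: "real \<times> (real ^ 'n) \<Rightarrow> real"
  assumes u: "u \<in> H1"
  shows "is_trace u v \<longleftrightarrow> v \<in> L2 lborel \<and>
     (\<exists>\<phi>. (\<forall>k. \<phi> k \<in> test_functions UNIV) \<and> (\<lambda>k. cls (\<phi> k)) \<longlonglongrightarrow> cls u \<and>
       (\<lambda>k. norm2 lborel (\<lambda>y. \<phi> k (0, y) - v y)) \<longlonglongrightarrow> 0)"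
proof -
  let ?d = "\<lambda>\<phi> k. norm2 lborel (\<lambda>y. \<phi> k (0, y) - v y)"
    and ?i = "\<lambda>\<phi> k. \<integral>y. (\<phi> k (0, y) - v y)\<^sup>2 \<partial>lborel"
  have 1: "(\<lambda>k. H1_norm (\<lambda>z. \<phi> k z - u z)) \<longlonglongrightarrow> 0 \<longleftrightarrow> (\<lambda>k. cls (\<phi> k)) \<longlonglongrightarrow> cls u"
    if t: "\<forall>k::nat. \<phi> k \<in> test_functions UNIV" for \<phi>
  proof -
    have "H1_norm (\<lambda>z. \<phi> k z - u z) = norm (cls (\<phi> k) - cls u)" for k
      using t u by (simp add: H1_norm_eq H1_diff cls_diff test_function_H1)
    then show ?thesis by (simp add: tendsto_norm_zero_iff LIM_zero_iff)
  qed
  have 2: "?i \<phi> \<longlonglongrightarrow> 0 \<longleftrightarrow> ?d \<phi> \<longlonglongrightarrow> 0"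
    for \<phi> :: "nat \<Rightarrow> real \<times> (real ^ 'n) \<Rightarrow> real"
  proof
    assume "?i \<phi> \<longlonglongrightarrow> 0"
    from tendsto_real_sqrt[OF this] show "?d \<phi> \<longlonglongrightarrow> 0" by (simp add: norm2_def)
  next
    assume "?d \<phi> \<longlonglongrightarrow> 0"
    from tendsto_power[OF this, of 2] show "?i \<phi> \<longlonglongrightarrow> 0"
      by (simp add: norm2_square_real)
  qed
  show ?thesis
  proof
    assume "is_trace u v"
    then obtain \<phi> where "v \<in> L2 lborel" "\<forall>k. \<phi> k \<in> test_functions UNIV"
      "(\<lambda>k. H1_norm (\<lambda>z. \<phi> k z - u z)) \<longlonglongrightarrow> 0" "?i \<phi> \<longlonglongrightarrow> 0"
      unfolding is_trace_def by blast
    then show "v \<in> L2 lborel \<and> (\<exists>\<phi>. (\<forall>k. \<phi> k \<in> test_functions UNIV) \<and> (\<lambda>k. cls (\<phi> k)) \<longlonglongrightarrow> cls u \<and>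
       ?d \<phi> \<longlonglongrightarrow> 0)"
      using 1[of \<phi>] 2[of \<phi>] by (intro conjI exI[of _ \<phi>]) simp_all
  next
    assume "v \<in> L2 lborel \<and> (\<exists>\<phi>. (\<forall>k. \<phi> k \<in> test_functions UNIV) \<and> (\<lambda>k. cls (\<phi> k)) \<longlonglongrightarrow> cls u \<and>
       ?d \<phi> \<longlonglongrightarrow> 0)"
    then obtain \<phi> where "v \<in> L2 lborel" "\<forall>k. \<phi> k \<in> test_functions UNIV" "(\<lambda>k. cls (\<phi> k)) \<longlonglongrightarrow> cls u"
      "?d \<phi> \<longlonglongrightarrow> 0" by blast
    then show "is_trace u v" unfolding is_trace_def
      using u 1[of \<phi>] 2[of \<phi>] by (intro conjI exI[of _ \<phi>]) simp_all
  qed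
qed

lemma trace_exists:
  assumes u: "u \<in> H1"
  shows "\<exists>v. is_trace u v"
proof -
  obtain \<phi> where t: "\<And>k. \<phi> k \<in> test_functions UNIV" and lim: "(\<lambda>k. cls (\<phi> k)) \<longlonglongrightarrow> cls u"
    using test_functions_dense_seq[of "cls u"] by blast
  have "\<exists>v\<in>L2 lborel. (\<lambda>k. norm2 lborel (\<lambda>y. \<phi> k (0, y) - v y)) \<longlonglongrightarrow> 0"
  proof (rule L2_complete[OF boundary_restriction_L2[OF t]])
    fix e :: real assume "e > 0"
    then obtain K where K: "\<And>m n. m \<ge> K \<Longrightarrow> n \<ge> K \<Longrightarrow> dist (cls (\<phi> m)) (cls (\<phi> n)) < e / 2"
      using metric_CauchyD[OF LIMSEQ_imp_Cauchy[OF lim], of "e/2"] by auto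
    have "norm2 lborel (\<lambda>y. \<phi> m (0, y) - \<phi> n (0, y)) < e" if "m \<ge> K" "n \<ge> K" for m n
      using K[OF that] boundary_norm_diff_le[OF t t, of m n] by (simp add: dist_norm)
    then show "\<exists>K. \<forall>m\<ge>K. \<forall>n\<ge>K. norm2 lborel (\<lambda>y. \<phi> m (0, y) - \<phi> n (0, y)) < e" by blast
  qed
  then show ?thesis unfolding is_trace_iff[OF u] using t lim by blast
qed

lemma trace_unique:
  assumes u: "u \<in> H1" "u' \<in> H1" and eq: "cls u = cls u'" and v: "is_trace u v" "is_trace u' v'"
  shows "AE y in lborel. v y = v' y"
proof -
  obtain \<phi> where \<phi>: "\<And>k. \<phi> k \<in> test_functions UNIV" "(\<lambda>k. cls (\<phi> k)) \<longlonglongrightarrow> cls u"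
    "(\<lambda>k. norm2 lborel (\<lambda>y. \<phi> k (0, y) - v y)) \<longlonglongrightarrow> 0" and vL: "v \<in> L2 lborel"
    using v(1) unfolding is_trace_iff[OF u(1)] by blast
  obtain \<psi> where \<psi>: "\<And>k. \<psi> k \<in> test_functions UNIV" "(\<lambda>k. cls (\<psi> k)) \<longlonglongrightarrow> cls u'"
    "(\<lambda>k. norm2 lborel (\<lambda>y. \<psi> k (0, y) - v' y)) \<longlonglongrightarrow> 0" and vL': "v' \<in> L2 lborel"
    using v(2) unfolding is_trace_iff[OF u(2)] by blast
  note bL = boundary_restriction_L2[OF \<phi>(1)] boundary_restriction_L2[OF \<psi>(1)]
  have "(\<lambda>k. norm2 lborel (\<lambda>y. \<phi> k (0, y) - v y) + 2 * norm (cls (\<phi> k) - cls (\<psi> k))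
      + norm2 lborel (\<lambda>y. \<psi> k (0, y) - v' y)) \<longlonglongrightarrow> 0 + 2 * norm (cls u - cls u') + 0"
    by (intro tendsto_intros \<phi> \<psi>)
  then have "(\<lambda>k. norm2 lborel (\<lambda>y. \<phi> k (0, y) - v y) + 2 * norm (cls (\<phi> k) - cls (\<psi> k))
      + norm2 lborel (\<lambda>y. \<psi> k (0, y) - v' y)) \<longlonglongrightarrow> 0" using eq by simp
  moreover have "norm2 lborel (\<lambda>y. v y - v' y) \<le> norm2 lborel (\<lambda>y. \<phi> k (0, y) - v y)
      + 2 * norm (cls (\<phi> k) - cls (\<psi> k)) + norm2 lborel (\<lambda>y. \<psi> k (0, y) - v' y)" for k
    using norm2_triangle_diff[OF vL bL(1)[of k] vL'] norm2_triangle_diff[OF bL(1)[of k] bL(2)[of k] vL']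
      boundary_norm_diff_le[OF \<phi>(1) \<psi>(1), of k k] norm2_diff_commute[of lborel v "\<lambda>y. \<phi> k (0, y)"] by linarith
  ultimately have "norm2 lborel (\<lambda>y. v y - v' y) \<le> 0"
    by (intro LIMSEQ_le_const) auto
  then have "norm2 lborel (\<lambda>y. v y - v' y) = 0" by (simp add: order_antisym)
  from norm2_eq_0_imp_AE[OF L2_diff[OF vL vL'] this] show ?thesis by simp
qed

abbreviation tr :: "'n::finite sobolev \<Rightarrow> real ^ 'n \<Rightarrow> real" where
  "tr x \<equiv> trace_op (fn x)"

lemma is_trace_trace_op:
  assumes u: "u \<in> H1" shows "is_trace u (trace_op u)"
proof -
  obtain v where "is_trace u v" using trace_exists[OF u] by blast
  then show ?thesis unfolding trace_op_def by (rule someI[of "is_trace u"])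
qed

lemma tr_cls: "u \<in> H1 \<Longrightarrow> AE y in lborel. trace_op u y = tr (cls u) y"
  for u :: "real \<times> (real ^ 'n) \<Rightarrow> real"
  by (intro trace_unique[of u "fn (cls u)"] is_trace_trace_op fn_H1) (simp_all add: cls_fn)

lemma tr_L2 [simp]: "tr x \<in> L2 lborel"
  using is_trace_trace_op[OF fn_H1[of x]] by (simp add: is_trace_def)

lemma tr_approx:
  obtains \<phi> where "\<And>k. \<phi> k \<in> test_functions UNIV" "(\<lambda>k. cls (\<phi> k)) \<longlonglongrightarrow> x"
    "(\<lambda>k. norm2 lborel (\<lambda>y. \<phi> k (0, y) - tr x y)) \<longlonglongrightarrow> 0"
  using is_trace_trace_op[OF fn_H1[of x]] unfolding is_trace_iff[OF fn_H1[of x]] cls_fn by blast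

lemma norm2_tr_le: "norm2 lborel (tr x) \<le> 2 * norm x"
  and norm2_tr_increment_le: "norm2 lborel (\<lambda>y. tr x (y + h) - tr x y) \<le> 4 * sqrt (norm h) * norm x"
  for x :: "'n::finite sobolev"
proof -
  obtain \<phi> where \<phi>: "\<And>k. \<phi> k \<in> test_functions UNIV" "(\<lambda>k. cls (\<phi> k)) \<longlonglongrightarrow> x"
    "(\<lambda>k. norm2 lborel (\<lambda>y. \<phi> k (0, y) - tr x y)) \<longlonglongrightarrow> 0" by (rule tr_approx[of x]) blast
  note bL = boundary_restriction_L2[OF \<phi>(1)]
  show "norm2 lborel (tr x) \<le> 2 * norm x"
  proof (rule LIMSEQ_le)
    show "(\<lambda>k. norm2 lborel (\<lambda>y. \<phi> k (0, y))) \<longlonglongrightarrow> norm2 lborel (tr x)" by (rule norm2_tendsto[OF bL tr_L2 \<phi>(3)])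
    show "(\<lambda>k. 2 * norm (cls (\<phi> k))) \<longlonglongrightarrow> 2 * norm x" by (intro tendsto_intros \<phi>)
  qed (use boundary_norm_le(1)[OF \<phi>(1)] in blast)
  have dL: "(\<lambda>y. f (y + h) - f y) \<in> L2 lborel" if "f \<in> L2 lborel" for f :: "real ^ 'n \<Rightarrow> real"
    using that by (intro L2_diff L2_translate)
  show "norm2 lborel (\<lambda>y. tr x (y + h) - tr x y) \<le> 4 * sqrt (norm h) * norm x"
  proof (rule LIMSEQ_le)
    show "(\<lambda>k. norm2 lborel (\<lambda>y. \<phi> k (0, y + h) - \<phi> k (0, y))) \<longlonglongrightarrow> norm2 lborel (\<lambda>y. tr x (y + h) - tr x y)"
    proof (rule norm2_tendsto[OF dL[OF bL] dL[OF tr_L2]], rule Lim_null_comparison[OF always_eventually[OF allI]])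
      show "(\<lambda>k. norm2 lborel (\<lambda>y. \<phi> k (0, y) - tr x y) + norm2 lborel (\<lambda>y. \<phi> k (0, y) - tr x y)) \<longlonglongrightarrow> 0"
        using tendsto_add[OF \<phi>(3) \<phi>(3)] by simp
      fix k
      let ?d = "\<lambda>y. \<phi> k (0, y) - tr x y"
      have d: "?d \<in> L2 lborel" by (intro L2_diff bL tr_L2)
      have "norm2 lborel (\<lambda>y. ?d (y + h) + - ?d y) \<le> norm2 lborel (\<lambda>y. ?d (y + h)) + norm2 lborel (\<lambda>y. - ?d y)"
        by (intro norm2_triangle L2_translate L2_uminus d)
      moreover have "norm2 lborel (\<lambda>y. ?d (y + h)) = norm2 lborel ?d"
        using L2_measurable[OF d] by (intro norm2_translate) simp
      moreover have "norm2 lborel (\<lambda>y. - ?d y) = norm2 lborel ?d" by (rule norm2_uminus)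
      moreover have "(\<lambda>y. ?d (y + h) + - ?d y) = (\<lambda>y. \<phi> k (0, y + h) - \<phi> k (0, y) - (tr x (y + h) - tr x y))"
        by (rule ext) simp
      ultimately show "norm (norm2 lborel (\<lambda>y. \<phi> k (0, y + h) - \<phi> k (0, y) - (tr x (y + h) - tr x y)))
         \<le> norm2 lborel ?d + norm2 lborel ?d" by simp
    qed
    show "(\<lambda>k. 4 * sqrt (norm h) * norm (cls (\<phi> k))) \<longlonglongrightarrow> 4 * sqrt (norm h) * norm x" by (intro tendsto_intros \<phi>)
  qed (use boundary_norm_le(2)[OF \<phi>(1)] in blast)
qed

lemma tr_eqI:
  fixes x :: "'n::finite sobolev"
  assumes v: "v \<in> L2 lborel" and t: "\<And>k. \<phi> k \<in> test_functions UNIV" and lim: "(\<lambda>k. cls (\<phi> k)) \<longlonglongrightarrow> x"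
    and blim: "(\<lambda>k. norm2 lborel (\<lambda>y. \<phi> k (0, y) - v y)) \<longlonglongrightarrow> 0"
  shows "AE y in lborel. tr x y = v y"
proof -
  have "is_trace (fn x) v" unfolding is_trace_iff[OF fn_H1] cls_fn using assms by blast
  then show ?thesis by (intro trace_unique[OF fn_H1 fn_H1 refl is_trace_trace_op[OF fn_H1]])
qed

lemma tr_test_function: "\<phi> \<in> test_functions UNIV \<Longrightarrow> AE y in lborel. tr (cls \<phi>) y = \<phi> (0, y)"
  by (rule tr_eqI[where \<phi>="\<lambda>_. \<phi>"]) (auto simp: boundary_restriction_L2 norm2_def)

lemma cls_lincomb: "u \<in> H1 \<Longrightarrow> v \<in> H1 \<Longrightarrow> cls (\<lambda>z. u z + c * v z) = cls u + c *\<^sub>R cls v"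
  for u v :: "real \<times> (real ^ 'n) \<Rightarrow> real"
proof -
  assume u: "u \<in> H1" and v: "v \<in> H1"
  show ?thesis
    by (rule sobolev_eqI)
      (use fn_cls[OF H1_lincomb(1)[OF u v, of c]] fn_lincomb(2)[of "cls u" "c *\<^sub>R cls v"] fn_lincomb(5)[of c "cls v"] fn_cls[OF u] fn_cls[OF v]
        in eventually_elim, simp)
qed

lemma tr_lincomb: "AE y in lborel. tr (x + c *\<^sub>R w) y = tr x y + c * tr w y"
  for x w :: "'n::finite sobolev"
proof -
  obtain \<phi> where \<phi>: "\<And>k. \<phi> k \<in> test_functions UNIV" "(\<lambda>k. cls (\<phi> k)) \<longlonglongrightarrow> x"
    "(\<lambda>k. norm2 lborel (\<lambda>y. \<phi> k (0, y) - tr x y)) \<longlonglongrightarrow> 0" by (rule tr_approx[of x]) blast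
  obtain \<psi> where \<psi>: "\<And>k. \<psi> k \<in> test_functions UNIV" "(\<lambda>k. cls (\<psi> k)) \<longlonglongrightarrow> w"
    "(\<lambda>k. norm2 lborel (\<lambda>y. \<psi> k (0, y) - tr w y)) \<longlonglongrightarrow> 0" by (rule tr_approx[of w]) blast
  show ?thesis
  proof (rule tr_eqI[where \<phi>="\<lambda>k z. \<phi> k z + c * \<psi> k z"])
    show "(\<lambda>y. tr x y + c * tr w y) \<in> L2 lborel" by (intro L2_add L2_cmult tr_L2)
    show "(\<lambda>z. \<phi> k z + c * \<psi> k z) \<in> test_functions UNIV" for k
      by (intro test_function_add test_function_cmult \<phi> \<psi>)
    show "(\<lambda>k. cls (\<lambda>z. \<phi> k z + c * \<psi> k z)) \<longlonglongrightarrow> x + c *\<^sub>R w"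
      unfolding cls_lincomb[OF test_function_H1[OF \<phi>(1)] test_function_H1[OF \<psi>(1)]] by (intro tendsto_intros \<phi> \<psi>)
    show "(\<lambda>k. norm2 lborel (\<lambda>y. \<phi> k (0, y) + c * \<psi> k (0, y) - (tr x y + c * tr w y))) \<longlonglongrightarrow> 0"
    proof (rule Lim_null_comparison[OF always_eventually[OF allI]])
      show "(\<lambda>k. norm2 lborel (\<lambda>y. \<phi> k (0, y) - tr x y) + \<bar>c\<bar> * norm2 lborel (\<lambda>y. \<psi> k (0, y) - tr w y)) \<longlonglongrightarrow> 0"
        using tendsto_add[OF \<phi>(3) tendsto_mult[OF tendsto_const[of "\<bar>c\<bar>"] \<psi>(3)]] by simp
      fix k
      have "norm2 lborel (\<lambda>y. (\<phi> k (0, y) - tr x y) + c * (\<psi> k (0, y) - tr w y))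
        \<le> norm2 lborel (\<lambda>y. \<phi> k (0, y) - tr x y) + norm2 lborel (\<lambda>y. c * (\<psi> k (0, y) - tr w y))"
        by (intro norm2_triangle L2_cmult L2_diff tr_L2 boundary_restriction_L2 \<phi> \<psi>)
      also have "norm2 lborel (\<lambda>y. c * (\<psi> k (0, y) - tr w y)) = \<bar>c\<bar> * norm2 lborel (\<lambda>y. \<psi> k (0, y) - tr w y)"
        by (rule norm2_cmult)
      also have "(\<lambda>y. (\<phi> k (0, y) - tr x y) + c * (\<psi> k (0, y) - tr w y)) = (\<lambda>y. \<phi> k (0, y) + c * \<psi> k (0, y) - (tr x y + c * tr w y))"
        by (rule ext) (simp add: algebra_simps)
      finally show "norm (norm2 lborel (\<lambda>y. \<phi> k (0, y) + c * \<psi> k (0, y) - (tr x y + c * tr w y)))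
        \<le> norm2 lborel (\<lambda>y. \<phi> k (0, y) - tr x y) + \<bar>c\<bar> * norm2 lborel (\<lambda>y. \<psi> k (0, y) - tr w y)" by simp
    qed
  qed
qed

lemma tr_add: "AE y in lborel. tr (x + w) y = tr x y + tr w y"
  and tr_diff: "AE y in lborel. tr (x - w) y = tr x y - tr w y"
  and tr_scaleR: "AE y in lborel. tr (c *\<^sub>R w) y = c * tr w y"
  for x w :: "'n::finite sobolev"
proof -
  show "AE y in lborel. tr (x + w) y = tr x y + tr w y" using tr_lincomb[of x 1 w] by simp
  show "AE y in lborel. tr (x - w) y = tr x y - tr w y" using tr_lincomb[of x "-1" w] by simp
  have "norm2 lborel (tr (0::'n sobolev)) = 0" using norm2_tr_le[of "0::'n sobolev"] by (simp add: order_antisym)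
  from norm2_eq_0_imp_AE[OF tr_L2 this] tr_lincomb[of 0 c w]
  show "AE y in lborel. tr (c *\<^sub>R w) y = c * tr w y" by eventually_elim simp
qed

section \<open>Functions with half a derivative in the mean square\<close>

text \<open>A bounded set of the Besov space \<open>B\<^sup>1\<^sup>/\<^sup>2\<close> with indices \<open>2\<close> and \<open>\<infinity>\<close>. It contains the traces of bounded sets
  and is described by translations alone.\<close>

definition half_smooth :: "real \<Rightarrow> ('a::euclidean_space \<Rightarrow> real) set" where
  "half_smooth A = {v \<in> L2 lborel. norm2 lborel v \<le> A \<and>
     (\<forall>h. norm2 lborel (\<lambda>z. v (z + h) - v z) \<le> A * sqrt (norm h))}"

definition cube_kernel :: "real \<Rightarrow> 'a::euclidean_space \<Rightarrow> real" where
  "cube_kernel \<epsilon> w = indicator (cbox 0 (\<epsilon> *\<^sub>R One)) w / \<epsilon> ^ DIM('a)"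

lemma half_smooth_L2: "v \<in> half_smooth A \<Longrightarrow> v \<in> L2 lborel"
  by (simp add: half_smooth_def)

lemma half_smooth_nonneg: "v \<in> half_smooth A \<Longrightarrow> 0 \<le> A"
  using order_trans[OF norm2_nonneg] by (force simp: half_smooth_def)

lemma measure_cube: "\<epsilon> > 0 \<Longrightarrow> measure lborel (cbox (0::'a::euclidean_space) (\<epsilon> *\<^sub>R One)) = \<epsilon> ^ DIM('a)"
  by (simp add: measure_lborel_cbox_eq inner_sum_left_Basis)

lemma cube_kernel_averaging:
  assumes e: "\<epsilon> > 0"
  shows "averaging_kernel (cube_kernel \<epsilon> :: 'a::euclidean_space \<Rightarrow> real) (1 / \<epsilon> ^ DIM('a))"
proof
  show "(cube_kernel \<epsilon> :: 'a \<Rightarrow> real) \<in> borel_measurable borel"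
    unfolding cube_kernel_def[abs_def] by measurable
  show "0 \<le> cube_kernel \<epsilon> w" "cube_kernel \<epsilon> w \<le> 1 / \<epsilon> ^ DIM('a)" for w :: 'a
    using e by (auto simp: cube_kernel_def indicator_def)
  have i: "integrable lborel (indicator (cbox (0::'a) (\<epsilon> *\<^sub>R One)) :: 'a \<Rightarrow> real)"
    by (rule integrable_real_indicator, simp, rule emeasure_lborel_cbox_finite)
  then show "integrable lborel (cube_kernel \<epsilon> :: 'a \<Rightarrow> real)" unfolding cube_kernel_def[abs_def] by simp
  have "(\<integral>w. cube_kernel \<epsilon> w \<partial>(lborel :: 'a measure)) = measure lborel (cbox (0::'a) (\<epsilon> *\<^sub>R One)) / \<epsilon> ^ DIM('a)"
    unfolding cube_kernel_def by simp
  then show "(\<integral>w. cube_kernel \<epsilon> w \<partial>(lborel :: 'a measure)) = 1" using e by (simp add: measure_cube)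
qed

lemma norm_le_cube:
  fixes w :: "'a::euclidean_space"
  assumes "w \<in> cbox 0 (\<epsilon> *\<^sub>R One)"
  shows "norm w \<le> real DIM('a) * \<epsilon>"
proof -
  have "norm w \<le> (\<Sum>b\<in>Basis. \<bar>w \<bullet> b\<bar>)" by (rule norm_le_l1)
  also have "\<dots> \<le> (\<Sum>b\<in>(Basis::'a set). \<epsilon>)"
    using assms by (intro sum_mono) (fastforce simp: mem_box inner_simps inner_sum_left_Basis)
  finally show ?thesis by simp
qed

lemma norm2_cube_average_diff:
  fixes v :: "'a::euclidean_space \<Rightarrow> real"
  assumes v: "v \<in> half_smooth A" and e: "\<epsilon> > 0"
  shows "(\<lambda>z. average (cube_kernel \<epsilon>) v z - v z) \<in> L2 lborel"
    "norm2 lborel (\<lambda>z. average (cube_kernel \<epsilon>) v z - v z) \<le> A * sqrt (real DIM('a) * \<epsilon>)"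
proof -
  have A: "A \<ge> 0" by (rule half_smooth_nonneg[OF v])
  have le: "norm2 lborel (\<lambda>z. v (z + w) - v z) \<le> A * sqrt (real DIM('a) * \<epsilon>)" if "cube_kernel \<epsilon> w \<noteq> 0" for w
  proof -
    have "w \<in> cbox 0 (\<epsilon> *\<^sub>R One)" using that by (simp add: cube_kernel_def indicator_def split: if_splits)
    then have "norm w \<le> real DIM('a) * \<epsilon>" by (rule norm_le_cube)
    then have "A * sqrt (norm w) \<le> A * sqrt (real DIM('a) * \<epsilon>)" using A by (intro mult_left_mono) auto
    then show ?thesis using v unfolding half_smooth_def by (auto intro: order_trans)
  qed
  have nn: "0 \<le> A * sqrt (real DIM('a) * \<epsilon>)" using A e by simp
  show "(\<lambda>z. average (cube_kernel \<epsilon>) v z - v z) \<in> L2 lborel"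
    "norm2 lborel (\<lambda>z. average (cube_kernel \<epsilon>) v z - v z) \<le> A * sqrt (real DIM('a) * \<epsilon>)"
    using averaging_kernel.norm2_average_diff[OF cube_kernel_averaging[OF e] half_smooth_L2[OF v] nn le] by auto
qed

subsection \<open>Level sets\<close>

text \<open>Where \<open>\<bar>v\<bar> > \<tau>\<close> the function differs from its average by at least \<open>\<tau> / 2\<close>, so Chebyshev's inequality
  applies to the difference.\<close>

lemma level_set_measure_le:
  fixes v :: "'a::euclidean_space \<Rightarrow> real"
  assumes v: "v \<in> half_smooth A" and e: "\<epsilon> > 0" and l: "\<tau> > 0"
    and avg: "\<And>z. \<bar>average (cube_kernel \<epsilon>) v z\<bar> \<le> \<tau> / 2"
  shows "emeasure lborel {z. \<bar>v z\<bar> > \<tau>} \<le> ennreal (4 * A\<^sup>2 * real DIM('a) * \<epsilon> / \<tau>\<^sup>2)"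
proof -
  have [measurable]: "v \<in> borel_measurable borel" using L2_measurable[OF half_smooth_L2[OF v]] by simp
  let ?d = "\<lambda>z. average (cube_kernel \<epsilon>) v z - v z"
  note d = norm2_cube_average_diff[OF v e]
  have [measurable]: "?d \<in> borel_measurable borel" using L2_measurable[OF d(1)] by simp
  have S: "{z. \<bar>v z\<bar> > \<tau>} \<in> sets lborel" by measurable
  have "emeasure lborel {z. \<bar>v z\<bar> > \<tau>} = (\<integral>\<^sup>+z. indicator {z. \<bar>v z\<bar> > \<tau>} z \<partial>lborel)"
    using S by simp
  also have "\<dots> \<le> (\<integral>\<^sup>+z. ennreal (4 / \<tau>\<^sup>2) * ennreal ((norm (?d z))\<^sup>2) \<partial>lborel)"
  proof (rule nn_integral_mono)
    fix z
    show "indicator {z. \<bar>v z\<bar> > \<tau>} z \<le> ennreal (4 / \<tau>\<^sup>2) * ennreal ((norm (?d z))\<^sup>2)"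
    proof (cases "\<bar>v z\<bar> > \<tau>")
      case True
      then have "\<tau> / 2 \<le> \<bar>?d z\<bar>" using avg[of z] by linarith
      then have "(\<tau> / 2)\<^sup>2 \<le> \<bar>?d z\<bar>\<^sup>2" using l by (intro power_mono) auto
      then have "1 \<le> 4 / \<tau>\<^sup>2 * (norm (?d z))\<^sup>2" using l by (simp add: field_simps power_divide)
      then show ?thesis using True by (simp add: ennreal_mult[symmetric])
    qed simp
  qed
  also have "\<dots> = ennreal (4 / \<tau>\<^sup>2) * ennreal ((norm2 lborel ?d)\<^sup>2)"
    unfolding ennreal_norm2_square[OF d(1)] by (rule nn_integral_cmult) measurable
  also have "\<dots> \<le> ennreal (4 / \<tau>\<^sup>2) * ennreal ((A * sqrt (real DIM('a) * \<epsilon>))\<^sup>2)"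
    using d(2) by (intro mult_left_mono ennreal_leI power_mono) auto
  also have "\<dots> = ennreal (4 * A\<^sup>2 * real DIM('a) * \<epsilon> / \<tau>\<^sup>2)"
    using e by (subst ennreal_mult[symmetric]) (auto simp: power_mult_distrib field_simps)
  finally show ?thesis .
qed

lemma nn_integral_mult_translate_le:
  fixes F :: "'a::euclidean_space \<Rightarrow> ennreal"
  assumes [measurable]: "F \<in> borel_measurable borel" and e: "\<epsilon> > 0"
  shows "(\<integral>\<^sup>+w. ennreal (cube_kernel \<epsilon> w) * F (z + w) \<partial>lborel) \<le> ennreal (1 / \<epsilon> ^ DIM('a)) * (\<integral>\<^sup>+w. F w \<partial>lborel)"
proof -
  have "(\<integral>\<^sup>+w. ennreal (cube_kernel \<epsilon> w) * F (z + w) \<partial>lborel) \<le> (\<integral>\<^sup>+w. ennreal (1 / \<epsilon> ^ DIM('a)) * F (z + w) \<partial>lborel)"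
    using averaging_kernel.bounded[OF cube_kernel_averaging[OF e]] by (intro nn_integral_mono mult_right_mono ennreal_leI) auto
  also have "\<dots> = ennreal (1 / \<epsilon> ^ DIM('a)) * (\<integral>\<^sup>+w. F (z + w) \<partial>lborel)"
    by (rule nn_integral_cmult) measurable
  also have "(\<integral>\<^sup>+w. F (z + w) \<partial>lborel) = (\<integral>\<^sup>+w. F w \<partial>lborel)"
    using nn_integral_translate[of F z] by (simp add: add.commute)
  finally show ?thesis .
qed

text \<open>The bound \<open>\<bar>t\<bar> \<le> a + a\<^sup>1\<^sup>-\<^sup>q \<bar>t\<bar>\<^sup>q\<close> turns the hypothesis on the \<open>q\<close>-th powers into a bound for averages.\<close>

lemma cube_average_bound:
  fixes v :: "'a::euclidean_space \<Rightarrow> real"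
  assumes v: "v \<in> L2 lborel" and e: "\<epsilon> > 0" and a: "a > 0" and q: "q \<ge> 1"
    and C: "(\<integral>\<^sup>+z. ennreal (\<bar>v z\<bar> powr q) \<partial>lborel) \<le> ennreal C" "C = a powr q * \<epsilon> ^ DIM('a)"
  shows "\<bar>average (cube_kernel \<epsilon>) v z\<bar> \<le> 2 * a"
proof -
  interpret averaging_kernel "cube_kernel \<epsilon> :: 'a \<Rightarrow> real" "1 / \<epsilon> ^ DIM('a)" by (rule cube_kernel_averaging[OF e])
  have [measurable]: "v \<in> borel_measurable borel" using L2_measurable[OF v] by simp
  have vz: "(\<lambda>w. \<bar>v (z + w)\<bar>) \<in> L2 lborel"
    using L2_norm[OF L2_translate[OF v, of z]] by (simp add: add.commute)
  have pt: "\<bar>t\<bar> \<le> a + a powr (1 - q) * \<bar>t\<bar> powr q" for t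
  proof (cases "\<bar>t\<bar> \<le> a")
    case False
    then have "\<bar>t\<bar> = \<bar>t\<bar> powr (1 - q) * \<bar>t\<bar> powr q" using a by (simp add: powr_add[symmetric])
    also have "\<dots> \<le> a powr (1 - q) * \<bar>t\<bar> powr q"
      using False a q by (intro mult_right_mono powr_mono2') auto
    finally show ?thesis using a by simp
  qed (use a in \<open>simp add: add_increasing2\<close>)
  define I where "I = (\<integral>w. cube_kernel \<epsilon> w * \<bar>v (z + w)\<bar> \<partial>lborel)"
  have le_I: "\<bar>average (cube_kernel \<epsilon>) v z\<bar> \<le> I"
    unfolding average_def I_def using integral_abs_bound[of lborel "\<lambda>w. cube_kernel \<epsilon> w * v (z + w)"] nonneg by (simp add: abs_mult)
  have "ennreal I = (\<integral>\<^sup>+w. ennreal (cube_kernel \<epsilon> w * \<bar>v (z + w)\<bar>) \<partial>lborel)"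
    unfolding I_def using integrable_mult(1)[OF vz] nonneg by (intro nn_integral_eq_integral[symmetric]) auto
  also have "\<dots> \<le> (\<integral>\<^sup>+w. ennreal a * ennreal (cube_kernel \<epsilon> w)
      + ennreal (a powr (1 - q)) * (ennreal (cube_kernel \<epsilon> w) * ennreal (\<bar>v (z + w)\<bar> powr q)) \<partial>lborel)"
  proof (rule nn_integral_mono)
    fix w
    have "cube_kernel \<epsilon> w * \<bar>v (z + w)\<bar> \<le> a * cube_kernel \<epsilon> w + a powr (1 - q) * (cube_kernel \<epsilon> w * \<bar>v (z + w)\<bar> powr q)"
      using mult_left_mono[OF pt[of "v (z + w)"] nonneg[of w]] by (simp add: algebra_simps)
    then have "ennreal (cube_kernel \<epsilon> w * \<bar>v (z + w)\<bar>)
      \<le> ennreal (a * cube_kernel \<epsilon> w + a powr (1 - q) * (cube_kernel \<epsilon> w * \<bar>v (z + w)\<bar> powr q))" by (rule ennreal_leI)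
    then show "ennreal (cube_kernel \<epsilon> w * \<bar>v (z + w)\<bar>) \<le> ennreal a * ennreal (cube_kernel \<epsilon> w)
      + ennreal (a powr (1 - q)) * (ennreal (cube_kernel \<epsilon> w) * ennreal (\<bar>v (z + w)\<bar> powr q))"
      using a nonneg[of w] by (simp add: ennreal_mult)
  qed
  also have "\<dots> = ennreal a * (\<integral>\<^sup>+w. ennreal (cube_kernel \<epsilon> w) \<partial>(lborel :: 'a measure))
      + ennreal (a powr (1 - q)) * (\<integral>\<^sup>+w. ennreal (cube_kernel \<epsilon> w) * ennreal (\<bar>v (z + w)\<bar> powr q) \<partial>lborel)"
    by (subst nn_integral_add) (auto simp: nn_integral_cmult)
  also have "(\<integral>\<^sup>+w. ennreal (cube_kernel \<epsilon> w) \<partial>(lborel :: 'a measure)) = 1"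
    using nn_integral_eq_integral[OF integrable] nonneg integral by simp
  also have "ennreal (a powr (1 - q)) * (\<integral>\<^sup>+w. ennreal (cube_kernel \<epsilon> w) * ennreal (\<bar>v (z + w)\<bar> powr q) \<partial>lborel)
      \<le> ennreal (a powr (1 - q)) * (ennreal (1 / \<epsilon> ^ DIM('a)) * ennreal C)"
    by (intro mult_left_mono order_trans[OF nn_integral_mult_translate_le[OF _ e]] C(1)) auto
  also have "\<dots> = ennreal a"
  proof -
    have "a powr (1 - q) * (1 / \<epsilon> ^ DIM('a) * C) = a"
      using a e by (simp add: C(2) powr_add[symmetric])
    then show ?thesis using a e by (simp add: ennreal_mult[symmetric] C(2))
  qed
  finally have "ennreal I \<le> ennreal a + ennreal a" by (simp add: add_left_mono)
  also have "\<dots> = ennreal (a + a)" using a by (intro ennreal_plus[symmetric]) auto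
  finally have "I \<le> a + a" using a by (subst (asm) ennreal_le_iff) auto
  then show ?thesis using le_I by simp
qed

subsection \<open>Integrability with higher exponents\<close>

definition uniform_Lq :: "real \<Rightarrow> real \<Rightarrow> 'a::euclidean_space itself \<Rightarrow> bool" where
  "uniform_Lq A q _ \<longleftrightarrow> (\<exists>C>0. \<forall>v\<in>half_smooth A. (\<integral>\<^sup>+z. ennreal (\<bar>v (z::'a)\<bar> powr q) \<partial>lborel) \<le> ennreal C)"

lemma abs_powr_2: "\<bar>t\<bar> powr 2 = t\<^sup>2" for t :: real
  by (cases "t = 0") (auto simp: powr_numeral)

lemma uniform_Lq_2: "uniform_Lq A 2 TYPE('a::euclidean_space)"
  unfolding uniform_Lq_def
proof (intro exI[of _ "A\<^sup>2 + 1"] conjI ballI)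
  fix v :: "'a \<Rightarrow> real" assume v: "v \<in> half_smooth A"
  have "(\<integral>\<^sup>+z. ennreal (\<bar>v z\<bar> powr 2) \<partial>lborel) = ennreal ((norm2 lborel v)\<^sup>2)"
    unfolding ennreal_norm2_square[OF half_smooth_L2[OF v]] by (simp add: abs_powr_2)
  also have "\<dots> \<le> ennreal (A\<^sup>2 + 1)"
    using v power_mono[of "norm2 lborel v" A 2] by (intro ennreal_leI) (simp add: half_smooth_def)
  finally show "(\<integral>\<^sup>+z. ennreal (\<bar>v z\<bar> powr 2) \<partial>lborel) \<le> ennreal (A\<^sup>2 + 1)" .
qed (simp add: add_nonneg_pos)

lemma powr_le_dyadic_sum:
  fixes t r :: real
  assumes r: "r \<ge> 2"
  shows "ennreal (\<bar>t\<bar> powr r) \<le> ennreal (t\<^sup>2) + (\<Sum>k. ennreal (2 powr (real (Suc k) * r)) * indicator {t. \<bar>t\<bar> > 2 ^ k} t)"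
proof (cases "\<bar>t\<bar> \<le> 1")
  case True
  have "\<bar>t\<bar> powr r \<le> \<bar>t\<bar> powr 2" using True r by (intro powr_mono') auto
  then have "ennreal (\<bar>t\<bar> powr r) \<le> ennreal (t\<^sup>2)" by (simp add: abs_powr_2 ennreal_leI)
  then show ?thesis by (rule order_trans) simp
next
  case False
  obtain n where "\<bar>t\<bar> < 2 ^ n" using real_arch_pow[of 2 "\<bar>t\<bar>"] by auto
  then have ex: "\<exists>n. \<bar>t\<bar> \<le> 2 ^ n" by (auto intro: less_imp_le)
  define n where "n = (LEAST n. \<bar>t\<bar> \<le> 2 ^ n)"
  have n: "\<bar>t\<bar> \<le> 2 ^ n" unfolding n_def by (rule LeastI_ex[OF ex])
  with False obtain k where k: "n = Suc k" by (cases n) auto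
  have "\<not> \<bar>t\<bar> \<le> 2 ^ k" unfolding k[symmetric] using not_less_Least[of k "\<lambda>n. \<bar>t\<bar> \<le> 2 ^ n"] k by (auto simp: n_def[symmetric])
  then have gt: "\<bar>t\<bar> > 2 ^ k" by simp
  define g where "g k = ennreal (2 powr (real (Suc k) * r)) * indicator {t. \<bar>t\<bar> > 2 ^ k} t" for k
  have "\<bar>t\<bar> powr r \<le> (2 ^ Suc k) powr r" using n r k by (intro powr_mono2) auto
  also have "(2 ^ Suc k :: real) powr r = 2 powr (real (Suc k) * r)"
    by (simp add: powr_realpow[symmetric] powr_powr del: power_Suc of_nat_Suc)
  finally have "ennreal (\<bar>t\<bar> powr r) \<le> g k"
    using gt by (simp add: g_def ennreal_leI)
  also have "\<dots> \<le> (\<Sum>k. g k)" using sum_le_suminf[of g "{k}"] by simp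
  finally show ?thesis unfolding g_def by (rule order_trans) simp
qed

text \<open>Averages over cubes of side \<open>\<epsilon>\<close> are bounded through the \<open>q\<close>-norm and are off by \<open>\<epsilon>\<^sup>1\<^sup>/\<^sup>2\<close> in the
  mean square. The best choice of \<open>\<epsilon>\<close> shows that the level sets \<open>\<bar>v\<bar> > \<tau>\<close> have measure
  \<open>O(\<tau>\<^sup>-\<^sup>2\<^sup>-\<^sup>q\<^sup>/\<^sup>d)\<close> in dimension \<open>d\<close>.\<close>

lemma uniform_Lq_improve:
  assumes q: "q \<ge> 2" and r: "r \<ge> 2" "r < 2 + q / real DIM('a)" and A: "A > 0"
    and U: "uniform_Lq A q TYPE('a::euclidean_space)"
  shows "uniform_Lq A r TYPE('a)"
proof -
  let ?d = "real DIM('a)"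
  obtain C where C: "C > 0" "\<And>v::'a \<Rightarrow> real. v \<in> half_smooth A \<Longrightarrow> (\<integral>\<^sup>+z. ennreal (\<bar>v z\<bar> powr q) \<partial>lborel) \<le> ennreal C"
    using U unfolding uniform_Lq_def by blast
  define s where "s = 2 + q / ?d"
  define K where "K = 4 * A\<^sup>2 * ?d * (C powr (1 / ?d) * 4 powr (q / ?d))"
  have K0: "K > 0" using A C by (simp add: K_def)
  have lev: "emeasure lborel {z. \<bar>v z\<bar> > \<tau>} \<le> ennreal (K * \<tau> powr (- s))"
    if v: "v \<in> half_smooth A" and l: "\<tau> > 0" for v :: "'a \<Rightarrow> real" and \<tau>
  proof -
    define a where "a = \<tau> / 4"
    have a: "a > 0" using l by (simp add: a_def)
    define \<epsilon> where "\<epsilon> = (C * a powr (- q)) powr (1 / ?d)"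
    have \<epsilon>: "\<epsilon> > 0" using C a by (simp add: \<epsilon>_def)
    have "\<epsilon> ^ DIM('a) = C * a powr (- q)"
      using C a by (simp add: \<epsilon>_def powr_realpow[symmetric] powr_powr)
    then have "C = a powr q * \<epsilon> ^ DIM('a)" using a by (simp add: powr_minus field_simps)
    then have "\<bar>average (cube_kernel \<epsilon>) v z\<bar> \<le> \<tau> / 2" for z
      using cube_average_bound[OF half_smooth_L2[OF v] \<epsilon> a _ C(2)[OF v], of z] q by (simp add: a_def)
    from level_set_measure_le[OF v \<epsilon> l this]
    have "emeasure lborel {z. \<bar>v z\<bar> > \<tau>} \<le> ennreal (4 * A\<^sup>2 * ?d * \<epsilon> / \<tau>\<^sup>2)" .
    also have "4 * A\<^sup>2 * ?d * \<epsilon> / \<tau>\<^sup>2 = K * \<tau> powr (- s)"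
    proof -
      have "\<epsilon> = C powr (1 / ?d) * (\<tau> / 4) powr (- q / ?d)"
        using C a by (simp add: \<epsilon>_def a_def powr_mult powr_powr)
      also have "(\<tau> / 4) powr (- q / ?d) = 4 powr (q / ?d) * \<tau> powr (- q / ?d)"
        using l by (simp add: powr_divide powr_minus field_simps)
      finally have e: "\<epsilon> = C powr (1 / ?d) * (4 powr (q / ?d) * \<tau> powr (- q / ?d))" .
      have "\<tau> powr (- s) = \<tau> powr (- q / ?d) / \<tau>\<^sup>2"
      proof -
        have "- s = - q / ?d - 2" by (simp add: s_def)
        then have "\<tau> powr (- s) = \<tau> powr (- q / ?d - 2)" by (simp only:)
        then show ?thesis using l by (simp add: powr_diff powr_numeral)
      qed
      then show ?thesis by (simp add: e K_def)
    qed
    finally show ?thesis .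
  qed
  define \<rho> where "\<rho> = 2 powr (r - s)"
  have \<rho>: "0 < \<rho>" "\<rho> < 1" using r by (auto simp: \<rho>_def s_def powr_less_one)
  define D where "D = A\<^sup>2 + 2 powr r * K * (\<Sum>k. \<rho> ^ k)"
  have sm: "summable (\<lambda>k. \<rho> ^ k)" using \<rho> by (intro summable_geometric) simp
  have sp: "(\<Sum>k. \<rho> ^ k) > 0" using \<rho> sm by (intro suminf_pos) auto
  have "(\<integral>\<^sup>+z. ennreal (\<bar>v z\<bar> powr r) \<partial>lborel) \<le> ennreal D" if v: "v \<in> half_smooth A" for v :: "'a \<Rightarrow> real"
  proof -
    have [measurable]: "v \<in> borel_measurable borel" using L2_measurable[OF half_smooth_L2[OF v]] by simp
    let ?I = "\<lambda>k. \<integral>\<^sup>+z. ennreal (2 powr (real (Suc k) * r)) * indicator {t. \<bar>t\<bar> > 2 ^ k} (v z) \<partial>lborel"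
    have "(\<integral>\<^sup>+z. ennreal (\<bar>v z\<bar> powr r) \<partial>lborel) \<le>
      (\<integral>\<^sup>+z. ennreal ((v z)\<^sup>2) + (\<Sum>k. ennreal (2 powr (real (Suc k) * r)) * indicator {t. \<bar>t\<bar> > 2 ^ k} (v z)) \<partial>lborel)"
      by (intro nn_integral_mono powr_le_dyadic_sum r)
    also have "\<dots> = (\<integral>\<^sup>+z. ennreal ((v z)\<^sup>2) \<partial>lborel)
        + (\<Sum>k. ?I k)"
      by (subst nn_integral_add) (auto simp: nn_integral_suminf)
    also have "(\<Sum>k. ?I k)
       \<le> (\<Sum>k. ennreal (2 powr r * K * \<rho> ^ k))"
    proof (rule suminf_le)
      fix k
      have "?I k
        = ennreal (2 powr (real (Suc k) * r)) * (\<integral>\<^sup>+z. indicator {z. \<bar>v z\<bar> > 2 ^ k} z \<partial>lborel)"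
        by (subst nn_integral_cmult[symmetric]) (auto simp: indicator_def intro!: nn_integral_cong)
      also have "(\<integral>\<^sup>+z. indicator {z. \<bar>v z\<bar> > 2 ^ k} z \<partial>lborel) = emeasure lborel {z. \<bar>v z\<bar> > 2 ^ k}"
        by (rule nn_integral_indicator) measurable
      also have "\<dots> \<le> ennreal (K * (2 ^ k) powr (- s))" by (rule lev[OF v]) simp
      also have "ennreal (2 powr (real (Suc k) * r)) * ennreal (K * (2 ^ k) powr (- s)) = ennreal (2 powr r * K * \<rho> ^ k)"
      proof -
        have "(2 ^ k :: real) powr (- s) = 2 powr (real k * (- s))" by (simp add: powr_realpow[symmetric] powr_powr)
        moreover have "\<rho> ^ k = 2 powr (real k * (r - s))" by (simp add: \<rho>_def powr_realpow[symmetric] powr_powr mult.commute)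
        moreover have "2 powr (real (Suc k) * r) * 2 powr (real k * (- s)) = 2 powr r * 2 powr (real k * (r - s))"
          by (simp add: powr_add[symmetric] algebra_simps)
        ultimately have E: "2 powr (real (Suc k) * r) * (K * (2 ^ k) powr (- s)) = 2 powr r * K * \<rho> ^ k"
          by (simp add: mult_ac del: of_nat_Suc)
        show ?thesis unfolding E[symmetric] by (rule ennreal_mult[symmetric]) (use K0 in auto)
      qed
      finally show "?I k
         \<le> ennreal (2 powr r * K * \<rho> ^ k)" by (simp add: mult_left_mono)
    qed auto
    also have "(\<Sum>k. ennreal (2 powr r * K * \<rho> ^ k)) = ennreal (\<Sum>k. 2 powr r * K * \<rho> ^ k)"
      using K0 \<rho> sm by (intro suminf_ennreal2 summable_mult) auto
    also have "(\<Sum>k. 2 powr r * K * \<rho> ^ k) = 2 powr r * K * (\<Sum>k. \<rho> ^ k)" by (rule suminf_mult[OF sm])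
    also have "(\<integral>\<^sup>+z. ennreal ((v z)\<^sup>2) \<partial>lborel) = ennreal ((norm2 lborel v)\<^sup>2)"
      using ennreal_norm2_square[OF half_smooth_L2[OF v]] by simp
    also have "ennreal ((norm2 lborel v)\<^sup>2) \<le> ennreal (A\<^sup>2)"
      using v by (intro ennreal_leI power_mono) (auto simp: half_smooth_def)
    also have "ennreal (A\<^sup>2) + ennreal (2 powr r * K * (\<Sum>k. \<rho> ^ k)) = ennreal D"
      unfolding D_def using K0 sp by (subst ennreal_plus) auto
    finally show ?thesis by (simp add: add_right_mono)
  qed
  moreover have "D > 0" unfolding D_def using K0 sp by (intro add_nonneg_pos mult_pos_pos) auto
  ultimately show ?thesis unfolding uniform_Lq_def by blast
qed

lemma uniform_Lq_interpolate:
  assumes U: "uniform_Lq A q TYPE('a::euclidean_space)" and r: "2 \<le> r" "r \<le> q"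
  shows "uniform_Lq A r TYPE('a)"
proof -
  obtain C where C: "C > 0" "\<And>v::'a \<Rightarrow> real. v \<in> half_smooth A \<Longrightarrow> (\<integral>\<^sup>+z. ennreal (\<bar>v z\<bar> powr q) \<partial>lborel) \<le> ennreal C"
    using U unfolding uniform_Lq_def by blast
  obtain D where D: "D > 0" "\<And>v::'a \<Rightarrow> real. v \<in> half_smooth A \<Longrightarrow> (\<integral>\<^sup>+z. ennreal (\<bar>v z\<bar> powr 2) \<partial>lborel) \<le> ennreal D"
    using uniform_Lq_2[where 'a='a] unfolding uniform_Lq_def by blast
  have pt: "ennreal (\<bar>t\<bar> powr r) \<le> ennreal (\<bar>t\<bar> powr 2) + ennreal (\<bar>t\<bar> powr q)" for t
  proof (cases "\<bar>t\<bar> \<le> 1")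
    case True
    have "\<bar>t\<bar> powr r \<le> \<bar>t\<bar> powr 2" using True r by (intro powr_mono') auto
    then show ?thesis by (rule order_trans[OF ennreal_leI]) simp
  next
    case False
    have "\<bar>t\<bar> powr r \<le> \<bar>t\<bar> powr q" using False r by (intro powr_mono) auto
    then show ?thesis by (rule order_trans[OF ennreal_leI]) simp
  qed
  have "(\<integral>\<^sup>+z. ennreal (\<bar>v z\<bar> powr r) \<partial>lborel) \<le> ennreal (D + C)" if v: "v \<in> half_smooth A" for v :: "'a \<Rightarrow> real"
  proof -
    have [measurable]: "v \<in> borel_measurable borel" using L2_measurable[OF half_smooth_L2[OF v]] by simp
    have "(\<integral>\<^sup>+z. ennreal (\<bar>v z\<bar> powr r) \<partial>lborel) \<le> (\<integral>\<^sup>+z. ennreal (\<bar>v z\<bar> powr 2) + ennreal (\<bar>v z\<bar> powr q) \<partial>lborel)"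
      by (intro nn_integral_mono pt)
    also have "\<dots> = (\<integral>\<^sup>+z. ennreal (\<bar>v z\<bar> powr 2) \<partial>lborel) + (\<integral>\<^sup>+z. ennreal (\<bar>v z\<bar> powr q) \<partial>lborel)"
      by (rule nn_integral_add) measurable
    also have "\<dots> \<le> ennreal D + ennreal C" by (intro add_mono C(2) D(2) v)
    finally show ?thesis using C(1) D(1) by (simp add: ennreal_plus)
  qed
  then show ?thesis unfolding uniform_Lq_def using C(1) D(1) by (intro exI[of _ "D + C"]) auto
qed

text \<open>Below the fixed point \<open>2 d / (d - 1)\<close> of \<open>q \<mapsto> 2 + q / d\<close> every exponent is passed after finitely
  many improvements.\<close>

theorem half_smooth_uniform_Lq:
  assumes d: "DIM('a::euclidean_space) \<ge> 2" and r: "2 \<le> r" "r < 2 * real DIM('a) / (real DIM('a) - 1)" and A: "A > 0"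
  shows "uniform_Lq A r TYPE('a)"
proof -
  let ?d = "real DIM('a)"
  define c where "c = 1 - 1 / ?d"
  define rc where "rc = r * c"
  define \<delta> where "\<delta> = (2 - rc) / 2"
  have "r * (?d - 1) < 2 * ?d" using r(2) d by (simp add: pos_less_divide_eq)
  then have \<delta>: "\<delta> > 0" using d by (simp add: \<delta>_def rc_def c_def field_simps)
  have ex: "\<exists>q\<ge>2. uniform_Lq A q TYPE('a) \<and> min r (2 + real k * \<delta>) \<le> q" for k
  proof (induction k)
    case 0
    then show ?case using uniform_Lq_2 by (intro exI[of _ 2]) auto
  next
    case (Suc k)
    then obtain q where q: "q \<ge> 2" "uniform_Lq A q TYPE('a)" "min r (2 + real k * \<delta>) \<le> q" by blast
    show ?case
    proof (cases "r \<le> q")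
      case True
      then show ?thesis using q by (intro exI[of _ q]) auto
    next
      case False
      have "q * c \<le> rc" unfolding rc_def using False d by (intro mult_right_mono) (auto simp: c_def)
      moreover have "rc < 2" "2 - \<delta> = 1 + rc / 2" using \<delta> by (simp_all add: \<delta>_def field_simps)
      ultimately have "q * c < 2 - \<delta>" by linarith
      moreover have "q * c = q - q / ?d" by (simp add: c_def algebra_simps)
      ultimately have "q + \<delta> < 2 + q / ?d" by linarith
      then have "uniform_Lq A (q + \<delta>) TYPE('a)" using q \<delta> by (intro uniform_Lq_improve[OF _ _ _ A q(2)]) auto
      moreover have "min r (2 + real (Suc k) * \<delta>) \<le> q + \<delta>" using False q(3) by (simp add: algebra_simps)
      ultimately show ?thesis using q \<delta> by (intro exI[of _ "q + \<delta>"]) auto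
    qed
  qed
  obtain k where "r / \<delta> < real k" using reals_Archimedean2 by blast
  then have "r \<le> 2 + real k * \<delta>" using \<delta> by (simp add: pos_divide_less_eq)
  then obtain q where q: "uniform_Lq A q TYPE('a)" "r \<le> q" using ex[of k] by auto
  show ?thesis by (rule uniform_Lq_interpolate[OF q(1) r(1) q(2)])
qed

subsection \<open>Vanishing and local compactness\<close>

definition unit_cube_mass :: "('a::euclidean_space \<Rightarrow> real) \<Rightarrow> 'a \<Rightarrow> real" where
  "unit_cube_mass v z = (\<integral>w. indicator (cbox 0 One) w * (v (z + w))\<^sup>2 \<partial>lborel)"

text \<open>If no unit cube carries much mass, then even the averages over small cubes are small.\<close>

lemma vanishing_level_sets:
  assumes l: "\<tau> > 0" and mu: "\<mu> > 0" and A: "A > 0"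
  shows "\<exists>\<delta>>0. \<forall>v\<in>half_smooth A. (\<forall>z. unit_cube_mass v z \<le> \<delta>) \<longrightarrow>
     emeasure lborel {z::'a::euclidean_space. \<bar>v z\<bar> > \<tau>} \<le> ennreal \<mu>"
proof -
  let ?d = "real DIM('a)"
  define \<epsilon> where "\<epsilon> = min 1 (\<mu> * \<tau>\<^sup>2 / (4 * A\<^sup>2 * ?d))"
  have \<epsilon>: "\<epsilon> > 0" "\<epsilon> \<le> 1" using l mu A by (auto simp: \<epsilon>_def)
  have \<epsilon>\<mu>: "4 * A\<^sup>2 * ?d * \<epsilon> / \<tau>\<^sup>2 \<le> \<mu>"
  proof -
    have "\<epsilon> \<le> \<mu> * \<tau>\<^sup>2 / (4 * A\<^sup>2 * ?d)" by (simp add: \<epsilon>_def)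
    moreover have "4 * A\<^sup>2 * ?d > 0" "\<tau>\<^sup>2 > 0" using l A by auto
    ultimately show ?thesis by (simp add: field_simps)
  qed
  interpret averaging_kernel "cube_kernel \<epsilon> :: 'a \<Rightarrow> real" "1 / \<epsilon> ^ DIM('a)" by (rule cube_kernel_averaging[OF \<epsilon>(1)])
  have "emeasure lborel {z::'a. \<bar>v z\<bar> > \<tau>} \<le> ennreal \<mu>"
    if v: "v \<in> half_smooth A" and mass: "\<And>z. unit_cube_mass v z \<le> \<epsilon> ^ DIM('a) * (\<tau> / 2)\<^sup>2" for v
  proof -
    have avg: "\<bar>average (cube_kernel \<epsilon>) v z\<bar> \<le> \<tau> / 2" for z
    proof -
      have vz: "(\<lambda>w. v (z + w)) \<in> L2 lborel" using L2_translate[OF half_smooth_L2[OF v], of z] by (simp add: add.commute)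
      have [measurable]: "(\<lambda>w. v (z + w)) \<in> borel_measurable borel" using L2_measurable[OF vz] by simp
      have "(average (cube_kernel \<epsilon>) v z)\<^sup>2 \<le> (\<integral>w. cube_kernel \<epsilon> w * (v (z + w))\<^sup>2 \<partial>lborel)"
        unfolding average_def by (rule jensen_square[OF vz])
      also have "\<dots> \<le> (\<integral>w. 1 / \<epsilon> ^ DIM('a) * (indicator (cbox 0 One) w * (v (z + w))\<^sup>2) \<partial>lborel)"
      proof (rule integral_mono[OF integrable_mult(2)[OF vz]])
        have sq: "integrable lborel (\<lambda>w. (v (z + w))\<^sup>2)" using L2_integrable_square[OF vz] by simp
        show "integrable lborel (\<lambda>w. 1 / \<epsilon> ^ DIM('a) * (indicator (cbox 0 One) w * (v (z + w))\<^sup>2))"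
          by (intro integrable_mult_right Bochner_Integration.integrable_bound[OF sq]) (auto simp: indicator_def)
        fix w :: 'a
        have "w \<in> cbox 0 One" if "w \<in> cbox 0 (\<epsilon> *\<^sub>R One)"
          using that \<epsilon> by (fastforce simp: mem_box inner_simps inner_sum_left_Basis)
        then show "cube_kernel \<epsilon> w * (v (z + w))\<^sup>2 \<le> 1 / \<epsilon> ^ DIM('a) * (indicator (cbox 0 One) w * (v (z + w))\<^sup>2)"
          using \<epsilon> by (auto simp: cube_kernel_def indicator_def)
      qed
      also have "\<dots> = 1 / \<epsilon> ^ DIM('a) * unit_cube_mass v z" by (simp add: unit_cube_mass_def)
      also have "\<dots> \<le> 1 / \<epsilon> ^ DIM('a) * (\<epsilon> ^ DIM('a) * (\<tau> / 2)\<^sup>2)" using mass \<epsilon> by (intro mult_left_mono) auto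
      also have "\<dots> = (\<tau> / 2)\<^sup>2" using \<epsilon> by simp
      finally show ?thesis using l abs_le_square_iff[of "average (cube_kernel \<epsilon>) v z" "\<tau> / 2"] by simp
    qed
    show ?thesis by (rule order_trans[OF level_set_measure_le[OF v \<epsilon>(1) l avg] ennreal_leI[OF \<epsilon>\<mu>]])
  qed
  then show ?thesis using \<epsilon> l by (intro exI[of _ "\<epsilon> ^ DIM('a) * (\<tau> / 2)\<^sup>2"]) auto
qed

lemma cube_average_uniform_bound:
  fixes v :: "'a::euclidean_space \<Rightarrow> real"
  assumes v: "v \<in> L2 lborel" and e: "\<epsilon> > 0"
  shows "\<bar>average (cube_kernel \<epsilon>) v z\<bar> \<le> norm2 lborel (cube_kernel \<epsilon> :: 'a \<Rightarrow> real) * norm2 lborel v"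
proof -
  have vz: "(\<lambda>w. v (z + w)) \<in> L2 lborel" using L2_translate[OF v, of z] by (simp add: add.commute)
  have "norm2 lborel (\<lambda>w. v (z + w)) = norm2 lborel v"
    using norm2_translate[of v z] L2_measurable[OF v] by (simp add: add.commute)
  then show ?thesis unfolding average_def
    using Cauchy_Schwarz_L2_real[OF averaging_kernel.L2[OF cube_kernel_averaging[OF e]] vz] by simp
qed

text \<open>A fixed small cube size makes all averages uniformly close to the functions, while the averages
  themselves converge boundedly.\<close>

lemma local_convergence_from_averages:
  fixes v :: "nat \<Rightarrow> 'a::euclidean_space \<Rightarrow> real"
  assumes v: "\<And>n. v n \<in> half_smooth A" and w: "w \<in> half_smooth A" and A: "A > 0"
    and lim: "\<And>\<epsilon> z. \<epsilon> > 0 \<Longrightarrow> (\<lambda>n. average (cube_kernel \<epsilon>) (v n) z) \<longlonglongrightarrow> average (cube_kernel \<epsilon>) w z"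
  shows "(\<lambda>n. norm2 lborel (\<lambda>z. indicator (cball 0 R) z * (v n z - w z))) \<longlonglongrightarrow> 0"
proof (rule LIMSEQ_I)
  fix e :: real assume e: "e > 0"
  let ?d = "real DIM('a)"
  define \<epsilon> where "\<epsilon> = (e / (4 * A))\<^sup>2 / ?d"
  have \<epsilon>: "\<epsilon> > 0" using e A by (simp add: \<epsilon>_def)
  have "A * sqrt (?d * \<epsilon>) = e / 4" using e A by (simp add: \<epsilon>_def)
  then have close: "norm2 lborel (\<lambda>z. average (cube_kernel \<epsilon>) u z - u z) \<le> e / 4" if "u \<in> half_smooth A" for u :: "'a \<Rightarrow> real"
    using norm2_cube_average_diff(2)[OF that \<epsilon>] by simp
  let ?a = "average (cube_kernel \<epsilon> :: 'a \<Rightarrow> real)" and ?I = "indicator (cball (0::'a) R) :: 'a \<Rightarrow> real"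
  have um: "u \<in> borel_measurable borel" if "u \<in> half_smooth A" for u :: "'a \<Rightarrow> real" using L2_measurable[OF half_smooth_L2[OF that]] by simp
  have am: "?a u \<in> borel_measurable borel" if "u \<in> half_smooth A" for u :: "'a \<Rightarrow> real"
    by (rule averaging_kernel.average_measurable[OF cube_kernel_averaging[OF \<epsilon>] um[OF that]])
  define B where "B = norm2 lborel (cube_kernel \<epsilon> :: 'a \<Rightarrow> real) * A"
  have ab: "\<bar>?a u z\<bar> \<le> B" if "u \<in> half_smooth A" for u z
  proof -
    have "\<bar>?a u z\<bar> \<le> norm2 lborel (cube_kernel \<epsilon> :: 'a \<Rightarrow> real) * norm2 lborel u" by (rule cube_average_uniform_bound[OF half_smooth_L2[OF that] \<epsilon>])
    also have "\<dots> \<le> B" unfolding B_def using that by (intro mult_left_mono) (auto simp: half_smooth_def)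
    finally show ?thesis .
  qed
  have "(\<lambda>n. \<integral>z. (?I z * (?a (v n) z - ?a w z))\<^sup>2 \<partial>lborel) \<longlonglongrightarrow> (\<integral>z. 0 \<partial>(lborel :: 'a measure))"
  proof (rule integral_dominated_convergence[where w="\<lambda>z. ?I z * (2 * B)\<^sup>2"])
    show "integrable lborel (\<lambda>z. ?I z * (2 * B)\<^sup>2)"
      by (intro integrable_mult_left integrable_real_indicator emeasure_bounded_finite) auto
    show "AE z in lborel. (\<lambda>n. (?I z * (?a (v n) z - ?a w z))\<^sup>2) \<longlonglongrightarrow> 0"
    proof (rule AE_I2)
      fix z
      have "(\<lambda>n. (?I z * (?a (v n) z - ?a w z))\<^sup>2) \<longlonglongrightarrow> (?I z * (?a w z - ?a w z))\<^sup>2"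
        by (intro tendsto_intros lim[OF \<epsilon>])
      then show "(\<lambda>n. (?I z * (?a (v n) z - ?a w z))\<^sup>2) \<longlonglongrightarrow> 0" by simp
    qed
    show "AE z in lborel. norm ((?I z * (?a (v n) z - ?a w z))\<^sup>2) \<le> ?I z * (2 * B)\<^sup>2" for n
    proof (rule AE_I2)
      fix z
      have "\<bar>?a (v n) z - ?a w z\<bar> \<le> 2 * B" using ab[OF v, of n z] ab[OF w, of z] by linarith
      then have "\<bar>?a (v n) z - ?a w z\<bar>\<^sup>2 \<le> (2 * B)\<^sup>2" by (intro power_mono) auto
      then show "norm ((?I z * (?a (v n) z - ?a w z))\<^sup>2) \<le> ?I z * (2 * B)\<^sup>2" by (auto simp: indicator_def)
    qed
  next
    have [measurable]: "?a (v n) \<in> borel_measurable borel" for n by (rule am[OF v])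
    have [measurable]: "?a w \<in> borel_measurable borel" by (rule am[OF w])
    have [measurable]: "cball (0::'a) R \<in> sets borel" by simp
    show "(\<lambda>z. (?I z * (?a (v n) z - ?a w z))\<^sup>2) \<in> borel_measurable lborel" for n by measurable
  qed simp
  from tendsto_real_sqrt[OF this] have "(\<lambda>n. norm2 lborel (\<lambda>z. ?I z * (?a (v n) z - ?a w z))) \<longlonglongrightarrow> 0"
    by (simp add: norm2_def)
  from LIMSEQ_D[OF this, of "e/4"] e obtain K where K: "\<And>n. n \<ge> K \<Longrightarrow> norm2 lborel (\<lambda>z. ?I z * (?a (v n) z - ?a w z)) < e / 4"
    by auto
  have ind_L2: "(\<lambda>z. ?I z * f z) \<in> L2 lborel" "norm2 lborel (\<lambda>z. ?I z * f z) \<le> norm2 lborel f" if f: "f \<in> L2 lborel" for f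
  proof -
    have [measurable]: "f \<in> borel_measurable borel" "cball (0::'a) R \<in> sets borel" using L2_measurable[OF f] by simp_all
    have m: "(\<lambda>z. ?I z * f z) \<in> borel_measurable lborel" by measurable
    have le: "AE z in lborel. norm (?I z * f z) \<le> norm (f z)" by (rule AE_I2) (auto simp: indicator_def)
    show "(\<lambda>z. ?I z * f z) \<in> L2 lborel" by (rule L2_dominated[OF f m le])
    show "norm2 lborel (\<lambda>z. ?I z * f z) \<le> norm2 lborel f" by (rule norm2_mono[OF f m le])
  qed
  have "norm (norm2 lborel (\<lambda>z. ?I z * (v n z - w z)) - 0) < e" if n: "n \<ge> K" for n
  proof -
    let ?p = "\<lambda>z. ?a (v n) z - v n z" and ?q = "\<lambda>z. ?a w z - w z" and ?m = "\<lambda>z. ?a (v n) z - ?a w z"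
    have p: "?p \<in> L2 lborel" and q: "?q \<in> L2 lborel" using norm2_cube_average_diff(1)[OF _ \<epsilon>] v w by auto
    have "(\<lambda>z. (?p z - ?q z) + (v n z - w z)) \<in> L2 lborel"
      by (rule L2_add[OF L2_diff[OF p q] L2_diff[OF half_smooth_L2[OF v] half_smooth_L2[OF w]]])
    then have m: "?m \<in> L2 lborel" by simp
    have "norm2 lborel (\<lambda>z. ?I z * (v n z - w z)) = norm2 lborel (\<lambda>z. (?I z * ?m z + ?I z * ?q z) + - (?I z * ?p z))"
      by (rule arg_cong[where f="norm2 lborel"]) (auto simp: algebra_simps)
    also have "\<dots> \<le> norm2 lborel (\<lambda>z. ?I z * ?m z + ?I z * ?q z) + norm2 lborel (\<lambda>z. - (?I z * ?p z))"
      by (intro norm2_triangle L2_add L2_uminus ind_L2 p q m)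
    also have "norm2 lborel (\<lambda>z. - (?I z * ?p z)) = norm2 lborel (\<lambda>z. ?I z * ?p z)" by (rule norm2_uminus)
    also have "norm2 lborel (\<lambda>z. ?I z * ?m z + ?I z * ?q z) \<le> norm2 lborel (\<lambda>z. ?I z * ?m z) + norm2 lborel (\<lambda>z. ?I z * ?q z)"
      by (intro norm2_triangle ind_L2 q m)
    finally have "norm2 lborel (\<lambda>z. ?I z * (v n z - w z)) < e"
      using K[OF n] ind_L2(2)[OF p] ind_L2(2)[OF q] close[OF v, of n] close[OF w] e by linarith
    then show ?thesis by simp
  qed
  then show "\<exists>K. \<forall>n\<ge>K. norm (norm2 lborel (\<lambda>z. indicator (cball 0 R) z * (v n z - w z)) - 0) < e" by blast
qed

lemma tr_half_smooth: "norm x \<le> A / 4 \<Longrightarrow> tr x \<in> half_smooth A"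
  for x :: "'n::finite sobolev"
proof -
  assume x: "norm x \<le> A / 4"
  have "norm2 lborel (tr x) \<le> A" using norm2_tr_le[of x] x norm_ge_zero[of x] by linarith
  moreover have "norm2 lborel (\<lambda>y. tr x (y + h) - tr x y) \<le> A * sqrt (norm h)" for h
  proof -
    have "4 * sqrt (norm h) * norm x \<le> 4 * sqrt (norm h) * (A / 4)" using x by (intro mult_left_mono) auto
    then have "4 * sqrt (norm h) * norm x \<le> A * sqrt (norm h)" by (simp add: mult.commute)
    then show ?thesis by (rule order_trans[OF norm2_tr_increment_le])
  qed
  ultimately show ?thesis by (simp add: half_smooth_def)
qed

section \<open>The nonlinearity\<close>

locale superlinear =
  fixes f :: "real \<Rightarrow> real" and p \<theta> :: real
  assumes C1: "f C1_differentiable_on UNIV"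
    and f_neg: "\<And>t. t < 0 \<Longrightarrow> f t = 0"
    and f_at_0: "((\<lambda>t. f t / t) \<longlongrightarrow> 0) (at 0)"
    and p: "1 < p" and f_at_top: "((\<lambda>t. f t / t powr p) \<longlongrightarrow> 0) at_top"
    and \<theta>: "\<theta> > 2" and AR: "\<And>t. t > 0 \<Longrightarrow> 0 < \<theta> * primitive f t \<and> \<theta> * primitive f t < t * f t"
begin

abbreviation F :: "real \<Rightarrow> real" where "F \<equiv> primitive f"

lemma f_derivative:
  obtains D where "\<And>t. (f has_real_derivative D t) (at t)" "continuous_on UNIV D"
  using C1 unfolding C1_differentiable_on_def by (auto simp: has_real_derivative_iff_has_vector_derivative)

lemma f_continuous: "continuous_on UNIV f"
  by (rule f_derivative) (auto intro!: continuous_at_imp_continuous_on DERIV_isCont)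

lemma f_measurable [measurable]: "f \<in> borel_measurable borel"
  by (rule borel_measurable_continuous_onI[OF f_continuous])

lemma f_nonpos: "t \<le> 0 \<Longrightarrow> f t = 0"
proof (cases "t = 0")
  case True
  have "(f \<longlongrightarrow> f 0) (at_left 0)"
    using f_continuous by (simp add: continuous_on_eq_continuous_at continuous_at filterlim_at_split)
  moreover have "(f \<longlongrightarrow> 0) (at_left 0)"
    by (rule tendsto_eventually) (auto simp: eventually_at_filter f_neg)
  ultimately have "f 0 = 0" by (intro tendsto_unique[of "at_left (0::real)" f]) auto
  then show ?thesis using True by simp
qed (auto simp: f_neg)

lemma F_derivative: "(F has_real_derivative f t) (at t)"
proof -
  define a where "a = \<bar>t\<bar> + 1"
  have "((\<lambda>u. LBINT y=ereal 0..ereal u. f y) has_vector_derivative f t) (at t within {- a..a})"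
    by (rule interval_integral_FTC2) (auto simp: a_def intro: continuous_on_subset[OF f_continuous])
  then have "((\<lambda>u. LBINT y=ereal 0..ereal u. f y) has_vector_derivative f t) (at t)"
    by (subst (asm) at_within_interior) (auto simp: a_def)
  then show ?thesis
    by (simp add: primitive_def[abs_def] has_real_derivative_iff_has_vector_derivative)
qed

lemma F_continuous: "continuous_on UNIV F"
  by (intro continuous_at_imp_continuous_on ballI DERIV_isCont[OF F_derivative])

lemma F_measurable [measurable]: "F \<in> borel_measurable borel"
  by (rule borel_measurable_continuous_onI[OF F_continuous])

lemma F_0: "F 0 = 0"
  by (simp add: primitive_def)

lemma F_mean_value: "\<exists>c. \<bar>c - a\<bar> \<le> \<bar>b\<bar> \<and> F (a + b) - F a = f c * b"
proof -
  consider "b = 0" | "b > 0" | "b < 0" by linarith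
  then show ?thesis
  proof cases
    case 2
    then obtain c where "a < c" "c < a + b" "F (a + b) - F a = (a + b - a) * f c"
      using MVT2[of a "a + b" F f] F_derivative by auto
    then show ?thesis by (intro exI[of _ c]) auto
  next
    case 3
    then obtain c where "a + b < c" "c < a" "F a - F (a + b) = (a - (a + b)) * f c"
      using MVT2[of "a + b" a F f] F_derivative by auto
    then show ?thesis by (intro exI[of _ c]) (auto simp: algebra_simps)
  qed (auto intro: exI[of _ a])
qed

lemma F_nonpos: "t \<le> 0 \<Longrightarrow> F t = 0"
proof -
  assume t: "t \<le> 0"
  show ?thesis
  proof (cases "t = 0")
    case False
    then obtain c where "t < c" "c < 0" "F 0 - F t = (0 - t) * f c"
      using MVT2[of t 0 F f] F_derivative t by auto
    then show ?thesis using F_0 f_neg by simp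
  qed (simp add: F_0)
qed

lemma F_nonneg: "0 \<le> F t"
  using AR[of t] F_nonpos[of t] \<theta> by (cases "t > 0") (auto simp: zero_less_mult_iff)

lemma AR_le: "\<theta> * F t \<le> f t * t"
  using AR[of t] F_nonpos[of t] f_nonpos[of t] by (cases "t > 0") (auto simp: mult.commute)

lemma f_mult_nonneg: "0 \<le> f t * t"
  using AR_le[of t] F_nonneg[of t] \<theta> by (smt (verit) mult_nonneg_nonneg)

lemma f_nonneg: "0 \<le> f t"
proof (cases "t > 0")
  case True
  then have "0 < t * f t" using AR[of t] by linarith
  then show ?thesis using True by (simp add: zero_less_mult_iff)
qed (simp add: f_nonpos)

lemma F_le: "F t \<le> f t * t"
  using AR_le[of t] F_nonneg[of t] \<theta> mult_right_mono[of 1 \<theta> "F t"] by simp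

lemma half_AR: "F t \<le> 1 / 2 * (f t * t)"
  using AR_le[of t] F_nonneg[of t] \<theta> mult_right_mono[of 2 \<theta> "F t"] by simp

text \<open>By the superquadraticity condition \<open>F t / t\<^sup>\<theta>\<close> is nondecreasing.\<close>

lemma F_growth: "t \<ge> 1 \<Longrightarrow> F 1 * t powr \<theta> \<le> F t" and F_1_pos: "F 1 > 0"
proof -
  show "F 1 > 0" using AR[of 1] \<theta> by (simp add: zero_less_mult_iff)
  assume t: "t \<ge> 1"
  define d where "d s = f s * s powr (- \<theta>) + (- \<theta>) * s powr (- \<theta> - 1) * F s" for s
  have D: "((\<lambda>t. F t * t powr (- \<theta>)) has_real_derivative d s) (at s)" if "s > 0" for s
    unfolding d_def using that by (auto intro!: derivative_eq_intros F_derivative)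
  have d0: "d s \<ge> 0" if s: "s > 0" for s
  proof -
    have "s powr (- \<theta>) = s powr (- \<theta> - 1) * s" using s by (simp add: powr_diff)
    then have "d s = s powr (- \<theta> - 1) * (f s * s - \<theta> * F s)"
      by (simp add: d_def algebra_simps)
    also have "\<dots> \<ge> 0" using AR_le[of s] by (intro mult_nonneg_nonneg) auto
    finally show ?thesis .
  qed
  have "F 1 * 1 powr (- \<theta>) \<le> F t * t powr (- \<theta>)"
  proof (rule DERIV_nonneg_imp_nondecreasing[OF t])
    fix s :: real assume "1 \<le> s" "s \<le> t"
    then have "s > 0" by simp
    from D[OF this] d0[OF this] show "\<exists>y. ((\<lambda>t. F t * t powr (- \<theta>)) has_real_derivative y) (at s) \<and> 0 \<le> y" by blast
  qed
  then have "F 1 * t powr \<theta> \<le> F t * t powr (- \<theta>) * t powr \<theta>" by (intro mult_right_mono) auto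
  moreover have "t powr (- \<theta>) * t powr \<theta> = 1" using t by (simp add: powr_add[symmetric])
  ultimately show "F 1 * t powr \<theta> \<le> F t" by (simp add: mult.assoc)
qed

lemma f_small_at_top:
  assumes "\<epsilon> > 0" shows "\<exists>R\<ge>1. \<forall>t\<ge>R. \<bar>f t\<bar> \<le> \<epsilon> * t powr p"
proof -
  have "\<forall>\<^sub>F t in at_top. dist (f t / t powr p) 0 < \<epsilon>" using tendstoD[OF f_at_top assms] .
  then obtain R where R: "\<And>t. t \<ge> R \<Longrightarrow> \<bar>f t / t powr p\<bar> < \<epsilon>" by (auto simp: eventually_at_top_linorder)
  have "\<bar>f t\<bar> \<le> \<epsilon> * t powr p" if "t \<ge> max 1 R" for t
    using R[of t] that by (simp add: abs_divide divide_less_eq split: if_splits)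
  then show ?thesis by (intro exI[of _ "max 1 R"]) auto
qed

text \<open>Up to an error that is small compared with the power \<open>p\<close> the nonlinearity is Lipschitz continuous,
  since it is so on bounded intervals.\<close>

lemma f_almost_lipschitz:
  assumes e: "\<epsilon> > 0"
  shows "\<exists>L>0. \<forall>a b. \<bar>f a - f b\<bar> \<le> L * \<bar>a - b\<bar> + \<epsilon> * (\<bar>a\<bar> powr p + \<bar>b\<bar> powr p)"
proof -
  obtain R where R: "R \<ge> 1" "\<And>t. t \<ge> R \<Longrightarrow> \<bar>f t\<bar> \<le> \<epsilon> / 2 * t powr p"
    using f_small_at_top[of "\<epsilon>/2"] e by auto
  obtain D where D: "\<And>t. (f has_real_derivative D t) (at t)" "continuous_on UNIV D" by (rule f_derivative) blast
  have "compact (D ` {0..R})" by (intro compact_continuous_image continuous_on_subset[OF D(2)]) auto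
  then obtain L where L: "L > 0" "\<And>t. t \<in> {0..R} \<Longrightarrow> \<bar>D t\<bar> \<le> L" using compact_imp_bounded by (force simp: bounded_pos)
  define c where "c t = max 0 (min t R)" for t
  have c: "c t \<in> {0..R}" "\<bar>c s - c t\<bar> \<le> \<bar>s - t\<bar>" for s t using R(1) by (auto simp: c_def)
  have lip: "\<bar>f (c a) - f (c b)\<bar> \<le> L * \<bar>a - b\<bar>" for a b
  proof -
    have "norm (f (c a) - f (c b)) \<le> L * norm (c a - c b)"
      by (rule field_differentiable_bound[where S="{0..R}" and f'=D])
        (use D(1) L c in \<open>auto intro: has_field_derivative_at_within\<close>)
    also have "\<dots> \<le> L * \<bar>a - b\<bar>" using c(2)[of a b] L(1) by (intro mult_left_mono) auto
    finally show ?thesis by simp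
  qed
  have rest: "\<bar>f t - f (c t)\<bar> \<le> \<epsilon> * \<bar>t\<bar> powr p" for t
  proof (cases "t > R")
    case True
    have "\<bar>f t\<bar> \<le> \<epsilon> / 2 * t powr p" "\<bar>f R\<bar> \<le> \<epsilon> / 2 * R powr p" using R True by auto
    moreover have "\<epsilon> / 2 * R powr p \<le> \<epsilon> / 2 * t powr p" using True R p e by (intro mult_left_mono powr_mono2) auto
    ultimately have "\<bar>f t\<bar> + \<bar>f R\<bar> \<le> \<epsilon> * t powr p" by simp
    moreover have "c t = R" "\<bar>t\<bar> = t" using True R by (auto simp: c_def)
    ultimately show ?thesis using abs_triangle_ineq4[of "f t" "f R"] by simp
  next
    case False
    then have "f (c t) = f t" using f_nonpos[of t] f_nonpos[of 0] by (cases "t \<le> 0") (auto simp: c_def)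
    then show ?thesis using e by simp
  qed
  have "\<bar>f a - f b\<bar> \<le> L * \<bar>a - b\<bar> + \<epsilon> * (\<bar>a\<bar> powr p + \<bar>b\<bar> powr p)" for a b
    using lip[of a b] rest[of a] rest[of b] unfolding distrib_left by linarith
  then show ?thesis using L(1) by blast
qed

text \<open>The growth conditions at \<open>0\<close> and at infinity make \<open>f t * t\<close> negligible except for \<open>t\<close> in a compact interval
  away from \<open>0\<close>, where it is bounded by \<open>M\<close>.\<close>

lemma f_mult_bound:
  assumes e: "\<eta> > 0"
  shows "\<exists>\<tau> M. \<tau> > 0 \<and> M \<ge> 0 \<and> (\<forall>t. f t * t \<le> \<eta> * t\<^sup>2 + \<eta> * \<bar>t\<bar> powr (p + 1) + M * indicator {t. \<bar>t\<bar> > \<tau>} t)"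
proof -
  have "\<forall>\<^sub>F t in at 0. dist (f t / t) 0 < \<eta>" using tendstoD[OF f_at_0 e] .
  then obtain d where d: "d > 0" "\<And>t. t \<noteq> 0 \<Longrightarrow> \<bar>t\<bar> < d \<Longrightarrow> \<bar>f t / t\<bar> < \<eta>"
    by (auto simp: eventually_at dist_real_def)
  obtain R where R: "R \<ge> 1" "\<And>t. t \<ge> R \<Longrightarrow> \<bar>f t\<bar> \<le> \<eta> * t powr p" using f_small_at_top[OF e] by auto
  have "compact ((\<lambda>t. f t * t) ` {0..R})"
    by (intro compact_continuous_image continuous_intros continuous_on_subset[OF f_continuous]) auto
  then obtain M where M: "M > 0" "\<And>t. t \<in> {0..R} \<Longrightarrow> \<bar>f t * t\<bar> \<le> M" using compact_imp_bounded by (force simp: bounded_pos)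
  define \<tau> where "\<tau> = d / 2"
  have "f t * t \<le> \<eta> * t\<^sup>2 + \<eta> * \<bar>t\<bar> powr (p + 1) + M * indicator {t. \<bar>t\<bar> > \<tau>} t" for t
  proof -
    have nn: "\<eta> * t\<^sup>2 \<ge> 0" "\<eta> * \<bar>t\<bar> powr (p + 1) \<ge> 0" "M * indicator {t. \<bar>t\<bar> > \<tau>} t \<ge> 0" using e M by auto
    consider "t \<le> 0" | "0 < t" "t \<le> \<tau>" | "\<tau> < t" "0 < t" "t \<le> R" | "t > R" by linarith
    then show ?thesis
    proof cases
      case 1
      then show ?thesis using f_nonpos nn by simp
    next
      case 2
      then have "\<bar>f t / t\<bar> < \<eta>" using d(1) by (intro d(2)) (auto simp: \<tau>_def)
      then have "f t < \<eta> * t" using 2 by (simp add: divide_less_eq)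
      then have "f t * t \<le> \<eta> * t * t" using 2 by (intro mult_right_mono) auto
      then show ?thesis using nn by (simp add: power2_eq_square)
    next
      case 3
      then show ?thesis using M(2)[of t] nn by simp
    next
      case 4
      then have "f t * t \<le> (\<eta> * t powr p) * t" using R(2)[of t] R(1) by (intro mult_right_mono) auto
      also have "\<dots> = \<eta> * \<bar>t\<bar> powr (p + 1)" using 4 R(1) by (simp add: powr_add)
      finally show ?thesis using nn by linarith
    qed
  qed
  moreover have "\<tau> > 0" using d by (simp add: \<tau>_def)
  ultimately show ?thesis using M(1) by (intro exI[of _ \<tau>] exI[of _ M]) auto
qed

lemma f_mult_growth:
  assumes e: "\<eta> > 0"
  shows "\<exists>C>0. \<forall>t. f t * t \<le> \<eta> * t\<^sup>2 + C * \<bar>t\<bar> powr (p + 1)"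
proof -
  obtain \<tau> M where \<tau>: "\<tau> > 0" and M: "M \<ge> 0"
    and b: "\<And>t. f t * t \<le> \<eta> * t\<^sup>2 + \<eta> * \<bar>t\<bar> powr (p + 1) + M * indicator {t. \<bar>t\<bar> > \<tau>} t"
    using f_mult_bound[OF e] by blast
  define C where "C = \<eta> + M / \<tau> powr (p + 1)"
  have "f t * t \<le> \<eta> * t\<^sup>2 + C * \<bar>t\<bar> powr (p + 1)" for t
  proof -
    have "M * indicator {t. \<bar>t\<bar> > \<tau>} t \<le> M / \<tau> powr (p + 1) * \<bar>t\<bar> powr (p + 1)"
    proof (cases "\<bar>t\<bar> > \<tau>")
      case True
      have "\<tau> powr (p + 1) \<le> \<bar>t\<bar> powr (p + 1)" using True \<tau> p by (intro powr_mono2) auto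
      then have "M * 1 \<le> M * (\<bar>t\<bar> powr (p + 1) / \<tau> powr (p + 1))" using M \<tau> by (intro mult_left_mono) (auto simp: le_divide_eq)
      then show ?thesis using True by simp
    qed (use M in simp)
    then show ?thesis using b[of t] unfolding C_def distrib_right by linarith
  qed
  moreover have "C > 0" using e M by (auto simp: C_def intro: add_pos_nonneg)
  ultimately show ?thesis by blast
qed

end

lemma powr_mult_le:
  fixes a b p :: real
  assumes "a \<ge> 0" "b \<ge> 0" "p \<ge> 0"
  shows "a powr p * b \<le> a powr (p + 1) + b powr (p + 1)"
proof -
  have s: "x powr p * x = x powr (p + 1)" if "x \<ge> 0" for x using that by (cases "x = 0") (simp_all add: powr_add)
  show ?thesis
  proof (cases "a \<le> b")
    case True
    have "a powr p * b \<le> b powr p * b" using True assms by (intro mult_right_mono powr_mono2) auto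
    also have "\<dots> = b powr (p + 1)" by (rule s[OF assms(2)])
    finally show ?thesis by (simp add: add_increasing)
  next
    case False
    have "a powr p * b \<le> a powr p * a" using False assms by (intro mult_left_mono) auto
    also have "\<dots> = a powr (p + 1)" by (rule s[OF assms(1)])
    finally show ?thesis by (simp add: add_increasing2)
  qed
qed

lemma powr_add_le:
  fixes a b q :: real
  assumes "a \<ge> 0" "b \<ge> 0" "q \<ge> 0"
  shows "(a + b) powr q \<le> 2 powr q * (a powr q + b powr q)"
proof -
  have "(a + b) powr q \<le> (2 * max a b) powr q" using assms by (intro powr_mono2) auto
  also have "\<dots> = 2 powr q * (max a b) powr q" using assms by (simp add: powr_mult)
  also have "(max a b) powr q \<le> a powr q + b powr q" by (auto simp: max_def add_increasing add_increasing2)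
  finally show ?thesis by (simp add: mult_left_mono)
qed

section \<open>The energy functional\<close>

lemma form_bound: "\<bar>form c x y\<bar> \<le> (2 + \<bar>c\<bar>) * norm x * norm y"
  for x y :: "'n::finite sobolev"
proof -
  have "form c x y = inner x y + (c - 1) * (\<integral>z. fn x z * fn y z \<partial>half_measure)"
    unfolding inner_sobolev_def form_eq by (simp add: algebra_simps)
  moreover have "\<bar>inner x y\<bar> \<le> norm x * norm y" by (rule Cauchy_Schwarz_ineq2)
  moreover have "\<bar>(c - 1) * (\<integral>z. fn x z * fn y z \<partial>half_measure)\<bar> \<le> (\<bar>c\<bar> + 1) * (norm x * norm y)"
    unfolding abs_mult
  proof (rule mult_mono)
    have "\<bar>\<integral>z. fn x z * fn y z \<partial>half_measure\<bar> \<le> norm2 half_measure (fn x) * norm2 half_measure (fn y)"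
      by (rule Cauchy_Schwarz_L2_real) simp_all
    also have "\<dots> \<le> norm x * norm y" by (intro mult_mono norm2_fn_le) simp_all
    finally show "\<bar>\<integral>z. fn x z * fn y z \<partial>half_measure\<bar> \<le> norm x * norm y" .
  qed auto
  ultimately have "\<bar>form c x y\<bar> \<le> norm x * norm y + (\<bar>c\<bar> + 1) * (norm x * norm y)" by linarith
  then show ?thesis by (simp add: algebra_simps)
qed

lemma form_bounded_linear: "bounded_linear (form c x)" and form_bounded_linear_left: "bounded_linear (\<lambda>x. form c x y)"
  for x y :: "'n::finite sobolev"
proof -
  show 1: "bounded_linear (\<lambda>x. form c x y)" for y :: "'n sobolev"
  proof (rule bounded_linear_intro)
    show "norm (form c x y) \<le> norm x * ((2 + \<bar>c\<bar>) * norm y)" for x using form_bound[of c x y] by (simp add: mult_ac)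
  qed (simp_all add: form_add_left form_scaleR_left)
  have "(\<lambda>w. form c w x) = form c x" by (rule ext) (rule form_commute)
  then show "bounded_linear (form c x)" using 1[of x] by simp
qed

lemma form_add_right: "form c w (x + y) = form c w x + form c w y"
  by (simp only: form_commute[of c w] form_add_left)

lemma homogeneous_bound:
  fixes g :: "'a::real_normed_vector \<Rightarrow> real"
  assumes hom: "\<And>c x. g (c *\<^sub>R x) = c * g x" and b: "\<And>x. norm x \<le> 1 \<Longrightarrow> \<bar>g x\<bar> \<le> B"
  shows "\<bar>g x\<bar> \<le> B * norm x"
proof (cases "x = 0")
  case True
  then show ?thesis using hom[of 0 0] by simp
next
  case False
  have "\<bar>g ((1 / norm x) *\<^sub>R x)\<bar> \<le> B" by (rule b) simp
  then show ?thesis using False by (simp add: hom abs_mult field_simps)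
qed

text \<open>The parameter \<open>dim\<close> ties the exponent condition to the type of the boundary points. The bound on \<open>p\<close> says
  that \<open>p + 1\<close> is subcritical for half a derivative in dimension \<open>N\<close>, that is, \<open>p + 1 < 2 N / (N - 1)\<close>.\<close>

locale boundary_problem = superlinear f p \<theta> for f p \<theta> +
  fixes m :: real and dim :: "'n::finite itself"
  assumes N: "CARD('n) \<ge> 2" and m: "m > 0" and p_less: "p < (real CARD('n) + 1) / (real CARD('n) - 1)"
begin

lemma tr_measurable [measurable]: "tr (x :: 'n sobolev) \<in> borel_measurable borel"
  using L2_measurable[OF tr_L2[of x]] by simp

abbreviation tr_power :: "'n sobolev \<Rightarrow> real" where
  "tr_power x \<equiv> (\<integral>y. \<bar>tr x y\<bar> powr (p + 1) \<partial>lborel)"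

lemma tr_power_bound:
  "\<exists>C>0. \<forall>x::'n sobolev. norm x \<le> R \<longrightarrow>
     integrable lborel (\<lambda>y. \<bar>tr x y\<bar> powr (p + 1)) \<and> tr_power x \<le> C"
proof -
  define A where "A = 4 * (\<bar>R\<bar> + 1)"
  have "p + 1 < 2 * real CARD('n) / (real CARD('n) - 1)"
  proof -
    have "(real CARD('n) + 1) / (real CARD('n) - 1) + 1 = 2 * real CARD('n) / (real CARD('n) - 1)"
      using N by (simp add: field_simps)
    then show ?thesis using p_less by linarith
  qed
  then have "uniform_Lq A (p + 1) TYPE(real ^ 'n)"
    using N p by (intro half_smooth_uniform_Lq) (auto simp: A_def)
  then obtain C where C: "C > 0" "\<And>v. v \<in> half_smooth A \<Longrightarrow> (\<integral>\<^sup>+z. ennreal (\<bar>v (z::real^'n)\<bar> powr (p + 1)) \<partial>lborel) \<le> ennreal C"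
    unfolding uniform_Lq_def by blast
  have "integrable lborel (\<lambda>y. \<bar>tr x y\<bar> powr (p + 1)) \<and> tr_power x \<le> C"
    if x: "norm x \<le> R" for x :: "'n sobolev"
  proof -
    have le: "(\<integral>\<^sup>+y. ennreal (\<bar>tr x y\<bar> powr (p + 1)) \<partial>lborel) \<le> ennreal C"
      using x by (intro C(2) tr_half_smooth) (simp add: A_def)
    have int: "integrable lborel (\<lambda>y. \<bar>tr x y\<bar> powr (p + 1))"
      using le by (intro integrableI_nonneg) (auto simp: order_le_less_trans[OF _ ennreal_less_top])
    have "ennreal (tr_power x) \<le> ennreal C"
      using le by (subst (asm) nn_integral_eq_integral[OF int]) auto
    then show ?thesis using int C(1) by (subst (asm) ennreal_le_iff) auto
  qed
  then show ?thesis using C(1) by blast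
qed

lemma tr_power_integrable: "integrable lborel (\<lambda>y. \<bar>tr (x :: 'n sobolev) y\<bar> powr (p + 1))"
  using tr_power_bound[of "norm x"] by blast

lemma tr_power_mult_integrable: "integrable lborel (\<lambda>y. \<bar>tr (x :: 'n sobolev) y\<bar> powr p * \<bar>tr h y\<bar>)"
  and tr_power_mult_le: "(\<integral>y. \<bar>tr x y\<bar> powr p * \<bar>tr h y\<bar> \<partial>lborel)
    \<le> tr_power x + tr_power h"
  for x h :: "'n sobolev"
proof -
  have s: "integrable lborel (\<lambda>y. \<bar>tr x y\<bar> powr (p + 1) + \<bar>tr h y\<bar> powr (p + 1))"
    by (intro Bochner_Integration.integrable_add tr_power_integrable)
  have le: "\<bar>tr x y\<bar> powr p * \<bar>tr h y\<bar> \<le> \<bar>tr x y\<bar> powr (p + 1) + \<bar>tr h y\<bar> powr (p + 1)" for y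
    using p by (intro powr_mult_le) auto
  show i: "integrable lborel (\<lambda>y. \<bar>tr x y\<bar> powr p * \<bar>tr h y\<bar>)"
  proof (rule Bochner_Integration.integrable_bound[OF s])
    show "AE y in lborel. norm (\<bar>tr x y\<bar> powr p * \<bar>tr h y\<bar>) \<le> norm (\<bar>tr x y\<bar> powr (p + 1) + \<bar>tr h y\<bar> powr (p + 1))"
      using le by (intro AE_I2) simp
  qed measurable
  have "(\<integral>y. \<bar>tr x y\<bar> powr p * \<bar>tr h y\<bar> \<partial>lborel) \<le> (\<integral>y. \<bar>tr x y\<bar> powr (p + 1) + \<bar>tr h y\<bar> powr (p + 1) \<partial>lborel)"
    by (intro integral_mono i s le)
  also have "\<dots> = tr_power x + tr_power h"
    by (intro Bochner_Integration.integral_add tr_power_integrable)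
  finally show "(\<integral>y. \<bar>tr x y\<bar> powr p * \<bar>tr h y\<bar> \<partial>lborel)
    \<le> tr_power x + tr_power h" .
qed

lemma f_tr_mult_integrable: "integrable lborel (\<lambda>y. f (tr (x :: 'n sobolev) y) * tr h y)"
proof -
  obtain L where L: "L > 0" "\<And>a b. \<bar>f a - f b\<bar> \<le> L * \<bar>a - b\<bar> + 1 * (\<bar>a\<bar> powr p + \<bar>b\<bar> powr p)"
    using f_almost_lipschitz[of 1] by auto
  have "integrable lborel (\<lambda>y. \<bar>tr x y * tr h y\<bar>)" by (intro integrable_abs integrable_mult_L2 tr_L2)
  then have s: "integrable lborel (\<lambda>y. L * \<bar>tr x y * tr h y\<bar> + \<bar>tr x y\<bar> powr p * \<bar>tr h y\<bar>)"
    by (intro Bochner_Integration.integrable_add integrable_mult_right tr_power_mult_integrable)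
  show ?thesis
  proof (rule Bochner_Integration.integrable_bound[OF s], rule borel_measurable_times)
    show "AE y in lborel. norm (f (tr x y) * tr h y) \<le> norm (L * \<bar>tr x y * tr h y\<bar> + \<bar>tr x y\<bar> powr p * \<bar>tr h y\<bar>)"
    proof (rule AE_I2)
      fix y
      have "\<bar>f (tr x y)\<bar> \<le> L * \<bar>tr x y\<bar> + \<bar>tr x y\<bar> powr p" using L(2)[of "tr x y" 0] f_nonpos[of 0] by simp
      then have "\<bar>f (tr x y)\<bar> * \<bar>tr h y\<bar> \<le> (L * \<bar>tr x y\<bar> + \<bar>tr x y\<bar> powr p) * \<bar>tr h y\<bar>" by (intro mult_right_mono) auto
      also have "\<dots> = L * \<bar>tr x y * tr h y\<bar> + \<bar>tr x y\<bar> powr p * \<bar>tr h y\<bar>" by (simp add: algebra_simps abs_mult)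
      also have "\<dots> \<le> norm \<dots>" by simp
      finally show "norm (f (tr x y) * tr h y) \<le> norm (L * \<bar>tr x y * tr h y\<bar> + \<bar>tr x y\<bar> powr p * \<bar>tr h y\<bar>)"
        by (simp add: abs_mult)
    qed
  qed measurable
qed

lemma F_tr_integrable: "integrable lborel (\<lambda>y. F (tr (x :: 'n sobolev) y))"
proof (rule Bochner_Integration.integrable_bound[OF f_tr_mult_integrable[of x x]])
  show "AE y in lborel. norm (F (tr x y)) \<le> norm (f (tr x y) * tr x y)"
    using F_le F_nonneg f_mult_nonneg by (intro AE_I2) (simp add: abs_of_nonneg del: abs_mult)
qed measurable

text \<open>\<open>K x\<close> is the derivative at \<open>x\<close> of the boundary integral in the energy \<open>J\<close>.\<close>

definition K :: "'n sobolev \<Rightarrow> 'n sobolev \<Rightarrow> real" where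
  "K x h = (\<integral>y. f (tr x y) * tr h y \<partial>lborel)"

definition J :: "'n sobolev \<Rightarrow> real" where
  "J x = 1 / 2 * form (m\<^sup>2) x x - (\<integral>y. F (tr x y) \<partial>lborel)"

lemma K_add: "K x (h + k) = K x h + K x k" and K_scaleR: "K x (c *\<^sub>R h) = c * K x h"
proof -
  have "K x (h + k) = (\<integral>y. f (tr x y) * tr h y + f (tr x y) * tr k y \<partial>lborel)"
    unfolding K_def
  proof (rule integral_cong_AE)
    show "AE y in lborel. f (tr x y) * tr (h + k) y = f (tr x y) * tr h y + f (tr x y) * tr k y"
      using tr_add[of h k] by eventually_elim (simp add: algebra_simps)
  qed measurable
  then show "K x (h + k) = K x h + K x k" by (simp add: K_def f_tr_mult_integrable)
  have "K x (c *\<^sub>R h) = (\<integral>y. c * (f (tr x y) * tr h y) \<partial>lborel)"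
    unfolding K_def
  proof (rule integral_cong_AE)
    show "AE y in lborel. f (tr x y) * tr (c *\<^sub>R h) y = c * (f (tr x y) * tr h y)"
      using tr_scaleR[of c h] by eventually_elim simp
  qed measurable
  then show "K x (c *\<^sub>R h) = c * K x h" by (simp add: K_def)
qed

lemma norm2_tr_diff_le: "norm2 lborel (\<lambda>y. tr x y - tr w y) \<le> 2 * norm (x - w)"
  for x w :: "'n sobolev"
proof -
  have "norm2 lborel (\<lambda>y. tr x y - tr w y) = norm2 lborel (tr (x - w))"
    by (rule norm2_cong_AE) (use tr_diff[of x w] in \<open>auto elim: eventually_mono\<close>)
  then show ?thesis using norm2_tr_le[of "x - w"] by simp
qed

text \<open>The basic estimate behind both the continuity of the derivative and the passage to weak
  limits.\<close>

lemma K_diff_bound: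
  assumes L: "\<And>a b. \<bar>f a - f b\<bar> \<le> L * \<bar>a - b\<bar> + \<epsilon> * (\<bar>a\<bar> powr p + \<bar>b\<bar> powr p)" and e: "\<epsilon> > 0"
    and C: "\<And>x::'n sobolev. norm x \<le> R \<Longrightarrow> tr_power x \<le> C"
    and x: "norm x \<le> R" "norm w \<le> R" "norm h \<le> R"
  shows "\<bar>K x h - K w h\<bar> \<le> L * (\<integral>y. \<bar>(tr x y - tr w y) * tr h y\<bar> \<partial>lborel) + 4 * \<epsilon> * C"
proof -
  have i1: "integrable lborel (\<lambda>y. \<bar>(tr x y - tr w y) * tr h y\<bar>)"
    by (intro integrable_abs integrable_mult_L2 L2_diff tr_L2)
  note i2 = tr_power_mult_integrable[of x h] tr_power_mult_integrable[of w h]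
  have "K x h - K w h = (\<integral>y. f (tr x y) * tr h y - f (tr w y) * tr h y \<partial>lborel)"
    unfolding K_def by (simp add: f_tr_mult_integrable)
  also have "\<bar>\<dots>\<bar> \<le> (\<integral>y. \<bar>f (tr x y) * tr h y - f (tr w y) * tr h y\<bar> \<partial>lborel)" by (rule integral_abs_bound)
  also have "\<dots> \<le> (\<integral>y. L * \<bar>(tr x y - tr w y) * tr h y\<bar>
      + \<epsilon> * (\<bar>tr x y\<bar> powr p * \<bar>tr h y\<bar> + \<bar>tr w y\<bar> powr p * \<bar>tr h y\<bar>) \<partial>lborel)"
  proof (rule integral_mono)
    show "integrable lborel (\<lambda>y. \<bar>f (tr x y) * tr h y - f (tr w y) * tr h y\<bar>)"
      by (intro integrable_abs Bochner_Integration.integrable_diff f_tr_mult_integrable)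
    show "integrable lborel (\<lambda>y. L * \<bar>(tr x y - tr w y) * tr h y\<bar>
      + \<epsilon> * (\<bar>tr x y\<bar> powr p * \<bar>tr h y\<bar> + \<bar>tr w y\<bar> powr p * \<bar>tr h y\<bar>))"
      by (intro Bochner_Integration.integrable_add integrable_mult_right i1 i2)
    fix y
    have "\<bar>f (tr x y) - f (tr w y)\<bar> * \<bar>tr h y\<bar>
      \<le> (L * \<bar>tr x y - tr w y\<bar> + \<epsilon> * (\<bar>tr x y\<bar> powr p + \<bar>tr w y\<bar> powr p)) * \<bar>tr h y\<bar>"
      by (intro mult_right_mono L) auto
    moreover have "\<bar>f (tr x y) * tr h y - f (tr w y) * tr h y\<bar> = \<bar>f (tr x y) - f (tr w y)\<bar> * \<bar>tr h y\<bar>"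
      by (simp add: left_diff_distrib[symmetric] abs_mult)
    moreover have "\<bar>(tr x y - tr w y) * tr h y\<bar> = \<bar>tr x y - tr w y\<bar> * \<bar>tr h y\<bar>" by (rule abs_mult)
    ultimately show "\<bar>f (tr x y) * tr h y - f (tr w y) * tr h y\<bar> \<le> L * \<bar>(tr x y - tr w y) * tr h y\<bar>
      + \<epsilon> * (\<bar>tr x y\<bar> powr p * \<bar>tr h y\<bar> + \<bar>tr w y\<bar> powr p * \<bar>tr h y\<bar>)"
      by (simp only:) (simp add: algebra_simps)
  qed
  also have "\<dots> = L * (\<integral>y. \<bar>(tr x y - tr w y) * tr h y\<bar> \<partial>lborel)
      + \<epsilon> * ((\<integral>y. \<bar>tr x y\<bar> powr p * \<bar>tr h y\<bar> \<partial>lborel) + (\<integral>y. \<bar>tr w y\<bar> powr p * \<bar>tr h y\<bar> \<partial>lborel))"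
    using i1 i2 by simp
  also have "\<dots> \<le> L * (\<integral>y. \<bar>(tr x y - tr w y) * tr h y\<bar> \<partial>lborel) + \<epsilon> * ((C + C) + (C + C))"
    using e tr_power_mult_le[of x h] tr_power_mult_le[of w h] C[OF x(1)] C[OF x(2)] C[OF x(3)]
    by (intro add_left_mono mult_left_mono add_mono) auto
  finally show ?thesis by simp
qed

lemma tr_mult_le: "(\<integral>y. \<bar>(tr x y - tr w y) * tr h y\<bar> \<partial>lborel) \<le> 4 * norm (x - w) * norm h"
  for x w h :: "'n sobolev"
proof -
  have "(\<integral>y. \<bar>(tr x y - tr w y) * tr h y\<bar> \<partial>lborel) = (\<integral>y. norm (tr x y - tr w y) * norm (tr h y) \<partial>lborel)"
    by (simp add: abs_mult)
  also have "\<dots> \<le> norm2 lborel (\<lambda>y. tr x y - tr w y) * norm2 lborel (tr h)"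
    by (intro Cauchy_Schwarz_norms L2_diff tr_L2)
  also have "\<dots> \<le> (2 * norm (x - w)) * (2 * norm h)"
    by (intro mult_mono norm2_tr_diff_le norm2_tr_le) auto
  finally show ?thesis by simp
qed

lemma K_uniformly_continuous:
  assumes e: "e > 0"
  shows "\<exists>\<delta>>0. \<forall>x w. norm x \<le> R \<longrightarrow> norm w \<le> R \<longrightarrow> norm (x - w) \<le> \<delta> \<longrightarrow> (\<forall>h. \<bar>K x h - K w h\<bar> \<le> e * norm h)"
proof -
  define S where "S = max R 1"
  obtain C where C: "C > 0" "\<And>x::'n sobolev. norm x \<le> S \<Longrightarrow> tr_power x \<le> C"
    using tr_power_bound[of S] by blast
  define \<epsilon> where "\<epsilon> = e / (8 * C)"
  have \<epsilon>: "\<epsilon> > 0" using e C by (simp add: \<epsilon>_def)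
  obtain L where L: "L > 0" "\<And>a b. \<bar>f a - f b\<bar> \<le> L * \<bar>a - b\<bar> + \<epsilon> * (\<bar>a\<bar> powr p + \<bar>b\<bar> powr p)"
    using f_almost_lipschitz[OF \<epsilon>] by blast
  have "\<bar>K x h - K w h\<bar> \<le> e * norm h"
    if x: "norm x \<le> R" "norm w \<le> R" "norm (x - w) \<le> e / (8 * L)" for x w h
  proof (rule homogeneous_bound[where g="\<lambda>h. K x h - K w h"])
    fix h :: "'n sobolev" assume h: "norm h \<le> 1"
    have "\<bar>K x h - K w h\<bar> \<le> L * (\<integral>y. \<bar>(tr x y - tr w y) * tr h y\<bar> \<partial>lborel) + 4 * \<epsilon> * C"
      using x h by (intro K_diff_bound[where R=S, OF L(2) \<epsilon> C(2)]) (auto simp: S_def)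
    also have "L * (\<integral>y. \<bar>(tr x y - tr w y) * tr h y\<bar> \<partial>lborel) \<le> L * (4 * (e / (8 * L)) * 1)"
      using x(3) h L(1) e by (intro mult_left_mono order_trans[OF tr_mult_le] mult_mono) auto
    also have "L * (4 * (e / (8 * L)) * 1) = e / 2" using L(1) by simp
    also have "4 * \<epsilon> * C = e / 2" using C(1) by (simp add: \<epsilon>_def)
    finally show "\<bar>K x h - K w h\<bar> \<le> e" by simp
  qed (simp add: K_scaleR algebra_simps)
  then show ?thesis using e L(1) by (intro exI[of _ "e / (8 * L)"]) auto
qed

lemma K_zero: "K 0 h = 0"
proof -
  have "AE y in lborel. tr (0::'n sobolev) y = 0" using tr_scaleR[of 0 0] by simp
  then have "K 0 h = (\<integral>y. 0 \<partial>(lborel :: (real^'n) measure))"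
    unfolding K_def by (intro integral_cong_AE) (auto elim!: eventually_mono simp: f_nonpos)
  then show ?thesis by simp
qed

lemma K_bounded_linear: "bounded_linear (K x)"
proof -
  define S where "S = max (norm x) 1"
  obtain C where C: "C > 0" "\<And>x::'n sobolev. norm x \<le> S \<Longrightarrow> tr_power x \<le> C"
    using tr_power_bound[of S] by blast
  obtain L where L: "L > 0" "\<And>a b. \<bar>f a - f b\<bar> \<le> L * \<bar>a - b\<bar> + 1 * (\<bar>a\<bar> powr p + \<bar>b\<bar> powr p)"
    using f_almost_lipschitz[of 1] by auto
  have "\<bar>K x h\<bar> \<le> (4 * L * norm x + 4 * C) * norm h" for h
  proof (rule homogeneous_bound)
    fix h :: "'n sobolev" assume h: "norm h \<le> 1"
    have "\<bar>K x h - K 0 h\<bar> \<le> L * (\<integral>y. \<bar>(tr x y - tr 0 y) * tr h y\<bar> \<partial>lborel) + 4 * 1 * C"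
      using h by (intro K_diff_bound[where R=S, OF L(2) _ C(2)]) (auto simp: S_def)
    also have "L * (\<integral>y. \<bar>(tr x y - tr 0 y) * tr h y\<bar> \<partial>lborel) \<le> L * (4 * norm x * 1)"
      using tr_mult_le[of x 0 h] h L(1) by (intro mult_left_mono order_trans[OF tr_mult_le] mult_mono) auto
    finally show "\<bar>K x h\<bar> \<le> 4 * L * norm x + 4 * C" by (simp add: K_zero algebra_simps)
  qed (rule K_scaleR)
  then have "norm (K x h) \<le> norm h * (4 * L * norm x + 4 * C)" for h by (simp add: mult.commute)
  then show ?thesis by (intro bounded_linear_intro) (simp_all add: K_add K_scaleR)
qed

text \<open>The gradient of the energy in the Hilbert space; its zeros are the weak solutions.\<close>

definition G :: "'n sobolev \<Rightarrow> 'n sobolev" where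
  "G x = (SOME g. \<forall>h. form (m\<^sup>2) x h - K x h = g \<bullet> h)"

lemma G_inner: "G x \<bullet> h = form (m\<^sup>2) x h - K x h"
proof -
  have "bounded_linear (\<lambda>h. form (m\<^sup>2) x h - K x h)"
    by (intro bounded_linear_sub form_bounded_linear K_bounded_linear)
  from someI_ex[OF riesz_representation[OF this]]
  have "\<forall>h. form (m\<^sup>2) x h - K x h = G x \<bullet> h" unfolding G_def .
  from this[rule_format, of h] show ?thesis by simp
qed

lemma G_uniformly_continuous:
  assumes e: "e > 0"
  shows "\<exists>\<delta>>0. \<forall>x w. norm x \<le> R \<longrightarrow> norm w \<le> R \<longrightarrow> norm (x - w) \<le> \<delta> \<longrightarrow> norm (G x - G w) \<le> e"
proof -
  obtain \<delta> where \<delta>: "\<delta> > 0" "\<And>x w h. norm x \<le> R \<Longrightarrow> norm w \<le> R \<Longrightarrow> norm (x - w) \<le> \<delta> \<Longrightarrow> \<bar>K x h - K w h\<bar> \<le> e / 2 * norm h"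
    using K_uniformly_continuous[of "e/2" R] e by auto
  define \<delta>' where "\<delta>' = min \<delta> (e / (2 * (2 + m\<^sup>2)))"
  have m2: "2 + m\<^sup>2 > 0" by (simp add: add_pos_nonneg)
  have cancel: "q * (e / (2 * q)) = e / 2" if "q > 0" for q :: real using that by simp
  have "norm (G x - G w) \<le> e" if x: "norm x \<le> R" "norm w \<le> R" "norm (x - w) \<le> \<delta>'" for x w
  proof -
    define h where "h = G x - G w"
    have "form (m\<^sup>2) (x - w) h = form (m\<^sup>2) x h - form (m\<^sup>2) w h"
      by (rule linear_diff[OF bounded_linear.linear[OF form_bounded_linear_left]])
    then have "h \<bullet> h = form (m\<^sup>2) (x - w) h - (K x h - K w h)"
      by (simp add: h_def inner_diff_left[of "G x" "G w"] G_inner)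
    also have "\<dots> \<le> (2 + m\<^sup>2) * norm (x - w) * norm h + e / 2 * norm h"
    proof -
      have "\<bar>K x h - K w h\<bar> \<le> e / 2 * norm h" using x(3) by (intro \<delta>(2) x) (simp add: \<delta>'_def)
      moreover have "\<bar>form (m\<^sup>2) (x - w) h\<bar> \<le> (2 + m\<^sup>2) * norm (x - w) * norm h"
        using form_bound[of "m\<^sup>2" "x - w" h] by simp
      ultimately show ?thesis by linarith
    qed
    also have "(2 + m\<^sup>2) * norm (x - w) \<le> (2 + m\<^sup>2) * (e / (2 * (2 + m\<^sup>2)))"
      using x(3) m2 by (intro mult_left_mono) (auto simp: \<delta>'_def)
    also have "\<dots> = e / 2" by (rule cancel[OF m2])
    finally have "norm h * norm h \<le> e * norm h" by (simp add: dot_square_norm power2_eq_square mult_right_mono)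
    then show ?thesis using e by (cases "norm h = 0") (auto simp: h_def[symmetric])
  qed
  then show ?thesis using \<delta>(1) e m2 by (intro exI[of _ \<delta>']) (auto simp: \<delta>'_def)
qed

text \<open>The remainder of first order at distance \<open>s * b\<close>, divided by \<open>s\<close>: a part that vanishes with \<open>s\<close> and a part
  with the small factor \<open>\<epsilon>\<close>.\<close>

lemma F_taylor_bound:
  assumes L: "\<And>a b. \<bar>f a - f b\<bar> \<le> L * \<bar>a - b\<bar> + \<epsilon> * (\<bar>a\<bar> powr p + \<bar>b\<bar> powr p)" and e: "\<epsilon> > 0" and L0: "L > 0"
    and s: "0 \<le> s" "s \<le> 1"
  shows "\<bar>F (a + s * b) - F a - f a * (s * b)\<bar>
    \<le> s * (s * (L * b\<^sup>2) + 2 * \<epsilon> * 2 powr (p + 1) * (\<bar>a\<bar> powr (p + 1) + \<bar>b\<bar> powr (p + 1)))"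
proof -
  obtain c where c: "\<bar>c - a\<bar> \<le> \<bar>s * b\<bar>" "F (a + s * b) - F a = f c * (s * b)" using F_mean_value by blast
  have sb: "\<bar>s * b\<bar> \<le> \<bar>b\<bar>" using s by (simp add: abs_mult mult_left_le_one_le)
  have "F (a + s * b) - F a - f a * (s * b) = (f c - f a) * (s * b)" using c(2) by (simp add: algebra_simps)
  then have "\<bar>F (a + s * b) - F a - f a * (s * b)\<bar> = \<bar>f c - f a\<bar> * (s * \<bar>b\<bar>)" using s by (simp add: abs_mult)
  also have "\<dots> \<le> (L * (s * \<bar>b\<bar>) + 2 * \<epsilon> * (\<bar>a\<bar> + \<bar>b\<bar>) powr p) * (s * \<bar>b\<bar>)"
  proof (rule mult_right_mono)
    have "\<bar>f c - f a\<bar> \<le> L * \<bar>c - a\<bar> + \<epsilon> * (\<bar>c\<bar> powr p + \<bar>a\<bar> powr p)" by (rule L)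
    also have "\<dots> \<le> L * (s * \<bar>b\<bar>) + \<epsilon> * ((\<bar>a\<bar> + \<bar>b\<bar>) powr p + (\<bar>a\<bar> + \<bar>b\<bar>) powr p)"
      using c(1) sb e L0 p s by (intro add_mono mult_left_mono powr_mono2) (auto simp: abs_mult)
    finally show "\<bar>f c - f a\<bar> \<le> L * (s * \<bar>b\<bar>) + 2 * \<epsilon> * (\<bar>a\<bar> + \<bar>b\<bar>) powr p" by simp
  qed (use s in auto)
  also have "\<dots> = s * (s * (L * b\<^sup>2) + 2 * \<epsilon> * ((\<bar>a\<bar> + \<bar>b\<bar>) powr p * \<bar>b\<bar>))"
    by (simp add: algebra_simps power2_eq_square)
  also have "\<dots> \<le> s * (s * (L * b\<^sup>2) + 2 * \<epsilon> * (2 powr (p + 1) * (\<bar>a\<bar> powr (p + 1) + \<bar>b\<bar> powr (p + 1))))"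
  proof (intro mult_left_mono add_left_mono)
    have "(\<bar>a\<bar> + \<bar>b\<bar>) powr p * \<bar>b\<bar> \<le> (\<bar>a\<bar> + \<bar>b\<bar>) powr p * (\<bar>a\<bar> + \<bar>b\<bar>)" by (intro mult_left_mono) auto
    also have "\<dots> = (\<bar>a\<bar> + \<bar>b\<bar>) powr (p + 1)" by (cases "\<bar>a\<bar> + \<bar>b\<bar> = 0") (simp_all add: powr_add)
    also have "\<dots> \<le> 2 powr (p + 1) * (\<bar>a\<bar> powr (p + 1) + \<bar>b\<bar> powr (p + 1))" using p by (intro powr_add_le) auto
    finally show "(\<bar>a\<bar> + \<bar>b\<bar>) powr p * \<bar>b\<bar> \<le> 2 powr (p + 1) * (\<bar>a\<bar> powr (p + 1) + \<bar>b\<bar> powr (p + 1))" .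
  qed (use s e in auto)
  finally show ?thesis by (simp add: mult.assoc)
qed

lemma J_has_derivative: "(J has_derivative (\<lambda>h. G x \<bullet> h)) (at x)"
  unfolding has_derivative_at
proof (intro conjI)
  show "bounded_linear (\<lambda>h. G x \<bullet> h)" by (rule bounded_linear_inner_right)
  define R where "R = max (norm x) 1"
  obtain C where C: "C > 0" "\<And>x::'n sobolev. norm x \<le> R \<Longrightarrow> tr_power x \<le> C"
    using tr_power_bound[of R] by blast
  show "(\<lambda>h. norm (J (x + h) - J x - G x \<bullet> h) / norm h) \<midarrow>0\<rightarrow> 0"
  proof (rule LIM_I)
    fix e :: real assume e: "e > 0"
    define \<epsilon> where "\<epsilon> = e / (8 * 2 powr (p + 1) * C)"
    have \<epsilon>: "\<epsilon> > 0" using e C by (simp add: \<epsilon>_def)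
    have \<epsilon>C: "2 * \<epsilon> * 2 powr (p + 1) * (C + C) = e / 2" using C(1) by (simp add: \<epsilon>_def)
    obtain L where L: "L > 0" "\<And>a b. \<bar>f a - f b\<bar> \<le> L * \<bar>a - b\<bar> + \<epsilon> * (\<bar>a\<bar> powr p + \<bar>b\<bar> powr p)"
      using f_almost_lipschitz[OF \<epsilon>] by blast
    define M where "M = 4 * L + (2 + m\<^sup>2)"
    have M: "M > 0" using L(1) by (simp add: M_def add_pos_nonneg)
    define \<delta> where "\<delta> = min 1 (e / (4 * M))"
    have \<delta>: "\<delta> > 0" using e M by (simp add: \<delta>_def)
    have "norm (J (x + h) - J x - G x \<bullet> h) / norm h < e" if h: "h \<noteq> 0" "norm h < \<delta>" for h
    proof -
      define s where "s = norm h"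
      have s: "0 < s" "s \<le> 1" "s < e / (4 * M)" using h by (auto simp: s_def \<delta>_def)
      define k where "k = (1 / s) *\<^sub>R h"
      have k: "norm k = 1" "h = s *\<^sub>R k" using s(1) by (auto simp: k_def s_def)
      have AEtr: "AE y in lborel. tr (x + h) y = tr x y + s * tr k y" using tr_lincomb[of x s k] k(2) by simp
      have AEh: "AE y in lborel. tr h y = s * tr k y" using tr_scaleR[of s k] k(2) by simp
      have i2: "integrable lborel (\<lambda>y. (tr k y)\<^sup>2)" using L2_integrable_square[OF tr_L2[of k]] by simp
      have iq: "integrable lborel (\<lambda>y. \<bar>tr x y\<bar> powr (p + 1) + \<bar>tr k y\<bar> powr (p + 1))"
        by (intro Bochner_Integration.integrable_add tr_power_integrable)
      let ?c = "2 * \<epsilon> * 2 powr (p + 1)"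
      have fx: "form (m\<^sup>2) (x + h) (x + h) = form (m\<^sup>2) x x + 2 * form (m\<^sup>2) x h + form (m\<^sup>2) h h"
        by (simp add: form_add_left form_add_right form_commute[of "m\<^sup>2" h x])
      define I where "I = (\<integral>y. F (tr (x + h) y) - F (tr x y) - f (tr x y) * tr h y \<partial>lborel)"
      have eq: "J (x + h) - J x - G x \<bullet> h = 1 / 2 * form (m\<^sup>2) h h - I"
        unfolding J_def G_inner fx K_def I_def using F_tr_integrable f_tr_mult_integrable[of x h] by (simp add: algebra_simps)
      have "\<bar>I\<bar> \<le> (\<integral>y. \<bar>F (tr (x + h) y) - F (tr x y) - f (tr x y) * tr h y\<bar> \<partial>lborel)"
        unfolding I_def by (rule integral_abs_bound)
      also have "\<dots> \<le> (\<integral>y. s * (s * (L * (tr k y)\<^sup>2) + ?c * (\<bar>tr x y\<bar> powr (p + 1) + \<bar>tr k y\<bar> powr (p + 1))) \<partial>lborel)"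
      proof (rule integral_mono_AE)
        show "integrable lborel (\<lambda>y. \<bar>F (tr (x + h) y) - F (tr x y) - f (tr x y) * tr h y\<bar>)"
          by (intro integrable_abs Bochner_Integration.integrable_diff F_tr_integrable f_tr_mult_integrable)
        show "integrable lborel (\<lambda>y. s * (s * (L * (tr k y)\<^sup>2) + ?c * (\<bar>tr x y\<bar> powr (p + 1) + \<bar>tr k y\<bar> powr (p + 1))))"
          by (intro Bochner_Integration.integrable_add integrable_mult_right i2 tr_power_integrable)
        show "AE y in lborel. \<bar>F (tr (x + h) y) - F (tr x y) - f (tr x y) * tr h y\<bar>
          \<le> s * (s * (L * (tr k y)\<^sup>2) + ?c * (\<bar>tr x y\<bar> powr (p + 1) + \<bar>tr k y\<bar> powr (p + 1)))"
          using AEtr AEh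
        proof eventually_elim
          case (elim y)
          show ?case unfolding elim using F_taylor_bound[OF L(2) \<epsilon> L(1), of s "tr x y" "tr k y"] s by simp
        qed
      qed
      also have "\<dots> = s * (s * (L * (\<integral>y. (tr k y)\<^sup>2 \<partial>lborel))
          + ?c * (tr_power x + tr_power k))"
        using i2 tr_power_integrable[of x] tr_power_integrable[of k] by simp
      also have "\<dots> \<le> s * (s * (L * 4) + ?c * (C + C))"
      proof (intro mult_left_mono add_mono)
        have "(norm2 lborel (tr k))\<^sup>2 \<le> 2\<^sup>2" using norm2_tr_le[of k] k(1) by (intro power_mono) auto
        then show "(\<integral>y. (tr k y)\<^sup>2 \<partial>lborel) \<le> 4" by (simp add: norm2_square_real)
        show "tr_power x \<le> C" "tr_power k \<le> C"
          using k(1) by (auto intro!: C(2) simp: R_def)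
      qed (use s L(1) \<epsilon> in auto)
      finally have I_le: "\<bar>I\<bar> \<le> s * (s * (L * 4) + ?c * (C + C))" .
      have "\<bar>form (m\<^sup>2) h h\<bar> \<le> (2 + m\<^sup>2) * s * s" using form_bound[of "m\<^sup>2" h h] by (simp add: s_def)
      moreover have "(2 + m\<^sup>2) * s * s \<ge> 0" using s by (simp add: add_nonneg_nonneg)
      ultimately have "\<bar>J (x + h) - J x - G x \<bullet> h\<bar> \<le> (2 + m\<^sup>2) * s * s + s * (s * (L * 4) + ?c * (C + C))"
        unfolding eq using I_le by linarith
      also have "\<dots> = s * (s * M + e / 2)" unfolding \<epsilon>C by (simp add: M_def algebra_simps)
      also have "\<dots> < s * e"
      proof (rule mult_strict_left_mono)
        have "s * M < e / 4" using s(3) M by (simp add: field_simps)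
        then show "s * M + e / 2 < e" using e by linarith
      qed (rule s)
      finally have "\<bar>J (x + h) - J x - G x \<bullet> h\<bar> < s * e" .
      then show ?thesis using s(1) by (simp add: s_def[symmetric] divide_less_eq mult.commute)
    qed
    then show "\<exists>d>0. \<forall>h. h \<noteq> 0 \<and> norm (h - 0) < d \<longrightarrow> norm (norm (J (x + h) - J x - G x \<bullet> h) / norm h - 0) < e"
      using \<delta> by (intro exI[of _ \<delta>]) auto
  qed
qed

end

section \<open>Translations of Sobolev functions\<close>

lemma L2_half_shift:
  assumes "u \<in> L2 half_measure" shows "(\<lambda>z. u (z + (0, a))) \<in> L2 half_measure"
  using L2_translate[of "zero_ext u" "(0, a)"] assms unfolding L2_half_iff by (simp add: half_space_shift indicator_def)

lemma integral_half_shift: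
  fixes u :: "real \<times> (real ^ 'n) \<Rightarrow> real"
  assumes u: "u \<in> borel_measurable half_measure"
  shows "(\<integral>z. u (z + (0, a)) \<partial>half_measure) = (\<integral>z. u z \<partial>half_measure)"
proof -
  have m: "zero_ext u \<in> borel_measurable borel" using u by (simp add: borel_measurable_restrict_space_iff)
  have "(\<integral>z. u (z + (0, a)) \<partial>half_measure) = (\<integral>z. zero_ext u (z + (0, a)) \<partial>lborel)"
    by (simp add: integral_restrict_space half_space_shift indicator_def)
  also have "\<dots> = (\<integral>z. zero_ext u z \<partial>lborel)" by (rule integral_translate[OF m])
  finally show ?thesis by (simp add: integral_restrict_space)
qed

lemma AE_half_shift:
  assumes "AE z in half_measure. P z"
  shows "AE z in half_measure. P (z + (0, a) :: real \<times> (real ^ 'n))"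
proof -
  have "AE z in lborel. z \<in> half_space \<longrightarrow> P z" using assms by (subst (asm) AE_restrict_space_iff) auto
  from AE_translate[OF this, of "(0, a)"] show ?thesis
    by (subst AE_restrict_space_iff) (auto simp: half_space_shift)
qed

lemma minus_shift: "z - (0, a) = (0, - a) + z" for z :: "real \<times> (real ^ 'n)"
  by (simp add: prod_eq_iff)

lemma test_function_half_shift:
  assumes t: "\<phi> \<in> test_functions half_space"
  shows "(\<lambda>z. \<phi> (z - (0, a))) \<in> test_functions half_space"
proof -
  obtain S where S: "compact S" "S \<subseteq> half_space" "\<And>z. z \<notin> S \<Longrightarrow> \<phi> z = 0" using t by (rule test_functionsE) blast
  show ?thesis
  proof (rule test_functionsI)
    show "Ck k (\<lambda>z. \<phi> (z - (0, a)))" for k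
      using Ck_compose_affine[OF test_function_Ck[OF t], of k "(0, - a)" 1] by (simp add: minus_shift)
    show "compact ((\<lambda>z. z + (0, a)) ` S)" by (intro compact_continuous_image continuous_intros S)
    show "(\<lambda>z. z + (0, a)) ` S \<subseteq> half_space" using S(2) half_space_shift by blast
    fix z assume z: "z \<notin> (\<lambda>z. z + (0, a)) ` S"
    have "z = (z - (0, a)) + (0, a)" by simp
    then show "\<phi> (z - (0, a)) = 0" using z S(3) by blast
  qed
qed

lemma has_weak_gradient_shift:
  fixes u :: "real \<times> (real ^ 'n) \<Rightarrow> real"
  assumes u: "u \<in> L2 half_measure" and g: "has_weak_gradient u g"
  shows "has_weak_gradient (\<lambda>z. u (z + (0, a))) (\<lambda>z. g (z + (0, a)))"
  unfolding has_weak_gradient_def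
proof (intro conjI ballI)
  note gL = has_weak_gradientD(1)[OF g]
  show "(\<lambda>z. g (z + (0, a))) \<in> L2 half_measure" by (rule L2_half_shift[OF gL])
  fix \<phi> :: "real \<times> (real ^ 'n) \<Rightarrow> real" and b :: "real \<times> (real ^ 'n)"
  assume t: "\<phi> \<in> test_functions half_space" and b: "b \<in> Basis"
  let ?\<psi> = "\<lambda>z. \<phi> (z - (0, a))"
  note t' = test_function_half_shift[OF t, of a]
  have p\<psi>: "partial b ?\<psi> z = partial b \<phi> (z - (0, a))" for z
    using frechet_derivative_eqI[OF has_derivative_compose_affine[of \<phi> "(0, - a)" 1 z]]
      Ck_differentiable[OF test_function_Ck[OF t]] by (simp add: minus_shift)
  note L = L2_lborel_imp_half(1)[OF test_function_L2]
  have "(\<integral>z. u (z + (0, a)) * partial b \<phi> z \<partial>half_measure) = (\<integral>z. u z * partial b ?\<psi> z \<partial>half_measure)"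
    using integral_half_shift[of "\<lambda>z. u z * partial b ?\<psi> z" a] L2_measurable[OF u]
      L2_measurable[OF L[OF test_function_partial[OF t' b]]] by (simp add: p\<psi>)
  also have "\<dots> = - (\<integral>z. (g z \<bullet> b) * ?\<psi> z \<partial>half_measure)" by (rule has_weak_gradientD(2)[OF g t' b])
  also have "(\<integral>z. (g z \<bullet> b) * ?\<psi> z \<partial>half_measure) = (\<integral>z. (g (z + (0, a)) \<bullet> b) * \<phi> z \<partial>half_measure)"
    using integral_half_shift[of "\<lambda>z. (g z \<bullet> b) * ?\<psi> z" a] L2_measurable[OF L2_inner_const[OF gL, of b]]
      L2_measurable[OF L[OF t']] by simp
  finally show "(\<integral>z. u (z + (0, a)) * partial b \<phi> z \<partial>half_measure) = - (\<integral>z. (g (z + (0, a)) \<bullet> b) * \<phi> z \<partial>half_measure)" .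
qed

lemma H1_shift: "u \<in> H1 \<Longrightarrow> (\<lambda>z. u (z + (0, a))) \<in> H1"
  for u :: "real \<times> (real ^ 'n) \<Rightarrow> real"
  by (rule H1I[OF L2_half_shift[OF H1_L2] has_weak_gradient_shift[OF H1_L2 has_weak_gradient_weak_gradient]])

definition shift :: "real ^ 'n \<Rightarrow> 'n::finite sobolev \<Rightarrow> 'n sobolev" where
  "shift a x = cls (\<lambda>z. fn x (z + (0, a)))"

lemma fn_shift: "AE z in half_measure. fn (shift a x) z = fn x (z + (0, a))"
  unfolding shift_def by (rule fn_cls[OF H1_shift[OF fn_H1]])

lemma grad_shift: "AE z in half_measure. grad (shift a x) z = grad x (z + (0, a))"
proof -
  have "AE z in half_measure. grad (shift a x) z = weak_gradient (\<lambda>z. fn x (z + (0, a))) z"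
    unfolding shift_def by (rule grad_cls[OF H1_shift[OF fn_H1]])
  moreover have "AE z in half_measure. weak_gradient (\<lambda>z. fn x (z + (0, a))) z = grad x (z + (0, a))"
    by (rule weak_gradient_eq_AE[OF L2_half_shift[OF fn_L2] has_weak_gradient_shift[OF fn_L2 has_weak_gradient_weak_gradient[OF fn_H1]]])
  ultimately show ?thesis by eventually_elim simp
qed

lemma form_shift: "form c (shift a x) (shift a y) = form c x y"
proof -
  have m: "(\<lambda>z. grad x z \<bullet> grad y z + c * fn x z * fn y z) \<in> borel_measurable half_measure" for x y :: "'a sobolev"
    by (intro borel_measurable_add borel_measurable_inner borel_measurable_times borel_measurable_const
        L2_measurable[OF fn_L2] L2_measurable[OF grad_L2])
  have "form c (shift a x) (shift a y) = (\<integral>z. grad x (z + (0, a)) \<bullet> grad y (z + (0, a)) + c * fn x (z + (0, a)) * fn y (z + (0, a)) \<partial>half_measure)"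
    unfolding form_def
  proof (rule integral_cong_AE[OF m])
    show "(\<lambda>z. grad x (z + (0, a)) \<bullet> grad y (z + (0, a)) + c * fn x (z + (0, a)) * fn y (z + (0, a))) \<in> borel_measurable half_measure"
      by (intro borel_measurable_add borel_measurable_inner borel_measurable_times borel_measurable_const
        L2_measurable[OF L2_half_shift[OF fn_L2]] L2_measurable[OF L2_half_shift[OF grad_L2]])
    show "AE z in half_measure. grad (shift a x) z \<bullet> grad (shift a y) z + c * fn (shift a x) z * fn (shift a y) z
      = grad x (z + (0, a)) \<bullet> grad y (z + (0, a)) + c * fn x (z + (0, a)) * fn y (z + (0, a))"
      using fn_shift[of a x] fn_shift[of a y] grad_shift[of a x] grad_shift[of a y] by eventually_elim simp
  qed
  then show ?thesis using integral_half_shift[OF m[of x y], of a] by (simp add: form_def)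
qed

lemma norm_shift: "norm (shift a x) = norm x"
  by (simp add: norm_eq_sqrt_inner inner_sobolev_def form_shift)

lemma shift_diff: "shift a (x - y) = shift a x - shift a y"
  by (rule sobolev_eqI) (use fn_shift[of a "x - y"] fn_shift[of a x] fn_shift[of a y] fn_lincomb(3)[of "shift a x" "shift a y"]
      AE_half_shift[OF fn_lincomb(3)[of x y], of a] in eventually_elim, simp)

lemma shift_shift: "shift a (shift (- a) x) = x"
  by (rule sobolev_eqI) (use fn_shift[of a "shift (- a) x"] AE_half_shift[OF fn_shift[of "- a" x], of a]
      in eventually_elim, simp add: add.assoc zero_prod_def[symmetric])

lemma cls_shift: "u \<in> H1 \<Longrightarrow> cls (\<lambda>z. u (z + (0, a))) = shift a (cls u)"
  for u :: "real \<times> (real ^ 'n) \<Rightarrow> real"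
proof -
  assume u: "u \<in> H1"
  show ?thesis
    by (rule sobolev_eqI) (use fn_cls[OF H1_shift[OF u], of a] fn_shift[of a "cls u"] AE_half_shift[OF fn_cls[OF u], of a]
        in eventually_elim, simp)
qed

lemma tr_shift: "AE y in lborel. tr (shift a x) y = tr x (y + a)"
  for x :: "'n::finite sobolev"
proof -
  obtain \<phi> where \<phi>: "\<And>k. \<phi> k \<in> test_functions UNIV" "(\<lambda>k. cls (\<phi> k)) \<longlonglongrightarrow> x"
    "(\<lambda>k. norm2 lborel (\<lambda>y. \<phi> k (0, y) - tr x y)) \<longlonglongrightarrow> 0" by (rule tr_approx[of x]) blast
  show ?thesis
  proof (rule tr_eqI[where \<phi>="\<lambda>k z. \<phi> k (z + (0, a))"])
    show "(\<lambda>y. tr x (y + a)) \<in> L2 lborel" by (rule L2_translate[OF tr_L2])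
    show "(\<lambda>z. \<phi> k (z + (0, a))) \<in> test_functions UNIV" for k
      using test_function_affine[OF \<phi>(1)[of k], of 1 "(0, a)"] by (simp add: add.commute)
    have "(\<lambda>k. norm (cls (\<phi> k) - x)) \<longlonglongrightarrow> 0" using \<phi>(2) by (simp add: tendsto_norm_zero_iff LIM_zero_iff)
    then have "(\<lambda>k. norm (shift a (cls (\<phi> k)) - shift a x)) \<longlonglongrightarrow> 0"
      by (simp add: shift_diff[symmetric] norm_shift)
    then show "(\<lambda>k. cls (\<lambda>z. \<phi> k (z + (0, a)))) \<longlonglongrightarrow> shift a x"
      by (simp add: cls_shift[OF test_function_H1[OF \<phi>(1)]] tendsto_norm_zero_iff LIM_zero_iff)
    have "norm2 lborel (\<lambda>y. \<phi> k (0, y + a) - tr x (y + a)) = norm2 lborel (\<lambda>y. \<phi> k (0, y) - tr x y)" for k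
      using L2_measurable[OF L2_diff[OF boundary_restriction_L2[OF \<phi>(1)[of k]] tr_L2[of x]]]
      by (intro norm2_translate[of "\<lambda>y. \<phi> k (0, y) - tr x y"]) simp
    then show "(\<lambda>k. norm2 lborel (\<lambda>y. \<phi> k ((0, y) + (0, a)) - tr x (y + a))) \<longlonglongrightarrow> 0" using \<phi>(3) by simp
  qed
qed

section \<open>Concentration and weak limits\<close>

lemma bounded_linear_weak_tendsto:
  fixes g :: "'a::{real_inner,complete_space} \<Rightarrow> real"
  assumes "bounded_linear g" "\<And>h. (\<lambda>n. x n \<bullet> h) \<longlonglongrightarrow> w \<bullet> h"
  shows "(\<lambda>n. g (x n)) \<longlonglongrightarrow> g w"
  using riesz_representation[OF assms(1)] assms(2) by (metis (no_types, lifting) ext inner_commute)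

context boundary_problem
begin

lemma K_shift: "K (shift a x) (shift a h) = K x h"
proof -
  have "K (shift a x) (shift a h) = (\<integral>y. f (tr x (y + a)) * tr h (y + a) \<partial>lborel)"
    unfolding K_def
  proof (rule integral_cong_AE)
    show "AE y in lborel. f (tr (shift a x) y) * tr (shift a h) y = f (tr x (y + a)) * tr h (y + a)"
      using tr_shift[of a x] tr_shift[of a h] by eventually_elim simp
  qed measurable
  also have "\<dots> = K x h" unfolding K_def by (rule integral_translate[of "\<lambda>y. f (tr x y) * tr h y"]) measurable
  finally show ?thesis .
qed

lemma norm_G_shift_le: "norm (G (shift a x)) \<le> norm (G x)"
proof -
  define h where "h = G (shift a x)"
  have "h \<bullet> h = form (m\<^sup>2) (shift a x) (shift a (shift (- a) h)) - K (shift a x) (shift a (shift (- a) h))"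
    unfolding shift_shift by (simp add: h_def G_inner)
  also have "\<dots> = G x \<bullet> shift (- a) h" by (simp add: form_shift K_shift G_inner)
  also have "\<dots> \<le> norm (G x) * norm (shift (- a) h)" by (rule norm_cauchy_schwarz)
  finally have "norm h * norm h \<le> norm (G x) * norm h" by (simp add: norm_shift dot_square_norm power2_eq_square)
  then show ?thesis by (cases "norm h = 0") (auto simp: h_def[symmetric])
qed

text \<open>On critical points the energy equals the integral of a nonnegative function of the trace, which
  makes it lower semicontinuous.\<close>

definition defect :: "real \<Rightarrow> real" where
  "defect t = 1 / 2 * (f t * t) - F t"

lemma defect_nonneg: "0 \<le> defect t"
  using half_AR[of t] by (simp add: defect_def)

lemma defect_continuous: "continuous_on UNIV defect"
  unfolding defect_def[abs_def] by (intro continuous_intros f_continuous F_continuous)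

lemma defect_measurable [measurable]: "defect \<in> borel_measurable borel"
  by (rule borel_measurable_continuous_onI[OF defect_continuous])

lemma defect_integrable: "integrable lborel (\<lambda>y. defect (tr (x :: 'n sobolev) y))"
  unfolding defect_def using F_tr_integrable[of x] f_tr_mult_integrable[of x x] by simp

lemma integral_defect: "(\<integral>y. defect (tr x y) \<partial>lborel) = J x - 1 / 2 * (G x \<bullet> x)"
  unfolding defect_def J_def G_inner K_def using F_tr_integrable[of x] f_tr_mult_integrable[of x x] by (simp add: algebra_simps)

lemma integral_defect_shift: "(\<integral>y. defect (tr (shift a x) y) \<partial>lborel) = (\<integral>y. defect (tr x y) \<partial>lborel)"
  for x :: "'n sobolev"
proof -
  have "(\<integral>y. defect (tr (shift a x) y) \<partial>lborel) = (\<integral>y. defect (tr x (y + a)) \<partial>lborel)"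
  proof (rule integral_cong_AE)
    show "AE y in lborel. defect (tr (shift a x) y) = defect (tr x (y + a))"
      using tr_shift[of a x] by eventually_elim simp
  qed measurable
  then show ?thesis using integral_translate[of "\<lambda>y. defect (tr x y)" a] by simp
qed

lemma unit_cube_mass_shift: "unit_cube_mass (tr (shift a x)) 0 = unit_cube_mass (tr x) a"
  for x :: "'n sobolev"
  unfolding unit_cube_mass_def
proof (rule integral_cong_AE)
  show "AE w in lborel. indicator (cbox 0 One) w * (tr (shift a x) (0 + w))\<^sup>2 = indicator (cbox 0 One) w * (tr x (a + w))\<^sup>2"
    using tr_shift[of a x] by eventually_elim (simp add: add.commute)
qed measurable

text \<open>Otherwise the trace would be small outside a set of small measure, and \<open>K x x\<close> would be small by the two
  growth conditions on the nonlinearity.\<close>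

lemma non_vanishing:
  assumes d: "\<delta> > 0"
  shows "\<exists>\<mu>>0. \<forall>x. norm x \<le> R \<longrightarrow> \<delta> \<le> K x x \<longrightarrow> (\<exists>a. \<mu> < unit_cube_mass (tr x) a)"
proof -
  obtain C where C: "C > 0" "\<And>x::'n sobolev. norm x \<le> R \<Longrightarrow> tr_power x \<le> C"
    using tr_power_bound[of R] by blast
  define \<eta> where "\<eta> = \<delta> / (4 * (4 * R\<^sup>2 + C))"
  have RC: "4 * R\<^sup>2 + C > 0" using C by (simp add: add_nonneg_pos)
  have \<eta>: "\<eta> > 0" using d RC by (simp add: \<eta>_def)
  have \<eta>RC: "\<eta> * (4 * R\<^sup>2) + \<eta> * C = \<delta> / 4"
  proof -
    have "\<eta> * (4 * R\<^sup>2 + C) = \<delta> / 4" using RC by (simp add: \<eta>_def del: distrib_left_numeral)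
    then show ?thesis by (simp add: algebra_simps)
  qed
  obtain \<tau> M where \<tau>: "\<tau> > 0" and M: "M \<ge> 0"
    and b: "\<And>t. f t * t \<le> \<eta> * t\<^sup>2 + \<eta> * \<bar>t\<bar> powr (p + 1) + M * indicator {t. \<bar>t\<bar> > \<tau>} t"
    using f_mult_bound[OF \<eta>] by blast
  define A where "A = 4 * (\<bar>R\<bar> + 1)"
  have A: "A > 0" by (simp add: A_def)
  define \<nu> where "\<nu> = \<delta> / (4 * (M + 1))"
  have \<nu>: "\<nu> > 0" using d M by (simp add: \<nu>_def)
  have M\<nu>: "M * \<nu> \<le> \<delta> / 4" using d M by (simp add: \<nu>_def field_simps)
  obtain \<mu> where \<mu>: "\<mu> > 0" "\<And>v. v \<in> half_smooth A \<Longrightarrow> (\<And>z. unit_cube_mass v z \<le> \<mu>) \<Longrightarrow>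
     emeasure lborel {z::real^'n. \<bar>v z\<bar> > \<tau>} \<le> ennreal \<nu>"
    using vanishing_level_sets[OF \<tau> \<nu> A] by blast
  have "\<exists>a. \<mu> < unit_cube_mass (tr x) a" if x: "norm x \<le> R" and K: "\<delta> \<le> K x x" for x :: "'n sobolev"
  proof (rule ccontr)
    assume "\<not> ?thesis"
    then have "unit_cube_mass (tr x) a \<le> \<mu>" for a by (simp add: not_less)
    moreover have "tr x \<in> half_smooth A" using x by (intro tr_half_smooth) (simp add: A_def)
    ultimately have S: "emeasure lborel {y. \<bar>tr x y\<bar> > \<tau>} \<le> ennreal \<nu>" by (intro \<mu>(2)) auto
    have Sm: "{y. \<bar>tr x y\<bar> > \<tau>} \<in> sets lborel" by measurable
    have Sfin: "emeasure lborel {y. \<bar>tr x y\<bar> > \<tau>} < \<infinity>" using S by (simp add: order_le_less_trans[OF _ ennreal_less_top])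
    have Smeas: "measure lborel {y. \<bar>tr x y\<bar> > \<tau>} \<le> \<nu>"
      using S \<nu> Sfin by (simp add: emeasure_eq_ennreal_measure less_top[symmetric])
    have i1: "integrable lborel (\<lambda>y. (tr x y)\<^sup>2)" using L2_integrable_square[OF tr_L2[of x]] by simp
    have i3: "integrable lborel (\<lambda>y. indicator {y. \<bar>tr x y\<bar> > \<tau>} y :: real)"
      by (rule integrable_real_indicator[OF Sm Sfin])
    have "K x x \<le> (\<integral>y. \<eta> * (tr x y)\<^sup>2 + \<eta> * \<bar>tr x y\<bar> powr (p + 1) + M * indicator {y. \<bar>tr x y\<bar> > \<tau>} y \<partial>lborel)"
      unfolding K_def
    proof (rule integral_mono[OF f_tr_mult_integrable])
      show "integrable lborel (\<lambda>y. \<eta> * (tr x y)\<^sup>2 + \<eta> * \<bar>tr x y\<bar> powr (p + 1) + M * indicator {y. \<bar>tr x y\<bar> > \<tau>} y)"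
        by (intro Bochner_Integration.integrable_add integrable_mult_right i1 i3 tr_power_integrable)
      show "f (tr x y) * tr x y \<le> \<eta> * (tr x y)\<^sup>2 + \<eta> * \<bar>tr x y\<bar> powr (p + 1) + M * indicator {y. \<bar>tr x y\<bar> > \<tau>} y" for y
        using b[of "tr x y"] by (simp add: indicator_def)
    qed
    also have "\<dots> = \<eta> * (\<integral>y. (tr x y)\<^sup>2 \<partial>lborel) + \<eta> * tr_power x
        + M * measure lborel {y. \<bar>tr x y\<bar> > \<tau>}"
      using i1 i3 tr_power_integrable[of x] by simp
    also have "\<dots> \<le> \<eta> * (4 * R\<^sup>2) + \<eta> * C + M * \<nu>"
    proof (intro add_mono mult_left_mono C(2) x Smeas)
      have "(norm2 lborel (tr x))\<^sup>2 \<le> (2 * R)\<^sup>2"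
        using norm2_tr_le[of x] x by (intro power_mono) auto
      then show "(\<integral>y. (tr x y)\<^sup>2 \<partial>lborel) \<le> 4 * R\<^sup>2" by (simp add: norm2_square_real power_mult_distrib)
    qed (use \<eta> M in auto)
    finally show False using \<eta>RC M\<nu> K d by linarith
  qed
  then show ?thesis using \<mu>(1) by blast
qed

lemma average_tr_bounded_linear:
  assumes e: "\<epsilon> > 0"
  shows "bounded_linear (\<lambda>x::'n sobolev. average (cube_kernel \<epsilon>) (tr x) z)"
proof (rule bounded_linear_intro)
  interpret averaging_kernel "cube_kernel \<epsilon> :: real ^ 'n \<Rightarrow> real" "1 / \<epsilon> ^ DIM(real ^ 'n)" by (rule cube_kernel_averaging[OF e])
  have tz: "(\<lambda>w. tr x (z + w)) \<in> L2 lborel" for x :: "'n sobolev" using L2_translate[OF tr_L2, of x z] by (simp add: add.commute)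
  note i = integrable_mult(1)[OF tz]
  have sh: "AE w in lborel. P (z + w)" if "AE w in lborel. P w" for P using AE_translate[OF that, of z] by (simp add: add.commute)
  fix x y :: "'n sobolev" and c :: real
  have "average (cube_kernel \<epsilon>) (tr (x + y)) z = (\<integral>w. cube_kernel \<epsilon> w * tr x (z + w) + cube_kernel \<epsilon> w * tr y (z + w) \<partial>lborel)"
    unfolding average_def
  proof (rule integral_cong_AE)
    show "AE w in lborel. cube_kernel \<epsilon> w * tr (x + y) (z + w) = cube_kernel \<epsilon> w * tr x (z + w) + cube_kernel \<epsilon> w * tr y (z + w)"
      using sh[OF tr_add[of x y]] by eventually_elim (simp add: distrib_left)
  qed measurable
  then show "average (cube_kernel \<epsilon>) (tr (x + y)) z = average (cube_kernel \<epsilon>) (tr x) z + average (cube_kernel \<epsilon>) (tr y) z"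
    using i by (simp add: average_def)
  have "average (cube_kernel \<epsilon>) (tr (c *\<^sub>R x)) z = (\<integral>w. c * (cube_kernel \<epsilon> w * tr x (z + w)) \<partial>lborel)"
    unfolding average_def
  proof (rule integral_cong_AE)
    show "AE w in lborel. cube_kernel \<epsilon> w * tr (c *\<^sub>R x) (z + w) = c * (cube_kernel \<epsilon> w * tr x (z + w))"
      using sh[OF tr_scaleR[of c x]] by eventually_elim simp
  qed measurable
  then show "average (cube_kernel \<epsilon>) (tr (c *\<^sub>R x)) z = c *\<^sub>R average (cube_kernel \<epsilon>) (tr x) z"
    by (simp add: average_def)
  have "\<bar>average (cube_kernel \<epsilon>) (tr x) z\<bar> \<le> norm2 lborel (cube_kernel \<epsilon> :: real ^ 'n \<Rightarrow> real) * norm2 lborel (tr x)"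
    by (rule cube_average_uniform_bound[OF tr_L2 e])
  also have "\<dots> \<le> norm2 lborel (cube_kernel \<epsilon> :: real ^ 'n \<Rightarrow> real) * (2 * norm x)"
    by (intro mult_left_mono norm2_tr_le) simp
  finally show "norm (average (cube_kernel \<epsilon>) (tr x) z) \<le> norm x * (2 * norm2 lborel (cube_kernel \<epsilon> :: real ^ 'n \<Rightarrow> real))"
    by (simp add: mult_ac)
qed

lemma tr_local_convergence:
  fixes x :: "nat \<Rightarrow> 'n sobolev"
  assumes R: "\<And>n. norm (x n) \<le> R" and w: "\<And>h. (\<lambda>n. x n \<bullet> h) \<longlonglongrightarrow> w \<bullet> h"
  shows "(\<lambda>n. norm2 lborel (\<lambda>y. indicator (cball 0 B) y * (tr (x n) y - tr w y))) \<longlonglongrightarrow> 0"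
proof -
  define A where "A = 4 * (max R (norm w) + 1)"
  have "max R (norm w) + 1 > 0" using norm_ge_zero[of w] by linarith
  then have A: "A > 0" by (simp add: A_def)
  show ?thesis
  proof (rule local_convergence_from_averages[OF _ _ A])
    show "tr (x n) \<in> half_smooth A" for n using R[of n] by (intro tr_half_smooth) (simp add: A_def)
    show "tr w \<in> half_smooth A" by (intro tr_half_smooth) (simp add: A_def)
    show "(\<lambda>n. average (cube_kernel \<epsilon>) (tr (x n)) z) \<longlonglongrightarrow> average (cube_kernel \<epsilon>) (tr w) z" if "\<epsilon> > 0" for \<epsilon> z
      by (rule bounded_linear_weak_tendsto[OF average_tr_bounded_linear[OF that] w])
  qed
qed

text \<open>Tested with a function of compact support, the nonlinear term only sees traces in a ball, where they
  converge strongly.\<close>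

lemma weak_limit_critical:
  fixes x :: "nat \<Rightarrow> 'n sobolev"
  assumes R: "\<And>n. norm (x n) \<le> R" and w: "\<And>h. (\<lambda>n. x n \<bullet> h) \<longlonglongrightarrow> w \<bullet> h"
    and G0: "(\<lambda>n. norm (G (x n))) \<longlonglongrightarrow> 0"
  shows "G w = 0"
proof -
  let ?I = "\<lambda>h n. \<integral>y. \<bar>(tr (x n) y - tr w y) * tr h y\<bar> \<partial>lborel"
  have test: "G w \<bullet> cls \<phi> = 0" if t: "\<phi> \<in> test_functions UNIV" for \<phi> :: "real \<times> (real ^ 'n) \<Rightarrow> real"
  proof -
    define h where "h = cls \<phi>"
    obtain B where B: "\<And>z. norm z > B \<Longrightarrow> \<phi> z = 0" using t by (rule test_function_bounded_support) blast
    have trh: "AE y in lborel. y \<notin> cball 0 B \<longrightarrow> tr h y = 0"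
      using tr_test_function[OF t] by eventually_elim (auto simp: h_def B)
    have loc: "?I h n
       \<le> norm2 lborel (\<lambda>y. indicator (cball 0 B) y * (tr (x n) y - tr w y)) * norm2 lborel (tr h)" for n
    proof -
      have [measurable]: "cball (0 :: real ^ 'n) B \<in> sets borel" by simp
      have L: "(\<lambda>y. indicator (cball 0 B) y * (tr (x n) y - tr w y)) \<in> L2 lborel"
        by (rule L2_dominated[OF L2_diff[OF tr_L2[of "x n"] tr_L2[of w]]]) (auto simp: indicator_def)
      have "?I h n
        = (\<integral>y. norm (indicator (cball 0 B) y * (tr (x n) y - tr w y)) * norm (tr h y) \<partial>lborel)"
      proof (rule integral_cong_AE)
        show "AE y in lborel. \<bar>(tr (x n) y - tr w y) * tr h y\<bar> = norm (indicator (cball 0 B) y * (tr (x n) y - tr w y)) * norm (tr h y)"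
          using trh by eventually_elim (auto simp: indicator_def abs_mult)
      qed measurable
      then show ?thesis using Cauchy_Schwarz_norms[OF L tr_L2[of h]] by simp
    qed
    have loc0: "?I h \<longlonglongrightarrow> 0"
    proof (rule Lim_null_comparison[OF always_eventually[OF allI]])
      show "norm (?I h n)
        \<le> norm2 lborel (\<lambda>y. indicator (cball 0 B) y * (tr (x n) y - tr w y)) * norm2 lborel (tr h)" for n
        using loc[of n] by simp
      show "(\<lambda>n. norm2 lborel (\<lambda>y. indicator (cball 0 B) y * (tr (x n) y - tr w y)) * norm2 lborel (tr h)) \<longlonglongrightarrow> 0"
        using tendsto_mult[OF tr_local_convergence[OF R w] tendsto_const] by simp
    qed
    have K0: "(\<lambda>n. K (x n) h) \<longlonglongrightarrow> K w h"
    proof (rule LIMSEQ_I)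
      fix e :: real assume e: "e > 0"
      define S where "S = max R (max (norm w) (norm h))"
      obtain C where C: "C > 0" "\<And>x::'n sobolev. norm x \<le> S \<Longrightarrow> tr_power x \<le> C"
        using tr_power_bound[of S] by blast
      define \<epsilon> where "\<epsilon> = e / (8 * C)"
      have \<epsilon>: "\<epsilon> > 0" "4 * \<epsilon> * C = e / 2" using e C by (auto simp: \<epsilon>_def)
      obtain L where L: "L > 0" "\<And>a b. \<bar>f a - f b\<bar> \<le> L * \<bar>a - b\<bar> + \<epsilon> * (\<bar>a\<bar> powr p + \<bar>b\<bar> powr p)"
        using f_almost_lipschitz[OF \<epsilon>(1)] by blast
      have "e / (2 * L) > 0" using e L by simp
      from LIMSEQ_D[OF loc0 this] obtain n0 where n0: "\<And>n. n \<ge> n0 \<Longrightarrow> ?I h n < e / (2 * L)"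
        by auto
      have "norm (K (x n) h - K w h) < e" if "n \<ge> n0" for n
      proof -
        have "\<bar>K (x n) h - K w h\<bar> \<le> L * ?I h n + 4 * \<epsilon> * C"
          using R[of n] by (intro K_diff_bound[where R=S, OF L(2) \<epsilon>(1) C(2)]) (auto simp: S_def)
        moreover have "L * ?I h n < L * (e / (2 * L))"
          using n0[OF that] L(1) by (intro mult_strict_left_mono)
        moreover have "L * (e / (2 * L)) = e / 2" using L(1) by simp
        ultimately show ?thesis using \<epsilon>(2) by simp
      qed
      then show "\<exists>no. \<forall>n\<ge>no. norm (K (x n) h - K w h) < e" by blast
    qed
    have "(\<lambda>n. form (m\<^sup>2) (x n) h) \<longlonglongrightarrow> form (m\<^sup>2) w h"
      by (rule bounded_linear_weak_tendsto[OF form_bounded_linear_left w])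
    then have "(\<lambda>n. G (x n) \<bullet> h) \<longlonglongrightarrow> G w \<bullet> h" unfolding G_inner by (intro tendsto_diff K0)
    moreover have "(\<lambda>n. G (x n) \<bullet> h) \<longlonglongrightarrow> 0"
    proof (rule Lim_null_comparison[OF always_eventually[OF allI]])
      show "norm (G (x n) \<bullet> h) \<le> norm (G (x n)) * norm h" for n using Cauchy_Schwarz_ineq2[of "G (x n)" h] by simp
      show "(\<lambda>n. norm (G (x n)) * norm h) \<longlonglongrightarrow> 0" using tendsto_mult[OF G0 tendsto_const] by simp
    qed
    ultimately show ?thesis unfolding h_def by (rule LIMSEQ_unique)
  qed
  obtain \<phi> where t: "\<And>k. \<phi> k \<in> test_functions UNIV" and lim: "(\<lambda>k. cls (\<phi> k)) \<longlonglongrightarrow> G w"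
    using test_functions_dense_seq[of "G w"] by blast
  have "(\<lambda>k. G w \<bullet> cls (\<phi> k)) \<longlonglongrightarrow> G w \<bullet> G w" by (intro tendsto_intros lim)
  then have "G w \<bullet> G w = 0" unfolding test[OF t] LIMSEQ_const_iff by simp
  then show ?thesis by simp
qed

text \<open>Fatou's lemma on balls of increasing size, along subsequences on which the traces converge almost
  everywhere.\<close>

lemma weak_limit_defect_le:
  fixes x :: "nat \<Rightarrow> 'n sobolev"
  assumes R: "\<And>n. norm (x n) \<le> R" and w: "\<And>h. (\<lambda>n. x n \<bullet> h) \<longlonglongrightarrow> w \<bullet> h"
    and c: "(\<lambda>n. \<integral>y. defect (tr (x n) y) \<partial>lborel) \<longlonglongrightarrow> c"
  shows "(\<integral>y. defect (tr w y) \<partial>lborel) \<le> c"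
proof -
  have loc: "(\<integral>y. indicator (cball 0 B) y * defect (tr w y) \<partial>lborel) \<le> c" for B
  proof (rule field_le_epsilon)
    fix e :: real assume e: "e > 0"
    have cb [measurable]: "cball (0 :: real ^ 'n) B \<in> sets borel" by simp
    let ?d = "\<lambda>n y. indicator (cball 0 B) y * (tr (x n) y - tr w y)"
    have L: "?d n \<in> L2 lborel" for n
      by (rule L2_dominated[OF L2_diff[OF tr_L2[of "x n"] tr_L2[of w]]]) (auto simp: indicator_def)
    have "(\<lambda>n. \<integral>y. norm ((?d n y)\<^sup>2) \<partial>lborel) \<longlonglongrightarrow> 0"
      using tendsto_power[OF tr_local_convergence[OF R w, of B], of 2] by (simp add: norm2_square_real)
    from tendsto_L1_AE_subseq[OF _ this] L2_integrable_square[OF L]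
    obtain r where r: "strict_mono r" "AE y in lborel. (\<lambda>n. (?d (r n) y)\<^sup>2) \<longlonglongrightarrow> 0" by auto
    have AElim: "AE y in lborel. (\<lambda>n. indicator (cball 0 B) y * defect (tr (x (r n)) y)) \<longlonglongrightarrow> indicator (cball 0 B) y * defect (tr w y)"
      using r(2)
    proof eventually_elim
      case (elim y)
      show ?case
      proof (cases "y \<in> cball 0 B")
        case True
        then have "(\<lambda>n. sqrt ((tr (x (r n)) y - tr w y)\<^sup>2)) \<longlonglongrightarrow> sqrt 0" using elim by (intro tendsto_real_sqrt) simp
        then have "(\<lambda>n. tr (x (r n)) y) \<longlonglongrightarrow> tr w y" by (simp add: tendsto_rabs_zero_iff LIM_zero_iff)
        then have "(\<lambda>n. defect (tr (x (r n)) y)) \<longlonglongrightarrow> defect (tr w y)"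
          using defect_continuous by (intro isCont_tendsto_compose[of _ defect]) (auto simp: continuous_on_eq_continuous_at)
        then show ?thesis using True by simp
      qed simp
    qed
    have ind_int: "integrable lborel (\<lambda>y. indicator (cball 0 B) y * defect (tr u y))" for u :: "'n sobolev"
      by (rule Bochner_Integration.integrable_bound[OF defect_integrable[of u]]) (auto simp: indicator_def)
    have ev: "\<forall>\<^sub>F n in sequentially. (\<integral>y. indicator (cball 0 B) y * defect (tr (x (r n)) y) \<partial>lborel) \<le> c + e"
    proof -
      have "(\<lambda>n. \<integral>y. defect (tr (x (r n)) y) \<partial>lborel) \<longlonglongrightarrow> c" using LIMSEQ_subseq_LIMSEQ[OF c r(1)] by (simp add: o_def)
      then have "\<forall>\<^sub>F n in sequentially. (\<integral>y. defect (tr (x (r n)) y) \<partial>lborel) < c + e" using e by (intro order_tendstoD) auto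
      then show ?thesis
      proof eventually_elim
        case (elim n)
        have "(\<integral>y. indicator (cball 0 B) y * defect (tr (x (r n)) y) \<partial>lborel) \<le> (\<integral>y. defect (tr (x (r n)) y) \<partial>lborel)"
          using defect_nonneg by (intro integral_mono ind_int defect_integrable) (auto simp: indicator_def)
        then show ?case using elim by simp
      qed
    qed
    show "(\<integral>y. indicator (cball 0 B) y * defect (tr w y) \<partial>lborel) \<le> c + e"
      by (rule fatou_bounded(2)[OF ind_int _ _ AElim ev]) (auto simp: defect_nonneg)
  qed
  have "(\<lambda>k. \<integral>y. indicator (cball 0 (real k)) y * defect (tr w y) \<partial>lborel) \<longlonglongrightarrow> (\<integral>y. defect (tr w y) \<partial>lborel)"
  proof (rule integral_dominated_convergence[where w="\<lambda>y. defect (tr w y)"])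
    show "AE y in lborel. (\<lambda>k. indicator (cball 0 (real k)) y * defect (tr w y)) \<longlonglongrightarrow> defect (tr w y)"
    proof (rule AE_I2)
      fix y :: "real ^ 'n"
      obtain k0 where "norm y \<le> real k0" using real_arch_simple by blast
      then have "\<forall>\<^sub>F k in sequentially. indicator (cball 0 (real k)) y * defect (tr w y) = defect (tr w y)"
        unfolding eventually_sequentially by (intro exI[of _ k0]) auto
      then show "(\<lambda>k. indicator (cball 0 (real k)) y * defect (tr w y)) \<longlonglongrightarrow> defect (tr w y)" by (rule tendsto_eventually)
    qed
    show "AE y in lborel. norm (indicator (cball 0 (real k)) y * defect (tr w y)) \<le> defect (tr w y)" for k
      using defect_nonneg by (intro AE_I2) (auto simp: indicator_def)
    have [measurable]: "cball (0 :: real ^ 'n) (real k) \<in> sets borel" for k by simp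
    show "(\<lambda>y. indicator (cball 0 (real k)) y * defect (tr w y)) \<in> borel_measurable lborel" for k by measurable
  qed (use defect_integrable[of w] in auto)
  then show ?thesis by (rule LIMSEQ_le_const2) (use loc in auto)
qed

text \<open>Mass that does not vanish can be translated to the origin, where compactness is local. This
  single statement serves both the sequences from the mountain pass and the sequences of solutions that
  minimize the energy.\<close>

lemma almost_critical_concentration:
  fixes x :: "nat \<Rightarrow> 'n sobolev"
  assumes R: "\<And>n. norm (x n) \<le> R" and G0: "(\<lambda>n. norm (G (x n))) \<longlonglongrightarrow> 0"
    and d: "\<delta> > 0" "\<And>n. \<delta> \<le> K (x n) (x n)" and c: "(\<lambda>n. J (x n)) \<longlonglongrightarrow> c"
  shows "\<exists>w. w \<noteq> 0 \<and> G w = 0 \<and> J w \<le> c"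
proof -
  obtain \<mu> where \<mu>: "\<mu> > 0" "\<And>x. norm x \<le> R \<Longrightarrow> \<delta> \<le> K x x \<Longrightarrow> \<exists>a. \<mu> < unit_cube_mass (tr x) a"
    using non_vanishing[OF d(1)] by blast
  have "\<exists>a. \<forall>n. \<mu> < unit_cube_mass (tr (x n)) (a n)" using \<mu>(2)[OF R d(2)] by (intro choice) blast
  then obtain a where a: "\<And>n. \<mu> < unit_cube_mass (tr (x n)) (a n)" by blast
  define y where "y n = shift (a n) (x n)" for n
  have yR: "norm (y n) \<le> R" for n using R by (simp add: y_def norm_shift)
  obtain r w where r: "strict_mono r" and w: "\<And>h. (\<lambda>n. y (r n) \<bullet> h) \<longlonglongrightarrow> w \<bullet> h"
    using bounded_imp_weakly_convergent_subseq[of y, OF yR] by blast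
  note yrR = yR[of "r _"]
  have "(\<lambda>n. norm (G (y n))) \<longlonglongrightarrow> 0"
    by (rule Lim_null_comparison[OF _ G0]) (simp add: y_def norm_G_shift_le)
  from LIMSEQ_subseq_LIMSEQ[OF this r] have Gy: "(\<lambda>n. norm (G (y (r n)))) \<longlonglongrightarrow> 0" by (simp add: o_def)
  have Gw: "G w = 0" by (rule weak_limit_critical[OF yrR w Gy])
  have "w \<noteq> 0"
  proof
    assume "w = 0"
    then have tw: "AE y in lborel. tr w y = 0" using tr_scaleR[of 0 w] by simp
    let ?B = "real DIM(real ^ 'n)"
    have "\<mu> \<le> (norm2 lborel (\<lambda>z. indicator (cball 0 ?B) z * (tr (y (r n)) z - tr w z)))\<^sup>2" for n
    proof -
      have [measurable]: "cball (0 :: real ^ 'n) ?B \<in> sets borel" by simp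
      have L: "(\<lambda>z. indicator (cball 0 ?B) z * (tr (y (r n)) z - tr w z)) \<in> L2 lborel"
        by (rule L2_dominated[OF L2_diff[OF tr_L2[of "y (r n)"] tr_L2[of w]]]) (auto simp: indicator_def)
      have "\<mu> < unit_cube_mass (tr (y (r n))) 0" unfolding y_def unit_cube_mass_shift by (rule a)
      also have "\<dots> \<le> (\<integral>z. (norm (indicator (cball 0 ?B) z * (tr (y (r n)) z - tr w z)))\<^sup>2 \<partial>lborel)"
        unfolding unit_cube_mass_def
      proof (rule integral_mono_AE[OF _ L2_integrable_square[OF L]])
        have "integrable lborel (\<lambda>z. (tr (y (r n)) z)\<^sup>2)" using L2_integrable_square[OF tr_L2[of "y (r n)"]] by simp
        then show "integrable lborel (\<lambda>z. indicator (cbox 0 One) z * (tr (y (r n)) (0 + z))\<^sup>2)"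
          by (rule Bochner_Integration.integrable_bound) (auto simp: indicator_def)
        show "AE z in lborel. indicator (cbox 0 One) z * (tr (y (r n)) (0 + z))\<^sup>2
          \<le> (norm (indicator (cball 0 ?B) z * (tr (y (r n)) z - tr w z)))\<^sup>2"
          using tw
        proof eventually_elim
          case (elim z)
          have "z \<in> cball 0 ?B" if "z \<in> cbox 0 One" using norm_le_cube[of z 1] that by simp
          then show ?case using elim by (cases "z \<in> cbox 0 One") auto
        qed
      qed
      finally show ?thesis by (simp add: norm2_square)
    qed
    moreover have "(\<lambda>n. (norm2 lborel (\<lambda>z. indicator (cball 0 ?B) z * (tr (y (r n)) z - tr w z)))\<^sup>2) \<longlonglongrightarrow> 0\<^sup>2"
      by (intro tendsto_power tr_local_convergence[OF yrR w])
    ultimately have "\<mu> \<le> 0\<^sup>2" using LIMSEQ_le_const by blast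
    then show False using \<mu>(1) by simp
  qed
  moreover have "J w \<le> c"
  proof -
    have "(\<lambda>n. J (x n) - 1 / 2 * (G (x n) \<bullet> x n)) \<longlonglongrightarrow> c - 1 / 2 * 0"
    proof (intro tendsto_intros c)
      show "(\<lambda>n. G (x n) \<bullet> x n) \<longlonglongrightarrow> 0"
      proof (rule Lim_null_comparison[OF always_eventually[OF allI]])
        show "norm (G (x n) \<bullet> x n) \<le> norm (G (x n)) * R" for n
          using Cauchy_Schwarz_ineq2[of "G (x n)" "x n"] mult_left_mono[OF R[of n] norm_ge_zero[of "G (x n)"]] by simp
        show "(\<lambda>n. norm (G (x n)) * R) \<longlonglongrightarrow> 0" using tendsto_mult[OF G0 tendsto_const] by simp
      qed
    qed
    then have "(\<lambda>n. \<integral>z. defect (tr (y n) z) \<partial>lborel) \<longlonglongrightarrow> c"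
      by (simp add: y_def integral_defect_shift integral_defect)
    from LIMSEQ_subseq_LIMSEQ[OF this r] have "(\<lambda>n. \<integral>z. defect (tr (y (r n)) z) \<partial>lborel) \<longlonglongrightarrow> c" by (simp add: o_def)
    from weak_limit_defect_le[OF yrR w this] show ?thesis by (simp add: integral_defect Gw)
  qed
  ultimately show ?thesis using Gw by blast
qed

end

section \<open>Existence of a nontrivial critical point\<close>

context boundary_problem
begin

abbreviation c0 :: real where "c0 \<equiv> min 1 (m\<^sup>2)"

lemma c0_pos: "c0 > 0"
  using m by simp

lemma form_lower: "c0 * (norm x)\<^sup>2 \<le> form (m\<^sup>2) x x"
  for x :: "'n sobolev"
proof -
  have "c0 * (norm2 half_measure (grad x))\<^sup>2 \<le> 1 * (norm2 half_measure (grad x))\<^sup>2" by (intro mult_right_mono) auto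
  moreover have "c0 * (norm2 half_measure (fn x))\<^sup>2 \<le> m\<^sup>2 * (norm2 half_measure (fn x))\<^sup>2" by (intro mult_right_mono) auto
  ultimately show ?thesis unfolding form_self norm_sobolev_square distrib_left by linarith
qed

lemma tr_power_homogeneous:
  "\<exists>C>0. \<forall>x::'n sobolev. tr_power x \<le> C * norm x powr (p + 1)"
proof -
  obtain C where C: "C > 0" "\<And>x::'n sobolev. norm x \<le> 1 \<Longrightarrow> tr_power x \<le> C"
    using tr_power_bound[of 1] by blast
  have "tr_power x \<le> C * norm x powr (p + 1)" for x :: "'n sobolev"
  proof -
    define k where "k = (1 / norm x) *\<^sub>R x"
    have k: "norm k \<le> 1" "x = norm x *\<^sub>R k" by (auto simp: k_def)
    have AEk: "AE y in lborel. tr x y = norm x * tr k y" using tr_scaleR[of "norm x" k] k(2) by simp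
    have "tr_power x = (\<integral>y. norm x powr (p + 1) * \<bar>tr k y\<bar> powr (p + 1) \<partial>lborel)"
    proof (rule integral_cong_AE)
      show "AE y in lborel. \<bar>tr x y\<bar> powr (p + 1) = norm x powr (p + 1) * \<bar>tr k y\<bar> powr (p + 1)"
        using AEk by eventually_elim (simp add: abs_mult powr_mult)
    qed measurable
    also have "\<dots> = norm x powr (p + 1) * tr_power k" by simp
    also have "\<dots> \<le> norm x powr (p + 1) * C" by (intro mult_left_mono C(2) k(1)) simp
    finally show ?thesis by (simp add: mult.commute)
  qed
  then show ?thesis using C(1) by blast
qed

text \<open>Near the origin the nonlinear term is negligible against the quadratic form.\<close>

lemma K_small: "\<exists>r>0. \<forall>x. norm x \<le> r \<longrightarrow> K x x \<le> c0 / 2 * (norm x)\<^sup>2"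
proof -
  obtain C where C: "C > 0" "\<And>t. f t * t \<le> c0 / 16 * t\<^sup>2 + C * \<bar>t\<bar> powr (p + 1)"
    using f_mult_growth[of "c0 / 16"] c0_pos by auto
  obtain D where D: "D > 0" "\<And>x::'n sobolev. tr_power x \<le> D * norm x powr (p + 1)"
    using tr_power_homogeneous by blast
  define r where "r = (c0 / (4 * C * D)) powr (1 / (p - 1))"
  have "0 < c0 / (4 * C * D)" by (intro divide_pos_pos mult_pos_pos c0_pos C(1) D(1)) simp
  then have r: "r > 0" unfolding r_def powr_gt_zero by linarith
  have "K x x \<le> c0 / 2 * (norm x)\<^sup>2" if x: "norm x \<le> r" for x
  proof -
    have i1: "integrable lborel (\<lambda>y. (tr x y)\<^sup>2)" using L2_integrable_square[OF tr_L2[of x]] by simp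
    have "K x x \<le> (\<integral>y. c0 / 16 * (tr x y)\<^sup>2 + C * \<bar>tr x y\<bar> powr (p + 1) \<partial>lborel)"
      unfolding K_def
      by (intro integral_mono f_tr_mult_integrable Bochner_Integration.integrable_add integrable_mult_right i1 tr_power_integrable C(2))
    also have "\<dots> = c0 / 16 * (\<integral>y. (tr x y)\<^sup>2 \<partial>lborel) + C * tr_power x"
      using i1 tr_power_integrable[of x] by simp
    also have "\<dots> \<le> c0 / 16 * (4 * (norm x)\<^sup>2) + C * (D * norm x powr (p + 1))"
    proof (intro add_mono mult_left_mono D(2))
      have "(norm2 lborel (tr x))\<^sup>2 \<le> (2 * norm x)\<^sup>2" by (intro power_mono norm2_tr_le) simp
      then show "(\<integral>y. (tr x y)\<^sup>2 \<partial>lborel) \<le> 4 * (norm x)\<^sup>2" by (simp add: norm2_square_real power_mult_distrib)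
    qed (use c0_pos C in auto)
    also have "C * (D * norm x powr (p + 1)) \<le> c0 / 4 * (norm x)\<^sup>2"
    proof -
      have "norm x powr (p - 1) \<le> r powr (p - 1)" using x p by (intro powr_mono2) auto
      also have "r powr (p - 1) = c0 / (4 * C * D)" using p c0_pos C D by (simp add: r_def powr_powr)
      finally have le: "C * D * norm x powr (p - 1) \<le> c0 / 4" using C D by (simp add: field_simps)
      have "norm x powr (p + 1) = norm x powr (p - 1) * (norm x)\<^sup>2"
      proof (cases "norm x = 0")
        case False
        have "norm x powr (p + 1) = norm x powr ((p - 1) + 2)" by (simp add: algebra_simps)
        also have "\<dots> = norm x powr (p - 1) * norm x powr 2" by (rule powr_add)
        finally show ?thesis using False by (simp add: powr_numeral)
      qed simp
      then have "C * (D * norm x powr (p + 1)) = (C * D * norm x powr (p - 1)) * (norm x)\<^sup>2" by simp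
      also have "\<dots> \<le> c0 / 4 * (norm x)\<^sup>2" by (intro mult_right_mono le) simp
      finally show ?thesis .
    qed
    finally show ?thesis by (simp add: mult.commute)
  qed
  then show ?thesis using r by blast
qed

lemma integral_F_le: "(\<integral>y. F (tr x y) \<partial>lborel) \<le> 1 / 2 * K x x"
proof -
  have "(\<integral>y. F (tr x y) \<partial>lborel) \<le> (\<integral>y. 1 / 2 * (f (tr x y) * tr x y) \<partial>lborel)"
    by (intro integral_mono F_tr_integrable integrable_mult_right f_tr_mult_integrable half_AR)
  then show ?thesis by (simp add: K_def)
qed

lemma J_ge_K: "2 * J x - G x \<bullet> x \<le> K x x"
proof -
  have "(\<integral>y. F (tr x y) \<partial>lborel) \<ge> 0" using F_nonneg by simp
  then show ?thesis by (simp add: J_def G_inner)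
qed

text \<open>The superquadraticity condition bounds almost critical points in terms of their energy.\<close>

lemma almost_critical_bound: "(\<theta> / 2 - 1) * c0 * (norm x)\<^sup>2 \<le> \<theta> * J x - G x \<bullet> x"
proof -
  have "\<theta> * (\<integral>y. F (tr x y) \<partial>lborel) = (\<integral>y. \<theta> * F (tr x y) \<partial>lborel)" by simp
  also have "\<dots> \<le> K x x" unfolding K_def
    by (intro integral_mono integrable_mult_right F_tr_integrable f_tr_mult_integrable AR_le)
  finally have "(\<theta> / 2 - 1) * form (m\<^sup>2) x x \<le> \<theta> * J x - G x \<bullet> x"
    by (simp add: J_def G_inner algebra_simps)
  moreover have "(\<theta> / 2 - 1) * (c0 * (norm x)\<^sup>2) \<le> (\<theta> / 2 - 1) * form (m\<^sup>2) x x"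
    using \<theta> by (intro mult_left_mono form_lower) simp
  ultimately show ?thesis by (simp add: mult.assoc)
qed

text \<open>Along a ray through a function with positive boundary values the boundary integral grows like
  \<open>s\<^sup>\<theta>\<close> with \<open>\<theta> > 2\<close>, faster than the quadratic part.\<close>

lemma J_tends_to_minus_infinity: "\<exists>e. J e \<le> 0 \<and> r < norm e"
proof -
  obtain \<eta> :: "real \<times> (real ^ 'n) \<Rightarrow> real" where \<eta>: "\<eta> \<in> test_functions UNIV" "\<And>z. 0 \<le> \<eta> z" "\<eta> 0 = 1"
    using cutoff_exists by blast
  define \<phi> where "\<phi> z = 2 * \<eta> z" for z
  have t: "\<phi> \<in> test_functions UNIV" unfolding \<phi>_def by (rule test_function_cmult[OF \<eta>(1)])
  define S where "S = {y. \<phi> (0, y) > 1}"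
  have cont: "continuous_on UNIV (\<lambda>y. \<phi> (0, y))"
    by (intro continuous_on_compose2[OF test_function_continuous[OF t]] continuous_intros) auto
  have So: "open S" unfolding S_def by (intro open_Collect_less continuous_on_const cont)
  have "0 \<in> S" using \<eta>(3) by (simp add: S_def \<phi>_def zero_prod_def)
  obtain R where R: "\<And>z. norm z > R \<Longrightarrow> \<phi> z = 0" using t by (rule test_function_bounded_support) blast
  have "S \<subseteq> cball 0 R"
  proof
    fix y assume "y \<in> S"
    then have "\<phi> (0, y) \<noteq> 0" by (simp add: S_def)
    then have "norm (0::real, y) \<le> R" using R[of "(0, y)"] by (meson not_le)
    then show "y \<in> cball 0 R" by (simp add: norm_Pair)
  qed
  then have Sfin: "emeasure lborel S < \<infinity>" by (intro emeasure_bounded_finite bounded_subset[OF bounded_cball])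
  have "emeasure lborel S \<noteq> 0"
  proof -
    obtain e where e: "e > 0" "ball 0 e \<subseteq> S" using So \<open>0 \<in> S\<close> open_contains_ball by blast
    have "emeasure lborel (ball (0 :: real ^ 'n) e) \<le> emeasure lborel S" using e So by (intro emeasure_mono) auto
    moreover have "emeasure lborel (ball (0 :: real ^ 'n) e) > 0" using e(1) by (simp add: emeasure_ball unit_ball_vol_pos ennreal_zero_less_mult_iff)
    ultimately show ?thesis by auto
  qed
  then have \<mu>: "measure lborel S > 0" using Sfin by (simp add: measure_def enn2real_positive_iff zero_less_iff_neq_zero)
  define u where "u = cls \<phi>"
  define \<mu> where "\<mu> = F 1 * measure lborel S"
  have \<mu>0: "\<mu> > 0" using \<mu> F_1_pos by (simp add: \<mu>_def)
  have Flow: "\<mu> * s powr \<theta> \<le> (\<integral>y. F (tr (s *\<^sub>R u) y) \<partial>lborel)" if s: "s \<ge> 1" for s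
  proof -
    have iS: "integrable lborel (\<lambda>y. indicator S y :: real)" using Sfin So by (intro integrable_real_indicator) auto
    have "\<mu> * s powr \<theta> = (\<integral>y. F 1 * s powr \<theta> * indicator S y \<partial>lborel)" by (simp add: \<mu>_def)
    also have "\<dots> \<le> (\<integral>y. F (tr (s *\<^sub>R u) y) \<partial>lborel)"
    proof (rule integral_mono_AE[OF integrable_mult_right[OF iS] F_tr_integrable])
      show "AE y in lborel. F 1 * s powr \<theta> * indicator S y \<le> F (tr (s *\<^sub>R u) y)"
        using tr_scaleR[of s u] tr_test_function[OF t]
      proof eventually_elim
        case (elim y)
        show ?case
        proof (cases "y \<in> S")
          case True
          define q where "q = s * \<phi> (0, y)"
          have q: "s \<le> q" using True s mult_left_mono[of 1 "\<phi> (0, y)" s] by (simp add: q_def S_def)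
          have "F 1 * s powr \<theta> \<le> F 1 * q powr \<theta>" using q s \<theta> F_1_pos by (intro mult_left_mono powr_mono2) auto
          also have "\<dots> \<le> F q" using q s by (intro F_growth) simp
          finally show ?thesis using True elim by (simp add: q_def u_def)
        qed (use F_nonneg in simp)
      qed
    qed
    finally show ?thesis .
  qed
  have unz: "norm u > 0"
  proof (rule ccontr)
    assume "\<not> norm u > 0"
    then have "u = 0" by simp
    then have "\<mu> \<le> (\<integral>y. F (tr (0 :: 'n sobolev) y) \<partial>lborel)" using Flow[of 1] by simp
    also have "\<dots> \<le> 1 / 2 * K 0 0" by (rule integral_F_le)
    finally show False using \<mu>0 by (simp add: K_zero)
  qed
  define M where "M = \<bar>form (m\<^sup>2) u u\<bar>"
  define s where "s = max (max 1 ((M / \<mu>) powr (1 / (\<theta> - 2)))) (\<bar>r\<bar> / norm u + 1)"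
  have s: "s \<ge> 1" "(M / \<mu>) powr (1 / (\<theta> - 2)) \<le> s" "\<bar>r\<bar> / norm u + 1 \<le> s" by (auto simp: s_def)
  have "M / \<mu> \<le> s powr (\<theta> - 2)"
  proof -
    have "((M / \<mu>) powr (1 / (\<theta> - 2))) powr (\<theta> - 2) \<le> s powr (\<theta> - 2)" using s(2) \<theta> by (intro powr_mono2) auto
    then show ?thesis using \<theta> \<mu>0 by (simp add: powr_powr M_def)
  qed
  then have "M \<le> \<mu> * s powr (\<theta> - 2)" using \<mu>0 by (simp add: pos_divide_le_eq mult.commute)
  then have "M * s\<^sup>2 \<le> \<mu> * s powr (\<theta> - 2) * s\<^sup>2" by (intro mult_right_mono) auto
  also have "\<dots> = \<mu> * s powr \<theta>"
  proof -
    have "s powr \<theta> = s powr ((\<theta> - 2) + 2)" by simp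
    also have "\<dots> = s powr (\<theta> - 2) * s powr 2" by (rule powr_add)
    finally show ?thesis using s(1) by (simp add: powr_numeral)
  qed
  finally have Ms: "M * s\<^sup>2 \<le> \<mu> * s powr \<theta>" .
  have "form (m\<^sup>2) (s *\<^sub>R u) (s *\<^sub>R u) = s\<^sup>2 * form (m\<^sup>2) u u"
    using form_scaleR_left[of "m\<^sup>2" s u "s *\<^sub>R u"] form_scaleR_left[of "m\<^sup>2" s u u] form_commute[of "m\<^sup>2" u "s *\<^sub>R u"]
    by (simp add: power2_eq_square)
  also have "\<dots> \<le> s\<^sup>2 * M" by (intro mult_left_mono) (auto simp: M_def)
  finally have "J (s *\<^sub>R u) \<le> 1 / 2 * (s\<^sup>2 * M) - \<mu> * s powr \<theta>" using Flow[OF s(1)] unfolding J_def by linarith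
  moreover have "M * s\<^sup>2 \<ge> 0" by (simp add: M_def)
  ultimately have "J (s *\<^sub>R u) \<le> 0" using Ms by (simp add: mult.commute)
  moreover have "r < norm (s *\<^sub>R u)"
  proof -
    have "r < \<bar>r\<bar> + norm u" using unz by linarith
    also have "\<dots> = (\<bar>r\<bar> / norm u + 1) * norm u" using unz by (simp add: distrib_right)
    also have "\<dots> \<le> s * norm u" using s(3) unz by (intro mult_right_mono) auto
    finally show ?thesis using s(1) by simp
  qed
  ultimately show ?thesis by blast
qed

text \<open>Almost critical points at levels between \<open>a / 2\<close> and \<open>b\<close> are bounded, and the lower bound on their energy
  keeps \<open>K x x\<close> away from \<open>0\<close>.\<close>

lemma nontrivial_critical_point_exists: "\<exists>w. w \<noteq> 0 \<and> G w = 0"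
proof -
  obtain r where r: "r > 0" "\<And>x. norm x \<le> r \<Longrightarrow> K x x \<le> c0 / 2 * (norm x)\<^sup>2" using K_small by blast
  define a where "a = c0 / 4 * r\<^sup>2"
  have a: "a > 0" using c0_pos r(1) by (simp add: a_def)
  have ridge: "a \<le> J x" if x: "norm x = r" for x
  proof -
    have "(\<integral>y. F (tr x y) \<partial>lborel) \<le> 1 / 2 * (c0 / 2 * (norm x)\<^sup>2)" using integral_F_le[of x] r(2)[of x] x by simp
    then show ?thesis using form_lower[of x] x unfolding J_def a_def by simp
  qed
  obtain e where e: "J e \<le> 0" "r < norm e" using J_tends_to_minus_infinity by blast
  have J0: "J 0 \<le> 0"
  proof -
    have "(\<integral>y. F (tr (0::'n sobolev) y) \<partial>lborel) \<ge> 0" using F_nonneg by simp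
    moreover have "form (m\<^sup>2) (0::'n sobolev) 0 = 0" using form_scaleR_left[of "m\<^sup>2" 0 "0::'n sobolev" 0] by simp
    ultimately show ?thesis by (simp add: J_def)
  qed
  obtain b where b: "\<And>\<delta>. \<delta> > 0 \<Longrightarrow> \<exists>x. a / 2 \<le> J x \<and> J x \<le> b \<and> norm (G x) \<le> \<delta>"
    using mountain_pass_almost_critical_points[OF J_has_derivative G_uniformly_continuous J0 e(1) r(1) e(2) a ridge] by blast
  define L where "L = (\<theta> / 2 - 1) * c0"
  have L: "L > 0" using \<theta> c0_pos by (simp add: L_def)
  define R where "R = (\<theta> * \<bar>b\<bar> + 1) / L + 1"
  have R: "R \<ge> 1" using L \<theta> by (simp add: R_def)
  have bound: "norm x \<le> R" if x: "J x \<le> b" "norm (G x) \<le> 1" for x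
  proof (rule ccontr)
    assume "\<not> norm x \<le> R"
    then have xR: "norm x > R" by simp
    then have x1: "norm x \<ge> 1" using R by linarith
    have "\<theta> * J x \<le> \<theta> * \<bar>b\<bar>" using x(1) \<theta> by (intro mult_left_mono) auto
    also have "\<dots> \<le> \<theta> * \<bar>b\<bar> * norm x" using x1 \<theta> mult_left_mono[of 1 "norm x" "\<theta> * \<bar>b\<bar>"] by simp
    finally have 1: "\<theta> * J x \<le> \<theta> * \<bar>b\<bar> * norm x" .
    have "\<bar>G x \<bullet> x\<bar> \<le> norm (G x) * norm x" by (rule Cauchy_Schwarz_ineq2)
    also have "\<dots> \<le> 1 * norm x" using x(2) by (intro mult_right_mono) auto
    finally have "\<bar>G x \<bullet> x\<bar> \<le> norm x" by simp
    then have "L * (norm x)\<^sup>2 \<le> (\<theta> * \<bar>b\<bar> + 1) * norm x"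
      using almost_critical_bound[of x] 1 unfolding L_def[symmetric] distrib_right by linarith
    then have "L * norm x * norm x \<le> (\<theta> * \<bar>b\<bar> + 1) * norm x" by (simp add: power2_eq_square mult.assoc)
    then have "L * norm x \<le> \<theta> * \<bar>b\<bar> + 1" using x1 mult_right_le_imp_le[of "L * norm x" "norm x" "\<theta> * \<bar>b\<bar> + 1"] by linarith
    then have "norm x \<le> (\<theta> * \<bar>b\<bar> + 1) / L" using L by (simp add: pos_le_divide_eq mult.commute)
    then show False using xR by (simp add: R_def)
  qed
  define d where "d n = min 1 (a / (2 * R)) * inverse (real (Suc n))" for n
  have d: "d n > 0" "d n \<le> 1" "d n \<le> a / (2 * R)" for n
  proof -
    have i: "0 < inverse (real (Suc n))" "inverse (real (Suc n)) \<le> 1" by (auto simp: field_simps)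
    have mm: "min 1 (a / (2 * R)) > 0" using a R by simp
    show "d n > 0" unfolding d_def using i mm by (intro mult_pos_pos)
    have "d n \<le> min 1 (a / (2 * R))" unfolding d_def using i mm by (intro mult_left_le) auto
    then show "d n \<le> 1" "d n \<le> a / (2 * R)" by auto
  qed
  have "\<exists>x. \<forall>n. a / 2 \<le> J (x n) \<and> J (x n) \<le> b \<and> norm (G (x n)) \<le> d n"
    using b[OF d(1)] by (intro choice) blast
  then obtain x where x: "\<And>n. a / 2 \<le> J (x n)" "\<And>n. J (x n) \<le> b" "\<And>n. norm (G (x n)) \<le> d n" by blast
  have xR: "norm (x n) \<le> R" for n by (rule bound[OF x(2) order_trans[OF x(3) d(2)]])
  have "d \<longlonglongrightarrow> min 1 (a / (2 * R)) * 0" unfolding d_def by (intro tendsto_intros LIMSEQ_inverse_real_of_nat)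
  then have d0: "d \<longlonglongrightarrow> 0" by simp
  have G0: "(\<lambda>n. norm (G (x n))) \<longlonglongrightarrow> 0"
    by (rule Lim_null_comparison[OF _ d0]) (simp add: x(3))
  have K: "a / 2 \<le> K (x n) (x n)" for n
  proof -
    have "G (x n) \<bullet> x n \<le> norm (G (x n)) * norm (x n)" by (rule norm_cauchy_schwarz)
    also have "\<dots> \<le> a / (2 * R) * R" using xR[of n] x(3)[of n] d(3)[of n] a R by (intro mult_mono) auto
    also have "\<dots> = a / 2" using R by simp
    finally show ?thesis using J_ge_K[of "x n"] x(1)[of n] by linarith
  qed
  have "bounded (range (\<lambda>n. J (x n)))"
    proof (rule boundedI[of _ "\<bar>b\<bar>"])
    fix v assume "v \<in> range (\<lambda>n. J (x n))"
    then obtain n where "v = J (x n)" by blast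
    then show "norm v \<le> \<bar>b\<bar>" using x(1,2)[of n] a by simp
  qed
  from bounded_imp_convergent_subsequence[OF this] obtain c s where s: "strict_mono s" "((\<lambda>n. J (x n)) \<circ> s) \<longlonglongrightarrow> c" by blast
  have "\<exists>w. w \<noteq> 0 \<and> G w = 0 \<and> J w \<le> c"
  proof (rule almost_critical_concentration[where x="\<lambda>n. x (s n)"])
    show "(\<lambda>n. norm (G (x (s n)))) \<longlonglongrightarrow> 0" using LIMSEQ_subseq_LIMSEQ[OF G0 s(1)] by (simp add: o_def)
    show "(\<lambda>n. J (x (s n))) \<longlonglongrightarrow> c" using s(2) by (simp add: o_def)
    show "a / 2 > 0" using a by simp
  qed (rule xR, rule K)
  then show ?thesis by blast
qed

text \<open>A sequence of nonzero solutions that minimizes the energy is bounded, and as \<open>K x x = form (m\<^sup>2) x x\<close> on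
  solutions, the estimate near the origin keeps \<open>K x x\<close> away from \<open>0\<close>. The limit produced by concentration is again a competitor.\<close>

lemma least_energy_critical_point_exists: "\<exists>w. w \<noteq> 0 \<and> G w = 0 \<and> (\<forall>x. x \<noteq> 0 \<longrightarrow> G x = 0 \<longrightarrow> J w \<le> J x)"
proof -
  define S where "S = {x. x \<noteq> 0 \<and> G x = 0}"
  have ne: "S \<noteq> {}" using nontrivial_critical_point_exists by (auto simp: S_def)
  define L where "L = (\<theta> / 2 - 1) * c0"
  have L: "L > 0" using \<theta> c0_pos by (simp add: L_def)
  have AR': "L * (norm x)\<^sup>2 \<le> \<theta> * J x" if "x \<in> S" for x using almost_critical_bound[of x] that by (simp add: S_def L_def)
  have Jnn: "0 \<le> J x" if "x \<in> S" for x
  proof -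
    have "0 \<le> L * (norm x)\<^sup>2" using L by simp
    then have "0 \<le> \<theta> * J x" using AR'[OF that] by linarith
    then show ?thesis using \<theta> by (simp add: zero_le_mult_iff)
  qed
  define c where "c = Inf (J ` S)"
  have bdd: "bdd_below (J ` S)" using Jnn by (intro bdd_belowI[of _ 0]) auto
  have cle: "c \<le> J x" if "x \<in> S" for x unfolding c_def using that bdd by (simp add: cInf_lower)
  have "\<exists>x\<in>S. J x < c + inverse (real (Suc n))" for n
  proof -
    have "Inf (J ` S) < c + inverse (real (Suc n))" by (simp add: c_def)
    then show ?thesis using ne bdd by (subst (asm) cInf_less_iff) auto
  qed
  then have "\<exists>x. \<forall>n. x n \<in> S \<and> J (x n) < c + inverse (real (Suc n))" by (intro choice) blast
  then obtain x where xS: "\<And>n. x n \<in> S" and xJ: "\<And>n. J (x n) < c + inverse (real (Suc n))" by blast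
  have lim: "(\<lambda>n. J (x n)) \<longlonglongrightarrow> c"
  proof (rule real_tendsto_sandwich[where f="\<lambda>_. c" and h="\<lambda>n. c + inverse (real (Suc n))"])
    show "(\<lambda>n. c + inverse (real (Suc n))) \<longlonglongrightarrow> c"
      using tendsto_add[OF tendsto_const LIMSEQ_inverse_real_of_nat, of c] by simp
  qed (use cle xS xJ in \<open>auto intro!: always_eventually less_imp_le simp del: of_nat_Suc\<close>)
  obtain r where r: "r > 0" "\<And>x. norm x \<le> r \<Longrightarrow> K x x \<le> c0 / 2 * (norm x)\<^sup>2" using K_small by blast
  have KS: "c0 * r\<^sup>2 \<le> K y y" if y: "y \<in> S" for y
  proof -
    have eq: "K y y = form (m\<^sup>2) y y" using y G_inner[of y y] by (simp add: S_def)
    have "norm y > r"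
    proof (rule ccontr)
      assume "\<not> norm y > r"
      then have "c0 * (norm y)\<^sup>2 \<le> c0 / 2 * (norm y)\<^sup>2" using r(2)[of y] form_lower[of y] eq by linarith
      moreover have "c0 * (norm y)\<^sup>2 > 0" using c0_pos y by (intro mult_pos_pos) (auto simp: S_def)
      ultimately show False by linarith
    qed
    then have "c0 * r\<^sup>2 \<le> c0 * (norm y)\<^sup>2" using r(1) c0_pos by (intro mult_left_mono power_mono) auto
    then show ?thesis using form_lower[of y] eq by linarith
  qed
  define R where "R = sqrt (\<theta> * (c + 1) / L)"
  have "norm (x n) \<le> R" for n
  proof -
    have "inverse (real (Suc n)) \<le> 1" by (simp add: field_simps)
    then have "\<theta> * J (x n) \<le> \<theta> * (c + 1)" using xJ[of n] \<theta> by (intro mult_left_mono) linarith+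
    then have "L * (norm (x n))\<^sup>2 \<le> \<theta> * (c + 1)" using AR'[OF xS[of n]] by linarith
    then have "(norm (x n))\<^sup>2 \<le> \<theta> * (c + 1) / L" using L by (simp add: pos_le_divide_eq mult.commute)
    then show ?thesis unfolding R_def by (rule real_le_rsqrt)
  qed
  moreover have "(\<lambda>n. norm (G (x n))) \<longlonglongrightarrow> 0" using xS by (simp add: S_def)
  moreover have "c0 * r\<^sup>2 > 0" using c0_pos r(1) by (intro mult_pos_pos) auto
  ultimately obtain w where "w \<noteq> 0" "G w = 0" "J w \<le> c"
    using almost_critical_concentration[of x R "c0 * r\<^sup>2" c] KS[OF xS] lim by blast
  then show ?thesis using cle by (intro exI[of _ w]) (auto simp: S_def intro: order_trans)
qed

end

section \<open>Nonnegativity\<close>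

text \<open>The regularized absolute value \<open>sqrt (t\<^sup>2 + c\<^sup>2)\<close>; its \<open>k\<close>-th derivative is a polynomial times
  \<open>(t\<^sup>2 + c\<^sup>2) powr (1 / 2 - k)\<close>.\<close>

primrec smooth_abs_poly :: "real \<Rightarrow> nat \<Rightarrow> real poly" where
  "smooth_abs_poly c 0 = 1"
| "smooth_abs_poly c (Suc k) = pderiv (smooth_abs_poly c k) * [:c\<^sup>2, 0, 1:] + [:0, 1 - 2 * real k:] * smooth_abs_poly c k"

definition smooth_abs_deriv :: "real \<Rightarrow> nat \<Rightarrow> real \<Rightarrow> real" where
  "smooth_abs_deriv c k t = poly (smooth_abs_poly c k) t * (t\<^sup>2 + c\<^sup>2) powr (1 / 2 - real k)"

lemma smooth_abs_deriv_has_derivative: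
  assumes c: "c > 0"
  shows "(smooth_abs_deriv c k has_real_derivative smooth_abs_deriv c (Suc k) t) (at t)"
proof -
  define q where "q = t\<^sup>2 + c\<^sup>2"
  have q: "q > 0" using c by (simp add: q_def add_nonneg_pos)
  have split: "q powr (1 / 2 - real k) = q * q powr (1 / 2 - real (Suc k))"
  proof -
    have "q powr (1 / 2 - real k) = q powr (1 + (1 / 2 - real (Suc k)))" by simp
    also have "\<dots> = q powr 1 * q powr (1 / 2 - real (Suc k))" by (rule powr_add)
    finally show ?thesis using q by simp
  qed
  have "((\<lambda>t. (t\<^sup>2 + c\<^sup>2) powr (1 / 2 - real k)) has_real_derivative
      (1 / 2 - real k) * q powr (1 / 2 - real k - 1) * (2 * t)) (at t)"
    using DERIV_fun_powr[of "\<lambda>t. t\<^sup>2 + c\<^sup>2" "2 * t" t "1 / 2 - real k"] q by (auto simp: q_def intro!: derivative_eq_intros)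
  from DERIV_mult[OF poly_DERIV[of "smooth_abs_poly c k"] this]
  have "(smooth_abs_deriv c k has_real_derivative
      poly (pderiv (smooth_abs_poly c k)) t * q powr (1 / 2 - real k)
      + (1 / 2 - real k) * q powr (1 / 2 - real k - 1) * (2 * t) * poly (smooth_abs_poly c k) t) (at t)"
    unfolding smooth_abs_deriv_def[abs_def] q_def .
  moreover have "1 / 2 - real k - 1 = 1 / 2 - real (Suc k)" by simp
  then have "poly (pderiv (smooth_abs_poly c k)) t * q powr (1 / 2 - real k)
      + (1 / 2 - real k) * q powr (1 / 2 - real k - 1) * (2 * t) * poly (smooth_abs_poly c k) t = smooth_abs_deriv c (Suc k) t"
    unfolding split smooth_abs_deriv_def q_def[symmetric]
    by (simp only: smooth_abs_poly.simps poly_add poly_mult) (simp add: q_def power2_eq_square algebra_simps)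
  ultimately show ?thesis by simp
qed

text \<open>The function \<open>sqrt (\<phi>\<^sup>2 + \<epsilon>\<^sup>2) - \<epsilon>\<close> has the support of \<open>\<phi>\<close>, and its gradient is that of \<open>\<phi>\<close> times
  a factor of modulus at most \<open>1\<close>.\<close>

lemma test_function_smooth_abs:
  fixes \<phi> :: "'a::euclidean_space \<Rightarrow> real"
  assumes t: "\<phi> \<in> test_functions UNIV" and e: "\<epsilon> > 0"
  shows "\<exists>\<psi>\<in>test_functions UNIV. (\<forall>z. 0 \<le> \<psi> z \<and> \<psi> z \<le> \<bar>\<phi> z\<bar> \<and> \<bar>\<phi> z\<bar> \<le> \<psi> z + \<epsilon>) \<and>
    (\<forall>z. norm (gradient \<psi> z) \<le> norm (gradient \<phi> z))"
proof -
  have g: "smooth_abs_deriv \<epsilon> 0 t = sqrt (t\<^sup>2 + \<epsilon>\<^sup>2)" for t by (simp add: smooth_abs_deriv_def powr_half_sqrt)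
  define \<psi> where "\<psi> z = smooth_abs_deriv \<epsilon> 0 (\<phi> z) + - \<epsilon>" for z
  obtain S where S: "compact S" "\<And>z. z \<notin> S \<Longrightarrow> \<phi> z = 0" using t by (rule test_functionsE) blast
  have "\<psi> \<in> test_functions UNIV"
  proof (rule test_functionsI[OF _ S(1)])
    show "Ck k \<psi>" for k
      unfolding \<psi>_def[abs_def]
      by (intro Ck_add Ck_const Ck_compose_real[where G="smooth_abs_deriv \<epsilon>", OF smooth_abs_deriv_has_derivative[OF e]] test_function_Ck[OF t])
    show "z \<notin> S \<Longrightarrow> \<psi> z = 0" for z using e S(2)[of z] by (simp add: \<psi>_def g)
  qed simp
  moreover have "0 \<le> \<psi> z \<and> \<psi> z \<le> \<bar>\<phi> z\<bar> \<and> \<bar>\<phi> z\<bar> \<le> \<psi> z + \<epsilon>" for z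
  proof -
    have "\<epsilon> \<le> sqrt ((\<phi> z)\<^sup>2 + \<epsilon>\<^sup>2)" by (rule real_le_rsqrt) simp
    moreover have "\<bar>\<phi> z\<bar> \<le> sqrt ((\<phi> z)\<^sup>2 + \<epsilon>\<^sup>2)" by (rule real_le_rsqrt) simp
    moreover have "sqrt ((\<phi> z)\<^sup>2 + \<epsilon>\<^sup>2) \<le> \<bar>\<phi> z\<bar> + \<epsilon>"
      using e by (intro real_le_lsqrt) (simp_all add: power2_sum)
    ultimately show ?thesis by (simp add: \<psi>_def g)
  qed
  moreover have "norm (gradient \<psi> z) \<le> norm (gradient \<phi> z)" for z
  proof -
    define a where "a = smooth_abs_deriv \<epsilon> (Suc 0) (\<phi> z)"
    have "(\<psi> has_derivative (\<lambda>h. a * partial h \<phi> z + 0)) (at z)"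
      unfolding \<psi>_def[abs_def] a_def
      by (intro has_derivative_add has_derivative_const
          has_derivative_compose_real[OF smooth_abs_deriv_has_derivative[OF e]] test_function_has_derivative[OF t])
    then have "gradient \<psi> z = a *\<^sub>R gradient \<phi> z"
      by (simp add: gradient_def frechet_derivative_eqI scaleR_sum_right)
    moreover have "\<bar>a\<bar> \<le> 1"
    proof -
      define q where "q = (\<phi> z)\<^sup>2 + \<epsilon>\<^sup>2"
      have q: "q > 0" using e by (simp add: q_def add_nonneg_pos)
      have "q powr (1 / 2 - real (Suc 0)) = q powr (- (1 / 2))" by simp
      also have "\<dots> = 1 / sqrt q" using q by (simp only: powr_minus powr_half_sqrt[OF less_imp_le] inverse_eq_divide)
      finally have "a = \<phi> z / sqrt q"
        unfolding a_def smooth_abs_deriv_def q_def[symmetric] by (simp add: pderiv_1)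
      moreover have "\<bar>\<phi> z\<bar> \<le> sqrt q" by (rule real_le_rsqrt) (simp add: q_def)
      ultimately show ?thesis using q by (simp add: abs_divide)
    qed
    ultimately show ?thesis by (simp add: mult_left_le_one_le)
  qed
  ultimately show ?thesis by blast
qed

context boundary_problem
begin

text \<open>As \<open>f\<close> is nonnegative, replacing \<open>\<phi>\<close> by a regularization of \<open>\<bar>\<phi>\<bar>\<close> lowers \<open>K w\<close> by at most the integral of
  \<open>f (tr w)\<close> times the error of the regularization, which tends to \<open>0\<close> by dominated convergence.\<close>

lemma nonnegative_competitor:
  assumes t: "\<phi> \<in> test_functions UNIV" and d: "\<delta> > 0"
  shows "\<exists>\<psi>\<in>test_functions UNIV. (\<forall>z. 0 \<le> \<psi> z) \<and> K w (cls \<phi>) \<le> K w (cls \<psi>) + \<delta>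
    \<and> form (m\<^sup>2) (cls \<psi>) (cls \<psi>) \<le> form (m\<^sup>2) (cls \<phi>) (cls \<phi>)"
proof -
  define e where "e n = inverse (real (Suc n))" for n
  have e: "e n > 0" for n by (simp add: e_def)
  define a where "a n = (\<integral>y. f (tr w y) * min (e n) \<bar>tr (cls \<phi>) y\<bar> \<partial>lborel)" for n
  have dom: "integrable lborel (\<lambda>y. \<bar>f (tr w y) * tr (cls \<phi>) y\<bar>)" by (intro integrable_abs f_tr_mult_integrable)
  have bnd: "norm (f (tr w y) * min (e n) \<bar>tr (cls \<phi>) y\<bar>) \<le> \<bar>f (tr w y) * tr (cls \<phi>) y\<bar>" for n y
  proof -
    have "\<bar>f (tr w y)\<bar> * \<bar>min (e n) \<bar>tr (cls \<phi>) y\<bar>\<bar> \<le> \<bar>f (tr w y)\<bar> * \<bar>tr (cls \<phi>) y\<bar>"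
      using e[of n] by (intro mult_left_mono) auto
    then show ?thesis by (simp only: real_norm_def abs_mult)
  qed
  have ia: "integrable lborel (\<lambda>y. f (tr w y) * min (e n) \<bar>tr (cls \<phi>) y\<bar>)" for n
    by (rule Bochner_Integration.integrable_bound[OF dom]) (measurable, simp only: real_norm_def abs_idempotent AE_I2[OF bnd[unfolded real_norm_def]])
  have "a \<longlonglongrightarrow> integral\<^sup>L (lborel :: (real ^ 'n) measure) (\<lambda>y. 0)"
    unfolding a_def[abs_def]
  proof (rule integral_dominated_convergence[OF _ _ dom])
    show "AE y in lborel. (\<lambda>n. f (tr w y) * min (e n) \<bar>tr (cls \<phi>) y\<bar>) \<longlonglongrightarrow> 0"
    proof (rule AE_I2)
      fix y
      have "(\<lambda>n. f (tr w y) * min (e n) \<bar>tr (cls \<phi>) y\<bar>) \<longlonglongrightarrow> f (tr w y) * min 0 \<bar>tr (cls \<phi>) y\<bar>"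
        unfolding e_def by (intro tendsto_intros LIMSEQ_inverse_real_of_nat)
      then show "(\<lambda>n. f (tr w y) * min (e n) \<bar>tr (cls \<phi>) y\<bar>) \<longlonglongrightarrow> 0" by simp
    qed
  qed (use bnd in auto)
  then have "\<forall>\<^sub>F n in sequentially. a n < \<delta>" using d by (intro order_tendstoD(2)) simp_all
  then obtain n where n: "a n < \<delta>" by (rule eventually_happens'[OF sequentially_bot, THEN exE])
  obtain \<psi> where \<psi>: "\<psi> \<in> test_functions UNIV" "\<And>z. 0 \<le> \<psi> z" "\<And>z. \<psi> z \<le> \<bar>\<phi> z\<bar>" "\<And>z. \<bar>\<phi> z\<bar> \<le> \<psi> z + e n"
    "\<And>z. norm (gradient \<psi> z) \<le> norm (gradient \<phi> z)"
    using test_function_smooth_abs[OF t e[of n]] by blast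
  have "K w (cls \<phi>) \<le> (\<integral>y. f (tr w y) * tr (cls \<psi>) y + f (tr w y) * min (e n) \<bar>tr (cls \<phi>) y\<bar> \<partial>lborel)"
    unfolding K_def
  proof (rule integral_mono_AE[OF f_tr_mult_integrable Bochner_Integration.integrable_add[OF f_tr_mult_integrable ia]])
    show "AE y in lborel. f (tr w y) * tr (cls \<phi>) y \<le> f (tr w y) * tr (cls \<psi>) y + f (tr w y) * min (e n) \<bar>tr (cls \<phi>) y\<bar>"
      using tr_test_function[OF t] tr_test_function[OF \<psi>(1)]
    proof eventually_elim
      case (elim y)
      have "\<phi> (0, y) \<le> \<psi> (0, y) + min (e n) \<bar>\<phi> (0, y)\<bar>" using \<psi>(2,4)[of "(0, y)"] by linarith
      then have "f (tr w y) * \<phi> (0, y) \<le> f (tr w y) * (\<psi> (0, y) + min (e n) \<bar>\<phi> (0, y)\<bar>)"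
        by (intro mult_left_mono f_nonneg)
      then show ?case by (simp only: elim distrib_left)
    qed
  qed
  also have "\<dots> = K w (cls \<psi>) + a n" unfolding K_def a_def by (rule Bochner_Integration.integral_add[OF f_tr_mult_integrable ia])
  finally have "K w (cls \<phi>) \<le> K w (cls \<psi>) + \<delta>" using n by linarith
  moreover have "form (m\<^sup>2) (cls \<psi>) (cls \<psi>) \<le> form (m\<^sup>2) (cls \<phi>) (cls \<phi>)"
  proof -
    have "norm2 half_measure (gradient \<psi>) \<le> norm2 half_measure (gradient \<phi>)"
      using \<psi>(5) by (intro norm2_mono L2_lborel_imp_half(1) gradient_L2[OF t] L2_measurable[OF L2_lborel_imp_half(1)] gradient_L2[OF \<psi>(1)]) simp
    moreover have "norm2 half_measure \<psi> \<le> norm2 half_measure \<phi>"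
      using \<psi>(2,3) by (intro norm2_mono L2_lborel_imp_half(1) test_function_L2[OF t] L2_measurable[OF L2_lborel_imp_half(1)] test_function_L2[OF \<psi>(1)]) simp
    ultimately show ?thesis
      unfolding form_self norm2_grad_cls_test[OF t, symmetric] norm2_grad_cls_test[OF \<psi>(1), symmetric]
      by (intro add_mono mult_left_mono power_mono) auto
  qed
  ultimately show ?thesis using \<psi>(1,2) by blast
qed

text \<open>A critical point \<open>w\<close> is the unique minimizer of the strictly convex functional
  \<open>1 / 2 * form (m\<^sup>2) x x - K w x\<close>, in which the nonlinearity is frozen at \<open>w\<close>. The competitors built from
  approximations of \<open>w\<close> show that \<open>w\<close> is a limit of nonnegative functions.\<close>

lemma critical_point_nonneg:
  assumes w: "G w = 0"
  shows "AE z in half_measure. 0 \<le> fn w z"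
proof -
  have fw: "form (m\<^sup>2) w h = K w h" for h using G_inner[of w h] w by simp
  have expand: "form (m\<^sup>2) (x - w) (x - w) = form (m\<^sup>2) x x - 2 * K w x + K w w" for x
  proof -
    have "form (m\<^sup>2) x x = form (m\<^sup>2) (x - w) x + form (m\<^sup>2) w x"
      and "form (m\<^sup>2) (x - w) x = form (m\<^sup>2) (x - w) (x - w) + form (m\<^sup>2) (x - w) w"
      and "form (m\<^sup>2) x w = form (m\<^sup>2) (x - w) w + form (m\<^sup>2) w w"
      using form_add_left[of "m\<^sup>2" "x - w" w x] form_add_right[of "m\<^sup>2" "x - w" "x - w" w] form_add_left[of "m\<^sup>2" "x - w" w w]
      by simp_all
    then show ?thesis using form_commute[of "m\<^sup>2" x w] fw[of x] fw[of w] by linarith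
  qed
  obtain \<phi> where \<phi>: "\<And>k. \<phi> k \<in> test_functions UNIV" "(\<lambda>k. cls (\<phi> k)) \<longlonglongrightarrow> w"
    using test_functions_dense_seq[of w] by blast
  have "\<exists>\<psi>. \<forall>k. \<psi> k \<in> test_functions UNIV \<and> (\<forall>z. 0 \<le> \<psi> k z) \<and> K w (cls (\<phi> k)) \<le> K w (cls (\<psi> k)) + inverse (real (Suc k))
      \<and> form (m\<^sup>2) (cls (\<psi> k)) (cls (\<psi> k)) \<le> form (m\<^sup>2) (cls (\<phi> k)) (cls (\<phi> k))"
    using nonnegative_competitor[OF \<phi>(1)] by (intro choice) (simp add: Bex_def del: of_nat_Suc)
  then obtain \<psi> where \<psi>: "\<And>k. \<psi> k \<in> test_functions UNIV" "\<And>k z. 0 \<le> \<psi> k z"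
    "\<And>k. K w (cls (\<phi> k)) \<le> K w (cls (\<psi> k)) + inverse (real (Suc k))"
    "\<And>k. form (m\<^sup>2) (cls (\<psi> k)) (cls (\<psi> k)) \<le> form (m\<^sup>2) (cls (\<phi> k)) (cls (\<phi> k))" by blast
  define C where "C = 2 + m\<^sup>2"
  have b: "c0 * (norm (cls (\<psi> k) - w))\<^sup>2 \<le> C * (norm (cls (\<phi> k) - w))\<^sup>2 + 2 * inverse (real (Suc k))" for k
  proof -
    have "\<bar>form (m\<^sup>2) (cls (\<phi> k) - w) (cls (\<phi> k) - w)\<bar> \<le> C * (norm (cls (\<phi> k) - w))\<^sup>2"
      using form_bound[of "m\<^sup>2" "cls (\<phi> k) - w" "cls (\<phi> k) - w"] by (simp add: C_def power2_eq_square mult.assoc)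
    then show ?thesis
      using form_lower[of "cls (\<psi> k) - w"] expand[of "cls (\<psi> k)"] expand[of "cls (\<phi> k)"] \<psi>(3,4)[of k] by linarith
  qed
  define N where "N = norm2 half_measure (\<lambda>z. max (- fn w z) 0)"
  have L: "(\<lambda>z. max (- fn w z) 0) \<in> L2 half_measure"
    by (rule L2_dominated[OF fn_L2[of w]]) (use L2_measurable[OF fn_L2[of w]] in auto)
  have "N \<le> norm (cls (\<psi> k) - w)" for k
  proof -
    have "N \<le> norm2 half_measure (fn (cls (\<psi> k) - w))"
      unfolding N_def
    proof (rule norm2_mono[OF fn_L2 L2_measurable[OF L]])
      show "AE z in half_measure. norm (max (- fn w z) 0) \<le> norm (fn (cls (\<psi> k) - w) z)"
        using fn_lincomb(3)[of "cls (\<psi> k)" w] fn_cls[OF test_function_H1[OF \<psi>(1)[of k]]]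
      proof eventually_elim
        case (elim z)
        then show ?case using \<psi>(2)[of k z] by simp
      qed
    qed
    then show ?thesis using norm2_fn_le[of "cls (\<psi> k) - w"] by linarith
  qed
  moreover have N0: "0 \<le> N" by (simp add: N_def)
  ultimately have "c0 * N\<^sup>2 \<le> c0 * (norm (cls (\<psi> k) - w))\<^sup>2" for k
    using c0_pos by (intro mult_left_mono power_mono) (auto simp del: min_less_iff_conj)
  then have "c0 * N\<^sup>2 \<le> C * (norm (cls (\<phi> k) - w))\<^sup>2 + 2 * inverse (real (Suc k))" for k using b[of k] order_trans by blast
  moreover have "(\<lambda>k. C * (norm (cls (\<phi> k) - w))\<^sup>2 + 2 * inverse (real (Suc k))) \<longlonglongrightarrow> C * (norm (w - w))\<^sup>2 + 2 * 0"
    by (intro tendsto_intros \<phi>(2) LIMSEQ_inverse_real_of_nat)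
  ultimately have "c0 * N\<^sup>2 \<le> C * (norm (w - w))\<^sup>2 + 2 * 0" by (intro LIMSEQ_le_const) auto
  then have "c0 * N\<^sup>2 \<le> 0" by simp
  moreover have "c0 * N\<^sup>2 > 0" if "N \<noteq> 0" using c0_pos that by (intro mult_pos_pos) auto
  ultimately have "N = 0" by linarith
  then have "AE z in half_measure. max (- fn w z) 0 = 0" unfolding N_def by (rule norm2_eq_0_imp_AE[OF L])
  then show ?thesis by eventually_elim (simp add: max_def split: if_splits)
qed

section \<open>Ground states\<close>

lemma form_cls:
  fixes u v :: "real \<times> (real ^ 'n) \<Rightarrow> real"
  assumes u: "u \<in> H1" and v: "v \<in> H1"
  shows "(\<integral>z. weak_gradient u z \<bullet> weak_gradient v z + c * u z * v z \<partial>half_measure) = form c (cls u) (cls v)"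
  unfolding form_def
proof (rule integral_cong_AE)
  note M = borel_measurable_add borel_measurable_inner borel_measurable_times borel_measurable_const L2_measurable
  show "(\<lambda>z. weak_gradient u z \<bullet> weak_gradient v z + c * u z * v z) \<in> borel_measurable half_measure"
    by (intro M weak_gradient_L2 H1_L2 u v)
  show "(\<lambda>z. grad (cls u) z \<bullet> grad (cls v) z + c * fn (cls u) z * fn (cls v) z) \<in> borel_measurable half_measure"
    by (intro M fn_L2 grad_L2)
  show "AE z in half_measure. weak_gradient u z \<bullet> weak_gradient v z + c * u z * v z
      = grad (cls u) z \<bullet> grad (cls v) z + c * fn (cls u) z * fn (cls v) z"
    using fn_cls[OF u] fn_cls[OF v] grad_cls[OF u] grad_cls[OF v] by eventually_elim simp
qed

lemma trace_op_measurable: "u \<in> H1 \<Longrightarrow> trace_op u \<in> borel_measurable borel"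
  for u :: "real \<times> (real ^ 'n) \<Rightarrow> real"
  using is_trace_trace_op[of u] L2_measurable[of "trace_op u" lborel] by (simp add: is_trace_def)

lemma weak_solution_iff: "weak_solution m f u \<longleftrightarrow> u \<in> H1 \<and> G (cls u) = 0"
  for u :: "real \<times> (real ^ 'n) \<Rightarrow> real"
proof (cases "u \<in> H1")
  case u: True
  have K: "(\<integral>y. f (trace_op u y) * trace_op v y \<partial>lborel) = K (cls u) (cls v)" if v: "v \<in> H1" for v :: "real \<times> (real ^ 'n) \<Rightarrow> real"
    unfolding K_def
  proof (rule integral_cong_AE)
    note [measurable] = trace_op_measurable[OF u] trace_op_measurable[OF v]
    show "(\<lambda>y. f (trace_op u y) * trace_op v y) \<in> borel_measurable lborel" by measurable
    show "AE y in lborel. f (trace_op u y) * trace_op v y = f (tr (cls u) y) * tr (cls v) y"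
      using tr_cls[OF u] tr_cls[OF v] by eventually_elim simp
  qed measurable
  have "weak_solution m f u \<longleftrightarrow> (\<forall>v\<in>H1. G (cls u) \<bullet> cls v = 0)"
    using u by (auto simp: weak_solution_def form_cls K G_inner)
  also have "\<dots> \<longleftrightarrow> (\<forall>h. G (cls u) \<bullet> h = 0)"
    by (metis cls_fn fn_H1)
  also have "\<dots> \<longleftrightarrow> G (cls u) = 0" using inner_eq_zero_iff[of "G (cls u)"] by auto
  finally show ?thesis using u by simp
qed (simp add: weak_solution_def)

lemma energy_eq: "u \<in> H1 \<Longrightarrow> energy m f u = J (cls u)" for u :: "real \<times> (real ^ 'n) \<Rightarrow> real"
proof -
  assume u: "u \<in> H1"
  have "(\<integral>y. F (trace_op u y) \<partial>lborel) = (\<integral>y. F (tr (cls u) y) \<partial>lborel)"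
  proof (rule integral_cong_AE)
    note [measurable] = trace_op_measurable[OF u]
    show "(\<lambda>y. F (trace_op u y)) \<in> borel_measurable lborel" by measurable
    show "AE y in lborel. F (trace_op u y) = F (tr (cls u) y)" using tr_cls[OF u] by eventually_elim simp
  qed measurable
  then show ?thesis
    using form_cls[OF u u, of "m\<^sup>2"] by (simp add: energy_def J_def power2_norm_eq_inner power2_eq_square[of "u _"] mult.assoc)
qed

lemma nonzero_solution_iff: "nonzero_solution m f u \<longleftrightarrow> u \<in> H1 \<and> cls u \<noteq> 0 \<and> G (cls u) = 0"
  for u :: "real \<times> (real ^ 'n) \<Rightarrow> real"
proof -
  have "cls u = 0 \<longleftrightarrow> (AE z in half_measure. u z = 0)" if u: "u \<in> H1"
  proof
    assume z: "cls u = 0"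
    show "AE z in half_measure. u z = 0"
      using fn_cls[OF u] fn_lincomb(1)[where 'a='n] unfolding z by eventually_elim simp
  next
    assume "AE z in half_measure. u z = 0"
    then show "cls u = 0" unfolding zero_sobolev_def by (rule cls_eqI[OF u H1_zero])
  qed
  then show ?thesis by (auto simp: nonzero_solution_def weak_solution_iff)
qed

lemma nonnegative_ground_state_exists:
  "\<exists>w :: real \<times> (real ^ 'n) \<Rightarrow> real. ground_state m f w \<and> (AE z in half_measure. 0 \<le> w z)"
proof -
  obtain w :: "'n sobolev" where w: "w \<noteq> 0" "G w = 0" and least: "\<And>x. x \<noteq> 0 \<Longrightarrow> G x = 0 \<Longrightarrow> J w \<le> J x"
    using least_energy_critical_point_exists by blast
  have "ground_state m f (fn w)"
    unfolding ground_state_def nonzero_solution_iff by (auto simp: w cls_fn energy_eq intro!: least)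
  then show ?thesis using critical_point_nonneg[OF w(2)] by blast
qed

end

theorem theorem1:
  fixes m :: real and f :: "real \<Rightarrow> real"
  assumes "CARD('n::finite) \<ge> 2"
    and "m > 0"
    and "f C1_differentiable_on UNIV"
    and "\<And>t. t < 0 \<Longrightarrow> f t = 0"
    and "((\<lambda>t. f t / t) \<longlongrightarrow> 0) (at 0)"
    and "\<exists>p::real. 1 < p \<and> p < (real CARD('n) + 1) / (real CARD('n) - 1) \<and>
           ((\<lambda>t. f t / t powr p) \<longlongrightarrow> 0) at_top"
    and "\<exists>\<theta>>2. \<forall>t>0. 0 < \<theta> * primitive f t \<and> \<theta> * primitive f t < t * f t"
  shows "\<exists>w :: real \<times> (real ^ 'n) \<Rightarrow> real.
           ground_state m f w \<and> (AE z in half_measure. 0 \<le> w z)"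
proof -
  obtain p where p: "1 < p" "p < (real CARD('n) + 1) / (real CARD('n) - 1)" "((\<lambda>t. f t / t powr p) \<longlongrightarrow> 0) at_top"
    using assms(6) by blast
  obtain \<theta> where \<theta>: "\<theta> > 2" "\<And>t. t > 0 \<Longrightarrow> 0 < \<theta> * primitive f t \<and> \<theta> * primitive f t < t * f t"
    using assms(7) by blast
  interpret boundary_problem f p \<theta> m "TYPE('n)"
    by unfold_locales (fact assms p \<theta>)+
  show ?thesis by (rule nonnegative_ground_state_exists)
qed

end
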